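(* Let $\Bbbk$ be a field and let $\mathscr A=\bigoplus_{n\ge0}A_n$ be a nice tower of algebras over $\Bbbk$. For all $M,N\in\mathscr A\text{-fmod}$ and $P,Q\in\mathscr A\text{-pmod}$ there are isomorphisms of functors $$\mathsf I_M\circ\mathsf I_N\cong\mathsf I_{\mathrm{IND}(N\boxtimes M)},\qquad \mathsf{TR}_P\circ\mathsf{TR}_Q\cong\mathsf{TR}_{\mathrm{IND}(P\boxtimes Q)}.$$
   Context: **Nice graded algebra.** A $\mathbb Z$-graded $\Bbbk$-algebra $R=\bigoplus_{i\in\mathbb Z}R_i$ is *nice* if (1) there is a positively (respectively negatively) graded ideal $I\subseteq\bigoplus_{i>0}R_i$ (respectively $I\subseteq\bigoplus_{i<0}R_i$) such that all graded simple $R$-modules are annihilated by $I$, and (2) $R/I$ is a finite-dimensional algebra. **Nice tower of algebras.** A graded $\Bbbk$-algebra $\mathscr A=\bigoplus_{n\ge0}A_n$ such that for all $m,n$: (TA1) $A_n$ is a nice graded algebra, and $A_0=\Bbbk$; (TA2) there is a unital algebra morphism $A_n\otimes A_m\to A_{n+m}$; (TA3) $A_{m+n}$ is a two-sided projective $A_n\otimes A_m$-module; (TA4) there exists an anti-automorphism $\psi$ of $A_n$. **Notation.** $\boxtimes=\otimes_\Bbbk$. $A_n\text{-fmod}$ and $A_n\text{-pmod}$ are the categories of graded finite-dimensional, respectively graded finitely generated projective, left $A_n$-modules; $\mathscr A\text{-fmod}=\bigoplus_nA_n\text{-fmod}$, $\mathscr A\text{-pmod}=\bigoplus_nA_n\text{-pmod}$.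 For $A_n$- and $A_m$-modules $X,Y$, $\mathrm{IND}(X\boxtimes Y)=A_{n+m}\otimes_{A_n\otimes A_m}(X\boxtimes Y)$. For a left module $P$, $P^\psi$ is the right module on the same space with $m\cdot a:=\psi(a)m$. **Functors** $\mathscr A\text{-fmod}\to\mathscr A\text{-fmod}$. For $M\in A_m\text{-fmod}$ and $N\in A_n\text{-fmod}$, $\mathsf I_M(N)=A_{n+m}\otimes_{A_n\otimes A_m}(N\boxtimes M)\in A_{n+m}\text{-fmod}$. For $P\in A_p\text{-pmod}$ and $N\in A_n\text{-fmod}$, $\mathsf{TR}_P(N)=P^\psi\otimes_{A_p}\mathrm{Res}^{A_n}_{A_{n-p}\otimes A_p}N\in A_{n-p}\text{-fmod}$ (the zero object if $n-p<0$), where $A_p$ acts on $N$ via $a\mapsto1\otimes a\in A_{n-p}\otimes A_p$, and $A_{n-p}$ acts by $a\cdot(x\otimes y)=x\otimes((a\otimes1)\cdot y)$. Everything is extended additively in $M$, $P$ and $N$.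
   Formalization: The second isomorphism assumes ψ(ab)=ψ(a)ψ(b) for the external product of a in A_m and b in A_n (it fails for unrelated ψ on the A_n); I_M takes values in all graded modules, since induction need not preserve finite dimension; the maps in (TA2) and ψ preserve degree. *)

theory Defs
  imports "HOL-Algebra.Module" "HOL-Algebra.QuotRing" "HOL-Algebra.Free_Abelian_Groups"
begin

section \<open>Modules over noncommutative rings\<close>

text \<open>
  The locale \<open>module\<close> of the library is restricted to commutative rings.  Right modules are left
  modules over the opposite ring, so in a right module \<open>r \<odot> x\<close> stands for \<open>x\<cdot>r\<close>.  When
  a record is used as a module, its fields \<open>mult\<close> and \<open>one\<close> play no role.
\<close>

locale left_module = R?: ring R + M?: abelian_group M
  for R :: "('r, 'u) ring_scheme" (structure) and M :: "('r, 'm, 'z) module_scheme" (structure) +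
  assumes smult_closed [simp, intro]:
      "\<lbrakk>a \<in> carrier R; x \<in> carrier M\<rbrakk> \<Longrightarrow> a \<odot>\<^bsub>M\<^esub> x \<in> carrier M"
    and smult_l_distr:
      "\<lbrakk>a \<in> carrier R; b \<in> carrier R; x \<in> carrier M\<rbrakk> \<Longrightarrow>
        (a \<oplus> b) \<odot>\<^bsub>M\<^esub> x = a \<odot>\<^bsub>M\<^esub> x \<oplus>\<^bsub>M\<^esub> b \<odot>\<^bsub>M\<^esub> x"
    and smult_r_distr:
      "\<lbrakk>a \<in> carrier R; x \<in> carrier M; y \<in> carrier M\<rbrakk> \<Longrightarrow>
        a \<odot>\<^bsub>M\<^esub> (x \<oplus>\<^bsub>M\<^esub> y) = a \<odot>\<^bsub>M\<^esub> x \<oplus>\<^bsub>M\<^esub> a \<odot>\<^bsub>M\<^esub> y"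
    and smult_assoc1:
      "\<lbrakk>a \<in> carrier R; b \<in> carrier R; x \<in> carrier M\<rbrakk> \<Longrightarrow>
        (a \<otimes> b) \<odot>\<^bsub>M\<^esub> x = a \<odot>\<^bsub>M\<^esub> (b \<odot>\<^bsub>M\<^esub> x)"
    and smult_one [simp]: "x \<in> carrier M \<Longrightarrow> \<one> \<odot>\<^bsub>M\<^esub> x = x"

definition opposite :: "('a, 'z) ring_scheme \<Rightarrow> ('a, 'z) ring_scheme"
  where "opposite R = R\<lparr>mult := (\<lambda>x y. y \<otimes>\<^bsub>R\<^esub> x)\<rparr>"

definition module_hom ::
    "('r, 'u) ring_scheme \<Rightarrow> ('r, 'x, 'v) module_scheme \<Rightarrow> ('r, 'y, 'w) module_scheme \<Rightarrow> ('x \<Rightarrow> 'y) set"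
  where "module_hom R M N = {f \<in> carrier M \<rightarrow> carrier N.
    (\<forall>x\<in>carrier M. \<forall>y\<in>carrier M. f (x \<oplus>\<^bsub>M\<^esub> y) = f x \<oplus>\<^bsub>N\<^esub> f y) \<and>
    (\<forall>r\<in>carrier R. \<forall>x\<in>carrier M. f (r \<odot>\<^bsub>M\<^esub> x) = r \<odot>\<^bsub>N\<^esub> f x)}"

definition finitely_generated :: "('r, 'u) ring_scheme \<Rightarrow> ('r, 'x, 'v) module_scheme \<Rightarrow> bool"
  where "finitely_generated R M \<longleftrightarrow> (\<exists>B. finite B \<and> B \<subseteq> carrier M \<and>
    (\<forall>x\<in>carrier M. \<exists>c\<in>B \<rightarrow> carrier R. x = (\<Oplus>\<^bsub>M\<^esub>b\<in>B. c b \<odot>\<^bsub>M\<^esub> b)))"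


section \<open>Graded algebras and graded modules\<close>

record ('r, 'm) graded = "('r, 'm) module" +
  grade :: "int \<Rightarrow> 'm set"

definition homogeneous_family :: "('r, 'm) graded \<Rightarrow> (int \<Rightarrow> 'm) \<Rightarrow> bool"
  where "homogeneous_family M f \<longleftrightarrow> (\<forall>i. f i \<in> grade M i) \<and> finite {i. f i \<noteq> \<zero>\<^bsub>M\<^esub>}"

definition family_sum :: "('r, 'm) graded \<Rightarrow> (int \<Rightarrow> 'm) \<Rightarrow> 'm"
  where "family_sum M f = (\<Oplus>\<^bsub>M\<^esub>i\<in>{i. f i \<noteq> \<zero>\<^bsub>M\<^esub>}. f i)"

definition is_graded :: "('r, 'm) graded \<Rightarrow> bool"
  where "is_graded M \<longleftrightarrow> (\<forall>i. additive_subgroup (grade M i) M) \<and>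
    (\<forall>x\<in>carrier M. \<exists>!f. homogeneous_family M f \<and> family_sum M f = x)"

locale graded_algebra = K?: field K + A?: module K A + A?: ring A
  for K :: "('k, 'u) ring_scheme" and A :: "('k, 'a) graded" +
  assumes smult_mult_left:
      "\<lbrakk>c \<in> carrier K; x \<in> carrier A; y \<in> carrier A\<rbrakk> \<Longrightarrow>
        (c \<odot>\<^bsub>A\<^esub> x) \<otimes>\<^bsub>A\<^esub> y = c \<odot>\<^bsub>A\<^esub> (x \<otimes>\<^bsub>A\<^esub> y)"
    and smult_mult_right:
      "\<lbrakk>c \<in> carrier K; x \<in> carrier A; y \<in> carrier A\<rbrakk> \<Longrightarrow>
        x \<otimes>\<^bsub>A\<^esub> (c \<odot>\<^bsub>A\<^esub> y) = c \<odot>\<^bsub>A\<^esub> (x \<otimes>\<^bsub>A\<^esub> y)"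
    and graded: "is_graded A"
    and grade_smult: "\<lbrakk>c \<in> carrier K; x \<in> grade A i\<rbrakk> \<Longrightarrow> c \<odot>\<^bsub>A\<^esub> x \<in> grade A i"
    and grade_one: "\<one>\<^bsub>A\<^esub> \<in> grade A 0"
    and grade_mult: "\<lbrakk>x \<in> grade A i; y \<in> grade A j\<rbrakk> \<Longrightarrow> x \<otimes>\<^bsub>A\<^esub> y \<in> grade A (i + j)"

definition graded_algebra_hom ::
    "('k, 'u) ring_scheme \<Rightarrow> ('k, 'a) graded \<Rightarrow> ('k, 'b) graded \<Rightarrow> ('a \<Rightarrow> 'b) set"
  where "graded_algebra_hom K A B = {f \<in> ring_hom A B.
    (\<forall>c\<in>carrier K. \<forall>x\<in>carrier A. f (c \<odot>\<^bsub>A\<^esub> x) = c \<odot>\<^bsub>B\<^esub> f x) \<and>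
    (\<forall>i. f ` grade A i \<subseteq> grade B i)}"

definition graded_module :: "('k, 'a) graded \<Rightarrow> ('a, 'm) graded \<Rightarrow> bool"
  where "graded_module A M \<longleftrightarrow> left_module A M \<and> is_graded M \<and>
    (\<forall>i j. \<forall>a\<in>grade A i. \<forall>x\<in>grade M j. a \<odot>\<^bsub>M\<^esub> x \<in> grade M (i + j))"

definition graded_hom ::
    "('k, 'a) graded \<Rightarrow> ('a, 'x) graded \<Rightarrow> ('a, 'y) graded \<Rightarrow> ('x \<Rightarrow> 'y) set"
  where "graded_hom A M N = {f \<in> module_hom A M N. \<forall>i. f ` grade M i \<subseteq> grade N i}"

text \<open>The structure map of an algebra, and restriction of scalars along a map.\<close>

definition scalar :: "('k, 'a) graded \<Rightarrow> 'k \<Rightarrow> 'a"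
  where "scalar A c = c \<odot>\<^bsub>A\<^esub> \<one>\<^bsub>A\<^esub>"

definition restrict_scalars :: "('s \<Rightarrow> 'r) \<Rightarrow> ('r, 'm) graded \<Rightarrow> ('s, 'm) graded"
  where "restrict_scalars h M = \<lparr>carrier = carrier M, mult = mult M, one = one M, ring.zero = \<zero>\<^bsub>M\<^esub>,
    add = add M, smult = (\<lambda>s. smult M (h s)), grade = grade M\<rparr>"

definition regular :: "('k, 'a) graded \<Rightarrow> ('a, 'a) graded"
  where "regular A = \<lparr>carrier = carrier A, mult = mult A, one = one A, ring.zero = \<zero>\<^bsub>A\<^esub>,
    add = add A, smult = mult A, grade = grade A\<rparr>"

definition direct_sum :: "'i set \<Rightarrow> ('i \<Rightarrow> ('r, 'm) graded) \<Rightarrow> ('r, 'i \<Rightarrow> 'm) graded"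
  where "direct_sum I M = (let S = sum_group I (\<lambda>i. add_monoid (M i)) in
    \<lparr>carrier = carrier S, mult = undefined, one = undefined, ring.zero = \<one>\<^bsub>S\<^esub>, add = mult S,
     smult = (\<lambda>r x. \<lambda>i\<in>I. r \<odot>\<^bsub>M i\<^esub> x i),
     grade = (\<lambda>d. {x \<in> carrier S. \<forall>i\<in>I. x i \<in> grade (M i) d})\<rparr>)"

definition direct_sum_map :: "'i set \<Rightarrow> ('i \<Rightarrow> 'x \<Rightarrow> 'y) \<Rightarrow> ('i \<Rightarrow> 'x) \<Rightarrow> 'i \<Rightarrow> 'y"
  where "direct_sum_map I f x = (\<lambda>i\<in>I. f i (x i))"

text \<open>
  Projective means direct summand of a free module.  A projective module is a direct summand of
  the free module on its own set of elements, so bases of type \<open>'m\<close> suffice.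
\<close>

definition projective :: "('k, 'a) graded \<Rightarrow> ('a, 'm) graded \<Rightarrow> bool"
  where "projective R P \<longleftrightarrow> left_module R P \<and>
    (\<exists>(S :: 'm set) s p.
      s \<in> module_hom R P (direct_sum S (\<lambda>_. regular R)) \<and>
      p \<in> module_hom R (direct_sum S (\<lambda>_. regular R)) P \<and>
      (\<forall>x\<in>carrier P. p (s x) = x))"


section \<open>Nice graded algebras\<close>

definition graded_submodule :: "('k, 'a) graded \<Rightarrow> ('a, 'm) graded \<Rightarrow> 'm set \<Rightarrow> bool"
  where "graded_submodule A M H \<longleftrightarrow> additive_subgroup H M \<and>
    (\<forall>a\<in>carrier A. \<forall>x\<in>H. a \<odot>\<^bsub>M\<^esub> x \<in> H) \<and>
    (\<forall>x\<in>H. \<exists>f. homogeneous_family M f \<and> (\<forall>i. f i \<in> H) \<and> family_sum M f = x)"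

definition graded_simple :: "('k, 'a) graded \<Rightarrow> ('a, 'm) graded \<Rightarrow> bool"
  where "graded_simple A M \<longleftrightarrow> graded_module A M \<and> carrier M \<noteq> {\<zero>\<^bsub>M\<^esub>} \<and>
    (\<forall>H. graded_submodule A M H \<longrightarrow> H = {\<zero>\<^bsub>M\<^esub>} \<or> H = carrier M)"

definition graded_ideal :: "('k, 'a) graded \<Rightarrow> 'a set \<Rightarrow> bool"
  where "graded_ideal A I \<longleftrightarrow> ideal I A \<and>
    (\<forall>x\<in>I. \<exists>f. homogeneous_family A f \<and> (\<forall>i. f i \<in> I) \<and> family_sum A f = x)"

text \<open>The sum of the components with degree in \<open>D\<close>.\<close>

definition degrees_part :: "('k, 'a) graded \<Rightarrow> int set \<Rightarrow> 'a set"
  where "degrees_part A D =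
    {family_sum A f | f. homogeneous_family A f \<and> (\<forall>i. i \<notin> D \<longrightarrow> f i = \<zero>\<^bsub>A\<^esub>)}"

definition quotient_algebra :: "('k, 'a) graded \<Rightarrow> 'a set \<Rightarrow> ('k, 'a set) module"
  where "quotient_algebra A I =
    \<lparr>carrier = carrier (A Quot I), mult = mult (A Quot I), one = \<one>\<^bsub>A Quot I\<^esub>,
     ring.zero = \<zero>\<^bsub>A Quot I\<^esub>, add = add (A Quot I),
     smult = (\<lambda>c X. \<Union>x\<in>X. I +>\<^bsub>A\<^esub> (c \<odot>\<^bsub>A\<^esub> x))\<rparr>"

text \<open>
  A graded simple module is generated by a homogeneous element, hence it is, up to a shift of the
  grading, a quotient of \<open>A\<close> by a left ideal.  So every graded simple module is isomorphic to one
  whose elements are of type \<open>'a set\<close>.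
\<close>

definition nice :: "('k, 'u) ring_scheme \<Rightarrow> ('k, 'a) graded \<Rightarrow> bool"
  where "nice K A \<longleftrightarrow> (\<exists>I. graded_ideal A I \<and>
    (I \<subseteq> degrees_part A {0<..} \<or> I \<subseteq> degrees_part A {..<0}) \<and>
    (\<forall>S :: ('a, 'a set) graded. graded_simple A S \<longrightarrow>
      (\<forall>a\<in>I. \<forall>x\<in>carrier S. a \<odot>\<^bsub>S\<^esub> x = \<zero>\<^bsub>S\<^esub>)) \<and>
    finitely_generated K (quotient_algebra A I))"


section \<open>Tensor products\<close>

text \<open>
  For a right \<open>R\<close>-module \<open>X\<close> and a left \<open>R\<close>-module \<open>Y\<close>, the tensor product is the quotient of the
  free abelian group on the pairs by the usual relations.
\<close>

type_synonym ('x, 'y) tensor = "(('x \<times> 'y) \<Rightarrow>\<^sub>0 int) set"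

definition tensor_relations ::
    "('r, 'u) ring_scheme \<Rightarrow> ('r, 'x, 'v) module_scheme \<Rightarrow> ('r, 'y, 'w) module_scheme \<Rightarrow>
      (('x \<times> 'y) \<Rightarrow>\<^sub>0 int) set"
  where "tensor_relations R X Y =
    {frag_of (x \<oplus>\<^bsub>X\<^esub> x', y) - frag_of (x, y) - frag_of (x', y) | x x' y.
      x \<in> carrier X \<and> x' \<in> carrier X \<and> y \<in> carrier Y} \<union>
    {frag_of (x, y \<oplus>\<^bsub>Y\<^esub> y') - frag_of (x, y) - frag_of (x, y') | x y y'.
      x \<in> carrier X \<and> y \<in> carrier Y \<and> y' \<in> carrier Y} \<union>
    {frag_of (r \<odot>\<^bsub>X\<^esub> x, y) - frag_of (x, r \<odot>\<^bsub>Y\<^esub> y) | r x y.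
      r \<in> carrier R \<and> x \<in> carrier X \<and> y \<in> carrier Y}"

definition tensor_kernel ::
    "('r, 'u) ring_scheme \<Rightarrow> ('r, 'x, 'v) module_scheme \<Rightarrow> ('r, 'y, 'w) module_scheme \<Rightarrow>
      (('x \<times> 'y) \<Rightarrow>\<^sub>0 int) set"
  where "tensor_kernel R X Y =
    generate (free_Abelian_group (carrier X \<times> carrier Y)) (tensor_relations R X Y)"

definition tensor_group ::
    "('r, 'u) ring_scheme \<Rightarrow> ('r, 'x, 'v) module_scheme \<Rightarrow> ('r, 'y, 'w) module_scheme \<Rightarrow>
      ('x, 'y) tensor monoid"
  where "tensor_group R X Y =
    free_Abelian_group (carrier X \<times> carrier Y) Mod tensor_kernel R X Y"

definition tensor_class ::
    "('r, 'u) ring_scheme \<Rightarrow> ('r, 'x, 'v) module_scheme \<Rightarrow> ('r, 'y, 'w) module_scheme \<Rightarrow>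
      (('x \<times> 'y) \<Rightarrow>\<^sub>0 int) \<Rightarrow> ('x, 'y) tensor"
  where "tensor_class R X Y c =
    tensor_kernel R X Y #>\<^bsub>free_Abelian_group (carrier X \<times> carrier Y)\<^esub> c"

definition pure ::
    "('r, 'u) ring_scheme \<Rightarrow> ('r, 'x, 'v) module_scheme \<Rightarrow> ('r, 'y, 'w) module_scheme \<Rightarrow>
      'x \<Rightarrow> 'y \<Rightarrow> ('x, 'y) tensor"
  where "pure R X Y x y = tensor_class R X Y (frag_of (x, y))"

text \<open>
  Operations on tensors are given by representatives.  In the following two definitions \<open>X\<close> and
  \<open>Y\<close> are the targets: \<open>tensor_map R X Y f g\<close> is \<open>x \<otimes> y \<mapsto> f x \<otimes> g y\<close>, and
  \<open>tensor_map2 R X Y f g\<close> is the biadditive map \<open>(a \<otimes> b, x \<otimes> y) \<mapsto> f a x \<otimes> g b y\<close>.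
  Where they are used, the union is a union of equal cosets.
\<close>

definition tensor_map ::
    "('r, 'u) ring_scheme \<Rightarrow> ('r, 'x, 'v) module_scheme \<Rightarrow> ('r, 'y, 'w) module_scheme \<Rightarrow>
      ('c \<Rightarrow> 'x) \<Rightarrow> ('d \<Rightarrow> 'y) \<Rightarrow> ('c, 'd) tensor \<Rightarrow> ('x, 'y) tensor"
  where "tensor_map R X Y f g t =
    (\<Union>u\<in>t. tensor_class R X Y (frag_extend (\<lambda>(x, y). frag_of (f x, g y)) u))"

definition tensor_map2 ::
    "('r, 'u) ring_scheme \<Rightarrow> ('r, 'x, 'v) module_scheme \<Rightarrow> ('r, 'y, 'w) module_scheme \<Rightarrow>
      ('a \<Rightarrow> 'c \<Rightarrow> 'x) \<Rightarrow> ('b \<Rightarrow> 'd \<Rightarrow> 'y) \<Rightarrow>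
      ('a, 'b) tensor \<Rightarrow> ('c, 'd) tensor \<Rightarrow> ('x, 'y) tensor"
  where "tensor_map2 R X Y f g s t = (\<Union>u\<in>s. \<Union>v\<in>t. tensor_class R X Y
    (frag_extend (\<lambda>(a, b). frag_extend (\<lambda>(x, y). frag_of (f a x, g b y)) v) u))"

text \<open>
  The tensor product over \<open>R\<close>, on which further scalars operate by \<open>act\<close>; its component of
  degree \<open>d\<close> is generated by the \<open>x \<otimes> y\<close> with \<open>x\<close>, \<open>y\<close> homogeneous of total degree \<open>d\<close>.
\<close>

definition tensor_product ::
    "('r, 'u) ring_scheme \<Rightarrow> ('r, 'x) graded \<Rightarrow> ('r, 'y) graded \<Rightarrow>
      ('s \<Rightarrow> ('x, 'y) tensor \<Rightarrow> ('x, 'y) tensor) \<Rightarrow> ('s, ('x, 'y) tensor) graded"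
  where "tensor_product R X Y act =
    \<lparr>carrier = carrier (tensor_group R X Y), mult = undefined, one = undefined,
     ring.zero = \<one>\<^bsub>tensor_group R X Y\<^esub>, add = mult (tensor_group R X Y), smult = act,
     grade = (\<lambda>d. generate (tensor_group R X Y)
       {pure R X Y x y | x y i j. x \<in> grade X i \<and> y \<in> grade Y j \<and> i + j = d})\<rparr>"

definition tensor_algebra ::
    "('k, 'u) ring_scheme \<Rightarrow> ('k, 'a) graded \<Rightarrow> ('k, 'b) graded \<Rightarrow> ('k, ('a, 'b) tensor) graded"
  where "tensor_algebra K A B =
    (tensor_product K A B (\<lambda>c. tensor_map K A B (\<lambda>a. c \<odot>\<^bsub>A\<^esub> a) (\<lambda>b. b)))
      \<lparr>mult := tensor_map2 K A B (mult A) (mult B), one := pure K A B \<one>\<^bsub>A\<^esub> \<one>\<^bsub>B\<^esub>\<rparr>"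

text \<open>The module \<open>X \<boxtimes> Y\<close> over \<open>A \<otimes> B\<close>, and its functoriality.\<close>

definition outer_tensor ::
    "('k, 'u) ring_scheme \<Rightarrow> ('k, 'a) graded \<Rightarrow> ('k, 'b) graded \<Rightarrow>
      ('a, 'x) graded \<Rightarrow> ('b, 'y) graded \<Rightarrow> (('a, 'b) tensor, ('x, 'y) tensor) graded"
  where "outer_tensor K A B X Y =
    (let X' = restrict_scalars (scalar A) X; Y' = restrict_scalars (scalar B) Y
     in tensor_product K X' Y' (tensor_map2 K X' Y' (smult X) (smult Y)))"

definition outer_tensor_map ::
    "('k, 'u) ring_scheme \<Rightarrow> ('k, 'a) graded \<Rightarrow> ('k, 'b) graded \<Rightarrow>
      ('a, 'x) graded \<Rightarrow> ('b, 'y) graded \<Rightarrow> ('c \<Rightarrow> 'x) \<Rightarrow> ('d \<Rightarrow> 'y) \<Rightarrow>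
      ('c, 'd) tensor \<Rightarrow> ('x, 'y) tensor"
  where "outer_tensor_map K A B X Y f g =
    tensor_map K (restrict_scalars (scalar A) X) (restrict_scalars (scalar B) Y) f g"


section \<open>Nice towers of algebras\<close>

text \<open>
  \<open>ext m n\<close> is the morphism \<open>A\<^sub>m \<otimes> A\<^sub>n \<rightarrow> A\<^sub>m\<^sub>+\<^sub>n\<close>, that is, the multiplication of the graded
  algebra \<open>\<Oplus>\<^sub>n A\<^sub>n\<close>, and \<open>anti n\<close> is the chosen anti-automorphism of \<open>A\<^sub>n\<close>.
\<close>

record ('k, 'a) tower =
  base :: "'k ring"
  alg :: "nat \<Rightarrow> ('k, 'a) graded"
  ext :: "nat \<Rightarrow> nat \<Rightarrow> ('a, 'a) tensor \<Rightarrow> 'a"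
  anti :: "nat \<Rightarrow> 'a \<Rightarrow> 'a"

abbreviation tens :: "('k, 'a) tower \<Rightarrow> nat \<Rightarrow> nat \<Rightarrow> ('k, ('a, 'a) tensor) graded"
  where "tens T m n \<equiv> tensor_algebra (base T) (alg T m) (alg T n)"

definition ext_mult :: "('k, 'a) tower \<Rightarrow> nat \<Rightarrow> nat \<Rightarrow> 'a \<Rightarrow> 'a \<Rightarrow> 'a"
  where "ext_mult T m n a b = ext T m n (pure (base T) (alg T m) (alg T n) a b)"

definition left_restriction :: "('k, 'a) tower \<Rightarrow> nat \<Rightarrow> nat \<Rightarrow> (('a, 'a) tensor, 'a) graded"
  where "left_restriction T m n = restrict_scalars (ext T m n) (regular (alg T (m + n)))"

definition right_restriction :: "('k, 'a) tower \<Rightarrow> nat \<Rightarrow> nat \<Rightarrow> (('a, 'a) tensor, 'a) graded"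
  where "right_restriction T m n =
    restrict_scalars (ext T m n) (regular (opposite (alg T (m + n))))"

definition nice_tower :: "('k, 'a) tower \<Rightarrow> bool"
  where "nice_tower T \<longleftrightarrow>
    field (base T) \<and>
    (\<forall>n. graded_algebra (base T) (alg T n) \<and> nice (base T) (alg T n)) \<and>
    bij_betw (scalar (alg T 0)) (carrier (base T)) (carrier (alg T 0)) \<and>
    (\<forall>m n. ext T m n \<in> graded_algebra_hom (base T) (tens T m n) (alg T (m + n))) \<and>
    (\<forall>l m n. \<forall>a\<in>carrier (alg T l). \<forall>b\<in>carrier (alg T m). \<forall>c\<in>carrier (alg T n).
      ext_mult T (l + m) n (ext_mult T l m a b) c = ext_mult T l (m + n) a (ext_mult T m n b c)) \<and>
    (\<forall>n. \<forall>a\<in>carrier (alg T n).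
      ext_mult T 0 n \<one>\<^bsub>alg T 0\<^esub> a = a \<and> ext_mult T n 0 a \<one>\<^bsub>alg T 0\<^esub> = a) \<and>
    (\<forall>m n. projective (tens T m n) (left_restriction T m n) \<and>
      projective (opposite (tens T m n)) (right_restriction T m n)) \<and>
    (\<forall>n. anti T n \<in> graded_algebra_hom (base T) (alg T n) (opposite (alg T n)) \<and>
      bij_betw (anti T n) (carrier (alg T n)) (carrier (alg T n)))"

text \<open>
  Compatibility of the anti-automorphisms with the multiplication of the tower.  It is not part of
  \<open>nice_tower\<close>, which chooses one anti-automorphism for each \<open>n\<close> independently.
\<close>

definition anti_multiplicative :: "('k, 'a) tower \<Rightarrow> bool"
  where "anti_multiplicative T \<longleftrightarrow>
    (\<forall>m n. \<forall>a\<in>carrier (alg T m). \<forall>b\<in>carrier (alg T n).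
      anti T (m + n) (ext_mult T m n a b) = ext_mult T m n (anti T m a) (anti T n b))"


section \<open>Categories of modules over a tower\<close>

text \<open>
  An object of a direct sum of categories indexed by \<open>n\<close> is a family of objects of which all but
  finitely many are zero; a morphism is a family of morphisms of degree zero.  Morphisms are
  represented by functions, which are identified if they agree on the carriers.  The category
  \<open>gmod\<close> of all graded modules is needed as a target, because \<open>A\<^sub>m\<^sub>+\<^sub>n\<close> is not assumed to be
  finitely generated over \<open>A\<^sub>m \<otimes> A\<^sub>n\<close>, and so induction need not preserve finite dimension.
\<close>

type_synonym ('a, 'm) family = "nat \<Rightarrow> ('a, 'm) graded"

definition gmod :: "('k, 'a) tower \<Rightarrow> ('a, 'm) family set"
  where "gmod T = {M. (\<forall>n. graded_module (alg T n) (M n)) \<and>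
    finite {n. carrier (M n) \<noteq> {\<zero>\<^bsub>M n\<^esub>}}}"

definition fmod :: "('k, 'a) tower \<Rightarrow> ('a, 'm) family set"
  where "fmod T = {M \<in> gmod T.
    \<forall>n. finitely_generated (base T) (restrict_scalars (scalar (alg T n)) (M n))}"

definition pmod :: "('k, 'a) tower \<Rightarrow> ('a, 'm) family set"
  where "pmod T = {M \<in> gmod T.
    \<forall>n. finitely_generated (alg T n) (M n) \<and> projective (alg T n) (M n)}"

definition gmod_hom ::
    "('k, 'a) tower \<Rightarrow> ('a, 'x) family \<Rightarrow> ('a, 'y) family \<Rightarrow> (nat \<Rightarrow> 'x \<Rightarrow> 'y) set"
  where "gmod_hom T M N = {f. \<forall>n. f n \<in> graded_hom (alg T n) (M n) (N n)}"

definition same_map :: "('a, 'x) family \<Rightarrow> (nat \<Rightarrow> 'x \<Rightarrow> 'y) \<Rightarrow> (nat \<Rightarrow> 'x \<Rightarrow> 'y) \<Rightarrow> bool"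
  where "same_map M f g \<longleftrightarrow> (\<forall>n. \<forall>x\<in>carrier (M n). f n x = g n x)"

definition gmod_iso ::
    "('k, 'a) tower \<Rightarrow> ('a, 'x) family \<Rightarrow> ('a, 'y) family \<Rightarrow> (nat \<Rightarrow> 'x \<Rightarrow> 'y) set"
  where "gmod_iso T M N = {f \<in> gmod_hom T M N. \<exists>g\<in>gmod_hom T N M.
    same_map M (\<lambda>n x. g n (f n x)) (\<lambda>n x. x) \<and> same_map N (\<lambda>n y. f n (g n y)) (\<lambda>n y. y)}"

text \<open>The action on a morphism also takes its source and its target.\<close>

record ('a, 'x, 'y) gfunctor =
  obj :: "('a, 'x) family \<Rightarrow> ('a, 'y) family"
  mor :: "('a, 'x) family \<Rightarrow> ('a, 'x) family \<Rightarrow> (nat \<Rightarrow> 'x \<Rightarrow> 'x) \<Rightarrow> nat \<Rightarrow> 'y \<Rightarrow> 'y"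

definition gfunctor_comp ::
    "('a, 'y, 'z) gfunctor \<Rightarrow> ('a, 'x, 'y) gfunctor \<Rightarrow> ('a, 'x, 'z) gfunctor"  (infixr \<open>\<circ>\<^sub>F\<close> 55)
  where "F \<circ>\<^sub>F G = \<lparr>obj = (\<lambda>L. obj F (obj G L)),
    mor = (\<lambda>L L' f. mor F (obj G L) (obj G L') (mor G L L' f))\<rparr>"

definition is_gfunctor ::
    "('k, 'a) tower \<Rightarrow> ('a, 'x) family set \<Rightarrow> ('a, 'y) family set \<Rightarrow> ('a, 'x, 'y) gfunctor \<Rightarrow> bool"
  where "is_gfunctor T C D F \<longleftrightarrow>
    (\<forall>L\<in>C. obj F L \<in> D) \<and>
    (\<forall>L\<in>C. \<forall>L'\<in>C. \<forall>f\<in>gmod_hom T L L'. mor F L L' f \<in> gmod_hom T (obj F L) (obj F L')) \<and>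
    (\<forall>L\<in>C. \<forall>L'\<in>C. \<forall>f\<in>gmod_hom T L L'. \<forall>g\<in>gmod_hom T L L'.
      same_map L f g \<longrightarrow> same_map (obj F L) (mor F L L' f) (mor F L L' g)) \<and>
    (\<forall>L\<in>C. same_map (obj F L) (mor F L L (\<lambda>n x. x)) (\<lambda>n x. x)) \<and>
    (\<forall>L\<in>C. \<forall>L'\<in>C. \<forall>L''\<in>C. \<forall>f\<in>gmod_hom T L L'. \<forall>g\<in>gmod_hom T L' L''.
      same_map (obj F L) (mor F L L'' (\<lambda>n x. g n (f n x)))
        (\<lambda>n x. mor F L' L'' g n (mor F L L' f n x)))"

definition isomorphic_functors ::
    "('k, 'a) tower \<Rightarrow> ('a, 'x) family set \<Rightarrow> ('a, 'y) family set \<Rightarrow> ('a, 'z) family set \<Rightarrow>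
      ('a, 'x, 'y) gfunctor \<Rightarrow> ('a, 'x, 'z) gfunctor \<Rightarrow> bool"
  where "isomorphic_functors T C D E F G \<longleftrightarrow>
    is_gfunctor T C D F \<and> is_gfunctor T C E G \<and>
    (\<exists>\<eta>. (\<forall>L\<in>C. \<eta> L \<in> gmod_iso T (obj F L) (obj G L)) \<and>
      (\<forall>L\<in>C. \<forall>L'\<in>C. \<forall>f\<in>gmod_hom T L L'.
        same_map (obj F L) (\<lambda>n x. \<eta> L' n (mor F L L' f n x)) (\<lambda>n x. mor G L L' f n (\<eta> L n x))))"


section \<open>Induction and twisted restriction\<close>

text \<open>\<open>A\<^sub>m\<^sub>+\<^sub>n \<otimes> (X \<boxtimes> Y)\<close>, the tensor product being over \<open>A\<^sub>m \<otimes> A\<^sub>n\<close>.\<close>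

definition induce ::
    "('k, 'a) tower \<Rightarrow> nat \<Rightarrow> nat \<Rightarrow> ('a, 'x) graded \<Rightarrow> ('a, 'y) graded \<Rightarrow>
      ('a, ('a, ('x, 'y) tensor) tensor) graded"
  where "induce T m n X Y =
    (let Z = outer_tensor (base T) (alg T m) (alg T n) X Y; C = right_restriction T m n
     in tensor_product (tens T m n) C Z
          (\<lambda>c. tensor_map (tens T m n) C Z (\<lambda>d. c \<otimes>\<^bsub>alg T (m + n)\<^esub> d) (\<lambda>z. z)))"

definition induce_map ::
    "('k, 'a) tower \<Rightarrow> nat \<Rightarrow> nat \<Rightarrow> ('a, 'x) graded \<Rightarrow> ('a, 'y) graded \<Rightarrow> ('c \<Rightarrow> 'x) \<Rightarrow> ('d \<Rightarrow> 'y) \<Rightarrow>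
      ('a, ('c, 'd) tensor) tensor \<Rightarrow> ('a, ('x, 'y) tensor) tensor"
  where "induce_map T m n X Y f g =
    tensor_map (tens T m n) (right_restriction T m n)
      (outer_tensor (base T) (alg T m) (alg T n) X Y)
      (\<lambda>c. c) (outer_tensor_map (base T) (alg T m) (alg T n) X Y f g)"

abbreviation splittings :: "nat \<Rightarrow> (nat \<times> nat) set"
  where "splittings k \<equiv> {(m, n). m + n = k}"

definition IND ::
    "('k, 'a) tower \<Rightarrow> ('a, 'x) family \<Rightarrow> ('a, 'y) family \<Rightarrow>
      ('a, nat \<times> nat \<Rightarrow> ('a, ('x, 'y) tensor) tensor) family"
  where "IND T X Y k = direct_sum (splittings k) (\<lambda>(m, n). induce T m n (X m) (Y n))"

definition I_functor ::
    "('k, 'a) tower \<Rightarrow> ('a, 'm) family \<Rightarrow>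
      ('a, 'l, nat \<times> nat \<Rightarrow> ('a, ('l, 'm) tensor) tensor) gfunctor"
  where "I_functor T M =
    \<lparr>obj = (\<lambda>L. IND T L M),
     mor = (\<lambda>L L' f k. direct_sum_map (splittings k)
       (\<lambda>(m, n). induce_map T m n (L' m) (M n) (f m) (\<lambda>y. y)))\<rparr>"

text \<open>
  \<open>P\<^sup>\<psi> \<otimes> N\<close> over \<open>A\<^sub>p\<close>, where \<open>N\<close> is a module over \<open>A\<^sub>k\<^sub>+\<^sub>p\<close>, on which \<open>A\<^sub>p\<close> acts through
  \<open>a \<mapsto> 1 \<otimes> a\<close>; the result is a module over \<open>A\<^sub>k\<close>.
\<close>

definition twist :: "('k, 'a) tower \<Rightarrow> nat \<Rightarrow> ('a, 'p) graded \<Rightarrow> ('a, 'p) graded"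
  where "twist T p P = restrict_scalars (anti T p) P"

definition right_part :: "('k, 'a) tower \<Rightarrow> nat \<Rightarrow> nat \<Rightarrow> ('a, 'x) graded \<Rightarrow> ('a, 'x) graded"
  where "right_part T k p N = restrict_scalars (ext_mult T k p \<one>\<^bsub>alg T k\<^esub>) N"

definition twisted_restriction ::
    "('k, 'a) tower \<Rightarrow> nat \<Rightarrow> nat \<Rightarrow> ('a, 'p) graded \<Rightarrow> ('a, 'x) graded \<Rightarrow>
      ('a, ('p, 'x) tensor) graded"
  where "twisted_restriction T k p P N =
    (let X = twist T p P; Y = right_part T k p N
     in tensor_product (alg T p) X Y
          (\<lambda>a. tensor_map (alg T p) X Y (\<lambda>x. x) (\<lambda>y. ext_mult T k p a \<one>\<^bsub>alg T p\<^esub> \<odot>\<^bsub>N\<^esub> y)))"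

text \<open>
  In degree \<open>k\<close>, the component \<open>P\<^sub>p\<close> contributes through \<open>N\<^sub>k\<^sub>+\<^sub>p\<close>; no contribution has \<open>n < p\<close>.
\<close>

definition TR_functor ::
    "('k, 'a) tower \<Rightarrow> ('a, 'p) family \<Rightarrow> ('a, 'x, nat \<Rightarrow> ('p, 'x) tensor) gfunctor"
  where "TR_functor T P =
    \<lparr>obj = (\<lambda>N k. direct_sum UNIV (\<lambda>p. twisted_restriction T k p (P p) (N (k + p)))),
     mor = (\<lambda>N N' f k. direct_sum_map UNIV
       (\<lambda>p. tensor_map (alg T p) (twist T p (P p)) (right_part T k p (N' (k + p)))
         (\<lambda>x. x) (f (k + p))))\<rparr>"

end

theory Submission
  imports Defs
begin

text \<open>
  Induced modules and twisted restrictions are tensor products over tensor products, but additive maps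
  out of them are the same as multiadditive balanced maps out of their factors.  Both composites of
  induction functors classify the maps \<open>\<phi>(c, x, y, z)\<close> with
  \<open>\<phi>(c\<cdot>(a \<otimes> b \<otimes> e), x, y, z) = \<phi>(c, a x, b y, e z)\<close>, where associativity of the tower makes the two
  readings of \<open>a \<otimes> b \<otimes> e\<close> agree; hence they are isomorphic.  Both composites of twisted
  restrictions classify the maps \<open>\<phi>(x, y, v)\<close> with
  \<open>\<phi>(\<psi>(a) x, \<psi>(b) y, v) = \<phi>(x, y, (1 \<otimes> a \<otimes> b) v)\<close>; on the side of \<open>IND(P \<boxtimes> Q)\<close> this needs
  \<open>\<psi>(a \<otimes> b) = \<psi>(a) \<otimes> \<psi>(b)\<close>.
\<close>

section \<open>Tensor products\<close>

text \<open>In the left composite of inductions a generator carries an outer algebra element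
  \<open>c\<close> and an inner one \<open>d\<close>. The inner one crosses the outer tensor sign:
  \<open>c \<otimes> (d \<otimes> (x \<otimes> y) \<otimes> z)\<close> equals \<open>c (d \<otimes>
  1) \<otimes> (1 \<otimes> (x \<otimes> y) \<otimes> z)\<close>. This is why the classified maps
  contain a single algebra element, and it dictates the values of all lifts. Under a twisted
  restriction the inner element of \<open>IND(P, Q)\<close> crosses to the restricted module instead
  and becomes its preimage under \<open>\<psi>\<close>; bijectivity of \<open>\<psi>\<close> enters
  there. Degrees are the second obstacle: homogeneous tensors are defined by generation, so
  directness of the grading needs projections, which come from a balanced map. Inverses are built as
  additive maps only; their linearity and degree follow from bijectivity.\<close>

definition balanced ::
    "('r, 'u) ring_scheme \<Rightarrow> ('r, 'x, 'v) module_scheme \<Rightarrow> ('r, 'y, 'w) module_scheme \<Rightarrow>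
      ('g, 'h) monoid_scheme \<Rightarrow> ('x \<Rightarrow> 'y \<Rightarrow> 'g) \<Rightarrow> bool"
  where "balanced R X Y G \<phi> \<longleftrightarrow>
    (\<forall>x\<in>carrier X. \<forall>y\<in>carrier Y. \<phi> x y \<in> carrier G) \<and>
    (\<forall>x\<in>carrier X. \<forall>x'\<in>carrier X. \<forall>y\<in>carrier Y. \<phi> (x \<oplus>\<^bsub>X\<^esub> x') y = \<phi> x y \<otimes>\<^bsub>G\<^esub> \<phi> x' y) \<and>
    (\<forall>x\<in>carrier X. \<forall>y\<in>carrier Y. \<forall>y'\<in>carrier Y. \<phi> x (y \<oplus>\<^bsub>Y\<^esub> y') = \<phi> x y \<otimes>\<^bsub>G\<^esub> \<phi> x y') \<and>
    (\<forall>r\<in>carrier R. \<forall>x\<in>carrier X. \<forall>y\<in>carrier Y. \<phi> (r \<odot>\<^bsub>X\<^esub> x) y = \<phi> x (r \<odot>\<^bsub>Y\<^esub> y))"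

lemma balancedI:
  assumes "\<And>x y. x \<in> carrier X \<Longrightarrow> y \<in> carrier Y \<Longrightarrow> \<phi> x y \<in> carrier G"
    and "\<And>x x' y. x \<in> carrier X \<Longrightarrow> x' \<in> carrier X \<Longrightarrow> y \<in> carrier Y \<Longrightarrow>
      \<phi> (x \<oplus>\<^bsub>X\<^esub> x') y = \<phi> x y \<otimes>\<^bsub>G\<^esub> \<phi> x' y"
    and "\<And>x y y'. x \<in> carrier X \<Longrightarrow> y \<in> carrier Y \<Longrightarrow> y' \<in> carrier Y \<Longrightarrow>
      \<phi> x (y \<oplus>\<^bsub>Y\<^esub> y') = \<phi> x y \<otimes>\<^bsub>G\<^esub> \<phi> x y'"
    and "\<And>r x y. r \<in> carrier R \<Longrightarrow> x \<in> carrier X \<Longrightarrow> y \<in> carrier Y \<Longrightarrow>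
      \<phi> (r \<odot>\<^bsub>X\<^esub> x) y = \<phi> x (r \<odot>\<^bsub>Y\<^esub> y)"
  shows "balanced R X Y G \<phi>"
  using assms unfolding balanced_def by blast

text \<open>A choice suffices: pure tensors generate, so any two candidates agree on the tensor
  group, and only the homomorphism property and the values on pure tensors are ever used.\<close>

definition tensor_lift ::
    "('r, 'u) ring_scheme \<Rightarrow> ('r, 'x, 'v) module_scheme \<Rightarrow> ('r, 'y, 'w) module_scheme \<Rightarrow>
      ('g, 'h) monoid_scheme \<Rightarrow> ('x \<Rightarrow> 'y \<Rightarrow> 'g) \<Rightarrow> ('x, 'y) tensor \<Rightarrow> 'g"
  where "tensor_lift R X Y G \<phi> = (SOME h. h \<in> hom (tensor_group R X Y) G \<and>
    (\<forall>x\<in>carrier X. \<forall>y\<in>carrier Y. h (pure R X Y x y) = \<phi> x y))"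

lemma keys_frag_diff3: "\<lbrakk>a \<in> S; b \<in> S; c \<in> S\<rbrakk> \<Longrightarrow>
   Poly_Mapping.keys (frag_of a - frag_of b - frag_of c) \<subseteq> S"
  by (intro order.trans[OF keys_diff] Un_least) simp_all

lemma keys_frag_diff2: "\<lbrakk>a \<in> S; b \<in> S\<rbrakk> \<Longrightarrow> Poly_Mapping.keys (frag_of a - frag_of b) \<subseteq> S"
  by (intro order.trans[OF keys_diff] Un_least) simp_all

lemma keys_frag_add2: "\<lbrakk>a \<in> S; b \<in> S\<rbrakk> \<Longrightarrow> Poly_Mapping.keys (frag_of a + frag_of b) \<subseteq> S"
  by (intro order.trans[OF keys_add] Un_least) simp_all

text \<open>These assumptions are what the relations require in order to lie in the free group.
  Stated without module axioms, they fit left and right modules alike.\<close>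

locale tensor_pair =
  fixes R :: "('r, 'u) ring_scheme" and X :: "('r, 'x, 'v) module_scheme"
    and Y :: "('r, 'y, 'w) module_scheme"
  assumes X: "abelian_group X" and Y: "abelian_group Y"
    and X_smult: "\<lbrakk>r \<in> carrier R; x \<in> carrier X\<rbrakk> \<Longrightarrow> r \<odot>\<^bsub>X\<^esub> x \<in> carrier X"
    and Y_smult: "\<lbrakk>r \<in> carrier R; y \<in> carrier Y\<rbrakk> \<Longrightarrow> r \<odot>\<^bsub>Y\<^esub> y \<in> carrier Y"
begin

sublocale X: abelian_group X by (rule X)
sublocale Y: abelian_group Y by (rule Y)

abbreviation F where "F \<equiv> free_Abelian_group (carrier X \<times> carrier Y)"
abbreviation T where "T \<equiv> tensor_group R X Y"
abbreviation p where "p \<equiv> pure R X Y"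

lemma relations_subset: "tensor_relations R X Y \<subseteq> carrier F"
  unfolding tensor_relations_def
proof (intro Un_least subsetI; elim CollectE exE conjE)
qed (simp_all add: keys_frag_diff2 keys_frag_diff3 X_smult Y_smult)

lemma kernel_subgroup: "subgroup (tensor_kernel R X Y) F"
  unfolding tensor_kernel_def
  by (rule group.generate_is_subgroup[OF group_free_Abelian_group relations_subset])

lemma kernel_normal: "tensor_kernel R X Y \<lhd> F"
  by (rule comm_group.subgroup_imp_normal[OF abelian_free_Abelian_group kernel_subgroup])

sublocale T: comm_group T
  unfolding tensor_group_def
  by (rule comm_group.abelian_FactGroup[OF abelian_free_Abelian_group kernel_subgroup])

lemma class_hom: "tensor_class R X Y \<in> hom F T"
  unfolding tensor_class_def tensor_group_def
  using normal.r_coset_hom_Mod[OF kernel_normal] by simp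

lemma class_surj: "t \<in> carrier T \<Longrightarrow> \<exists>u\<in>carrier F. t = tensor_class R X Y u"
  unfolding tensor_class_def tensor_group_def carrier_FactGroup by blast

lemma class_closed: "u \<in> carrier F \<Longrightarrow> tensor_class R X Y u \<in> carrier T"
  using class_hom by (rule hom_in_carrier)

lemma class_add: "\<lbrakk>u \<in> carrier F; v \<in> carrier F\<rbrakk> \<Longrightarrow>
    tensor_class R X Y (u + v) = tensor_class R X Y u \<otimes>\<^bsub>T\<^esub> tensor_class R X Y v"
  using hom_mult[OF class_hom] by simp

lemma class_kernel:
  assumes "u \<in> tensor_kernel R X Y" shows "tensor_class R X Y u = \<one>\<^bsub>T\<^esub>"
  using assms kernel_subgroup
  by (simp add: tensor_class_def tensor_group_def subgroup.rcos_const)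

lemma class_zero: "tensor_class R X Y 0 = \<one>\<^bsub>T\<^esub>"
  using class_kernel subgroup.one_closed[OF kernel_subgroup] by simp

lemma class_diff:
  assumes "u \<in> carrier F" "v \<in> carrier F"
  shows "tensor_class R X Y (u - v) = tensor_class R X Y u \<otimes>\<^bsub>T\<^esub> inv\<^bsub>T\<^esub> tensor_class R X Y v"
proof -
  have k: "u - v \<in> carrier F"
    using assms keys_diff[of u v] by (meson Un_least carrier_free_Abelian_group_iff order.trans)
  have "tensor_class R X Y (u - v) \<otimes>\<^bsub>T\<^esub> tensor_class R X Y v = tensor_class R X Y u"
    using class_add[OF k assms(2)] by simp
  from T.inv_solve_right'[OF class_closed[OF k] class_closed[OF assms(1)] class_closed[OF assms(2)]] this
  show ?thesis by metis
qed

lemma pure_closed [simp]: "\<lbrakk>x \<in> carrier X; y \<in> carrier Y\<rbrakk> \<Longrightarrow> p x y \<in> carrier T"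
  unfolding pure_def by (rule class_closed) simp

text \<open>Every defining relation is a difference \<open>u - v\<close>, and the class map is a
  homomorphism that kills it. The three rules for pure tensors below are instances.\<close>

lemma class_rel:
  assumes "u - v \<in> tensor_relations R X Y" "u \<in> carrier F" "v \<in> carrier F"
  shows "tensor_class R X Y u = tensor_class R X Y v"
proof -
  have "u - v \<in> tensor_kernel R X Y"
    using assms(1) unfolding tensor_kernel_def by (rule generate.incl)
  then have "tensor_class R X Y u \<otimes>\<^bsub>T\<^esub> inv\<^bsub>T\<^esub> tensor_class R X Y v = \<one>\<^bsub>T\<^esub>"
    using class_kernel class_diff assms by metis
  then show ?thesis
    using class_closed[OF assms(2)] class_closed[OF assms(3)] by (metis T.inv_equality T.inv_inv T.inv_closed)
qed

lemma pure_add_left: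
  assumes "x \<in> carrier X" "x' \<in> carrier X" "y \<in> carrier Y"
  shows "p (x \<oplus>\<^bsub>X\<^esub> x') y = p x y \<otimes>\<^bsub>T\<^esub> p x' y"
proof -
  have "tensor_class R X Y (frag_of (x \<oplus>\<^bsub>X\<^esub> x', y)) = tensor_class R X Y (frag_of (x, y) + frag_of (x', y))"
    \<comment> \<open>The difference \<open>u - (v + w)\<close> is rewritten to
      \<open>u - v - w\<close>, the form in which the relation was imposed.\<close>
    by (rule class_rel, unfold tensor_relations_def diff_diff_eq[symmetric])
       (use assms in \<open>blast, simp_all add: keys_frag_add2\<close>)
  then show ?thesis
    unfolding pure_def using class_add assms by simp
qed

lemma pure_add_right:
  assumes "x \<in> carrier X" "y \<in> carrier Y" "y' \<in> carrier Y"
  shows "p x (y \<oplus>\<^bsub>Y\<^esub> y') = p x y \<otimes>\<^bsub>T\<^esub> p x y'"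
proof -
  have "tensor_class R X Y (frag_of (x, y \<oplus>\<^bsub>Y\<^esub> y')) = tensor_class R X Y (frag_of (x, y) + frag_of (x, y'))"
    by (rule class_rel, unfold tensor_relations_def diff_diff_eq[symmetric])
       (use assms in \<open>blast, simp_all add: keys_frag_add2\<close>)
  then show ?thesis
    unfolding pure_def using class_add assms by simp
qed

lemma pure_smult:
  assumes "r \<in> carrier R" "x \<in> carrier X" "y \<in> carrier Y"
  shows "p (r \<odot>\<^bsub>X\<^esub> x) y = p x (r \<odot>\<^bsub>Y\<^esub> y)"
  unfolding pure_def
  by (rule class_rel, unfold tensor_relations_def)
     (use assms X_smult Y_smult in \<open>blast, simp_all\<close>)

text \<open>Additivity at zero plus zero makes the element idempotent, and a group has no idempotent
  but its unit. The same argument serves for all generators later on.\<close>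

lemma pure_zero_left:
  assumes "y \<in> carrier Y" shows "p \<zero>\<^bsub>X\<^esub> y = \<one>\<^bsub>T\<^esub>"
  using pure_add_left[of "\<zero>\<^bsub>X\<^esub>" "\<zero>\<^bsub>X\<^esub>" y] assms by (simp add: T.l_cancel_one')

lemma pure_zero_right:
  assumes "x \<in> carrier X" shows "p x \<zero>\<^bsub>Y\<^esub> = \<one>\<^bsub>T\<^esub>"
  using pure_add_right[of x "\<zero>\<^bsub>Y\<^esub>" "\<zero>\<^bsub>Y\<^esub>"] assms by (simp add: T.l_cancel_one')

lemma pure_minus:
  assumes "x \<in> carrier X" "y \<in> carrier Y" shows "inv\<^bsub>T\<^esub> (p x y) = p (\<ominus>\<^bsub>X\<^esub> x) y"
  using pure_add_left[of "\<ominus>\<^bsub>X\<^esub> x" x y] assms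
  by (intro T.inv_equality) (simp_all add: X.l_neg pure_zero_left)

text \<open>Inverses need no case of their own, because the inverse of a pure tensor is again
  pure.\<close>

lemma tensor_induct [consumes 1, case_names pure add]:
  assumes t: "t \<in> carrier T"
    and pure: "\<And>x y. \<lbrakk>x \<in> carrier X; y \<in> carrier Y\<rbrakk> \<Longrightarrow> P (p x y)"
    and add: "\<And>s t. \<lbrakk>s \<in> carrier T; t \<in> carrier T; P s; P t\<rbrakk> \<Longrightarrow> P (s \<otimes>\<^bsub>T\<^esub> t)"
  shows "P t"
proof -
  \<comment> \<open>Formal sums are built by differences of formal sums, so the property has to be
    carried along for the inverse as well.\<close>
  define Q where "Q = (\<lambda>t. P t \<and> P (inv\<^bsub>T\<^esub> t))"
  obtain u where u: "Poly_Mapping.keys u \<subseteq> carrier X \<times> carrier Y" "t = tensor_class R X Y u"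
    using class_surj[OF t] by auto
  have one: "P \<one>\<^bsub>T\<^esub>"
    using pure[of "\<zero>\<^bsub>X\<^esub>" "\<zero>\<^bsub>Y\<^esub>"] by (simp add: pure_zero_left)
  have "Q (tensor_class R X Y u)"
    using u(1)
  proof (rule free_Abelian_group_induct)
    show "Q (tensor_class R X Y 0)"
      unfolding Q_def using one class_zero by simp
  next
    fix a b
    assume ab: "Poly_Mapping.keys a \<subseteq> carrier X \<times> carrier Y" "Poly_Mapping.keys b \<subseteq> carrier X \<times> carrier Y"
      and Q: "Q (tensor_class R X Y a)" "Q (tensor_class R X Y b)"
    have c: "tensor_class R X Y a \<in> carrier T" "tensor_class R X Y b \<in> carrier T"
      using ab class_closed by simp_all
    show "Q (tensor_class R X Y (a - b))"
      using Q ab c unfolding Q_def by (simp add: class_diff T.inv_mult add)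
  next
    fix z assume z: "z \<in> carrier X \<times> carrier Y"
    then obtain x y where "z = (x, y)" "x \<in> carrier X" "y \<in> carrier Y"
      by blast
    then show "Q (tensor_class R X Y (frag_of z))"
      using pure[of x y] pure_minus[of x y] pure[of "\<ominus>\<^bsub>X\<^esub> x" y] unfolding Q_def pure_def by simp
  qed
  then show ?thesis
    using u Q_def by simp
qed

text \<open>The free group provides a homomorphism with the given values on pairs. The three clauses
  of \<open>balanced\<close> say exactly that it kills the three kinds of relations, so it factors
  through the quotient.\<close>

lemma tensor_lift_exists:
  assumes G: "comm_group G" and b: "balanced R X Y G \<phi>"
  shows "\<exists>h. h \<in> hom T G \<and> (\<forall>x\<in>carrier X. \<forall>y\<in>carrier Y. h (p x y) = \<phi> x y)"
proof -
  interpret G: comm_group G by (rule G)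
  have "case_prod \<phi> ` (carrier X \<times> carrier Y) \<subseteq> carrier G"
    using b by (auto simp: balanced_def)
  then obtain h where h: "h \<in> hom F G"
    and hf: "\<And>z. z \<in> carrier X \<times> carrier Y \<Longrightarrow> h (frag_of z) = case_prod \<phi> z"
    using G.free_Abelian_group_universal by blast
  interpret h: group_hom F G h
    using h G.group_axioms by (simp add: group_hom_def group_hom_axioms_def)
  have hdiff: "h (u - v) = h u \<otimes>\<^bsub>G\<^esub> inv\<^bsub>G\<^esub> h v" if "u \<in> carrier F" "v \<in> carrier F" for u v
    using h.hom_mult[of u "- v"] h.hom_inv[of v] that by simp
  have cl: "\<phi> x y \<in> carrier G" if "x \<in> carrier X" "y \<in> carrier Y" for x y
    using b that by (auto simp: balanced_def)
  have "tensor_relations R X Y \<subseteq> kernel F G h"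
  proof
    fix u assume u: "u \<in> tensor_relations R X Y"
    have "h u = \<one>\<^bsub>G\<^esub>"
      using u unfolding tensor_relations_def
    proof (elim UnE CollectE exE conjE)
      fix x x' y assume c: "x \<in> carrier X" "x' \<in> carrier X" "y \<in> carrier Y"
        and e: "u = frag_of (x \<oplus>\<^bsub>X\<^esub> x', y) - frag_of (x, y) - frag_of (x', y)"
      have "h u = \<phi> (x \<oplus>\<^bsub>X\<^esub> x') y \<otimes>\<^bsub>G\<^esub> inv\<^bsub>G\<^esub> \<phi> x y \<otimes>\<^bsub>G\<^esub> inv\<^bsub>G\<^esub> \<phi> x' y"
        unfolding e using c keys_frag_diff2[of "(x \<oplus>\<^bsub>X\<^esub> x', y)" "carrier X \<times> carrier Y" "(x, y)"]
        by (simp add: hdiff hf)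
      then show ?thesis
        using b c by (simp add: balanced_def G.m_comm[of "\<phi> x y"] G.m_assoc)
    next
      fix x y y' assume c: "x \<in> carrier X" "y \<in> carrier Y" "y' \<in> carrier Y"
        and e: "u = frag_of (x, y \<oplus>\<^bsub>Y\<^esub> y') - frag_of (x, y) - frag_of (x, y')"
      have "h u = \<phi> x (y \<oplus>\<^bsub>Y\<^esub> y') \<otimes>\<^bsub>G\<^esub> inv\<^bsub>G\<^esub> \<phi> x y \<otimes>\<^bsub>G\<^esub> inv\<^bsub>G\<^esub> \<phi> x y'"
        unfolding e using c keys_frag_diff2[of "(x, y \<oplus>\<^bsub>Y\<^esub> y')" "carrier X \<times> carrier Y" "(x, y)"]
        by (simp add: hdiff hf)
      then show ?thesis
        using b c by (simp add: balanced_def G.m_comm[of "\<phi> x y"] G.m_assoc)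
    next
      fix r x y assume c: "r \<in> carrier R" "x \<in> carrier X" "y \<in> carrier Y"
        and e: "u = frag_of (r \<odot>\<^bsub>X\<^esub> x, y) - frag_of (x, r \<odot>\<^bsub>Y\<^esub> y)"
      have "h u = \<phi> (r \<odot>\<^bsub>X\<^esub> x) y \<otimes>\<^bsub>G\<^esub> inv\<^bsub>G\<^esub> \<phi> x (r \<odot>\<^bsub>Y\<^esub> y)"
        unfolding e using c by (simp add: hdiff hf X_smult Y_smult)
      then show ?thesis
        using b c cl Y_smult by (simp add: balanced_def)
    qed
    then show "u \<in> kernel F G h"
      using relations_subset u unfolding kernel_def by blast
  qed
  then have "tensor_kernel R X Y \<subseteq> kernel F G h"
    unfolding tensor_kernel_def
    by (rule group.generate_subgroup_incl[OF group_free_Abelian_group _ h.subgroup_kernel])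
  then obtain g where "g \<in> hom T G" "\<And>u. u \<in> carrier F \<Longrightarrow> g (tensor_class R X Y u) = h u"
    using h.FactGroup_universal_kernel[OF kernel_normal] unfolding tensor_class_def tensor_group_def by metis
  then show ?thesis
    using hf unfolding pure_def by (intro exI[of _ g]) simp
qed

lemma
  assumes "comm_group G" and "balanced R X Y G \<phi>"
  shows tensor_lift_hom: "tensor_lift R X Y G \<phi> \<in> hom T G"
    and tensor_lift_pure:
      "\<lbrakk>x \<in> carrier X; y \<in> carrier Y\<rbrakk> \<Longrightarrow> tensor_lift R X Y G \<phi> (p x y) = \<phi> x y"
  using someI_ex[OF tensor_lift_exists[OF assms]] unfolding tensor_lift_def by auto

text \<open>A tensor is a set of formal sums, and each member represents it. Together with
  nonemptiness this collapses the unions in \<open>tensor_map\<close> and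
  \<open>tensor_map2\<close>.\<close>

lemma class_of_mem:
  assumes "t \<in> carrier T" "u \<in> t" shows "u \<in> carrier F" "tensor_class R X Y u = t"
proof -
  obtain v where v: "v \<in> carrier F" "t = tensor_class R X Y v"
    using class_surj assms(1) by blast
  show "u \<in> carrier F"
    using v assms(2) subgroup.subset[OF kernel_subgroup]
      monoid.r_coset_subset_G[OF group.is_monoid[OF group_free_Abelian_group]]
    unfolding tensor_class_def by blast
  show "tensor_class R X Y u = t"
    using v assms(2) kernel_subgroup unfolding tensor_class_def
    by (metis group.repr_independence group_free_Abelian_group)
qed

lemma mem_nonempty: "t \<in> carrier T \<Longrightarrow> t \<noteq> {}"
  using class_surj kernel_subgroup unfolding tensor_class_def
  by (metis empty_iff group.rcos_self group_free_Abelian_group)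

text \<open>Both sides are homomorphisms on the free group and agree on its basis. It compares a
  formula on representatives with a map obtained from the universal property.\<close>

lemma hom_class_eqI:
  assumes "u \<in> carrier F" "h \<in> hom T G" "group G" "k \<in> hom F G"
    and "\<And>x y. \<lbrakk>x \<in> carrier X; y \<in> carrier Y\<rbrakk> \<Longrightarrow> k (frag_of (x, y)) = h (p x y)"
  shows "k u = h (tensor_class R X Y u)"
proof -
  interpret k: group_hom F G k
    using assms by (simp add: group_hom_def group_hom_axioms_def)
  interpret h: group_hom T G h
    using assms T.group_axioms by (simp add: group_hom_def group_hom_axioms_def)
  have kdiff: "k (a - b) = k a \<otimes>\<^bsub>G\<^esub> inv\<^bsub>G\<^esub> k b" if "a \<in> carrier F" "b \<in> carrier F" for a b
    using k.hom_mult[of a "- b"] k.hom_inv[of b] that by simp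
  have "Poly_Mapping.keys u \<subseteq> carrier X \<times> carrier Y"
    using assms by simp
  then show ?thesis
  proof (rule free_Abelian_group_induct)
    show "k 0 = h (tensor_class R X Y 0)"
      using k.hom_one class_zero by simp
  next
    fix a b
    assume ab: "Poly_Mapping.keys a \<subseteq> carrier X \<times> carrier Y" "Poly_Mapping.keys b \<subseteq> carrier X \<times> carrier Y"
      and e: "k a = h (tensor_class R X Y a)" "k b = h (tensor_class R X Y b)"
    have c: "tensor_class R X Y a \<in> carrier T" "tensor_class R X Y b \<in> carrier T"
      using ab class_closed by simp_all
    show "k (a - b) = h (tensor_class R X Y (a - b))"
      using e ab c by (simp add: class_diff kdiff)
  next
    fix z assume z: "z \<in> carrier X \<times> carrier Y"
    then obtain x y where "z = (x, y)" "x \<in> carrier X" "y \<in> carrier Y"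
      by blast
    then show "k (frag_of z) = h (tensor_class R X Y (frag_of z))"
      using assms(5)[of x y] unfolding pure_def by simp
  qed
qed

end

lemma frag_extend_closed:
  assumes "Poly_Mapping.keys u \<subseteq> A" "\<And>z. z \<in> A \<Longrightarrow> Poly_Mapping.keys (f z) \<subseteq> B"
  shows "Poly_Mapping.keys (frag_extend f u) \<subseteq> B"
  using keys_frag_extend[of f u] assms by blast

lemma frag_extend_hom:
  assumes "\<And>z. z \<in> A \<Longrightarrow> Poly_Mapping.keys (f z) \<subseteq> B"
  shows "frag_extend f \<in> hom (free_Abelian_group A) (free_Abelian_group B)"
  by (rule homI) (simp_all add: frag_extend_closed[OF _ assms] frag_extend_add)

section \<open>Maps of tensor products given on representatives\<close>

text \<open>The map given on representatives is identified with the lift of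
  \<open>f x \<otimes> g y\<close>, which is well defined; hence the union runs over equal cosets,
  and both conclusions are those of the lift.\<close>

lemma
  assumes S: "tensor_pair R C D" and T: "tensor_pair Q X Y"
    and b: "balanced R C D (tensor_group Q X Y) (\<lambda>x y. pure Q X Y (f x) (g y))"
    and f: "f \<in> carrier C \<rightarrow> carrier X" and g: "g \<in> carrier D \<rightarrow> carrier Y"
  shows tensor_map_hom: "tensor_map Q X Y f g \<in> hom (tensor_group R C D) (tensor_group Q X Y)"
    and tensor_map_pure: "\<lbrakk>x \<in> carrier C; y \<in> carrier D\<rbrakk> \<Longrightarrow>
      tensor_map Q X Y f g (pure R C D x y) = pure Q X Y (f x) (g y)"
proof -
  interpret S: tensor_pair R C D by (rule S)
  interpret T: tensor_pair Q X Y by (rule T)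
  define h where "h = tensor_lift R C D T.T (\<lambda>x y. pure Q X Y (f x) (g y))"
  have h: "h \<in> hom S.T T.T" and hp: "\<And>x y. \<lbrakk>x \<in> carrier C; y \<in> carrier D\<rbrakk> \<Longrightarrow>
      h (S.p x y) = T.p (f x) (g y)"
    unfolding h_def using S.tensor_lift_hom[OF T.T.comm_group_axioms b]
      S.tensor_lift_pure[OF T.T.comm_group_axioms b] by auto
  let ?e = "frag_extend (\<lambda>(x, y). frag_of (f x, g y))"
  have e: "?e \<in> hom S.F T.F"
    by (rule frag_extend_hom) (use f g in auto)
  have eq: "tensor_class Q X Y (?e u) = h (tensor_class R C D u)" if "u \<in> carrier S.F" for u
    by (rule S.hom_class_eqI[OF that h T.T.group_axioms, of "\<lambda>u. tensor_class Q X Y (?e u)"])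
       (use hom_compose[OF e T.class_hom] hp in \<open>auto simp: comp_def pure_def\<close>)
  have "tensor_map Q X Y f g t = h t" if "t \<in> carrier S.T" for t
  proof -
    have "tensor_map Q X Y f g t = (\<Union>u\<in>t. h t)"
      unfolding tensor_map_def
      using S.class_of_mem[OF that] eq by (intro SUP_cong) auto
    then show ?thesis using S.mem_nonempty[OF that] by simp
  qed
  then show "tensor_map Q X Y f g \<in> hom S.T T.T"
    and "\<lbrakk>x \<in> carrier C; y \<in> carrier D\<rbrakk> \<Longrightarrow> tensor_map Q X Y f g (S.p x y) = T.p (f x) (g y)"
    using h hp by (auto simp: hom_def Pi_def)
qed


text \<open>The biadditive map arises in two stages: with \<open>a\<close>, \<open>b\<close> fixed
  the second argument is lifted (\<open>k a b\<close>), then for a fixed tensor \<open>t\<close> the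
  value is balanced in \<open>a\<close>, \<open>b\<close> and is lifted once more
  (\<open>K t\<close>). Finally the formula on representatives is matched with
  \<open>K\<close>.\<close>

lemma
  assumes S: "tensor_pair R A B" and U: "tensor_pair R' C D" and T: "tensor_pair Q X Y"
    and b1: "\<And>a b. \<lbrakk>a \<in> carrier A; b \<in> carrier B\<rbrakk> \<Longrightarrow>
      balanced R' C D (tensor_group Q X Y) (\<lambda>x y. pure Q X Y (f a x) (g b y))"
    and b2: "\<And>x y. \<lbrakk>x \<in> carrier C; y \<in> carrier D\<rbrakk> \<Longrightarrow>
      balanced R A B (tensor_group Q X Y) (\<lambda>a b. pure Q X Y (f a x) (g b y))"
    and f: "\<And>a x. \<lbrakk>a \<in> carrier A; x \<in> carrier C\<rbrakk> \<Longrightarrow> f a x \<in> carrier X"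
    and g: "\<And>b y. \<lbrakk>b \<in> carrier B; y \<in> carrier D\<rbrakk> \<Longrightarrow> g b y \<in> carrier Y"
  shows tensor_map2_hom_left: "t \<in> carrier (tensor_group R' C D) \<Longrightarrow>
      (\<lambda>s. tensor_map2 Q X Y f g s t) \<in> hom (tensor_group R A B) (tensor_group Q X Y)"
    and tensor_map2_hom_right: "s \<in> carrier (tensor_group R A B) \<Longrightarrow>
      tensor_map2 Q X Y f g s \<in> hom (tensor_group R' C D) (tensor_group Q X Y)"
    and tensor_map2_pure:
      "\<lbrakk>a \<in> carrier A; b \<in> carrier B; x \<in> carrier C; y \<in> carrier D\<rbrakk> \<Longrightarrow>
        tensor_map2 Q X Y f g (pure R A B a b) (pure R' C D x y) = pure Q X Y (f a x) (g b y)"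
proof -
  interpret S: tensor_pair R A B by (rule S)
  interpret U: tensor_pair R' C D by (rule U)
  interpret T: tensor_pair Q X Y by (rule T)
  define k where "k a b = tensor_lift R' C D T.T (\<lambda>x y. T.p (f a x) (g b y))" for a b
  have k: "k a b \<in> hom U.T T.T" if "a \<in> carrier A" "b \<in> carrier B" for a b
    unfolding k_def using U.tensor_lift_hom[OF T.T.comm_group_axioms b1[OF that]] .
  have kp: "k a b (U.p x y) = T.p (f a x) (g b y)"
    if "a \<in> carrier A" "b \<in> carrier B" "x \<in> carrier C" "y \<in> carrier D" for a b x y
    unfolding k_def using U.tensor_lift_pure[OF T.T.comm_group_axioms b1[OF that(1,2)] that(3,4)] .
  have kc: "k a b t \<in> carrier T.T" if "a \<in> carrier A" "b \<in> carrier B" "t \<in> carrier U.T" for a b t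
    using hom_in_carrier[OF k] that by blast
  have kbal: "balanced R A B T.T (\<lambda>a b. k a b t)" if "t \<in> carrier U.T" for t
  proof (rule balancedI)
    fix a a' b assume c: "a \<in> carrier A" "a' \<in> carrier A" "b \<in> carrier B"
    show "k (a \<oplus>\<^bsub>A\<^esub> a') b t = k a b t \<otimes>\<^bsub>T.T\<^esub> k a' b t"
      using that
    proof (induction rule: U.tensor_induct)
      case (pure x y)
      then show ?case using b2[of x y] c by (simp add: kp balanced_def)
    next
      case (add s t)
      then show ?case using c by (simp add: hom_mult[OF k] kc T.T.m_ac)
    qed
  next
    fix a b b' assume c: "a \<in> carrier A" "b \<in> carrier B" "b' \<in> carrier B"
    show "k a (b \<oplus>\<^bsub>B\<^esub> b') t = k a b t \<otimes>\<^bsub>T.T\<^esub> k a b' t"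
      using that
    proof (induction rule: U.tensor_induct)
      case (pure x y)
      then show ?case using b2[of x y] c by (simp add: kp balanced_def)
    next
      case (add s t)
      then show ?case using c by (simp add: hom_mult[OF k] kc T.T.m_ac)
    qed
  next
    fix r a b assume c: "r \<in> carrier R" "a \<in> carrier A" "b \<in> carrier B"
    show "k (r \<odot>\<^bsub>A\<^esub> a) b t = k a (r \<odot>\<^bsub>B\<^esub> b) t"
      using that
    proof (induction rule: U.tensor_induct)
      case (pure x y)
      then show ?case using b2[of x y] c S.X_smult S.Y_smult by (simp add: kp balanced_def)
    next
      case (add s t)
      then show ?case using c S.X_smult S.Y_smult by (simp add: hom_mult[OF k] kc)
    qed
  qed (use that kc in auto)
  define K where "K t = tensor_lift R A B T.T (\<lambda>a b. k a b t)" for t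
  have K: "K t \<in> hom S.T T.T" if "t \<in> carrier U.T" for t
    unfolding K_def using S.tensor_lift_hom[OF T.T.comm_group_axioms kbal[OF that]] .
  have Kp: "K t (S.p a b) = k a b t" if "a \<in> carrier A" "b \<in> carrier B" "t \<in> carrier U.T" for a b t
    unfolding K_def using S.tensor_lift_pure[OF T.T.comm_group_axioms kbal[OF that(3)] that(1,2)] .
  \<comment> \<open>Additivity in the first argument is part of the lift; in \<open>t\<close>, for
    which \<open>K t\<close> is chosen separately, it has to be recovered by induction on
    \<open>s\<close>.\<close>
  have Kadd: "K (t \<otimes>\<^bsub>U.T\<^esub> t') s = K t s \<otimes>\<^bsub>T.T\<^esub> K t' s"
    if s: "s \<in> carrier S.T" and t: "t \<in> carrier U.T" "t' \<in> carrier U.T" for s t t'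
    using s
  proof (induction rule: S.tensor_induct)
    case (pure a b)
    then show ?case using t by (simp add: Kp hom_mult[OF k])
  next
    case (add s s')
    then show ?case using t hom_in_carrier[OF K] by (simp add: hom_mult[OF K] T.T.m_ac)
  qed
  let ?i = "\<lambda>a b. frag_extend (\<lambda>(x, y). frag_of (f a x, g b y))"
  have i: "?i a b \<in> hom U.F T.F" if "a \<in> carrier A" "b \<in> carrier B" for a b
    by (rule frag_extend_hom) (use f g that in auto)
  have ieq: "tensor_class Q X Y (?i a b v) = k a b (tensor_class R' C D v)"
    if "v \<in> carrier U.F" "a \<in> carrier A" "b \<in> carrier B" for v a b
    by (rule U.hom_class_eqI[OF that(1) k[OF that(2,3)] T.T.group_axioms, of "\<lambda>u. tensor_class Q X Y (?i a b u)"])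
       (use hom_compose[OF i[OF that(2,3)] T.class_hom] kp[OF that(2,3)] in \<open>auto simp: comp_def pure_def\<close>)
  have eq: "tensor_class Q X Y (frag_extend (\<lambda>(a, b). ?i a b v) u) = K (tensor_class R' C D v) (tensor_class R A B u)"
    if uv: "u \<in> carrier S.F" "v \<in> carrier U.F" for u v
  proof -
    have j: "frag_extend (\<lambda>(a, b). ?i a b v) \<in> hom S.F T.F"
      by (rule frag_extend_hom) (use hom_in_carrier[OF i uv(2)] in auto)
    show ?thesis
      by (rule S.hom_class_eqI[OF uv(1) K[OF U.class_closed[OF uv(2)]] T.T.group_axioms,
            of "\<lambda>u. tensor_class Q X Y (frag_extend (\<lambda>(a, b). ?i a b v) u)"])
         (use hom_compose[OF j T.class_hom] ieq[OF uv(2)] Kp[OF _ _ U.class_closed[OF uv(2)]] in \<open>auto simp: comp_def\<close>)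
  qed
  have map2: "tensor_map2 Q X Y f g s t = K t s" if s: "s \<in> carrier S.T" and t: "t \<in> carrier U.T" for s t
  proof -
    have "tensor_map2 Q X Y f g s t = (\<Union>u\<in>s. \<Union>v\<in>t. K t s)"
      unfolding tensor_map2_def
      using S.class_of_mem[OF s] U.class_of_mem[OF t] eq by (intro SUP_cong refl) auto
    then show ?thesis using S.mem_nonempty[OF s] U.mem_nonempty[OF t] by simp
  qed
  show "t \<in> carrier U.T \<Longrightarrow> (\<lambda>s. tensor_map2 Q X Y f g s t) \<in> hom S.T T.T"
    using K[of t] map2[of _ t] by (auto simp: hom_def Pi_def)
  show "s \<in> carrier S.T \<Longrightarrow> tensor_map2 Q X Y f g s \<in> hom U.T T.T"
    by (rule homI) (use map2[of s] Kadd[of s] hom_in_carrier[OF K] in auto)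
  show "\<lbrakk>a \<in> carrier A; b \<in> carrier B; x \<in> carrier C; y \<in> carrier D\<rbrakk> \<Longrightarrow>
      tensor_map2 Q X Y f g (S.p a b) (U.p x y) = T.p (f a x) (g b y)"
    using map2[of "S.p a b" "U.p x y"] by (simp add: Kp kp)
qed

section \<open>Graded groups\<close>

abbreviation ahom :: "('a, 'x) ring_scheme \<Rightarrow> ('b, 'y) ring_scheme \<Rightarrow> ('a \<Rightarrow> 'b) set"
  where "ahom M N \<equiv> hom (add_monoid M) (add_monoid N)"

lemma ahomI:
  assumes "\<And>x. x \<in> carrier M \<Longrightarrow> h x \<in> carrier N"
    and "\<And>x y. \<lbrakk>x \<in> carrier M; y \<in> carrier M\<rbrakk> \<Longrightarrow> h (x \<oplus>\<^bsub>M\<^esub> y) = h x \<oplus>\<^bsub>N\<^esub> h y"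
  shows "h \<in> ahom M N"
  by (rule homI) (simp_all add: assms)

lemma ahom_closed: "\<lbrakk>h \<in> ahom M N; x \<in> carrier M\<rbrakk> \<Longrightarrow> h x \<in> carrier N"
  using hom_in_carrier[of h "add_monoid M" "add_monoid N"] by simp

lemma ahom_add:
  "\<lbrakk>h \<in> ahom M N; x \<in> carrier M; y \<in> carrier M\<rbrakk> \<Longrightarrow> h (x \<oplus>\<^bsub>M\<^esub> y) = h x \<oplus>\<^bsub>N\<^esub> h y"
  using hom_mult[of h "add_monoid M" "add_monoid N"] by simp

lemma (in abelian_group) group_add_monoid: "group (add_monoid G)"
  using a_comm_group by (rule comm_group.axioms(2))

lemma ahom_zero:
  assumes "abelian_group M" "abelian_group N" "h \<in> ahom M N"
  shows "h \<zero>\<^bsub>M\<^esub> = \<zero>\<^bsub>N\<^esub>"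
  using hom_one[OF assms(3) assms(1,2)[THEN abelian_group.group_add_monoid]] by simp

lemma ahom_minus:
  assumes "abelian_group M" "abelian_group N" "h \<in> ahom M N" "x \<in> carrier M"
  shows "h (\<ominus>\<^bsub>M\<^esub> x) = \<ominus>\<^bsub>N\<^esub> h x"
  using group_hom.hom_inv[of "add_monoid M" "add_monoid N" h x] assms(3,4)
    assms(1,2)[THEN abelian_group.group_add_monoid]
  by (simp add: group_hom_def group_hom_axioms_def a_inv_def)

lemma ahom_finsum:
  assumes M: "abelian_group M" and N: "abelian_group N" and h: "h \<in> ahom M N"
    and f: "f \<in> S \<rightarrow> carrier M"
  shows "h (finsum M f S) = finsum N (\<lambda>i. h (f i)) S"
  using f
proof (induction S rule: infinite_finite_induct)
  case (insert i S)
  interpret M: abelian_group M by (rule M)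
  interpret N: abelian_group N by (rule N)
  have "(\<lambda>i. h (f i)) \<in> S \<rightarrow> carrier N" "h (f i) \<in> carrier N"
    using insert.prems ahom_closed[OF h] by auto
  then show ?case
    using insert by (simp add: Pi_def ahom_add[OF h])
qed (use ahom_zero[OF M N h] M N in
      \<open>simp_all add: abelian_group_def abelian_monoid.finsum_empty abelian_monoid.finsum_infinite\<close>)

section \<open>Homogeneous components and a criterion for gradings\<close>

definition component :: "('r, 'm) graded \<Rightarrow> int \<Rightarrow> 'm \<Rightarrow> 'm"
  where "component M d x = (THE f. homogeneous_family M f \<and> family_sum M f = x) d"

locale graded_group = abelian_group M for M :: "('r, 'm) graded" (structure) +
  assumes graded: "is_graded M"
begin

lemma grade_subgroup: "additive_subgroup (grade M i) M"
  using graded by (auto simp: is_graded_def)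

lemma grade_carrier: "x \<in> grade M i \<Longrightarrow> x \<in> carrier M"
  using additive_subgroup.a_subset[OF grade_subgroup] by blast

lemma grade_zero [simp]: "\<zero> \<in> grade M i"
  using additive_subgroup.zero_closed[OF grade_subgroup] .

lemma grade_add: "\<lbrakk>x \<in> grade M i; y \<in> grade M i\<rbrakk> \<Longrightarrow> x \<oplus> y \<in> grade M i"
  using additive_subgroup.a_closed[OF grade_subgroup] .

text \<open>A family is summed over its own support. Two families can be added only after both sums
  run over a common finite set.\<close>

lemma family_sum_superset:
  assumes "homogeneous_family M f" "finite S" "{i. f i \<noteq> \<zero>} \<subseteq> S"
  shows "family_sum M f = finsum M f S"
  unfolding family_sum_def
  by (rule add.finprod_mono_neutral_cong_left)
     (use assms grade_carrier in \<open>auto simp: homogeneous_family_def\<close>)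

lemma
  assumes "x \<in> carrier M"
  shows component_family: "homogeneous_family M (\<lambda>d. component M d x)"
    and component_sum: "family_sum M (\<lambda>d. component M d x) = x"
proof -
  have "\<exists>!f. homogeneous_family M f \<and> family_sum M f = x"
    using graded assms by (auto simp: is_graded_def)
  from theI'[OF this] show "homogeneous_family M (\<lambda>d. component M d x)" "family_sum M (\<lambda>d. component M d x) = x"
    unfolding component_def by (simp_all add: eta_contract_eq)
qed

lemma component_unique:
  assumes "homogeneous_family M f" "family_sum M f = x" "x \<in> carrier M"
  shows "component M d x = f d"
proof -
  have "\<exists>!f. homogeneous_family M f \<and> family_sum M f = x"
    using graded assms by (auto simp: is_graded_def)
  then have "(THE f. homogeneous_family M f \<and> family_sum M f = x) = f"
    using assms by (intro the1_equality) auto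
  then show ?thesis by (simp add: component_def)
qed

lemma component_grade: "x \<in> carrier M \<Longrightarrow> component M d x \<in> grade M d"
  using component_family by (auto simp: homogeneous_family_def)

lemma component_closed: "x \<in> carrier M \<Longrightarrow> component M d x \<in> carrier M"
  using component_grade grade_carrier by blast

lemma component_finite: "x \<in> carrier M \<Longrightarrow> finite {d. component M d x \<noteq> \<zero>}"
  using component_family by (auto simp: homogeneous_family_def)

lemma component_add:
  assumes x: "x \<in> carrier M" and y: "y \<in> carrier M"
  shows "component M d (x \<oplus> y) = component M d x \<oplus> component M d y"
proof (rule component_unique)
  let ?S = "{d. component M d x \<noteq> \<zero>} \<union> {d. component M d y \<noteq> \<zero>}"
  have fin: "finite ?S" using component_finite x y by simp
  have sub: "{d. component M d x \<oplus> component M d y \<noteq> \<zero>} \<subseteq> ?S"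
    using component_closed[OF y] by auto
  show h: "homogeneous_family M (\<lambda>d. component M d x \<oplus> component M d y)"
    unfolding homogeneous_family_def
    using finite_subset[OF sub fin] component_grade x y grade_add by simp
  have "family_sum M (\<lambda>d. component M d x \<oplus> component M d y)
      = finsum M (\<lambda>d. component M d x) ?S \<oplus> finsum M (\<lambda>d. component M d y) ?S"
    unfolding family_sum_superset[OF h fin sub]
    using component_closed x y by (intro finsum_addf) auto
  then show "family_sum M (\<lambda>d. component M d x \<oplus> component M d y) = x \<oplus> y"
    using family_sum_superset[OF component_family[OF x] fin] family_sum_superset[OF component_family[OF y] fin]
      component_sum x y by simp
qed (use x y in simp)

lemma component_hom: "component M d \<in> ahom M M"
  by (rule ahomI) (simp_all add: component_closed component_add)

lemma component_of_grade:
  assumes x: "x \<in> grade M e"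
  shows "component M d x = (if d = e then x else \<zero>)"
proof (rule component_unique)
  let ?f = "\<lambda>d. if d = e then x else \<zero>"
  have sub: "{i. ?f i \<noteq> \<zero>} \<subseteq> {e}" by auto
  show h: "homogeneous_family M ?f"
    unfolding homogeneous_family_def using finite_subset[OF sub] x by simp
  show "family_sum M ?f = x"
    unfolding family_sum_superset[OF h _ sub, simplified] using grade_carrier[OF x] by simp
qed (use grade_carrier[OF x] in simp)

lemma graded_induct [consumes 1, case_names homogeneous add]:
  assumes x: "x \<in> carrier M"
    and hom: "\<And>d x. x \<in> grade M d \<Longrightarrow> P x"
    and add: "\<And>x y. \<lbrakk>x \<in> carrier M; y \<in> carrier M; P x; P y\<rbrakk> \<Longrightarrow> P (x \<oplus> y)"
  shows "P x"
proof -
  have "P (finsum M (\<lambda>d. component M d x) S)" if "finite S" for S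
    using that
  proof (induction S)
    case empty
    then show ?case using hom[OF grade_zero] by simp
  next
    case (insert d S)
    then show ?case
      using component_closed[OF x] add hom[OF component_grade[OF x]] by simp
  qed
  then have "P (family_sum M (\<lambda>d. component M d x))"
    using component_finite[OF x] by (simp add: family_sum_def)
  then show ?thesis by (simp add: component_sum[OF x])
qed

text \<open>For homogeneous \<open>x\<close> both sides are \<open>h x\<close> if the degrees match
  and zero otherwise; both are additive in \<open>x\<close>. It is applied to scalars that shift
  degrees.\<close>

lemma component_shift:
  assumes h: "h \<in> ahom M M" and s: "\<And>i y. y \<in> grade M i \<Longrightarrow> h y \<in> grade M (i + e)"
    and x: "x \<in> carrier M"
  shows "component M d (h x) = h (component M (d - e) x)"
  using x
proof (induction rule: graded_induct)
  case (homogeneous i x)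
  show ?case
    using component_of_grade[OF homogeneous] component_of_grade[OF s[OF homogeneous]]
      ahom_zero[OF abelian_group_axioms abelian_group_axioms h] by auto
next
  case (add x y)
  then show ?case
    by (simp add: ahom_add[OF h] component_add component_closed ahom_closed[OF h])
qed

end

text \<open>Uniqueness of decompositions is not visible from generators. The additive maps
  \<open>\<pi> d\<close>, which are the identity in degree \<open>d\<close> and kill all other
  degrees, recover every member of a decomposition from its sum. Existence follows by the induction
  principle \<open>gen\<close>, and the members are again the values of
  \<open>\<pi>\<close>.\<close>

lemma is_gradedI:
  fixes M :: "('r, 'm) graded"
  assumes M: "abelian_group M"
    and grade: "\<And>i. additive_subgroup (grade M i) M"
    and \<pi>: "\<And>d. \<pi> d \<in> ahom M M"
    and \<pi>_grade: "\<And>d e x. x \<in> grade M e \<Longrightarrow> \<pi> d x = (if d = e then x else \<zero>\<^bsub>M\<^esub>)"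
    and gen: "\<And>P x. \<lbrakk>x \<in> carrier M; \<And>d x. x \<in> grade M d \<Longrightarrow> P x;
      \<And>x y. \<lbrakk>x \<in> carrier M; y \<in> carrier M; P x; P y\<rbrakk> \<Longrightarrow> P (x \<oplus>\<^bsub>M\<^esub> y)\<rbrakk> \<Longrightarrow> P x"
  shows "is_graded M"
proof -
  interpret M: abelian_group M by (rule M)
  have gc: "x \<in> carrier M" if "x \<in> grade M i" for x i
    using additive_subgroup.a_subset[OF grade] that by blast
  have g0: "\<zero>\<^bsub>M\<^esub> \<in> grade M i" for i
    using additive_subgroup.zero_closed[OF grade] .
  have sup: "family_sum M f = finsum M f S"
    if "homogeneous_family M f" "finite S" "{i. f i \<noteq> \<zero>\<^bsub>M\<^esub>} \<subseteq> S" for f S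
    unfolding family_sum_def
    by (rule M.add.finprod_mono_neutral_cong_left)
       (use that gc in \<open>auto simp: homogeneous_family_def\<close>)
  have uniq: "f d = \<pi> d x" if f: "homogeneous_family M f" "family_sum M f = x" for f d x
  proof -
    \<comment> \<open>The index \<open>d\<close> is inserted because \<open>f d\<close> may be zero,
      in which case the support does not contain it.\<close>
    let ?S = "insert d {i. f i \<noteq> \<zero>\<^bsub>M\<^esub>}"
    have fin: "finite ?S" using f by (auto simp: homogeneous_family_def)
    have fg: "f i \<in> grade M i" and fc: "f i \<in> carrier M" for i
      using f gc by (auto simp: homogeneous_family_def)
    have "\<pi> d x = finsum M (\<lambda>i. \<pi> d (f i)) ?S"
      using f sup[OF f(1) fin subset_insertI] gc ahom_finsum[OF M M \<pi>, of f ?S d]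
      by (auto simp: homogeneous_family_def)
    also have "\<dots> = finsum M (\<lambda>i. if d = i then f i else \<zero>\<^bsub>M\<^esub>) ?S"
      by (rule M.finsum_cong') (simp_all add: \<pi>_grade[OF fg] fc)
    also have "\<dots> = f d"
      using M.add.finprod_singleton[of d ?S f] fin f gc by (simp add: fc)
    finally show ?thesis by simp
  qed
  have ex: "homogeneous_family M (\<lambda>d. \<pi> d x) \<and> family_sum M (\<lambda>d. \<pi> d x) = x"
    if "x \<in> carrier M" for x
    using that
  proof (rule gen)
    fix e x assume x: "x \<in> grade M e"
    have sub: "{d. \<pi> d x \<noteq> \<zero>\<^bsub>M\<^esub>} \<subseteq> {e}" using x \<pi>_grade by auto
    have h: "homogeneous_family M (\<lambda>d. \<pi> d x)"
      unfolding homogeneous_family_def using finite_subset[OF sub] x g0 by (auto simp: \<pi>_grade)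
    then show "homogeneous_family M (\<lambda>d. \<pi> d x) \<and> family_sum M (\<lambda>d. \<pi> d x) = x"
      using sup[OF h _ sub] gc[OF x] \<pi>_grade[OF x] by simp
  next
    fix x y assume c: "x \<in> carrier M" "y \<in> carrier M"
      and X: "homogeneous_family M (\<lambda>d. \<pi> d x) \<and> family_sum M (\<lambda>d. \<pi> d x) = x"
      and Y: "homogeneous_family M (\<lambda>d. \<pi> d y) \<and> family_sum M (\<lambda>d. \<pi> d y) = y"
    let ?S = "{d. \<pi> d x \<noteq> \<zero>\<^bsub>M\<^esub>} \<union> {d. \<pi> d y \<noteq> \<zero>\<^bsub>M\<^esub>}"
    have fin: "finite ?S" using X Y by (auto simp: homogeneous_family_def)
    have add: "\<pi> d (x \<oplus>\<^bsub>M\<^esub> y) = \<pi> d x \<oplus>\<^bsub>M\<^esub> \<pi> d y" for d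
      by (rule ahom_add[OF \<pi> c])
    have sub: "{d. \<pi> d (x \<oplus>\<^bsub>M\<^esub> y) \<noteq> \<zero>\<^bsub>M\<^esub>} \<subseteq> ?S"
      using ahom_closed[OF \<pi> c(2)] by (auto simp: add)
    have h: "homogeneous_family M (\<lambda>d. \<pi> d (x \<oplus>\<^bsub>M\<^esub> y))"
      unfolding homogeneous_family_def
      using finite_subset[OF sub fin] X Y additive_subgroup.a_closed[OF grade]
      by (auto simp: homogeneous_family_def add)
    have "family_sum M (\<lambda>d. \<pi> d (x \<oplus>\<^bsub>M\<^esub> y)) = finsum M (\<lambda>d. \<pi> d x) ?S \<oplus>\<^bsub>M\<^esub> finsum M (\<lambda>d. \<pi> d y) ?S"
      unfolding sup[OF h fin sub] unfolding add
      by (intro M.finsum_addf) (use ahom_closed[OF \<pi>] c in auto)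
    then have "family_sum M (\<lambda>d. \<pi> d (x \<oplus>\<^bsub>M\<^esub> y)) = x \<oplus>\<^bsub>M\<^esub> y"
      using sup[of "\<lambda>d. \<pi> d x" ?S] sup[of "\<lambda>d. \<pi> d y" ?S] X Y fin by auto
    then show "homogeneous_family M (\<lambda>d. \<pi> d (x \<oplus>\<^bsub>M\<^esub> y)) \<and> family_sum M (\<lambda>d. \<pi> d (x \<oplus>\<^bsub>M\<^esub> y)) = x \<oplus>\<^bsub>M\<^esub> y"
      using h by simp
  qed
  show ?thesis
    unfolding is_graded_def
  proof (intro conjI allI ballI ex1I)
    fix x assume "x \<in> carrier M"
    from ex[OF this] show "homogeneous_family M (\<lambda>d. \<pi> d x)" "family_sum M (\<lambda>d. \<pi> d x) = x"
      by auto
  next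
    fix x f assume "homogeneous_family M f \<and> family_sum M f = x"
    then show "f = (\<lambda>d. \<pi> d x)" using uniq by auto
  qed (rule grade)
qed

section \<open>Graded tensor products and direct sums\<close>

text \<open>The product runs over the support, so the bijection is used between the two supports;
  one is finite exactly when the other is.\<close>

lemma (in comm_monoid) gfinprod_reindex:
  assumes h: "bij_betw h A B" and f: "f \<in> B \<rightarrow> carrier G"
  shows "gfinprod G (\<lambda>i. f (h i)) A = gfinprod G f B"
proof -
  have im: "h ` {i \<in> A. f (h i) \<noteq> \<one>} = {j \<in> B. f j \<noteq> \<one>}"
    using h by (auto simp: bij_betw_def)
  have inj: "inj_on h {i \<in> A. f (h i) \<noteq> \<one>}"
    using h by (auto simp: bij_betw_def inj_on_def)
  have "finite {i \<in> A. f (h i) \<noteq> \<one>} \<longleftrightarrow> finite {j \<in> B. f j \<noteq> \<one>}"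
    using finite_image_iff[OF inj] unfolding im by simp
  moreover have "finprod G f (h ` {i \<in> A. f (h i) \<noteq> \<one>}) = finprod G (\<lambda>i. f (h i)) {i \<in> A. f (h i) \<noteq> \<one>}"
    by (rule finprod_reindex[OF _ inj]) (use f im in auto)
  ultimately show ?thesis
    by (simp add: gfinprod_def im)
qed

lemma (in comm_monoid) gfinprod_single:
  assumes "i \<in> I" "x i \<in> carrier G" "\<And>j. j \<in> I \<Longrightarrow> j \<noteq> i \<Longrightarrow> x j = \<one>"
  shows "gfinprod G x I = x i"
proof -
  have "x j \<in> carrier G" if "j \<in> I" for j
    using assms that by (cases "j = i") auto
  then have "gfinprod G x {i} = gfinprod G x I"
    using assms by (intro gfinprod_mono_neutral_cong_left) auto
  then show ?thesis using assms by (simp add: Pi_def)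
qed

lemma tensor_product_simps [simp]:
  "carrier (tensor_product R X Y act) = carrier (tensor_group R X Y)"
  "add (tensor_product R X Y act) = mult (tensor_group R X Y)"
  "ring.zero (tensor_product R X Y act) = \<one>\<^bsub>tensor_group R X Y\<^esub>"
  "smult (tensor_product R X Y act) = act"
  "grade (tensor_product R X Y act) = (\<lambda>d. generate (tensor_group R X Y)
     {pure R X Y x y | x y i j. x \<in> grade X i \<and> y \<in> grade Y j \<and> i + j = d})"
  by (simp_all add: tensor_product_def)

lemma comm_group_cong:
  assumes "comm_group G" "carrier H = carrier G" "mult H = mult G" "one H = one G"
  shows "comm_group H"
proof -
  interpret G: comm_group G by (rule assms(1))
  show ?thesis
    by (rule comm_groupI) (auto simp: assms G.m_assoc intro: G.m_comm G.l_inv_ex)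
qed

lemma m_inv_cong:
  assumes "carrier H = carrier G" "mult H = mult G" "one H = one G"
  shows "m_inv H = m_inv G"
  using assms by (simp add: m_inv_def fun_eq_iff)

lemma abelian_groupI': "comm_group (add_monoid M) \<Longrightarrow> abelian_group M"
  by (simp add: abelian_group_def abelian_monoid_def abelian_group_axioms_def comm_group.axioms(1))

text \<open>Not stronger than \<open>tensor_pair\<close>: only the types are restricted, as \<open>tensor_product\<close> takes
  graded records.\<close>

locale graded_carrier_pair = tensor_pair R X Y
  for R :: "('r, 'u) ring_scheme" and X :: "('r, 'x) graded" and Y :: "('r, 'y) graded"

lemma (in graded_carrier_pair) abelian_group_tensor: "abelian_group (tensor_product R X Y act)"
  by (rule abelian_groupI'[OF comm_group_cong[OF T.comm_group_axioms]]) simp_all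

lemma hom_tensor_product:
  "hom (add_monoid (tensor_product R X Y act)) H = hom (tensor_group R X Y) H"
  "hom H (add_monoid (tensor_product R X Y act)) = hom H (tensor_group R X Y)"
  by (simp_all add: hom_def)

text \<open>Both factors are sums of homogeneous elements and pure tensors are biadditive. The left
  factor is decomposed first, then the right one for a homogeneous left factor.\<close>

lemma (in graded_carrier_pair) pure_sum_homogeneous_induct:
  assumes X: "graded_group X" and Y: "graded_group Y"
    and xy: "x \<in> carrier X" "y \<in> carrier Y"
    and hom: "\<And>i j x y. \<lbrakk>x \<in> grade X i; y \<in> grade Y j\<rbrakk> \<Longrightarrow> P (p x y)"
    and add: "\<And>s t. \<lbrakk>s \<in> carrier T; t \<in> carrier T; P s; P t\<rbrakk> \<Longrightarrow> P (s \<otimes>\<^bsub>T\<^esub> t)"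
  shows "P (p x y)"
proof -
  interpret GX: graded_group X by (rule X)
  interpret GY: graded_group Y by (rule Y)
  show ?thesis
    using xy(1)
  proof (induction rule: GX.graded_induct)
    case (homogeneous i x)
    note x = this
    have xc: "x \<in> carrier X" using graded_group.grade_carrier[OF X x] .
    show ?case
      using xy(2)
    proof (induction rule: GY.graded_induct)
      case (homogeneous j y)
      then show ?case using x assms(5) by blast
    next
      case (add y y')
      then show ?case using xc assms(6) by (simp add: pure_add_right)
    qed
  next
    case (add x x')
    then show ?case using xy assms(6) by (simp add: pure_add_left)
  qed
qed

section \<open>The grading of a tensor product\<close>

definition shifts ::
    "('r, 'u) ring_scheme \<Rightarrow> ('r, 'x) graded \<Rightarrow> ('r, 'y) graded \<Rightarrow> int \<Rightarrow> 'r \<Rightarrow> bool"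
  where "shifts R X Y e r \<longleftrightarrow> r \<in> carrier R \<and>
    (\<forall>i. \<forall>x\<in>grade X i. r \<odot>\<^bsub>X\<^esub> x \<in> grade X (i + e)) \<and>
    (\<forall>i. \<forall>y\<in>grade Y i. r \<odot>\<^bsub>Y\<^esub> y \<in> grade Y (i + e))"

text \<open>The last assumption says that \<open>R\<close> is additively generated by elements that shift degrees.  It
  covers the base field, the algebras of a tower and their tensor products without a grading on \<open>R\<close>.\<close>

locale graded_tensor_pair = graded_carrier_pair R X Y
  for R :: "('r, 'u) ring_scheme" and X :: "('r, 'x) graded" and Y :: "('r, 'y) graded" +
  assumes graded_X: "is_graded X" and graded_Y: "is_graded Y"
    and X_smult_l: "\<lbrakk>r \<in> carrier R; s \<in> carrier R; x \<in> carrier X\<rbrakk> \<Longrightarrow>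
      (r \<oplus>\<^bsub>R\<^esub> s) \<odot>\<^bsub>X\<^esub> x = r \<odot>\<^bsub>X\<^esub> x \<oplus>\<^bsub>X\<^esub> s \<odot>\<^bsub>X\<^esub> x"
    and X_smult_r: "\<lbrakk>r \<in> carrier R; x \<in> carrier X; x' \<in> carrier X\<rbrakk> \<Longrightarrow>
      r \<odot>\<^bsub>X\<^esub> (x \<oplus>\<^bsub>X\<^esub> x') = r \<odot>\<^bsub>X\<^esub> x \<oplus>\<^bsub>X\<^esub> r \<odot>\<^bsub>X\<^esub> x'"
    and Y_smult_l: "\<lbrakk>r \<in> carrier R; s \<in> carrier R; y \<in> carrier Y\<rbrakk> \<Longrightarrow>
      (r \<oplus>\<^bsub>R\<^esub> s) \<odot>\<^bsub>Y\<^esub> y = r \<odot>\<^bsub>Y\<^esub> y \<oplus>\<^bsub>Y\<^esub> s \<odot>\<^bsub>Y\<^esub> y"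
    and Y_smult_r: "\<lbrakk>r \<in> carrier R; y \<in> carrier Y; y' \<in> carrier Y\<rbrakk> \<Longrightarrow>
      r \<odot>\<^bsub>Y\<^esub> (y \<oplus>\<^bsub>Y\<^esub> y') = r \<odot>\<^bsub>Y\<^esub> y \<oplus>\<^bsub>Y\<^esub> r \<odot>\<^bsub>Y\<^esub> y'"
    and R_gen: "\<And>P r. \<lbrakk>r \<in> carrier R; \<And>e r. shifts R X Y e r \<Longrightarrow> P r;
      \<And>r s. \<lbrakk>r \<in> carrier R; s \<in> carrier R; P r; P s\<rbrakk> \<Longrightarrow> P (r \<oplus>\<^bsub>R\<^esub> s)\<rbrakk> \<Longrightarrow> P r"
begin

sublocale GX: graded_group X
  by (unfold_locales) (rule graded_X)

sublocale GY: graded_group Y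
  by (unfold_locales) (rule graded_Y)

text \<open>The component of degree \<open>d\<close> of \<open>x \<otimes> y\<close>.  It is balanced, so it induces the projections that
  separate the degrees.\<close>

definition part where
  "part d x y = gfinprod T (\<lambda>i. p (component X i x) (component Y (d - i) y)) UNIV"

lemma part_closed: "\<lbrakk>x \<in> carrier X; y \<in> carrier Y\<rbrakk> \<Longrightarrow> part d x y \<in> carrier T"
  unfolding part_def by (rule T.gfinprod_closed) (simp add: Pi_def GX.component_closed GY.component_closed)

text \<open>A vanishing left component makes the pure tensor trivial, so only the finitely many
  degrees of \<open>x\<close> contribute. Without finite support the product would not distribute
  over sums.\<close>

lemma part_finite:
  assumes "x \<in> carrier X" "y \<in> carrier Y"
  shows "finite {i \<in> UNIV. p (component X i x) (component Y (d - i) y) \<noteq> \<one>\<^bsub>T\<^esub>}"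
  by (rule finite_subset[OF _ GX.component_finite[OF assms(1)]])
     (use assms in \<open>auto simp: pure_zero_left GY.component_closed\<close>)

lemma part_add_left:
  assumes "x \<in> carrier X" "x' \<in> carrier X" "y \<in> carrier Y"
  shows "part d (x \<oplus>\<^bsub>X\<^esub> x') y = part d x y \<otimes>\<^bsub>T\<^esub> part d x' y"
  unfolding part_def
  using T.gfinprod_distrib[OF part_finite[of x y d] part_finite[of x' y d]] assms
  by (simp add: Pi_def GX.component_closed GY.component_closed GX.component_add pure_add_left)

lemma part_add_right:
  assumes "x \<in> carrier X" "y \<in> carrier Y" "y' \<in> carrier Y"
  shows "part d x (y \<oplus>\<^bsub>Y\<^esub> y') = part d x y \<otimes>\<^bsub>T\<^esub> part d x y'"
  unfolding part_def
  using T.gfinprod_distrib[OF part_finite[of x y d] part_finite[of x y' d]] assms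
  by (simp add: Pi_def GX.component_closed GY.component_closed GY.component_add pure_add_right)

text \<open>A scalar that shifts by \<open>e\<close> carries the component \<open>i - e\<close> of
  \<open>x\<close> to the component \<open>i\<close>. After crossing the tensor sign it shifts the
  components of \<open>y\<close> by the same amount, so the two products differ by the reindexing
  \<open>i \<mapsto> i - e\<close>. General scalars are sums of such, and both sides are additive in
  the scalar.\<close>

lemma part_smult:
  assumes r: "r \<in> carrier R" and x: "x \<in> carrier X" and y: "y \<in> carrier Y"
  shows "part d (r \<odot>\<^bsub>X\<^esub> x) y = part d x (r \<odot>\<^bsub>Y\<^esub> y)"
  using r
proof (rule R_gen)
  fix e r assume s: "shifts R X Y e r"
  then have r: "r \<in> carrier R" by (simp add: shifts_def)
  have cX: "component X i (r \<odot>\<^bsub>X\<^esub> x) = r \<odot>\<^bsub>X\<^esub> component X (i - e) x" for i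
    by (rule GX.component_shift[where h = "\<lambda>x. r \<odot>\<^bsub>X\<^esub> x", OF ahomI])
       (use s r x X_smult X_smult_r in \<open>auto simp: shifts_def\<close>)
  have cY: "component Y i (r \<odot>\<^bsub>Y\<^esub> y) = r \<odot>\<^bsub>Y\<^esub> component Y (i - e) y" for i
    by (rule GY.component_shift[where h = "\<lambda>y. r \<odot>\<^bsub>Y\<^esub> y", OF ahomI])
       (use s r y Y_smult Y_smult_r in \<open>auto simp: shifts_def\<close>)
  have bij: "bij_betw (\<lambda>i. i - e) UNIV UNIV"
    by (rule bij_betwI[where g = "\<lambda>i. i + e"]) auto
  have "part d (r \<odot>\<^bsub>X\<^esub> x) y
      = gfinprod T (\<lambda>i. p (component X (i - e) x) (component Y (d - (i - e)) (r \<odot>\<^bsub>Y\<^esub> y))) UNIV"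
    unfolding part_def cX cY
    using r x y by (simp add: pure_smult GX.component_closed GY.component_closed algebra_simps)
  also have "\<dots> = part d x (r \<odot>\<^bsub>Y\<^esub> y)"
    unfolding part_def
    by (rule T.gfinprod_reindex[OF bij, where f = "\<lambda>i. p (component X i x) (component Y (d - i) (r \<odot>\<^bsub>Y\<^esub> y))"])
       (simp add: Pi_def GX.component_closed GY.component_closed x y r Y_smult)
  finally show "part d (r \<odot>\<^bsub>X\<^esub> x) y = part d x (r \<odot>\<^bsub>Y\<^esub> y)" .
next
  fix r s assume rs: "r \<in> carrier R" "s \<in> carrier R"
    and "part d (r \<odot>\<^bsub>X\<^esub> x) y = part d x (r \<odot>\<^bsub>Y\<^esub> y)" "part d (s \<odot>\<^bsub>X\<^esub> x) y = part d x (s \<odot>\<^bsub>Y\<^esub> y)"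
  then show "part d ((r \<oplus>\<^bsub>R\<^esub> s) \<odot>\<^bsub>X\<^esub> x) y = part d x ((r \<oplus>\<^bsub>R\<^esub> s) \<odot>\<^bsub>Y\<^esub> y)"
    using x y by (simp add: X_smult_l Y_smult_l X_smult Y_smult part_add_left part_add_right)
qed

lemma part_balanced: "balanced R X Y T (part d)"
  by (rule balancedI) (simp_all add: part_closed part_add_left part_add_right part_smult)

lemma part_homogeneous:
  assumes "x \<in> grade X i" "y \<in> grade Y j"
  shows "part d x y = (if d = i + j then p x y else \<one>\<^bsub>T\<^esub>)"
proof -
  have c: "x \<in> carrier X" "y \<in> carrier Y"
    using assms GX.grade_carrier GY.grade_carrier by auto
  have "part d x y = p (component X i x) (component Y (d - i) y)"
    unfolding part_def
    by (rule T.gfinprod_single)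
       (use c GX.component_of_grade[OF assms(1)] in \<open>simp_all add: GX.component_closed GY.component_closed pure_zero_left\<close>)
  then show ?thesis
    using GX.component_of_grade[OF assms(1), of i] GY.component_of_grade[OF assms(2), of "d - i"] c
    by (auto simp: pure_zero_right)
qed

abbreviation hgens where "hgens d \<equiv> {p x y | x y i j. x \<in> grade X i \<and> y \<in> grade Y j \<and> i + j = d}"

lemma hgens_closed: "hgens d \<subseteq> carrier T"
  using GX.grade_carrier GY.grade_carrier by auto

text \<open>The lift of \<open>part d\<close> is the projection to degree \<open>d\<close>: on the
  generators of degree \<open>e\<close> it is the identity or trivial, and a homomorphism keeps this
  behaviour on the subgroup they generate.\<close>

lemma tensor_graded: "is_graded (tensor_product R X Y act)"
proof (rule is_gradedI[OF abelian_group_tensor, where \<pi> = "\<lambda>d. tensor_lift R X Y T (part d)"])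
  show "additive_subgroup (grade (tensor_product R X Y act) i) (tensor_product R X Y act)" for i
    using T.generate_is_subgroup[OF hgens_closed[of i]]
      m_inv_cong[of "add_monoid (tensor_product R X Y act)" T]
    by (intro additive_subgroupI) (simp add: subgroup_def)
  have h: "tensor_lift R X Y T (part d) \<in> hom T T" for d
    by (rule tensor_lift_hom[OF T.comm_group_axioms part_balanced])
  then show "tensor_lift R X Y T (part d)
      \<in> ahom (tensor_product R X Y act) (tensor_product R X Y act)" for d
    by (simp only: hom_tensor_product)
  interpret h: group_hom T T "tensor_lift R X Y T (part d)" for d
    by (intro group_hom.intro group_hom_axioms.intro T.group_axioms h)
  show "tensor_lift R X Y T (part d) t = (if d = e then t else \<zero>\<^bsub>tensor_product R X Y act\<^esub>)"
    if "t \<in> grade (tensor_product R X Y act) e" for d e t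
  proof -
    have gen: "tensor_lift R X Y T (part d) t = (if d = e then t else \<one>\<^bsub>T\<^esub>)" if th: "t \<in> hgens e" for t
    proof -
      obtain x y i j where "t = p x y" "x \<in> grade X i" "y \<in> grade Y j" "i + j = e"
        using th by blast
      then show ?thesis
        using tensor_lift_pure[OF T.comm_group_axioms part_balanced] part_homogeneous
          GX.grade_carrier GY.grade_carrier by auto
    qed
    have "t \<in> generate T (hgens e)" using that by simp
    then show ?thesis
    proof (induction rule: generate.induct)
      case (inv t)
      then have "t \<in> carrier T" by (rule subsetD[OF hgens_closed])
      then show ?case using gen[OF inv] h.hom_inv[of t] by simp
    next
      case (eng s t)
      then show ?case
        using T.generate_in_carrier[OF hgens_closed] by simp
    qed (simp_all only: gen h.hom_one if_cancel tensor_product_simps)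
  qed
  fix P t assume t: "t \<in> carrier (tensor_product R X Y act)"
    and g: "\<And>d t. t \<in> grade (tensor_product R X Y act) d \<Longrightarrow> P t"
    and plus: "\<And>s t. \<lbrakk>s \<in> carrier (tensor_product R X Y act); t \<in> carrier (tensor_product R X Y act); P s; P t\<rbrakk>
       \<Longrightarrow> P (s \<oplus>\<^bsub>tensor_product R X Y act\<^esub> t)"
  have gp: "P (p x y)" if "x \<in> grade X i" "y \<in> grade Y j" for x y i j
  proof (rule g)
    show "p x y \<in> grade (tensor_product R X Y act) (i + j)"
      unfolding tensor_product_simps by (rule generate.incl) (use that in blast)
  qed
  have "t \<in> carrier T" using t by simp
  then show "P t"
  proof (induction rule: tensor_induct)
    case (pure x y)
    show ?case
      by (rule pure_sum_homogeneous_induct[OF GX.graded_group_axioms GY.graded_group_axioms pure])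
         (use gp plus in auto)
  next
    case (add s t)
    then show ?case using plus[of s t] by simp
  qed
qed

end


text \<open>One criterion for both kinds of module: induction acts through the left factor, with
  \<open>g s\<close> the identity, and twisted restriction through the right one, with
  \<open>f s\<close> the identity. The laws are required on pure tensors and extend
  additively.\<close>

lemma (in graded_carrier_pair) tensor_left_module:
  assumes S: "ring S"
    and b: "\<And>s. s \<in> carrier S \<Longrightarrow> balanced R X Y T (\<lambda>x y. p (f s x) (g s y))"
    and f: "\<And>s x. \<lbrakk>s \<in> carrier S; x \<in> carrier X\<rbrakk> \<Longrightarrow> f s x \<in> carrier X"
    and g: "\<And>s y. \<lbrakk>s \<in> carrier S; y \<in> carrier Y\<rbrakk> \<Longrightarrow> g s y \<in> carrier Y"
    and add: "\<And>s s' x y. \<lbrakk>s \<in> carrier S; s' \<in> carrier S; x \<in> carrier X; y \<in> carrier Y\<rbrakk> \<Longrightarrow>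
      p (f (s \<oplus>\<^bsub>S\<^esub> s') x) (g (s \<oplus>\<^bsub>S\<^esub> s') y) = p (f s x) (g s y) \<otimes>\<^bsub>T\<^esub> p (f s' x) (g s' y)"
    and mult: "\<And>s s' x y. \<lbrakk>s \<in> carrier S; s' \<in> carrier S; x \<in> carrier X; y \<in> carrier Y\<rbrakk> \<Longrightarrow>
      p (f (s \<otimes>\<^bsub>S\<^esub> s') x) (g (s \<otimes>\<^bsub>S\<^esub> s') y) = p (f s (f s' x)) (g s (g s' y))"
    and one: "\<And>x y. \<lbrakk>x \<in> carrier X; y \<in> carrier Y\<rbrakk> \<Longrightarrow> p (f \<one>\<^bsub>S\<^esub> x) (g \<one>\<^bsub>S\<^esub> y) = p x y"
  shows "left_module S (tensor_product R X Y (\<lambda>s. tensor_map R X Y (f s) (g s)))"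
proof -
  interpret S: ring S by (rule S)
  let ?a = "\<lambda>s. tensor_map R X Y (f s) (g s)"
  have h: "?a s \<in> hom T T" if "s \<in> carrier S" for s
    by (rule tensor_map_hom[OF tensor_pair_axioms tensor_pair_axioms b]) (use f g that in auto)
  have hp: "?a s (p x y) = p (f s x) (g s y)" if "s \<in> carrier S" "x \<in> carrier X" "y \<in> carrier Y" for s x y
    by (rule tensor_map_pure[OF tensor_pair_axioms tensor_pair_axioms b]) (use f g that in auto)
  have hc: "?a s t \<in> carrier T" if "s \<in> carrier S" "t \<in> carrier T" for s t
    using hom_in_carrier[OF h] that by blast
  show ?thesis
  proof (intro left_module.intro left_module_axioms.intro S abelian_group_tensor, unfold tensor_product_simps)
    fix s s' t assume s: "s \<in> carrier S" "s' \<in> carrier S" and t: "t \<in> carrier T"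
    show "?a (s \<oplus>\<^bsub>S\<^esub> s') t = ?a s t \<otimes>\<^bsub>T\<^esub> ?a s' t"
      using t
    proof (induction rule: tensor_induct)
      case (add t t')
      then show ?case using s by (simp add: hom_mult[OF h] hc T.m_ac)
    qed (simp add: s hp add)
    show "?a (s \<otimes>\<^bsub>S\<^esub> s') t = ?a s (?a s' t)"
      using t
    proof (induction rule: tensor_induct)
      case (add t t')
      then show ?case using s by (simp add: hom_mult[OF h] hc)
    qed (simp add: s hp mult f g)
  next
    fix s t t' assume "s \<in> carrier S" "t \<in> carrier T" "t' \<in> carrier T"
    then show "?a s (t \<otimes>\<^bsub>T\<^esub> t') = ?a s t \<otimes>\<^bsub>T\<^esub> ?a s t'"
      by (rule hom_mult[OF h])
  next
    fix t assume t: "t \<in> carrier T"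
    then show "?a \<one>\<^bsub>S\<^esub> t = t"
    proof (induction rule: tensor_induct)
      case (add t t')
      then show ?case by (simp add: hom_mult[OF h])
    qed (simp add: hp one)
  qed (rule hc)
qed

text \<open>A homogeneous part is a generated subgroup, so its image lies in the subgroup
  \<open>H\<close> as soon as the generators do.\<close>

lemma (in graded_tensor_pair) hom_grade:
  assumes h: "h \<in> hom T (add_monoid N)" and N: "abelian_group N" and t: "t \<in> generate T (hgens d)"
    and H: "additive_subgroup H N"
    and p: "\<And>i j x y. \<lbrakk>x \<in> grade X i; y \<in> grade Y j; i + j = d\<rbrakk> \<Longrightarrow> h (p x y) \<in> H"
  shows "h t \<in> H"
proof -
  interpret H: additive_subgroup H N by (rule H)
  interpret h: group_hom T "add_monoid N" h
    using h T.group_axioms abelian_group.group_add_monoid[OF N]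
    by (simp add: group_hom_def group_hom_axioms_def)
  show ?thesis
    using t
  proof (induction rule: generate.induct)
    case one
    then show ?case using h.hom_one by simp
  next
    case (incl t)
    then show ?case using p by blast
  next
    case (inv t)
    then have "h t \<in> H" "t \<in> carrier T" using p hgens_closed by blast+
    then show ?case using h.hom_inv[of t] by (simp flip: a_inv_def)
  next
    case (eng s t)
    then show ?case using T.generate_in_carrier[OF hgens_closed] h.hom_mult[of s t] by simp
  qed
qed

text \<open>The hypothesis \<open>shift\<close> leaves open which factor absorbs the degree of
  \<open>s\<close>: the left one in induction, the right one in twisted restriction.\<close>

lemma (in graded_tensor_pair) tensor_graded_module:
  fixes S :: "('k, 's) graded"
  assumes M: "left_module S (tensor_product R X Y (\<lambda>s. tensor_map R X Y (f s) (g s)))"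
    and b: "\<And>s. s \<in> carrier S \<Longrightarrow> balanced R X Y T (\<lambda>x y. p (f s x) (g s y))"
    and f: "\<And>s x. \<lbrakk>s \<in> carrier S; x \<in> carrier X\<rbrakk> \<Longrightarrow> f s x \<in> carrier X"
    and g: "\<And>s y. \<lbrakk>s \<in> carrier S; y \<in> carrier Y\<rbrakk> \<Longrightarrow> g s y \<in> carrier Y"
    and S: "\<And>s i. s \<in> grade S i \<Longrightarrow> s \<in> carrier S"
    and shift: "\<And>s x y i j l. \<lbrakk>s \<in> grade S i; x \<in> grade X j; y \<in> grade Y l\<rbrakk> \<Longrightarrow>
      \<exists>j' l'. f s x \<in> grade X j' \<and> g s y \<in> grade Y l' \<and> j' + l' = i + (j + l)"
  shows "graded_module S (tensor_product R X Y (\<lambda>s. tensor_map R X Y (f s) (g s)))"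
  unfolding graded_module_def
proof (intro conjI allI ballI M tensor_graded)
  let ?a = "\<lambda>s. tensor_map R X Y (f s) (g s)"
  let ?N = "tensor_product R X Y ?a"
  fix i j s t assume s: "s \<in> grade S i" and t: "t \<in> grade ?N j"
  interpret N: graded_group ?N
    by (intro graded_group.intro graded_group_axioms.intro abelian_group_tensor tensor_graded)
  have h: "?a s \<in> hom T T"
    by (rule tensor_map_hom[OF tensor_pair_axioms tensor_pair_axioms b]) (use f g S[OF s] in auto)
  have hp: "?a s (p x y) = p (f s x) (g s y)" if "x \<in> carrier X" "y \<in> carrier Y" for x y
    by (rule tensor_map_pure[OF tensor_pair_axioms tensor_pair_axioms b]) (use f g S[OF s] that in auto)
  have "?a s t \<in> grade ?N (i + j)"
  proof (rule hom_grade[where N = ?N and h = "?a s" and H = "grade ?N (i + j)" and d = j])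
    show "?a s \<in> hom T (add_monoid ?N)" using h by (simp only: hom_tensor_product)
    show "t \<in> generate T (hgens j)" using t by simp
    fix k l x y assume xy: "x \<in> grade X k" "y \<in> grade Y l" "k + l = j"
    then have "x \<in> carrier X" "y \<in> carrier Y" using GX.grade_carrier GY.grade_carrier by auto
    then have "?a s (p x y) \<in> hgens (i + j)"
      using shift[OF s xy(1,2)] xy(3) hp by blast
    then show "?a s (p x y) \<in> grade ?N (i + j)" by (simp add: generate.incl)
  qed (rule abelian_group_tensor N.grade_subgroup)+
  then show "s \<odot>\<^bsub>?N\<^esub> t \<in> grade ?N (i + j)" by simp
qed

lemma left_module_smult_zero:
  assumes "left_module R M" "r \<in> carrier R"
  shows "r \<odot>\<^bsub>M\<^esub> \<zero>\<^bsub>M\<^esub> = \<zero>\<^bsub>M\<^esub>"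
  using ahom_zero[OF left_module.axioms(2)[OF assms(1)] left_module.axioms(2)[OF assms(1)], of "smult M r"]
    left_module.smult_closed[OF assms] left_module.smult_r_distr[OF assms]
  by (simp add: ahomI)

section \<open>Direct sums of graded modules\<close>

definition summand :: "'i set \<Rightarrow> ('i \<Rightarrow> ('r, 'm) graded) \<Rightarrow> 'i \<Rightarrow> 'm \<Rightarrow> 'i \<Rightarrow> 'm"
  where "summand I M i x = (\<lambda>j\<in>I. if j = i then x else \<zero>\<^bsub>M j\<^esub>)"

text \<open>A nonempty index set makes the zero of the sum an embedded zero of some summand, so that
  induction over the sum needs no case for zero.\<close>

locale summands =
  fixes I :: "'i set" and M :: "'i \<Rightarrow> ('r, 'm) graded"
  assumes nonempty: "I \<noteq> {}" and abelian: "i \<in> I \<Longrightarrow> abelian_group (M i)"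
begin

abbreviation D where "D \<equiv> direct_sum I M"
abbreviation \<iota> where "\<iota> \<equiv> summand I M"

lemma group_summand: "i \<in> I \<Longrightarrow> group (add_monoid (M i))"
  using abelian abelian_group.group_add_monoid by blast

lemma direct_sum_carrier:
  "carrier D = {x \<in> \<Pi>\<^sub>E i\<in>I. carrier (M i). finite {i \<in> I. x i \<noteq> \<zero>\<^bsub>M i\<^esub>}}"
  using carrier_sum_group[of I "\<lambda>i. add_monoid (M i)"] group_summand
  by (simp add: direct_sum_def Let_def)

lemma direct_sum_simps [simp]:
  "add D = (\<lambda>x y. \<lambda>i\<in>I. x i \<oplus>\<^bsub>M i\<^esub> y i)"
  "\<zero>\<^bsub>D\<^esub> = (\<lambda>i\<in>I. \<zero>\<^bsub>M i\<^esub>)"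
  "smult D = (\<lambda>r x. \<lambda>i\<in>I. r \<odot>\<^bsub>M i\<^esub> x i)"
  "grade D d = {x \<in> carrier D. \<forall>i\<in>I. x i \<in> grade (M i) d}"
  by (simp_all add: direct_sum_def Let_def)

lemma abelian_direct_sum: "abelian_group D"
proof (rule abelian_groupI')
  have g: "group (sum_group I (\<lambda>i. add_monoid (M i)))"
    by (rule sum_group) (rule group_summand)
  have "comm_group (sum_group I (\<lambda>i. add_monoid (M i)))"
  proof (rule group.group_comm_groupI[OF g])
    fix x y assume "x \<in> carrier (sum_group I (\<lambda>i. add_monoid (M i)))" "y \<in> carrier (sum_group I (\<lambda>i. add_monoid (M i)))"
    then show "x \<otimes>\<^bsub>sum_group I (\<lambda>i. add_monoid (M i))\<^esub> y = y \<otimes>\<^bsub>sum_group I (\<lambda>i. add_monoid (M i))\<^esub> x"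
      using group_summand abelian
      by (auto simp: carrier_sum_group PiE_iff intro!: restrict_ext abelian_monoid.a_comm abelian_group.axioms(1))
  qed
  then show "comm_group (add_monoid D)"
    by (rule comm_group_cong) (simp_all add: direct_sum_def Let_def)
qed

sublocale D: abelian_group D by (rule abelian_direct_sum)

lemma direct_sum_closed: "\<lbrakk>x \<in> carrier D; i \<in> I\<rbrakk> \<Longrightarrow> x i \<in> carrier (M i)"
  by (auto simp: direct_sum_carrier)

lemma direct_sum_finite: "x \<in> carrier D \<Longrightarrow> finite {i \<in> I. x i \<noteq> \<zero>\<^bsub>M i\<^esub>}"
  by (simp add: direct_sum_carrier)

lemma direct_sum_eqI: "\<lbrakk>x \<in> carrier D; y \<in> carrier D; \<And>i. i \<in> I \<Longrightarrow> x i = y i\<rbrakk> \<Longrightarrow> x = y"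
  by (auto simp: direct_sum_carrier intro: PiE_ext)

lemma zero_mem: "i \<in> I \<Longrightarrow> \<zero>\<^bsub>M i\<^esub> \<in> carrier (M i)"
  using abelian abelian_group.axioms(1) abelian_monoid.zero_closed by blast

lemma summand_closed [simp]:
  assumes "i \<in> I" "x \<in> carrier (M i)" shows "\<iota> i x \<in> carrier D"
proof -
  have "{j \<in> I. \<iota> i x j \<noteq> \<zero>\<^bsub>M j\<^esub>} \<subseteq> {i}"
    by (auto simp: summand_def split: if_splits)
  then show ?thesis
    using assms zero_mem finite_subset[of _ "{i}"] by (auto simp: direct_sum_carrier summand_def)
qed

lemma summand_add:
  assumes "i \<in> I" "x \<in> carrier (M i)" "y \<in> carrier (M i)"
  shows "\<iota> i (x \<oplus>\<^bsub>M i\<^esub> y) = \<iota> i x \<oplus>\<^bsub>D\<^esub> \<iota> i y"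
proof -
  have "\<zero>\<^bsub>M j\<^esub> \<oplus>\<^bsub>M j\<^esub> \<zero>\<^bsub>M j\<^esub> = \<zero>\<^bsub>M j\<^esub>" if "j \<in> I" for j
    using abelian_monoid.l_zero[OF abelian_group.axioms(1)[OF abelian[OF that]] zero_mem[OF that]] .
  then show ?thesis by (auto simp: summand_def intro!: restrict_ext)
qed

lemma summand_grade:
  assumes "i \<in> I" "x \<in> grade (M i) d" "x \<in> carrier (M i)"
    and "\<And>j. j \<in> I \<Longrightarrow> \<zero>\<^bsub>M j\<^esub> \<in> grade (M j) d"
  shows "\<iota> i x \<in> grade D d"
  using summand_closed[OF assms(1,3)] assms by (simp add: summand_def)

lemma summand_hom: "i \<in> I \<Longrightarrow> \<iota> i \<in> ahom (M i) D"
  by (rule ahomI) (simp_all only: summand_add summand_closed)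

lemma summand_zero: "i \<in> I \<Longrightarrow> \<iota> i \<zero>\<^bsub>M i\<^esub> = \<zero>\<^bsub>D\<^esub>"
  by (auto simp: summand_def intro!: restrict_ext)

lemma summand_same: "i \<in> I \<Longrightarrow> \<iota> i x i = x"
  by (simp add: summand_def)

text \<open>The sets \<open>S i\<close> can be taken as the parts of a fixed degree, which
  decomposes a homogeneous element into homogeneous summands; whole carriers give the ordinary
  induction. The proof splits off one coordinate at a time from a finite set containing the
  support.\<close>

lemma direct_sum_induct_within [consumes 2, case_names zero subset summand add]:
  assumes x: "x \<in> carrier D" and xS: "\<And>i. i \<in> I \<Longrightarrow> x i \<in> S i"
    and zero: "\<And>i. i \<in> I \<Longrightarrow> \<zero>\<^bsub>M i\<^esub> \<in> S i"
    and S: "\<And>i. i \<in> I \<Longrightarrow> S i \<subseteq> carrier (M i)"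
    and s: "\<And>i x. \<lbrakk>i \<in> I; x \<in> S i\<rbrakk> \<Longrightarrow> P (\<iota> i x)"
    and add: "\<And>x y. \<lbrakk>x \<in> carrier D; y \<in> carrier D; P x; P y\<rbrakk> \<Longrightarrow> P (x \<oplus>\<^bsub>D\<^esub> y)"
  shows "P x"
proof -
  have "P x" if "finite J" "x \<in> carrier D" "\<forall>i\<in>I. x i \<in> S i" "{i \<in> I. x i \<noteq> \<zero>\<^bsub>M i\<^esub>} \<subseteq> J" for J
    using that
  proof (induction J arbitrary: x)
    case empty
    obtain i where i: "i \<in> I" using nonempty by blast
    have "x = \<zero>\<^bsub>D\<^esub>"
      using empty by (intro direct_sum_eqI D.zero_closed) auto
    then show ?case using s[OF i zero[OF i]] summand_zero[OF i] by metis
  next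
    case (insert i J)
    show ?case
    proof (cases "i \<in> I")
      case True
      \<comment> \<open>The coordinate \<open>i\<close> is erased, so the support of
        \<open>y\<close> fits into the smaller set \<open>J\<close>.\<close>
      define y where "y = (\<lambda>j\<in>I. if j = i then \<zero>\<^bsub>M j\<^esub> else x j)"
      have yJ: "{j \<in> I. y j \<noteq> \<zero>\<^bsub>M j\<^esub>} \<subseteq> J"
        using insert.prems by (auto simp: y_def)
      have yS: "\<forall>j\<in>I. y j \<in> S j"
        using insert.prems zero by (simp add: y_def)
      have y: "y \<in> carrier D"
        using insert.prems zero_mem finite_subset[OF yJ insert.hyps(1)] direct_sum_closed[OF insert.prems(1)]
        by (auto simp: direct_sum_carrier y_def)
      have xi: "x i \<in> carrier (M i)" using direct_sum_closed[OF insert.prems(1) True] .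
      have e: "x j = (\<iota> i (x i) \<oplus>\<^bsub>D\<^esub> y) j" if "j \<in> I" for j
        using that direct_sum_closed[OF insert.prems(1) that] abelian[OF that, THEN abelian_group.axioms(1)]
        by (auto simp: summand_def y_def abelian_monoid.l_zero abelian_monoid.r_zero)
      have "x = \<iota> i (x i) \<oplus>\<^bsub>D\<^esub> y"
        by (rule direct_sum_eqI[OF insert.prems(1) D.a_closed[OF summand_closed[OF True xi] y] e])
      then show ?thesis
        using add[OF summand_closed[OF True xi] y s[OF True] insert.IH[OF y yS yJ]] insert.prems True by metis
    next
      case False
      then show ?thesis using insert by auto
    qed
  qed
  then show ?thesis using direct_sum_finite[OF x] x xS by blast
qed

lemma direct_sum_induct [consumes 1, case_names summand add]:
  assumes "x \<in> carrier D"
    and "\<And>i x. \<lbrakk>i \<in> I; x \<in> carrier (M i)\<rbrakk> \<Longrightarrow> P (\<iota> i x)"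
    and "\<And>x y. \<lbrakk>x \<in> carrier D; y \<in> carrier D; P x; P y\<rbrakk> \<Longrightarrow> P (x \<oplus>\<^bsub>D\<^esub> y)"
  shows "P x"
  by (rule direct_sum_induct_within[where S = "\<lambda>i. carrier (M i)" and P = P])
     (use assms direct_sum_closed zero_mem in auto)

text \<open>The lift multiplies the images of all coordinates. Its product has finite support
  because homomorphisms send zero coordinates to the unit.\<close>

lemma direct_sum_lift:
  assumes G: "comm_group G" and h: "\<And>i. i \<in> I \<Longrightarrow> h i \<in> hom (add_monoid (M i)) G"
  shows "\<exists>k\<in>hom (add_monoid D) G. \<forall>i\<in>I. \<forall>x\<in>carrier (M i). k (\<iota> i x) = h i x"
proof -
  interpret G: comm_group G by (rule G)
  let ?k = "\<lambda>x. gfinprod G (\<lambda>i. h i (x i)) I"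
  have "?k \<in> hom (sum_group I (\<lambda>i. add_monoid (M i))) G"
    by (rule G.hom_group_sum[OF h group_summand])
  then have k: "?k \<in> hom (add_monoid D) G"
    by (simp add: hom_def direct_sum_def Let_def)
  have kp: "?k (\<iota> i x) = h i x" if "i \<in> I" "x \<in> carrier (M i)" for i x
  proof -
    have "?k (\<iota> i x) = h i (\<iota> i x i)"
    proof (rule G.gfinprod_single[OF that(1)])
      show "h i (\<iota> i x i) \<in> carrier G"
        using hom_in_carrier[OF h[OF that(1)]] that summand_same by simp
      show "h j (\<iota> i x j) = \<one>\<^bsub>G\<^esub>" if "j \<in> I" "j \<noteq> i" for j
        using hom_one[OF h[OF that(1)] group_summand[OF that(1)] G.group_axioms] that by (simp add: summand_def)
    qed
    then show ?thesis by (simp add: summand_same[OF that(1)])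
  qed
  show ?thesis
    by (rule bexI[OF _ k]) (intro ballI kp)
qed

lemma direct_sum_map_hom:
  assumes N: "summands I N" and f: "\<And>i. i \<in> I \<Longrightarrow> f i \<in> ahom (M i) (N i)"
  shows "direct_sum_map I f \<in> ahom D (direct_sum I N)"
    and "\<lbrakk>i \<in> I; x \<in> carrier (M i)\<rbrakk> \<Longrightarrow> direct_sum_map I f (\<iota> i x) = summand I N i (f i x)"
proof -
  interpret N: summands I N by (rule N)
  have z: "f i \<zero>\<^bsub>M i\<^esub> = \<zero>\<^bsub>N i\<^esub>" if "i \<in> I" for i
    using ahom_zero[OF abelian[OF that] N.abelian[OF that] f[OF that]] .
  show "direct_sum_map I f \<in> ahom D (direct_sum I N)"
  proof (rule ahomI)
    fix x assume x: "x \<in> carrier D"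
    have "{i \<in> I. f i (x i) \<noteq> \<zero>\<^bsub>N i\<^esub>} \<subseteq> {i \<in> I. x i \<noteq> \<zero>\<^bsub>M i\<^esub>}"
      using z by auto
    from finite_subset[OF this direct_sum_finite[OF x]]
    show "direct_sum_map I f x \<in> carrier (direct_sum I N)"
      using ahom_closed[OF f direct_sum_closed[OF x]]
      by (auto simp: N.direct_sum_carrier direct_sum_map_def conj_commute cong: rev_conj_cong)
  next
    fix x y assume "x \<in> carrier D" "y \<in> carrier D"
    then show "direct_sum_map I f (x \<oplus>\<^bsub>D\<^esub> y) = direct_sum_map I f x \<oplus>\<^bsub>direct_sum I N\<^esub> direct_sum_map I f y"
      using direct_sum_closed f by (auto simp: direct_sum_map_def ahom_add[OF f] intro!: restrict_ext)
  qed
  show "\<lbrakk>i \<in> I; x \<in> carrier (M i)\<rbrakk> \<Longrightarrow> direct_sum_map I f (\<iota> i x) = summand I N i (f i x)"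
    using z by (auto simp: direct_sum_map_def summand_def intro!: restrict_ext)
qed

text \<open>All structure is coordinatewise, and so is the projection to degree \<open>d\<close>
  demanded by \<open>is_gradedI\<close>: it takes the component of degree \<open>d\<close> in every
  coordinate.\<close>

lemma direct_sum_graded_module:
  fixes A :: "('k, 'r) graded"
  assumes m: "\<And>i. i \<in> I \<Longrightarrow> graded_module A (M i)"
    and A: "\<And>i a. a \<in> grade A i \<Longrightarrow> a \<in> carrier A"
  shows "graded_module A D"
proof -
  have lm: "left_module A (M i)" and gr: "graded_group (M i)" if "i \<in> I" for i
    using m[OF that] abelian[OF that]
    by (auto simp: graded_module_def graded_group_def graded_group_axioms_def)
  obtain i0 where i0: "i0 \<in> I" using nonempty by blast
  interpret A: ring A using lm[OF i0] by (rule left_module.axioms(1))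
  note s0 = left_module_smult_zero[OF lm]
  have sc: "a \<odot>\<^bsub>D\<^esub> x \<in> carrier D" if "a \<in> carrier A" "x \<in> carrier D" for a x
  proof -
    have "{i \<in> I. a \<odot>\<^bsub>M i\<^esub> x i \<noteq> \<zero>\<^bsub>M i\<^esub>} \<subseteq> {i \<in> I. x i \<noteq> \<zero>\<^bsub>M i\<^esub>}"
      using s0 that(1) by auto
    from finite_subset[OF this direct_sum_finite[OF that(2)]] show ?thesis
      using left_module.smult_closed[OF lm that(1)] direct_sum_closed[OF that(2)]
      by (auto simp: direct_sum_carrier conj_commute cong: rev_conj_cong)
  qed
  have LM: "left_module A D"
  proof (intro left_module.intro left_module_axioms.intro abelian_direct_sum A.ring_axioms sc)
    fix x assume x: "x \<in> carrier D"
    show "\<one>\<^bsub>A\<^esub> \<odot>\<^bsub>D\<^esub> x = x"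
      using direct_sum_closed[OF x] left_module.smult_one[OF lm]
      by (intro direct_sum_eqI[OF sc[OF A.one_closed x] x]) auto
  qed (auto simp: left_module.smult_l_distr[OF lm] left_module.smult_r_distr[OF lm]
        left_module.smult_assoc1[OF lm] direct_sum_closed intro!: restrict_ext)
  have sub: "additive_subgroup (grade D d) D" for d
  proof (intro additive_subgroupI group.subgroupI[OF D.group_add_monoid])
    show "grade D d \<noteq> {}"
      using graded_group.grade_zero[OF gr] by (auto intro!: exI[of _ "\<zero>\<^bsub>D\<^esub>"] simp del: direct_sum_simps(2))
        (simp add: direct_sum_simps(2))
  next
    fix x assume x: "x \<in> grade D d"
    have "\<ominus>\<^bsub>D\<^esub> x = (\<lambda>i\<in>I. \<ominus>\<^bsub>M i\<^esub> x i)"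
      using inv_sum_group[of I "\<lambda>i. add_monoid (M i)" x] group_summand x
      unfolding a_inv_def
      by (subst m_inv_cong[of _ "sum_group I (\<lambda>i. add_monoid (M i))"]) (auto simp: direct_sum_def Let_def)
    then have "\<ominus>\<^bsub>D\<^esub> x \<in> grade D d"
      using x D.a_inv_closed[of x] additive_subgroup.a_inv_closed[OF graded_group.grade_subgroup[OF gr]]
      by auto
    then show "inv\<^bsub>add_monoid D\<^esub> x \<in> grade D d"
      by (simp only: a_inv_def)
  next
    fix x y assume "x \<in> grade D d" "y \<in> grade D d"
    then show "x \<otimes>\<^bsub>add_monoid D\<^esub> y \<in> grade D d"
      using D.a_closed[of x y] graded_group.grade_add[OF gr] by auto
  qed auto
  have "is_graded D"
  proof (rule is_gradedI[OF abelian_direct_sum sub])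
    fix d
    show "direct_sum_map I (\<lambda>i. component (M i) d) \<in> ahom D D"
      by (rule direct_sum_map_hom(1)[OF summands_axioms graded_group.component_hom[OF gr]])
    show "direct_sum_map I (\<lambda>i. component (M i) d) x = (if d = e then x else \<zero>\<^bsub>D\<^esub>)"
      if x: "x \<in> grade D e" for e x
    proof (rule direct_sum_eqI)
      show "direct_sum_map I (\<lambda>i. component (M i) d) x \<in> carrier D"
        by (rule ahom_closed[OF direct_sum_map_hom(1)[OF summands_axioms graded_group.component_hom[OF gr]]])
           (use x in auto)
      show "(if d = e then x else \<zero>\<^bsub>D\<^esub>) \<in> carrier D"
        using x D.zero_closed by (auto simp del: direct_sum_simps(2))
      show "direct_sum_map I (\<lambda>i. component (M i) d) x i = (if d = e then x else \<zero>\<^bsub>D\<^esub>) i" if "i \<in> I" for i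
        using x that graded_group.component_of_grade[OF gr[OF that]] by (auto simp: direct_sum_map_def)
    qed
  next
    fix P x assume "x \<in> carrier D"
      and g: "\<And>d x. x \<in> grade D d \<Longrightarrow> P x"
      and plus: "\<And>x y. \<lbrakk>x \<in> carrier D; y \<in> carrier D; P x; P y\<rbrakk> \<Longrightarrow> P (x \<oplus>\<^bsub>D\<^esub> y)"
    then show "P x"
    proof (induction rule: direct_sum_induct)
      case (summand i x)
      note i = this(1)
      interpret Mi: graded_group "M i" by (rule gr[OF i])
      show ?case
        using summand(2)
      proof (induction rule: Mi.graded_induct)
        case (homogeneous d x)
        have "\<iota> i x \<in> grade D d"
          by (rule summand_grade[OF i homogeneous Mi.grade_carrier[OF homogeneous] graded_group.grade_zero[OF gr]])
        then show ?case by (rule g)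
      next
        case (add x y)
        then show ?case
          using plus[OF summand_closed[OF i] summand_closed[OF i]] summand_add[OF i] by metis
      qed
    next
      case (add x y)
      then show ?case using plus by blast
    qed
  qed
  then show ?thesis
    unfolding graded_module_def
  proof (intro conjI LM allI ballI)
    fix i j a x assume a: "a \<in> grade A i" and x: "x \<in> grade D j"
    have g: "a \<odot>\<^bsub>M l\<^esub> x l \<in> grade (M l) (i + j)" if "l \<in> I" for l
      using m[OF that] a x that by (auto simp: graded_module_def)
    then show "a \<odot>\<^bsub>D\<^esub> x \<in> grade D (i + j)"
      using sc[OF A[OF a], of x] x by auto
  qed
qed

end

section \<open>Nice towers\<close>

lemma restrict_scalars_simps [simp]:
  "carrier (restrict_scalars h M) = carrier M"
  "add (restrict_scalars h M) = add M"
  "ring.zero (restrict_scalars h M) = ring.zero M"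
  "smult (restrict_scalars h M) s x = h s \<odot>\<^bsub>M\<^esub> x"
  "grade (restrict_scalars h M) = grade M"
  by (simp_all add: restrict_scalars_def)

lemma abelian_group_restrict_scalars:
  assumes "abelian_group M" shows "abelian_group (restrict_scalars h M)"
  by (rule abelian_groupI'[OF comm_group_cong[OF abelian_group.a_comm_group[OF assms]]]) simp_all

lemma additive_subgroup_cong:
  assumes "carrier M' = carrier M" "add M' = add M" "ring.zero M' = ring.zero M" "additive_subgroup H M"
  shows "additive_subgroup H M'"
  using assms m_inv_cong[of "add_monoid M'" "add_monoid M"] unfolding additive_subgroup_def
  by (simp add: subgroup_def)

lemma finsum_cong_record:
  assumes "carrier M' = carrier M" "add M' = add M" "ring.zero M' = ring.zero M"
  shows "finsum M' = finsum M"
  using assms by (intro ext) (simp add: finsum_def finprod_def)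

text \<open>A grading sees only the additive group and the homogeneous parts. The scalar types may
  differ, which covers restriction of scalars and the passage to right modules.\<close>

lemma is_graded_cong:
  fixes M' :: "('r, 'm) graded" and M :: "('s, 'm) graded"
  assumes "carrier M' = carrier M" "add M' = add M" "ring.zero M' = ring.zero M" "grade M' = grade M"
    and "is_graded M"
  shows "is_graded M'"
  using assms(5) additive_subgroup_cong[OF assms(1-3)]
  unfolding is_graded_def homogeneous_family_def family_sum_def finsum_cong_record[OF assms(1-3)] assms(1-4)
  by auto

lemma is_graded_restrict_scalars: "is_graded M \<Longrightarrow> is_graded (restrict_scalars h M)"
  by (rule is_graded_cong) simp_all

lemma graded_moduleD:
  assumes "graded_module A M"
  shows "left_module A M" "is_graded M" "abelian_group M" "graded_group M" "ring A"
    "\<lbrakk>a \<in> grade A i; x \<in> grade M j\<rbrakk> \<Longrightarrow> a \<odot>\<^bsub>M\<^esub> x \<in> grade M (i + j)"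
  using assms by (auto simp: graded_module_def left_module_def graded_group_def graded_group_axioms_def)

lemma graded_module_smult:
  assumes "graded_module A M"
  shows "\<lbrakk>a \<in> carrier A; x \<in> carrier M\<rbrakk> \<Longrightarrow> a \<odot>\<^bsub>M\<^esub> x \<in> carrier M"
    and "\<lbrakk>a \<in> carrier A; b \<in> carrier A; x \<in> carrier M\<rbrakk> \<Longrightarrow> (a \<oplus>\<^bsub>A\<^esub> b) \<odot>\<^bsub>M\<^esub> x = a \<odot>\<^bsub>M\<^esub> x \<oplus>\<^bsub>M\<^esub> b \<odot>\<^bsub>M\<^esub> x"
    and "\<lbrakk>a \<in> carrier A; x \<in> carrier M; y \<in> carrier M\<rbrakk> \<Longrightarrow> a \<odot>\<^bsub>M\<^esub> (x \<oplus>\<^bsub>M\<^esub> y) = a \<odot>\<^bsub>M\<^esub> x \<oplus>\<^bsub>M\<^esub> a \<odot>\<^bsub>M\<^esub> y"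
    and "\<lbrakk>a \<in> carrier A; b \<in> carrier A; x \<in> carrier M\<rbrakk> \<Longrightarrow> (a \<otimes>\<^bsub>A\<^esub> b) \<odot>\<^bsub>M\<^esub> x = a \<odot>\<^bsub>M\<^esub> (b \<odot>\<^bsub>M\<^esub> x)"
    and "x \<in> carrier M \<Longrightarrow> \<one>\<^bsub>A\<^esub> \<odot>\<^bsub>M\<^esub> x = x"
  using graded_moduleD(1)[OF assms]
  by (simp_all add: left_module.smult_closed left_module.smult_l_distr left_module.smult_r_distr
      left_module.smult_assoc1 left_module.smult_one)

locale nice_tower_of_algebras =
  fixes T :: "('k, 'a) tower"
  assumes nice: "nice_tower T"
begin

abbreviation K where "K \<equiv> base T"
abbreviation A where "A \<equiv> alg T"
abbreviation em where "em \<equiv> ext_mult T"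

lemma alg_graded: "graded_algebra K (A n)"
  using nice by (simp add: nice_tower_def)

lemma alg_ring: "ring (A n)"
  using alg_graded graded_algebra.axioms(3) by blast

sublocale A: ring "A n" for n by (rule alg_ring)

lemma alg_module: "module K (A n)"
  using alg_graded graded_algebra.axioms(2) by blast

sublocale AM: module K "A n" for n by (rule alg_module)

sublocale AG: graded_group "A n" for n
  by (intro graded_group.intro graded_group_axioms.intro A.abelian_group_axioms
      graded_algebra.graded[OF alg_graded])

lemma K_ring: "ring K"
  using alg_graded[of 0] field.axioms(1) graded_algebra.axioms(1) domain.axioms(1) cring.axioms(1) by blast

lemma scalar_closed [simp]: "c \<in> carrier K \<Longrightarrow> scalar (A n) c \<in> carrier (A n)"
  by (simp add: scalar_def)

lemma scalar_add: "\<lbrakk>c \<in> carrier K; d \<in> carrier K\<rbrakk> \<Longrightarrow>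
    scalar (A n) (c \<oplus>\<^bsub>K\<^esub> d) = scalar (A n) c \<oplus>\<^bsub>A n\<^esub> scalar (A n) d"
  by (simp add: scalar_def AM.smult_l_distr)

lemma scalar_grade: "c \<in> carrier K \<Longrightarrow> scalar (A n) c \<in> grade (A n) 0"
  unfolding scalar_def
  using graded_algebra.grade_smult[OF alg_graded] graded_algebra.grade_one[OF alg_graded] by blast

lemma grade_mult: "\<lbrakk>x \<in> grade (A n) i; y \<in> grade (A n) j\<rbrakk> \<Longrightarrow> x \<otimes>\<^bsub>A n\<^esub> y \<in> grade (A n) (i + j)"
  by (rule graded_algebra.grade_mult[OF alg_graded])

lemma grade_one: "\<one>\<^bsub>A n\<^esub> \<in> grade (A n) 0"
  by (rule graded_algebra.grade_one[OF alg_graded])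

lemma scalar_mult_left: "\<lbrakk>c \<in> carrier K; x \<in> carrier (A n)\<rbrakk> \<Longrightarrow> scalar (A n) c \<otimes>\<^bsub>A n\<^esub> x = c \<odot>\<^bsub>A n\<^esub> x"
  unfolding scalar_def by (subst graded_algebra.smult_mult_left[OF alg_graded]) simp_all

lemma alg_tensor_pair: "graded_tensor_pair K (A m) (A n)"
proof unfold_locales
  fix P :: "'k \<Rightarrow> bool" and r
  assume r: "r \<in> carrier K" and P: "\<And>e r. shifts K (A m) (A n) e r \<Longrightarrow> P r"
  show "P r"
    by (rule P[of 0]) (use r graded_algebra.grade_smult[OF alg_graded] in \<open>simp add: shifts_def\<close>)
qed (simp_all add: AM.smult_l_distr AM.smult_r_distr AG.graded)

sublocale AT: graded_tensor_pair K "A m" "A n" for m n by (rule alg_tensor_pair)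

abbreviation R where "R \<equiv> tens T"

lemma tens_simps [simp]:
  "carrier (R m n) = carrier (tensor_group K (A m) (A n))"
  "add (R m n) = mult (tensor_group K (A m) (A n))"
  "ring.zero (R m n) = \<one>\<^bsub>tensor_group K (A m) (A n)\<^esub>"
  by (simp_all add: tensor_algebra_def)

lemma ext_hom: "ext T m n \<in> graded_algebra_hom K (R m n) (A (m + n))"
  using nice by (simp add: nice_tower_def)

lemma ext_ring_hom: "ext T m n \<in> ring_hom (R m n) (A (m + n))"
  using ext_hom by (simp add: graded_algebra_hom_def)

lemma ext_closed [simp]: "r \<in> carrier (tensor_group K (A m) (A n)) \<Longrightarrow> ext T m n r \<in> carrier (A (m + n))"
  using ring_hom_closed[OF ext_ring_hom[of m n]] by simp

lemma ext_add: "\<lbrakk>r \<in> carrier (tensor_group K (A m) (A n)); s \<in> carrier (tensor_group K (A m) (A n))\<rbrakk> \<Longrightarrow>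
    ext T m n (r \<otimes>\<^bsub>tensor_group K (A m) (A n)\<^esub> s) = ext T m n r \<oplus>\<^bsub>A (m + n)\<^esub> ext T m n s"
  using ring_hom_add[OF ext_ring_hom[of m n]] by simp

text \<open>The degree equation is a premise with a free variable \<open>k\<close>, here and in
  later lemmas, so that \<open>l + (m + n)\<close> and \<open>l + m + n\<close> can both be replaced
  by one \<open>k\<close> without rewriting inside subscripts.\<close>

lemma em_closed [simp]:
  "\<lbrakk>a \<in> carrier (A m); b \<in> carrier (A n); m + n = k\<rbrakk> \<Longrightarrow> em m n a b \<in> carrier (A k)"
  by (auto simp: ext_mult_def)

lemma em_add_left: "\<lbrakk>a \<in> carrier (A m); a' \<in> carrier (A m); b \<in> carrier (A n); m + n = k\<rbrakk> \<Longrightarrow>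
    em m n (a \<oplus>\<^bsub>A m\<^esub> a') b = em m n a b \<oplus>\<^bsub>A k\<^esub> em m n a' b"
  by (auto simp: ext_mult_def AT.pure_add_left ext_add)

lemma em_add_right: "\<lbrakk>a \<in> carrier (A m); b \<in> carrier (A n); b' \<in> carrier (A n); m + n = k\<rbrakk> \<Longrightarrow>
    em m n a (b \<oplus>\<^bsub>A n\<^esub> b') = em m n a b \<oplus>\<^bsub>A k\<^esub> em m n a b'"
  by (auto simp: ext_mult_def AT.pure_add_right ext_add)

text \<open>The multiplication of a tensor algebra is a \<open>tensor_map2\<close>; its balance
  conditions over the base hold because both multiplications are bilinear.\<close>

lemma tens_mult_pure:
  assumes "a \<in> carrier (A m)" "b \<in> carrier (A n)" "a' \<in> carrier (A m)" "b' \<in> carrier (A n)"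
  shows "pure K (A m) (A n) a b \<otimes>\<^bsub>R m n\<^esub> pure K (A m) (A n) a' b'
    = pure K (A m) (A n) (a \<otimes>\<^bsub>A m\<^esub> a') (b \<otimes>\<^bsub>A n\<^esub> b')"
proof -
  note sm = graded_algebra.smult_mult_left[OF alg_graded] graded_algebra.smult_mult_right[OF alg_graded]
  have "tensor_map2 K (A m) (A n) (mult (A m)) (mult (A n)) (pure K (A m) (A n) a b) (pure K (A m) (A n) a' b')
    = pure K (A m) (A n) (a \<otimes>\<^bsub>A m\<^esub> a') (b \<otimes>\<^bsub>A n\<^esub> b')"
    by (rule tensor_map2_pure[OF AT.tensor_pair_axioms AT.tensor_pair_axioms AT.tensor_pair_axioms])
       (use assms in \<open>auto intro!: balancedI simp: A.l_distr A.r_distr AT.pure_add_left AT.pure_add_right sm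
           AT.pure_smult\<close>)
  then show ?thesis by (simp add: tensor_algebra_def)
qed

lemma em_mult:
  assumes "a \<in> carrier (A m)" "b \<in> carrier (A n)" "a' \<in> carrier (A m)" "b' \<in> carrier (A n)" "m + n = k"
  shows "em m n a b \<otimes>\<^bsub>A k\<^esub> em m n a' b' = em m n (a \<otimes>\<^bsub>A m\<^esub> a') (b \<otimes>\<^bsub>A n\<^esub> b')"
  using ring_hom_mult[OF ext_ring_hom[of m n], of "pure K (A m) (A n) a b" "pure K (A m) (A n) a' b'"]
    tens_mult_pure assms
  by (auto simp: ext_mult_def)

lemma em_one: "m + n = k \<Longrightarrow> em m n \<one>\<^bsub>A m\<^esub> \<one>\<^bsub>A n\<^esub> = \<one>\<^bsub>A k\<^esub>"
  using ring_hom_one[OF ext_ring_hom[of m n]] by (auto simp: ext_mult_def tensor_algebra_def)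

lemma em_assoc:
  assumes "a \<in> carrier (A l)" "b \<in> carrier (A m)" "c \<in> carrier (A n)" "l + m = p" "m + n = q"
  shows "em p n (em l m a b) c = em l q a (em m n b c)"
  using nice assms by (auto simp: nice_tower_def)

lemma em_grade:
  assumes "a \<in> grade (A m) i" "b \<in> grade (A n) j" "m + n = k"
  shows "em m n a b \<in> grade (A k) (i + j)"
proof -
  have "pure K (A m) (A n) a b \<in> grade (R m n) (i + j)"
    unfolding tensor_algebra_def
    using assms by (auto intro!: generate.incl)
  moreover have "ext T m n ` grade (R m n) (i + j) \<subseteq> grade (A (m + n)) (i + j)"
    using ext_hom[of m n] unfolding graded_algebra_hom_def by blast
  ultimately show ?thesis
    using assms(3) by (auto simp: ext_mult_def)
qed

text \<open>The morphism \<open>ext\<close> is linear over the base field. Hence base scalars act on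
  a twisted restriction through the restricted module, as its finiteness proof requires.\<close>

lemma em_scalar_left:
  assumes "c \<in> carrier K" "m + n = k"
  shows "em m n (scalar (A m) c) \<one>\<^bsub>A n\<^esub> = scalar (A k) c"
proof -
  have "c \<odot>\<^bsub>R m n\<^esub> pure K (A m) (A n) \<one>\<^bsub>A m\<^esub> \<one>\<^bsub>A n\<^esub> = pure K (A m) (A n) (scalar (A m) c) \<one>\<^bsub>A n\<^esub>"
    unfolding tensor_algebra_def scalar_def
    using assms
    by (simp, intro tensor_map_pure[OF AT.tensor_pair_axioms AT.tensor_pair_axioms])
       (auto intro!: balancedI simp: AM.smult_r_distr AT.pure_add_left AT.pure_add_right AT.pure_smult
        simp flip: AM.smult_assoc1)
  moreover have "ext T m n (c \<odot>\<^bsub>R m n\<^esub> r) = c \<odot>\<^bsub>A (m + n)\<^esub> ext T m n r" if "r \<in> carrier (R m n)" for r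
    using ext_hom[of m n] that assms(1) unfolding graded_algebra_hom_def by blast
  ultimately have "ext T m n (pure K (A m) (A n) (scalar (A m) c) \<one>\<^bsub>A n\<^esub>)
      = c \<odot>\<^bsub>A (m + n)\<^esub> ext T m n (pure K (A m) (A n) \<one>\<^bsub>A m\<^esub> \<one>\<^bsub>A n\<^esub>)"
    by (metis AT.pure_closed A.one_closed tens_simps(1))
  then show ?thesis
    using em_one[of m n "m + n"] assms(2) by (auto simp: ext_mult_def scalar_def)
qed

text \<open>A base scalar crosses the tensor sign over the base. Balance over the tensor algebra
  thereby implies balance over the base field.\<close>

lemma em_scalar_swap:
  assumes "c \<in> carrier K"
  shows "em m n (scalar (A m) c) \<one>\<^bsub>A n\<^esub> = em m n \<one>\<^bsub>A m\<^esub> (scalar (A n) c)"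
  unfolding ext_mult_def scalar_def using assms by (simp add: AT.pure_smult)

end

section \<open>Induction\<close>

text \<open>The element \<open>c \<otimes> (x \<otimes> y)\<close>, where the outer tensor product
  is over \<open>A_m \<otimes> A_n\<close> and the inner one over the base field.\<close>

definition induce_gen ::
    "('k, 'a) tower \<Rightarrow> ('a, 'x) family \<Rightarrow> ('a, 'y) family \<Rightarrow> nat \<Rightarrow> nat \<Rightarrow>
      'a \<Rightarrow> 'x \<Rightarrow> 'y \<Rightarrow> ('a, ('x, 'y) tensor) tensor"
  where "induce_gen T X Y m n c x y =
    pure (tens T m n) (right_restriction T m n)
      (outer_tensor (base T) (alg T m) (alg T n) (X m) (Y n)) c
      (pure (base T) (restrict_scalars (scalar (alg T m)) (X m))
        (restrict_scalars (scalar (alg T n)) (Y n)) x y)"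

text \<open>The element \<open>c \<otimes> (x \<otimes> y)\<close> placed in the summand of the
  splitting \<open>(m, n)\<close>. The total \<open>k\<close> is an argument of its own, so that
  \<open>m + n = k\<close> can remain a hypothesis.\<close>

definition ind_gen ::
    "('k, 'a) tower \<Rightarrow> ('a, 'x) family \<Rightarrow> ('a, 'y) family \<Rightarrow> nat \<Rightarrow> nat \<Rightarrow> nat \<Rightarrow>
      'a \<Rightarrow> 'x \<Rightarrow> 'y \<Rightarrow> nat \<times> nat \<Rightarrow> ('a, ('x, 'y) tensor) tensor"
  where "ind_gen T X Y k m n c x y =
    summand (splittings k) (\<lambda>(m, n). induce T m n (X m) (Y n)) (m, n) (induce_gen T X Y m n c x y)"

lemma right_restriction_simps [simp]:
  "carrier (right_restriction T m n) = carrier (alg T (m + n))"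
  "add (right_restriction T m n) = add (alg T (m + n))"
  "ring.zero (right_restriction T m n) = ring.zero (alg T (m + n))"
  "smult (right_restriction T m n) r c = c \<otimes>\<^bsub>alg T (m + n)\<^esub> ext T m n r"
  "grade (right_restriction T m n) = grade (alg T (m + n))"
  by (simp_all add: right_restriction_def regular_def opposite_def)

locale module_pair = nice_tower_of_algebras T
  for T :: "('k, 'a) tower" +
  fixes X :: "('a, 'x) family" and Y :: "('a, 'y) family"
  assumes X: "graded_module (alg T n) (X n)" and Y: "graded_module (alg T n) (Y n)"
begin

abbreviation XK where "XK m \<equiv> restrict_scalars (scalar (A m)) (X m)"
abbreviation YK where "YK n \<equiv> restrict_scalars (scalar (A n)) (Y n)"
abbreviation Z where "Z m n \<equiv> outer_tensor K (A m) (A n) (X m) (Y n)"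
abbreviation C where "C \<equiv> right_restriction T"
abbreviation U where "U m n \<equiv> induce T m n (X m) (Y n)"
abbreviation g where "g \<equiv> induce_gen T X Y"

lemma outer_pair: "graded_tensor_pair K (XK m) (YK n)"
proof -
  interpret X: graded_group "X m" by (rule graded_moduleD(4)[OF X])
  interpret Y: graded_group "Y n" by (rule graded_moduleD(4)[OF Y])
  show ?thesis
  proof (intro graded_tensor_pair.intro graded_carrier_pair.intro tensor_pair.intro graded_tensor_pair_axioms.intro
      abelian_group_restrict_scalars is_graded_restrict_scalars X.abelian_group_axioms Y.abelian_group_axioms
      X.graded Y.graded)
    fix P :: "'k \<Rightarrow> bool" and r
    assume r: "r \<in> carrier K" and P: "\<And>e r. shifts K (XK m) (YK n) e r \<Longrightarrow> P r"
    \<comment> \<open>Base scalars act through elements of degree zero, so each one shifts by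
      \<open>0\<close> on both factors.\<close>
    have "shifts K (XK m) (YK n) 0 r"
      using graded_moduleD(6)[OF X scalar_grade[OF r]] graded_moduleD(6)[OF Y scalar_grade[OF r]] r
      by (simp add: shifts_def)
    then show "P r" by (rule P)
  qed (simp_all add: graded_module_smult[OF X] graded_module_smult[OF Y] scalar_add)
qed

sublocale ZP: graded_tensor_pair K "XK m" "YK n" for m n by (rule outer_pair)

abbreviation zp where "zp m n \<equiv> pure K (XK m) (YK n)"

lemma Z_simps [simp]:
  "carrier (Z m n) = carrier (tensor_group K (XK m) (YK n))"
  "add (Z m n) = mult (tensor_group K (XK m) (YK n))"
  "ring.zero (Z m n) = \<one>\<^bsub>tensor_group K (XK m) (YK n)\<^esub>"
  "smult (Z m n) = tensor_map2 K (XK m) (YK n) (smult (X m)) (smult (Y n))"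
  "grade (Z m n) = (\<lambda>d. generate (tensor_group K (XK m) (YK n))
     {zp m n x y | x y i j. x \<in> grade (X m) i \<and> y \<in> grade (Y n) j \<and> i + j = d})"
  by (simp_all add: outer_tensor_def Let_def)

lemma Z_abelian: "abelian_group (Z m n)"
  by (simp add: outer_tensor_def Let_def ZP.abelian_group_tensor)

lemma Z_graded: "is_graded (Z m n)"
  by (simp add: outer_tensor_def Let_def ZP.tensor_graded)

sublocale Z: graded_group "Z m n" for m n
  by (intro graded_group.intro graded_group_axioms.intro Z_abelian Z_graded)

lemma scalar_swap:
  "\<lbrakk>r \<in> carrier K; a \<in> carrier (A m)\<rbrakk> \<Longrightarrow> a \<otimes>\<^bsub>A m\<^esub> scalar (A m) r = r \<odot>\<^bsub>A m\<^esub> a"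
  unfolding scalar_def by (subst graded_algebra.smult_mult_right[OF alg_graded]) simp_all

text \<open>A base scalar multiplied into \<open>a\<close> or \<open>b\<close> comes out in front of
  the vector, where it may cross the tensor sign. With the next lemma this supplies the action of
  \<open>A_m \<otimes> A_n\<close> on the outer tensor product.\<close>

lemma act_balanced_left:
  assumes "x \<in> carrier (XK m)" "y \<in> carrier (YK n)"
  shows "balanced K (A m) (A n) (tensor_group K (XK m) (YK n)) (\<lambda>a b. zp m n (a \<odot>\<^bsub>X m\<^esub> x) (b \<odot>\<^bsub>Y n\<^esub> y))"
proof (rule balancedI)
  fix r a b assume r: "r \<in> carrier K" and ab: "a \<in> carrier (A m)" "b \<in> carrier (A n)"
  have "(r \<odot>\<^bsub>A m\<^esub> a) \<odot>\<^bsub>X m\<^esub> x = r \<odot>\<^bsub>XK m\<^esub> (a \<odot>\<^bsub>X m\<^esub> x)"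
    using r ab assms by (simp flip: scalar_mult_left add: graded_module_smult[OF X])
  moreover have "(r \<odot>\<^bsub>A n\<^esub> b) \<odot>\<^bsub>Y n\<^esub> y = r \<odot>\<^bsub>YK n\<^esub> (b \<odot>\<^bsub>Y n\<^esub> y)"
    using r ab assms by (simp flip: scalar_mult_left add: graded_module_smult[OF Y])
  ultimately show "zp m n ((r \<odot>\<^bsub>A m\<^esub> a) \<odot>\<^bsub>X m\<^esub> x) (b \<odot>\<^bsub>Y n\<^esub> y) = zp m n (a \<odot>\<^bsub>X m\<^esub> x) ((r \<odot>\<^bsub>A n\<^esub> b) \<odot>\<^bsub>Y n\<^esub> y)"
    using r ab assms ZP.pure_smult[of r "a \<odot>\<^bsub>X m\<^esub> x" m "b \<odot>\<^bsub>Y n\<^esub> y" n]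
    by (simp add: graded_module_smult[OF X] graded_module_smult[OF Y])
qed (use assms ZP.pure_add_left ZP.pure_add_right in
    \<open>auto simp: graded_module_smult[OF X] graded_module_smult[OF Y] intro!: ZP.pure_closed\<close>)

text \<open>Here the scalar stands behind \<open>a\<close> or \<open>b\<close> and has to pass it;
  this is centrality of the base field in the algebras.\<close>

lemma act_balanced_right:
  assumes "a \<in> carrier (A m)" "b \<in> carrier (A n)"
  shows "balanced K (XK m) (YK n) (tensor_group K (XK m) (YK n)) (\<lambda>x y. zp m n (a \<odot>\<^bsub>X m\<^esub> x) (b \<odot>\<^bsub>Y n\<^esub> y))"
proof (rule balancedI)
  fix r x y assume r: "r \<in> carrier K" and xy: "x \<in> carrier (XK m)" "y \<in> carrier (YK n)"
  have "a \<odot>\<^bsub>X m\<^esub> (r \<odot>\<^bsub>XK m\<^esub> x) = r \<odot>\<^bsub>XK m\<^esub> (a \<odot>\<^bsub>X m\<^esub> x)"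
    using r xy assms
    by (simp flip: graded_module_smult(4)[OF X] add: scalar_mult_left scalar_swap)
  moreover have "b \<odot>\<^bsub>Y n\<^esub> (r \<odot>\<^bsub>YK n\<^esub> y) = r \<odot>\<^bsub>YK n\<^esub> (b \<odot>\<^bsub>Y n\<^esub> y)"
    using r xy assms
    by (simp flip: graded_module_smult(4)[OF Y] add: scalar_mult_left scalar_swap)
  ultimately show "zp m n (a \<odot>\<^bsub>X m\<^esub> (r \<odot>\<^bsub>XK m\<^esub> x)) (b \<odot>\<^bsub>Y n\<^esub> y) = zp m n (a \<odot>\<^bsub>X m\<^esub> x) (b \<odot>\<^bsub>Y n\<^esub> (r \<odot>\<^bsub>YK n\<^esub> y))"
    using r xy assms ZP.pure_smult[of r "a \<odot>\<^bsub>X m\<^esub> x" m "b \<odot>\<^bsub>Y n\<^esub> y" n]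
    by (simp add: graded_module_smult[OF X] graded_module_smult[OF Y])
qed (use assms ZP.pure_add_left ZP.pure_add_right in
    \<open>auto simp: graded_module_smult[OF X] graded_module_smult[OF Y] intro!: ZP.pure_closed\<close>)

lemma
  shows Z_smult_hom_left: "z \<in> carrier (Z m n) \<Longrightarrow>
      (\<lambda>r. r \<odot>\<^bsub>Z m n\<^esub> z) \<in> hom (tensor_group K (A m) (A n)) (tensor_group K (XK m) (YK n))"
    and Z_smult_hom_right: "r \<in> carrier (R m n) \<Longrightarrow>
      smult (Z m n) r \<in> hom (tensor_group K (XK m) (YK n)) (tensor_group K (XK m) (YK n))"
    and Z_smult_pure: "\<lbrakk>a \<in> carrier (A m); b \<in> carrier (A n); x \<in> carrier (X m); y \<in> carrier (Y n)\<rbrakk> \<Longrightarrow>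
      pure K (A m) (A n) a b \<odot>\<^bsub>Z m n\<^esub> zp m n x y = zp m n (a \<odot>\<^bsub>X m\<^esub> x) (b \<odot>\<^bsub>Y n\<^esub> y)"
proof -
  note hyps = AT.tensor_pair_axioms[of m n] ZP.tensor_pair_axioms[of m n] ZP.tensor_pair_axioms[of m n]
    act_balanced_right act_balanced_left
  show "z \<in> carrier (Z m n) \<Longrightarrow>
      (\<lambda>r. r \<odot>\<^bsub>Z m n\<^esub> z) \<in> hom (tensor_group K (A m) (A n)) (tensor_group K (XK m) (YK n))"
    unfolding Z_simps
    by (rule tensor_map2_hom_left[OF hyps]) (simp_all add: graded_module_smult[OF X] graded_module_smult[OF Y])
  show "r \<in> carrier (R m n) \<Longrightarrow>
      smult (Z m n) r \<in> hom (tensor_group K (XK m) (YK n)) (tensor_group K (XK m) (YK n))"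
    unfolding Z_simps tens_simps
    by (rule tensor_map2_hom_right[OF hyps]) (simp_all add: graded_module_smult[OF X] graded_module_smult[OF Y])
  show "\<lbrakk>a \<in> carrier (A m); b \<in> carrier (A n); x \<in> carrier (X m); y \<in> carrier (Y n)\<rbrakk> \<Longrightarrow>
      pure K (A m) (A n) a b \<odot>\<^bsub>Z m n\<^esub> zp m n x y = zp m n (a \<odot>\<^bsub>X m\<^esub> x) (b \<odot>\<^bsub>Y n\<^esub> y)"
    unfolding Z_simps
    by (rule tensor_map2_pure[OF hyps]) (simp_all add: graded_module_smult[OF X] graded_module_smult[OF Y])
qed

lemma Z_smult_closed:
  "\<lbrakk>r \<in> carrier (R m n); z \<in> carrier (Z m n)\<rbrakk> \<Longrightarrow> r \<odot>\<^bsub>Z m n\<^esub> z \<in> carrier (Z m n)"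
  using hom_in_carrier[OF Z_smult_hom_right] by simp

lemma C_abelian: "abelian_group (C m n)"
  by (rule abelian_groupI'[OF comm_group_cong[OF A.a_comm_group[of "m + n"]]]) simp_all

lemma C_graded: "is_graded (C m n)"
  by (rule is_graded_cong[OF _ _ _ _ AG.graded]) simp_all

text \<open>The tensor algebra is additively generated by \<open>a \<otimes> b\<close> with
  \<open>a\<close> and \<open>b\<close> homogeneous. Such an element shifts \<open>A_(m+n)\<close>,
  through \<open>ext\<close>, and the outer tensor product by the same sum of degrees.\<close>

lemma induce_pair: "graded_tensor_pair (R m n) (C m n) (Z m n)"
proof (intro graded_tensor_pair.intro graded_carrier_pair.intro tensor_pair.intro graded_tensor_pair_axioms.intro
      C_abelian C_graded Z_abelian Z_graded Z_smult_closed)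
  fix r s z assume "r \<in> carrier (R m n)" "s \<in> carrier (R m n)" "z \<in> carrier (Z m n)"
  then show "(r \<oplus>\<^bsub>R m n\<^esub> s) \<odot>\<^bsub>Z m n\<^esub> z = r \<odot>\<^bsub>Z m n\<^esub> z \<oplus>\<^bsub>Z m n\<^esub> s \<odot>\<^bsub>Z m n\<^esub> z"
    using hom_mult[OF Z_smult_hom_left, of z m n r s] by simp
next
  fix r z z' assume "r \<in> carrier (R m n)" "z \<in> carrier (Z m n)" "z' \<in> carrier (Z m n)"
  then show "r \<odot>\<^bsub>Z m n\<^esub> (z \<oplus>\<^bsub>Z m n\<^esub> z') = r \<odot>\<^bsub>Z m n\<^esub> z \<oplus>\<^bsub>Z m n\<^esub> r \<odot>\<^bsub>Z m n\<^esub> z'"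
    using hom_mult[OF Z_smult_hom_right, of r m n z z'] by simp
next
  fix P :: "('a, 'a) tensor \<Rightarrow> bool" and r
  assume r: "r \<in> carrier (R m n)" and P: "\<And>e r. shifts (R m n) (C m n) (Z m n) e r \<Longrightarrow> P r"
    and add: "\<And>r s. \<lbrakk>r \<in> carrier (R m n); s \<in> carrier (R m n); P r; P s\<rbrakk> \<Longrightarrow> P (r \<oplus>\<^bsub>R m n\<^esub> s)"
  have shift: "shifts (R m n) (C m n) (Z m n) (i + j) (pure K (A m) (A n) a b)"
    if ab: "a \<in> grade (A m) i" "b \<in> grade (A n) j" for a b i j
    unfolding shifts_def
  proof (intro conjI allI ballI)
    have c: "a \<in> carrier (A m)" "b \<in> carrier (A n)" using ab AG.grade_carrier by auto
    then have pc: "pure K (A m) (A n) a b \<in> carrier (R m n)" by simp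
    show "pure K (A m) (A n) a b \<in> carrier (R m n)" by (rule pc)
    show "pure K (A m) (A n) a b \<odot>\<^bsub>C m n\<^esub> c \<in> grade (C m n) (d + (i + j))" if "c \<in> grade (C m n) d" for c d
      using grade_mult[of c "m + n" d] em_grade[OF ab refl] that by (simp add: ext_mult_def)
    show "pure K (A m) (A n) a b \<odot>\<^bsub>Z m n\<^esub> z \<in> grade (Z m n) (d + (i + j))" if z: "z \<in> grade (Z m n) d" for z d
    proof (rule ZP.hom_grade[where h = "smult (Z m n) (pure K (A m) (A n) a b)" and N = "Z m n" and H = "grade (Z m n) (d + (i + j))" and d = d])
      show "smult (Z m n) (pure K (A m) (A n) a b) \<in> hom (tensor_group K (XK m) (YK n)) (add_monoid (Z m n))"
        using Z_smult_hom_right[OF pc] by (simp add: hom_def)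
      show "z \<in> generate (tensor_group K (XK m) (YK n)) (ZP.hgens m n d)"
        using z by simp
      fix e f x y assume xy: "x \<in> grade (XK m) e" "y \<in> grade (YK n) f" "e + f = d"
      have "x \<in> carrier (X m)" "y \<in> carrier (Y n)"
        using xy ZP.GX.grade_carrier[of x m e] ZP.GY.grade_carrier[of y n f] by simp_all
      then have "pure K (A m) (A n) a b \<odot>\<^bsub>Z m n\<^esub> zp m n x y = zp m n (a \<odot>\<^bsub>X m\<^esub> x) (b \<odot>\<^bsub>Y n\<^esub> y)"
        using c Z_smult_pure by blast
      moreover have "a \<odot>\<^bsub>X m\<^esub> x \<in> grade (X m) (i + e)" "b \<odot>\<^bsub>Y n\<^esub> y \<in> grade (Y n) (j + f)"
        using graded_moduleD(6)[OF X] graded_moduleD(6)[OF Y] ab xy by auto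
      moreover have "(i + e) + (j + f) = d + (i + j)" using xy(3) by simp
      ultimately show "pure K (A m) (A n) a b \<odot>\<^bsub>Z m n\<^esub> zp m n x y \<in> grade (Z m n) (d + (i + j))"
        unfolding Z_simps(5) by (intro generate.incl) blast
    qed (rule Z_abelian Z.grade_subgroup)+
  qed
  have "r \<in> carrier (tensor_group K (A m) (A n))" using r by simp
  then show "P r"
  proof (induction rule: AT.tensor_induct)
    case (pure a b)
    show ?case
      by (rule AT.pure_sum_homogeneous_induct[OF AG.graded_group_axioms AG.graded_group_axioms pure])
         (use P[OF shift] add in auto)
  next
    case (add r s)
    then show ?case using \<open>\<And>r s. \<lbrakk>r \<in> carrier (R m n); s \<in> carrier (R m n); P r; P s\<rbrakk> \<Longrightarrow> P (r \<oplus>\<^bsub>R m n\<^esub> s)\<close>[of r s] by simp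
  qed
qed (auto simp: A.r_distr A.l_distr ext_add)

sublocale UP: graded_tensor_pair "R m n" "C m n" "Z m n" for m n by (rule induce_pair)

lemma induce_eq: "U m n = tensor_product (R m n) (C m n) (Z m n)
    (\<lambda>c. tensor_map (R m n) (C m n) (Z m n) (\<lambda>d. c \<otimes>\<^bsub>A (m + n)\<^esub> d) (\<lambda>z. z))"
  by (simp add: induce_def Let_def)

text \<open>Left multiplication by \<open>c\<close> commutes with the right action through
  \<open>ext\<close>, by associativity.\<close>

lemma induce_balanced:
  assumes "c \<in> carrier (A (m + n))"
  shows "balanced (R m n) (C m n) (Z m n) (tensor_group (R m n) (C m n) (Z m n))
    (\<lambda>d z. pure (R m n) (C m n) (Z m n) (c \<otimes>\<^bsub>A (m + n)\<^esub> d) z)"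
proof (rule balancedI)
  fix r d z assume "r \<in> carrier (R m n)" "d \<in> carrier (C m n)" "z \<in> carrier (Z m n)"
  then show "pure (R m n) (C m n) (Z m n) (c \<otimes>\<^bsub>A (m + n)\<^esub> (r \<odot>\<^bsub>C m n\<^esub> d)) z
    = pure (R m n) (C m n) (Z m n) (c \<otimes>\<^bsub>A (m + n)\<^esub> d) (r \<odot>\<^bsub>Z m n\<^esub> z)"
    using UP.pure_smult[of r m n "c \<otimes>\<^bsub>A (m + n)\<^esub> d" z] assms by (simp add: A.m_assoc)
qed (use assms UP.pure_add_left UP.pure_add_right UP.pure_closed in \<open>simp_all add: A.r_distr\<close>)

lemma induce_graded_module: "graded_module (A (m + n)) (U m n)"
  unfolding induce_eq
proof (rule UP.tensor_graded_module[OF UP.tensor_left_module[OF A.ring_axioms]])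
  fix s x y i j l assume "s \<in> grade (A (m + n)) i" "x \<in> grade (C m n) j" "y \<in> grade (Z m n) l"
  then show "\<exists>j' l'. s \<otimes>\<^bsub>A (m + n)\<^esub> x \<in> grade (C m n) j' \<and> y \<in> grade (Z m n) l' \<and> j' + l' = i + (j + l)"
    using grade_mult[of s "m + n" i x j] by (intro exI[of _ "i + j"] exI[of _ l]) simp
qed (use induce_balanced AG.grade_carrier UP.pure_add_left in \<open>auto simp: A.l_distr A.m_assoc\<close>)

lemma U_carrier: "carrier (U m n) = carrier (tensor_group (R m n) (C m n) (Z m n))"
  and U_add: "add (U m n) = mult (tensor_group (R m n) (C m n) (Z m n))"
  unfolding induce_eq by simp_all

lemma g_closed: "\<lbrakk>c \<in> carrier (A (m + n)); x \<in> carrier (X m); y \<in> carrier (Y n)\<rbrakk> \<Longrightarrow>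
    g m n c x y \<in> carrier (U m n)"
  unfolding induce_gen_def U_carrier by (intro UP.pure_closed) simp_all

lemma g_add1: "\<lbrakk>c \<in> carrier (A (m + n)); c' \<in> carrier (A (m + n)); x \<in> carrier (X m); y \<in> carrier (Y n)\<rbrakk> \<Longrightarrow>
    g m n (c \<oplus>\<^bsub>A (m + n)\<^esub> c') x y = g m n c x y \<oplus>\<^bsub>U m n\<^esub> g m n c' x y"
  unfolding induce_gen_def U_add using UP.pure_add_left[of c m n c' "zp m n x y"] by simp

lemma g_add2: "\<lbrakk>c \<in> carrier (A (m + n)); x \<in> carrier (X m); x' \<in> carrier (X m); y \<in> carrier (Y n)\<rbrakk> \<Longrightarrow>
    g m n c (x \<oplus>\<^bsub>X m\<^esub> x') y = g m n c x y \<oplus>\<^bsub>U m n\<^esub> g m n c x' y"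
  unfolding induce_gen_def U_add
  using UP.pure_add_right[of c m n "zp m n x y" "zp m n x' y"] ZP.pure_add_left[of x m x' y n] by simp

lemma g_add3: "\<lbrakk>c \<in> carrier (A (m + n)); x \<in> carrier (X m); y \<in> carrier (Y n); y' \<in> carrier (Y n)\<rbrakk> \<Longrightarrow>
    g m n c x (y \<oplus>\<^bsub>Y n\<^esub> y') = g m n c x y \<oplus>\<^bsub>U m n\<^esub> g m n c x y'"
  unfolding induce_gen_def U_add
  using UP.pure_add_right[of c m n "zp m n x y" "zp m n x y'"] ZP.pure_add_right[of x m y n y'] by simp

lemma g_balanced:
  "\<lbrakk>c \<in> carrier (A (m + n)); a \<in> carrier (A m); b \<in> carrier (A n); x \<in> carrier (X m); y \<in> carrier (Y n)\<rbrakk> \<Longrightarrow>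
    g m n (c \<otimes>\<^bsub>A (m + n)\<^esub> em m n a b) x y = g m n c (a \<odot>\<^bsub>X m\<^esub> x) (b \<odot>\<^bsub>Y n\<^esub> y)"
  unfolding induce_gen_def
  using UP.pure_smult[of "pure K (A m) (A n) a b" m n c "zp m n x y"] Z_smult_pure[of a m b n x y]
  by (simp add: ext_mult_def)

lemma g_smult:
  assumes "a \<in> carrier (A (m + n))" "c \<in> carrier (A (m + n))" "x \<in> carrier (X m)" "y \<in> carrier (Y n)"
  shows "a \<odot>\<^bsub>U m n\<^esub> g m n c x y = g m n (a \<otimes>\<^bsub>A (m + n)\<^esub> c) x y"
  unfolding induce_eq induce_gen_def tensor_product_simps
  by (rule tensor_map_pure[OF UP.tensor_pair_axioms UP.tensor_pair_axioms induce_balanced])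
     (use assms in auto)

lemma g_grade:
  assumes "c \<in> grade (A (m + n)) i" "x \<in> grade (X m) j" "y \<in> grade (Y n) l"
  shows "g m n c x y \<in> grade (U m n) (i + j + l)"
proof -
  have "zp m n x y \<in> grade (Z m n) (j + l)"
    unfolding Z_simps using assms by (intro generate.incl) blast
  then have "g m n c x y \<in> UP.hgens m n (i + (j + l))"
    unfolding induce_gen_def right_restriction_simps using assms(1) by blast
  then show ?thesis
    unfolding induce_eq tensor_product_simps by (simp add: generate.incl add.assoc)
qed

lemma induce_induct [consumes 1, case_names gen add]:
  assumes u: "u \<in> carrier (U m n)"
    and gen: "\<And>c x y. \<lbrakk>c \<in> carrier (A (m + n)); x \<in> carrier (X m); y \<in> carrier (Y n)\<rbrakk> \<Longrightarrow> P (g m n c x y)"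
    and add: "\<And>u v. \<lbrakk>u \<in> carrier (U m n); v \<in> carrier (U m n); P u; P v\<rbrakk> \<Longrightarrow> P (u \<oplus>\<^bsub>U m n\<^esub> v)"
  shows "P u"
  using u unfolding U_carrier
proof (induction rule: UP.tensor_induct)
  case (pure c z)
  then have c: "c \<in> carrier (A (m + n))" and z: "z \<in> carrier (tensor_group K (XK m) (YK n))" by simp_all
  from z show ?case
  proof (induction rule: ZP.tensor_induct)
    case (pure x y)
    then show ?case using gen[of c x y] c by (simp add: induce_gen_def)
  next
    case (add z z')
    then show ?case
      using assms(3) UP.pure_add_right[of c m n z z'] UP.pure_closed[of c m n] c by (simp add: U_add U_carrier)
  qed
next
  case (add u v)
  then show ?case using assms(3) by (simp add: U_add U_carrier)
qed

text \<open>Nested use of \<open>hom_grade\<close>: for the outer tensor product, and then, with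
  \<open>c\<close> fixed, for the inner one over the base field.\<close>

lemma induce_hom_grade:
  assumes h: "h \<in> ahom (U m n) N" and N: "abelian_group N" and u: "u \<in> grade (U m n) d"
    and H: "additive_subgroup H N"
    and p: "\<And>i j l c x y. \<lbrakk>c \<in> grade (A (m + n)) i; x \<in> grade (X m) j; y \<in> grade (Y n) l; i + j + l = d\<rbrakk> \<Longrightarrow>
      h (g m n c x y) \<in> H"
  shows "h u \<in> H"
proof (rule UP.hom_grade[OF _ N _ H])
  show h': "h \<in> hom (tensor_group (R m n) (C m n) (Z m n)) (add_monoid N)"
    using h unfolding induce_eq hom_tensor_product .
  show "u \<in> generate (tensor_group (R m n) (C m n) (Z m n)) (UP.hgens m n d)"
    using u unfolding induce_eq tensor_product_simps .
  fix i e c z assume c: "c \<in> grade (C m n) i" and z: "z \<in> grade (Z m n) e" and d: "i + e = d"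
  let ?h = "\<lambda>z. h (pure (R m n) (C m n) (Z m n) c z)"
  have cc: "c \<in> carrier (C m n)" using c UP.GX.grade_carrier by blast
  show "?h z \<in> H"
  proof (rule ZP.hom_grade[OF _ N _ H, where h = ?h])
    show "?h \<in> hom (tensor_group K (XK m) (YK n)) (add_monoid N)"
    proof (rule homI)
      fix z z' assume z: "z \<in> carrier (tensor_group K (XK m) (YK n))" "z' \<in> carrier (tensor_group K (XK m) (YK n))"
      then show "?h z \<in> carrier (add_monoid N)"
        using hom_in_carrier[OF h'] UP.pure_closed[OF cc] by simp
      show "?h (z \<otimes>\<^bsub>tensor_group K (XK m) (YK n)\<^esub> z') = ?h z \<otimes>\<^bsub>add_monoid N\<^esub> ?h z'"
        using z UP.pure_add_right[OF cc] UP.pure_closed[OF cc] hom_mult[OF h'] by simp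
    qed
    show "z \<in> generate (tensor_group K (XK m) (YK n)) (ZP.hgens m n e)"
      using z by simp
    fix j l x y assume "x \<in> grade (XK m) j" "y \<in> grade (YK n) l" "j + l = e"
    then show "?h (zp m n x y) \<in> H"
      using p[of c i x j y l] c d by (simp add: induce_gen_def)
  qed
qed

text \<open>The universal property in three variables. For fixed \<open>c\<close> the map lifts to
  the inner tensor product (\<open>L c\<close>). For pure ring elements and pure vectors the balance
  of \<open>L\<close> is \<open>bal\<close>; it extends because both sides are additive in the ring
  element and in the vector.\<close>

lemma induce_lift:
  assumes N: "abelian_group N"
    and cl: "\<And>c x y. \<lbrakk>c \<in> carrier (A (m + n)); x \<in> carrier (X m); y \<in> carrier (Y n)\<rbrakk> \<Longrightarrow> \<phi> c x y \<in> carrier N"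
    and add1: "\<And>c c' x y. \<lbrakk>c \<in> carrier (A (m + n)); c' \<in> carrier (A (m + n)); x \<in> carrier (X m); y \<in> carrier (Y n)\<rbrakk> \<Longrightarrow>
      \<phi> (c \<oplus>\<^bsub>A (m + n)\<^esub> c') x y = \<phi> c x y \<oplus>\<^bsub>N\<^esub> \<phi> c' x y"
    and add2: "\<And>c x x' y. \<lbrakk>c \<in> carrier (A (m + n)); x \<in> carrier (X m); x' \<in> carrier (X m); y \<in> carrier (Y n)\<rbrakk> \<Longrightarrow>
      \<phi> c (x \<oplus>\<^bsub>X m\<^esub> x') y = \<phi> c x y \<oplus>\<^bsub>N\<^esub> \<phi> c x' y"
    and add3: "\<And>c x y y'. \<lbrakk>c \<in> carrier (A (m + n)); x \<in> carrier (X m); y \<in> carrier (Y n); y' \<in> carrier (Y n)\<rbrakk> \<Longrightarrow>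
      \<phi> c x (y \<oplus>\<^bsub>Y n\<^esub> y') = \<phi> c x y \<oplus>\<^bsub>N\<^esub> \<phi> c x y'"
    and bal: "\<And>c a b x y. \<lbrakk>c \<in> carrier (A (m + n)); a \<in> carrier (A m); b \<in> carrier (A n); x \<in> carrier (X m); y \<in> carrier (Y n)\<rbrakk> \<Longrightarrow>
      \<phi> (c \<otimes>\<^bsub>A (m + n)\<^esub> em m n a b) x y = \<phi> c (a \<odot>\<^bsub>X m\<^esub> x) (b \<odot>\<^bsub>Y n\<^esub> y)"
  shows "\<exists>h\<in>ahom (U m n) N. \<forall>c\<in>carrier (A (m + n)). \<forall>x\<in>carrier (X m). \<forall>y\<in>carrier (Y n). h (g m n c x y) = \<phi> c x y"
proof -
  interpret N: abelian_group N by (rule N)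
  let ?N = "add_monoid N"
  define L where "L c = tensor_lift K (XK m) (YK n) ?N (\<phi> c)" for c
  have b1: "balanced K (XK m) (YK n) ?N (\<phi> c)" if c: "c \<in> carrier (A (m + n))" for c
  proof (rule balancedI)
    fix r x y assume r: "r \<in> carrier K" and xy: "x \<in> carrier (XK m)" "y \<in> carrier (YK n)"
    \<comment> \<open>Balance over the base field comes from \<open>bal\<close>, once with the
      scalar as \<open>a\<close> and \<open>b = 1\<close>, once the other way round;
      \<open>em_scalar_swap\<close> identifies the two.\<close>
    show "\<phi> c (r \<odot>\<^bsub>XK m\<^esub> x) y = \<phi> c x (r \<odot>\<^bsub>YK n\<^esub> y)"
      using bal[of c "scalar (A m) r" "\<one>\<^bsub>A n\<^esub>" x y] bal[of c "\<one>\<^bsub>A m\<^esub>" "scalar (A n) r" x y] r xy c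
        em_scalar_swap[OF r] graded_module_smult(5)[OF X] graded_module_smult(5)[OF Y] by simp
  qed (use c cl add2 add3 in simp_all)
  have L: "L c \<in> hom (tensor_group K (XK m) (YK n)) ?N" if "c \<in> carrier (A (m + n))" for c
    unfolding L_def by (rule ZP.tensor_lift_hom[OF N.a_comm_group b1[OF that]])
  have Lp: "L c (zp m n x y) = \<phi> c x y" if "c \<in> carrier (A (m + n))" "x \<in> carrier (X m)" "y \<in> carrier (Y n)" for c x y
    unfolding L_def by (rule ZP.tensor_lift_pure[OF N.a_comm_group b1[OF that(1)]]) (use that in simp_all)
  have Lc: "L c z \<in> carrier N" if "c \<in> carrier (A (m + n))" "z \<in> carrier (Z m n)" for c z
    using hom_in_carrier[OF L] that by simp
  have Ladd: "L c (z \<otimes>\<^bsub>tensor_group K (XK m) (YK n)\<^esub> z') = L c z \<oplus>\<^bsub>N\<^esub> L c z'"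
    if "c \<in> carrier (A (m + n))" "z \<in> carrier (tensor_group K (XK m) (YK n))" "z' \<in> carrier (tensor_group K (XK m) (YK n))" for c z z'
    using hom_mult[OF L[OF that(1)] that(2,3)] by simp
  have Ladd1: "L (c \<oplus>\<^bsub>A (m + n)\<^esub> c') z = L c z \<oplus>\<^bsub>N\<^esub> L c' z"
    if c: "c \<in> carrier (A (m + n))" "c' \<in> carrier (A (m + n))" and z: "z \<in> carrier (tensor_group K (XK m) (YK n))" for c c' z
    using z
  proof (induction rule: ZP.tensor_induct)
    case (pure x y)
    then show ?case using c by (simp add: Lp add1)
  next
    case (add z z')
    then show ?case using c Lc by (simp add: Ladd N.a_ac)
  qed
  have b2: "balanced (R m n) (C m n) (Z m n) ?N L"
  proof (rule balancedI)
    fix r c z assume r: "r \<in> carrier (R m n)" and c: "c \<in> carrier (C m n)" and z: "z \<in> carrier (Z m n)"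
    have cc: "c \<in> carrier (A (m + n))" using c by simp
    have r': "r \<in> carrier (tensor_group K (A m) (A n))" using r by simp
    then have "L (c \<otimes>\<^bsub>A (m + n)\<^esub> ext T m n r) z = L c (r \<odot>\<^bsub>Z m n\<^esub> z)"
    proof (induction rule: AT.tensor_induct)
      case (pure a b)
      have pc: "pure K (A m) (A n) a b \<in> carrier (R m n)" using pure by simp
      have "z \<in> carrier (tensor_group K (XK m) (YK n))" using z by simp
      then show ?case
      proof (induction rule: ZP.tensor_induct)
        case xy: (pure x y)
        then show ?case
          using bal[of c a b x y] pure cc unfolding ext_mult_def
          by (simp only: Z_smult_pure restrict_scalars_simps)
             (simp add: Lp graded_module_smult[OF X] graded_module_smult[OF Y])
      next
        case (add z z')
        then show ?case
          using hom_mult[OF Z_smult_hom_right[OF pc]] hom_in_carrier[OF Z_smult_hom_right[OF pc]] cc pc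
          by (simp add: Ladd)
      qed
    next
      case (add r s)
      have "(r \<otimes>\<^bsub>tensor_group K (A m) (A n)\<^esub> s) \<odot>\<^bsub>Z m n\<^esub> z = (r \<odot>\<^bsub>Z m n\<^esub> z) \<otimes>\<^bsub>tensor_group K (XK m) (YK n)\<^esub> (s \<odot>\<^bsub>Z m n\<^esub> z)"
        using hom_mult[OF Z_smult_hom_left[OF z]] add by simp
      moreover have "r \<odot>\<^bsub>Z m n\<^esub> z \<in> carrier (Z m n)" "s \<odot>\<^bsub>Z m n\<^esub> z \<in> carrier (Z m n)"
        using Z_smult_closed[OF _ z] add by simp_all
      ultimately show ?case
        using add cc z by (simp add: ext_add A.r_distr Ladd1 Ladd)
    qed
    then show "L (r \<odot>\<^bsub>C m n\<^esub> c) z = L c (r \<odot>\<^bsub>Z m n\<^esub> z)" by simp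
  qed (simp_all add: Ladd1 Ladd Lc)
  define h where "h = tensor_lift (R m n) (C m n) (Z m n) ?N L"
  have "h \<in> ahom (U m n) N"
    unfolding h_def induce_eq hom_tensor_product by (rule UP.tensor_lift_hom[OF N.a_comm_group b2])
  moreover have "h (g m n c x y) = \<phi> c x y" if "c \<in> carrier (A (m + n))" "x \<in> carrier (X m)" "y \<in> carrier (Y n)" for c x y
    unfolding h_def induce_gen_def
    using UP.tensor_lift_pure[OF N.a_comm_group b2, of c "zp m n x y"] Lp that by simp
  ultimately show ?thesis by (intro bexI[where x = h]) auto
qed

end

text \<open>It turns a zero module into an idempotent generator: additivity in this argument gives
  \<open>u + u = u\<close>, hence \<open>u = 0\<close>. The finiteness of supports rests on
  this.\<close>

lemma trivial_group_add:
  assumes "abelian_group M" "carrier M = {\<zero>\<^bsub>M\<^esub>}" "x \<in> carrier M"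
  shows "x \<oplus>\<^bsub>M\<^esub> x = x"
  using assms abelian_monoid.l_zero[OF abelian_group.axioms(1)[OF assms(1)], of "\<zero>\<^bsub>M\<^esub>"] by simp

section \<open>Induction of families, summed over the splittings of a degree\<close>

context module_pair
begin

lemma splittings_summands: "summands (splittings k) (\<lambda>(m, n). U m n)"
proof (rule summands.intro)
  show "splittings k \<noteq> {}" by (auto intro: exI[of _ k])
  fix mn :: "nat \<times> nat"
  show "abelian_group (case mn of (m, n) \<Rightarrow> U m n)"
    using graded_moduleD(3)[OF induce_graded_module] by (cases mn) simp
qed

sublocale S: summands "splittings k" "\<lambda>(m, n). U m n" for k by (rule splittings_summands)

lemma IND_eq: "IND T X Y k = direct_sum (splittings k) (\<lambda>(m, n). U m n)"
  by (simp add: IND_def)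

abbreviation V where "V \<equiv> IND T X Y"
abbreviation i where "i \<equiv> ind_gen T X Y"

lemma IND_abelian: "abelian_group (V k)"
  unfolding IND_eq by (rule S.abelian_direct_sum)

sublocale V: abelian_group "V k" for k by (rule IND_abelian)

lemma IND_graded_module: "graded_module (A k) (V k)"
  unfolding IND_eq
proof (rule S.direct_sum_graded_module)
  fix mn assume "mn \<in> splittings k"
  then obtain m n where "mn = (m, n)" "k = m + n" by blast
  then show "graded_module (A k) (case mn of (m, n) \<Rightarrow> U m n)"
    using induce_graded_module by simp
qed (rule AG.grade_carrier)

lemma ind_closed: "\<lbrakk>m + n = k; c \<in> carrier (A k); x \<in> carrier (X m); y \<in> carrier (Y n)\<rbrakk> \<Longrightarrow>
    i k m n c x y \<in> carrier (V k)"
  unfolding ind_gen_def IND_eq by (rule S.summand_closed) (auto intro: g_closed)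

lemma ind_summand_add:
  assumes "m + n = k" "u \<in> carrier (U m n)" "v \<in> carrier (U m n)"
  shows "S.\<iota> k (m, n) (u \<oplus>\<^bsub>U m n\<^esub> v) = S.\<iota> k (m, n) u \<oplus>\<^bsub>V k\<^esub> S.\<iota> k (m, n) v"
  unfolding IND_eq using S.summand_add[of "(m, n)" k u v] assms by simp

lemma ind_add1:
  assumes "m + n = k" "c \<in> carrier (A k)" "c' \<in> carrier (A k)" "x \<in> carrier (X m)" "y \<in> carrier (Y n)"
  shows "i k m n (c \<oplus>\<^bsub>A k\<^esub> c') x y = i k m n c x y \<oplus>\<^bsub>V k\<^esub> i k m n c' x y"
  using assms g_add1[of c m n c' x y] ind_summand_add[OF assms(1) g_closed[of c m n x y] g_closed[of c' m n x y]]
  by (auto simp: ind_gen_def)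

lemma ind_add2:
  assumes "m + n = k" "c \<in> carrier (A k)" "x \<in> carrier (X m)" "x' \<in> carrier (X m)" "y \<in> carrier (Y n)"
  shows "i k m n c (x \<oplus>\<^bsub>X m\<^esub> x') y = i k m n c x y \<oplus>\<^bsub>V k\<^esub> i k m n c x' y"
  using assms g_add2[of c m n x x' y] ind_summand_add[OF assms(1) g_closed[of c m n x y] g_closed[of c m n x' y]]
  by (auto simp: ind_gen_def)

lemma ind_add3:
  assumes "m + n = k" "c \<in> carrier (A k)" "x \<in> carrier (X m)" "y \<in> carrier (Y n)" "y' \<in> carrier (Y n)"
  shows "i k m n c x (y \<oplus>\<^bsub>Y n\<^esub> y') = i k m n c x y \<oplus>\<^bsub>V k\<^esub> i k m n c x y'"
  using assms g_add3[of c m n x y y'] ind_summand_add[OF assms(1) g_closed[of c m n x y] g_closed[of c m n x y']]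
  by (auto simp: ind_gen_def)

lemma ind_balanced:
  assumes "m + n = k" "c \<in> carrier (A k)" "a \<in> carrier (A m)" "b \<in> carrier (A n)"
    "x \<in> carrier (X m)" "y \<in> carrier (Y n)"
  shows "i k m n (c \<otimes>\<^bsub>A k\<^esub> em m n a b) x y = i k m n c (a \<odot>\<^bsub>X m\<^esub> x) (b \<odot>\<^bsub>Y n\<^esub> y)"
  using assms g_balanced[of c m n a b x y] by (auto simp: ind_gen_def)

lemma ind_smult:
  assumes "m + n = k" "a \<in> carrier (A k)" "c \<in> carrier (A k)" "x \<in> carrier (X m)" "y \<in> carrier (Y n)"
  shows "a \<odot>\<^bsub>V k\<^esub> i k m n c x y = i k m n (a \<otimes>\<^bsub>A k\<^esub> c) x y"
proof -
  have "a \<odot>\<^bsub>U m' n'\<^esub> \<zero>\<^bsub>U m' n'\<^esub> = \<zero>\<^bsub>U m' n'\<^esub>" if "m' + n' = k" for m' n'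
    using left_module_smult_zero[OF graded_moduleD(1)[OF induce_graded_module[of m' n']]] that assms(2) by simp
  then show ?thesis
    using assms g_smult[of a m n c x y]
    by (auto simp: ind_gen_def IND_eq summand_def intro!: restrict_ext)
qed

lemma ind_grade:
  assumes "m + n = k" "c \<in> grade (A k) d" "x \<in> grade (X m) e" "y \<in> grade (Y n) f"
  shows "i k m n c x y \<in> grade (V k) (d + e + f)"
  unfolding ind_gen_def IND_eq
proof (rule S.summand_grade)
  have c: "c \<in> carrier (A k)" "x \<in> carrier (X m)" "y \<in> carrier (Y n)"
    using assms AG.grade_carrier graded_group.grade_carrier[OF graded_moduleD(4)[OF X]]
      graded_group.grade_carrier[OF graded_moduleD(4)[OF Y]] by blast+
  show "g m n c x y \<in> grade (case (m, n) of (m, n) \<Rightarrow> U m n) (d + e + f)"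
    using g_grade[of c m n d x e y f] assms by simp
  show "g m n c x y \<in> carrier (case (m, n) of (m, n) \<Rightarrow> U m n)"
    using g_closed[of c m n x y] c assms by simp
  fix j
  show "\<zero>\<^bsub>(case j of (m, n) \<Rightarrow> U m n)\<^esub> \<in> grade (case j of (m, n) \<Rightarrow> U m n) (d + e + f)"
    using graded_group.grade_zero[OF graded_moduleD(4)[OF induce_graded_module]] by (cases j) simp
qed (use assms in simp)

lemma ind_induct [consumes 1, case_names gen add]:
  assumes u: "u \<in> carrier (V k)"
    and gen: "\<And>m n c x y. \<lbrakk>m + n = k; c \<in> carrier (A k); x \<in> carrier (X m); y \<in> carrier (Y n)\<rbrakk> \<Longrightarrow> P (i k m n c x y)"
    and add: "\<And>u v. \<lbrakk>u \<in> carrier (V k); v \<in> carrier (V k); P u; P v\<rbrakk> \<Longrightarrow> P (u \<oplus>\<^bsub>V k\<^esub> v)"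
  shows "P u"
  using u unfolding IND_eq
proof (induction rule: S.direct_sum_induct)
  case (summand mn u)
  then obtain m n where mn: "mn = (m, n)" "m + n = k" and u: "u \<in> carrier (U m n)" by auto
  from u show ?case
  proof (induction rule: induce_induct)
    case (gen c x y)
    then show ?case using assms(2)[of m n c x y] mn by (simp add: ind_gen_def)
  next
    case (add u v)
    have "S.\<iota> k (m, n) w \<in> carrier (V k)" if "w \<in> carrier (U m n)" for w
      unfolding IND_eq by (rule S.summand_closed) (use mn that in auto)
    then have "P (S.\<iota> k (m, n) u \<oplus>\<^bsub>V k\<^esub> S.\<iota> k (m, n) v)"
      using add unfolding mn(1) by (intro assms(3))
    then show ?case
      unfolding mn(1) by (subst ind_summand_add[OF mn(2) add(1,2)])
  qed
next
  case (add u v)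
  then show ?case using assms(3) by (simp only: IND_eq)
qed

text \<open>A homogeneous element of the sum has homogeneous coordinates, so it is assembled from
  homogeneous elements of the induced summands, to which \<open>induce_hom_grade\<close>
  applies.\<close>

lemma ind_hom_grade:
  assumes h: "h \<in> ahom (V k) N" and N: "abelian_group N" and u: "u \<in> grade (V k) d"
    and H: "additive_subgroup H N"
    and p: "\<And>m n e f l c x y. \<lbrakk>m + n = k; c \<in> grade (A k) e; x \<in> grade (X m) f; y \<in> grade (Y n) l; e + f + l = d\<rbrakk> \<Longrightarrow>
      h (i k m n c x y) \<in> H"
  shows "h u \<in> H"
proof -
  have uV: "u \<in> carrier (S.D k)" and ug: "\<And>j. j \<in> splittings k \<Longrightarrow> u j \<in> grade (case j of (m, n) \<Rightarrow> U m n) d"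
    using u unfolding IND_eq by (simp_all split: prod.splits)
  have gr: "graded_group (case j of (m, n) \<Rightarrow> U m n)" for j
    using graded_moduleD(4)[OF induce_graded_module] by (cases j) simp
  show ?thesis
  proof (rule S.direct_sum_induct_within[OF uV ug])
    show "\<zero>\<^bsub>(case j of (m, n) \<Rightarrow> U m n)\<^esub> \<in> grade (case j of (m, n) \<Rightarrow> U m n) d" for j
      by (rule graded_group.grade_zero[OF gr])
    show "grade (case j of (m, n) \<Rightarrow> U m n) d \<subseteq> carrier (case j of (m, n) \<Rightarrow> U m n)" for j
      using graded_group.grade_carrier[OF gr] by blast
  next
    fix mn u assume "mn \<in> splittings k" "u \<in> grade (case mn of (m, n) \<Rightarrow> U m n) d"
    then obtain m n where mn: "mn = (m, n)" "m + n = k" and u: "u \<in> grade (U m n) d" by auto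
    have "S.\<iota> k (m, n) \<in> ahom (U m n) (V k)"
      using S.summand_hom[of "(m, n)" k] mn by (simp add: IND_eq)
    from hom_compose[OF this h] have c: "h \<circ> S.\<iota> k (m, n) \<in> ahom (U m n) N" .
    have "(h \<circ> S.\<iota> k (m, n)) u \<in> H"
      by (rule induce_hom_grade[OF c N u H]) (use p mn in \<open>auto simp: ind_gen_def\<close>)
    then show "h (S.\<iota> k mn u) \<in> H" by (simp add: mn)
  next
    fix u v assume "u \<in> carrier (S.D k)" "v \<in> carrier (S.D k)" "h u \<in> H" "h v \<in> H"
    then show "h (u \<oplus>\<^bsub>S.D k\<^esub> v) \<in> H"
      using ahom_add[OF h, of u v] additive_subgroup.a_closed[OF H] by (simp only: IND_eq)
  qed
qed

lemma ind_lift: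
  assumes N: "abelian_group N"
    and cl: "\<And>m n c x y. \<lbrakk>m + n = k; c \<in> carrier (A k); x \<in> carrier (X m); y \<in> carrier (Y n)\<rbrakk> \<Longrightarrow> \<phi> m n c x y \<in> carrier N"
    and add1: "\<And>m n c c' x y. \<lbrakk>m + n = k; c \<in> carrier (A k); c' \<in> carrier (A k); x \<in> carrier (X m); y \<in> carrier (Y n)\<rbrakk> \<Longrightarrow>
      \<phi> m n (c \<oplus>\<^bsub>A k\<^esub> c') x y = \<phi> m n c x y \<oplus>\<^bsub>N\<^esub> \<phi> m n c' x y"
    and add2: "\<And>m n c x x' y. \<lbrakk>m + n = k; c \<in> carrier (A k); x \<in> carrier (X m); x' \<in> carrier (X m); y \<in> carrier (Y n)\<rbrakk> \<Longrightarrow>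
      \<phi> m n c (x \<oplus>\<^bsub>X m\<^esub> x') y = \<phi> m n c x y \<oplus>\<^bsub>N\<^esub> \<phi> m n c x' y"
    and add3: "\<And>m n c x y y'. \<lbrakk>m + n = k; c \<in> carrier (A k); x \<in> carrier (X m); y \<in> carrier (Y n); y' \<in> carrier (Y n)\<rbrakk> \<Longrightarrow>
      \<phi> m n c x (y \<oplus>\<^bsub>Y n\<^esub> y') = \<phi> m n c x y \<oplus>\<^bsub>N\<^esub> \<phi> m n c x y'"
    and bal: "\<And>m n c a b x y. \<lbrakk>m + n = k; c \<in> carrier (A k); a \<in> carrier (A m); b \<in> carrier (A n); x \<in> carrier (X m); y \<in> carrier (Y n)\<rbrakk> \<Longrightarrow>
      \<phi> m n (c \<otimes>\<^bsub>A k\<^esub> em m n a b) x y = \<phi> m n c (a \<odot>\<^bsub>X m\<^esub> x) (b \<odot>\<^bsub>Y n\<^esub> y)"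
  shows "\<exists>h\<in>ahom (V k) N. \<forall>m n. m + n = k \<longrightarrow>
    (\<forall>c\<in>carrier (A k). \<forall>x\<in>carrier (X m). \<forall>y\<in>carrier (Y n). h (i k m n c x y) = \<phi> m n c x y)"
proof -
  have ex: "\<exists>h\<in>ahom (U m n) N.
      \<forall>c\<in>carrier (A k). \<forall>x\<in>carrier (X m). \<forall>y\<in>carrier (Y n). h (g m n c x y) = \<phi> m n c x y"
    if "m + n = k" for m n
    by (rule induce_lift[OF N, where m = m and n = n and \<phi> = "\<phi> m n", unfolded that,
          OF cl[OF that] add1[OF that] add2[OF that] add3[OF that] bal[OF that]])
  define Q where "Q m n h \<longleftrightarrow> h \<in> ahom (U m n) N \<and>
      (\<forall>c\<in>carrier (A k). \<forall>x\<in>carrier (X m). \<forall>y\<in>carrier (Y n). h (g m n c x y) = \<phi> m n c x y)" for m n h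
  \<comment> \<open>One lift is chosen for each splitting; the universal property of the direct sum
    takes the whole family.\<close>
  define h where "h m n = (SOME h. Q m n h)" for m n
  have "Q m n (h m n)" if "m + n = k" for m n
  proof -
    have "\<exists>h. Q m n h" using ex[OF that] by (auto simp: Q_def)
    then show ?thesis unfolding h_def by (rule someI_ex)
  qed
  then have h: "\<And>m n. m + n = k \<Longrightarrow> h m n \<in> ahom (U m n) N"
    and hg: "\<And>m n c x y. \<lbrakk>m + n = k; c \<in> carrier (A k); x \<in> carrier (X m); y \<in> carrier (Y n)\<rbrakk> \<Longrightarrow> h m n (g m n c x y) = \<phi> m n c x y"
    unfolding Q_def by auto
  have "\<exists>f\<in>hom (add_monoid (S.D k)) (add_monoid N). \<forall>mn\<in>splittings k. \<forall>u\<in>carrier (case mn of (m, n) \<Rightarrow> U m n).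
      f (S.\<iota> k mn u) = (case mn of (m, n) \<Rightarrow> h m n) u"
    by (rule S.direct_sum_lift[OF abelian_group.a_comm_group[OF N]]) (use h in auto)
  then obtain f where f: "f \<in> ahom (V k) N"
    and fi: "\<And>m n u. \<lbrakk>m + n = k; u \<in> carrier (U m n)\<rbrakk> \<Longrightarrow> f (S.\<iota> k (m, n) u) = h m n u"
    unfolding IND_eq by force
  show ?thesis
    by (rule bexI[OF _ f]) (use fi g_closed hg in \<open>auto simp: ind_gen_def\<close>)
qed

lemma ind_hom_eqI:
  assumes "h \<in> ahom (V k) N" "h' \<in> ahom (V k) N" "u \<in> carrier (V k)"
    and "\<And>m n c x y. \<lbrakk>m + n = k; c \<in> carrier (A k); x \<in> carrier (X m); y \<in> carrier (Y n)\<rbrakk> \<Longrightarrow>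
      h (i k m n c x y) = h' (i k m n c x y)"
  shows "h u = h' u"
  using assms(3) by (induction rule: ind_induct) (simp_all add: assms ahom_add[OF assms(1)] ahom_add[OF assms(2)])

text \<open>A generator with a factor from a zero module vanishes. So a nonzero part of degree
  \<open>k\<close> forces \<open>k = m + n\<close> with \<open>m\<close> and \<open>n\<close> in the
  two finite supports.\<close>

lemma ind_finite_support:
  assumes "finite {n. carrier (X n) \<noteq> {\<zero>\<^bsub>X n\<^esub>}}" "finite {n. carrier (Y n) \<noteq> {\<zero>\<^bsub>Y n\<^esub>}}"
  shows "finite {k. carrier (V k) \<noteq> {\<zero>\<^bsub>V k\<^esub>}}"
proof -
  let ?P = "{n. carrier (X n) \<noteq> {\<zero>\<^bsub>X n\<^esub>}}" and ?Q = "{n. carrier (Y n) \<noteq> {\<zero>\<^bsub>Y n\<^esub>}}"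
  have "k \<in> (\<lambda>(m, n). m + n) ` (?P \<times> ?Q)" if "carrier (V k) \<noteq> {\<zero>\<^bsub>V k\<^esub>}" for k
  proof (rule ccontr)
    assume k: "k \<notin> (\<lambda>(m, n). m + n) ` (?P \<times> ?Q)"
    have "u = \<zero>\<^bsub>V k\<^esub>" if "u \<in> carrier (V k)" for u
      using that
    proof (induction rule: ind_induct)
      case (gen m n c x y)
      then consider "carrier (X m) = {\<zero>\<^bsub>X m\<^esub>}" | "carrier (Y n) = {\<zero>\<^bsub>Y n\<^esub>}"
        using k by force
      then show ?case
      proof cases
        case 1
        have e: "x \<oplus>\<^bsub>X m\<^esub> x = x"
          by (rule trivial_group_add[OF graded_moduleD(3)[OF X] 1 gen(3)])
        show ?thesis
          using ind_add2[OF gen(1,2,3,3,4)] ind_closed[OF gen] unfolding e by (simp add: V.add.l_cancel_one')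
      next
        case 2
        have e: "y \<oplus>\<^bsub>Y n\<^esub> y = y"
          by (rule trivial_group_add[OF graded_moduleD(3)[OF Y] 2 gen(4)])
        show ?thesis
          using ind_add3[OF gen(1,2,3,4,4)] ind_closed[OF gen] unfolding e by (simp add: V.add.l_cancel_one')
      qed
    qed simp
    then have "carrier (V k) \<subseteq> {\<zero>\<^bsub>V k\<^esub>}" by (intro subsetI) simp
    then show False using that V.zero_closed by (auto dest: subset_singletonD)
  qed
  then have "{k. carrier (V k) \<noteq> {\<zero>\<^bsub>V k\<^esub>}} \<subseteq> (\<lambda>(m, n). m + n) ` (?P \<times> ?Q)" by blast
  then show ?thesis using assms finite_subset by blast
qed

end

section \<open>Twisted restriction\<close>

definition tr_gen ::
    "('k, 'a) tower \<Rightarrow> ('a, 'p) family \<Rightarrow> ('a, 'x) family \<Rightarrow> nat \<Rightarrow> nat \<Rightarrow> 'p \<Rightarrow> 'x \<Rightarrow> nat \<Rightarrow> ('p, 'x) tensor"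
  where "tr_gen T P N k p x v =
    summand UNIV (\<lambda>p. twisted_restriction T k p (P p) (N (k + p))) p
      (pure (alg T p) (twist T p (P p)) (right_part T k p (N (k + p))) x v)"

lemma twist_simps [simp]:
  "carrier (twist T p M) = carrier M" "add (twist T p M) = add M"
  "ring.zero (twist T p M) = ring.zero M" "smult (twist T p M) a x = anti T p a \<odot>\<^bsub>M\<^esub> x"
  "grade (twist T p M) = grade M"
  by (simp_all add: twist_def)

lemma right_part_simps [simp]:
  "carrier (right_part T k p M) = carrier M" "add (right_part T k p M) = add M"
  "ring.zero (right_part T k p M) = ring.zero M"
  "smult (right_part T k p M) a x = ext_mult T k p \<one>\<^bsub>alg T k\<^esub> a \<odot>\<^bsub>M\<^esub> x"
  "grade (right_part T k p M) = grade M"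
  by (simp_all add: right_part_def)

context nice_tower_of_algebras
begin

abbreviation \<psi> where "\<psi> \<equiv> anti T"

lemma anti_hom: "\<psi> n \<in> graded_algebra_hom K (A n) (opposite (A n))"
  using nice by (simp add: nice_tower_def)

lemma anti_bij: "bij_betw (\<psi> n) (carrier (A n)) (carrier (A n))"
  using nice by (simp add: nice_tower_def)

lemma anti_ring_hom: "\<psi> n \<in> ring_hom (A n) (opposite (A n))"
  using anti_hom by (simp add: graded_algebra_hom_def)

lemma anti_closed [simp]: "a \<in> carrier (A n) \<Longrightarrow> \<psi> n a \<in> carrier (A n)"
  using anti_bij by (rule bij_betwE[THEN bspec])

lemma anti_add: "\<lbrakk>a \<in> carrier (A n); b \<in> carrier (A n)\<rbrakk> \<Longrightarrow> \<psi> n (a \<oplus>\<^bsub>A n\<^esub> b) = \<psi> n a \<oplus>\<^bsub>A n\<^esub> \<psi> n b"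
  using ring_hom_add[OF anti_ring_hom] by (simp add: opposite_def)

lemma anti_mult: "\<lbrakk>a \<in> carrier (A n); b \<in> carrier (A n)\<rbrakk> \<Longrightarrow> \<psi> n (a \<otimes>\<^bsub>A n\<^esub> b) = \<psi> n b \<otimes>\<^bsub>A n\<^esub> \<psi> n a"
  using ring_hom_mult[OF anti_ring_hom] by (simp add: opposite_def)

lemma anti_one [simp]: "\<psi> n \<one>\<^bsub>A n\<^esub> = \<one>\<^bsub>A n\<^esub>"
  using ring_hom_one[OF anti_ring_hom] by (simp add: opposite_def)

lemma anti_grade: "a \<in> grade (A n) i \<Longrightarrow> \<psi> n a \<in> grade (A n) i"
  using anti_hom[of n] unfolding graded_algebra_hom_def by (auto simp: opposite_def image_subset_iff)

text \<open>The inverse anti-automorphism. It presents an arbitrary algebra element as a value of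
  \<open>\<psi>\<close>, the form in which scalars cross the tensor sign.\<close>

definition \<psi>' where "\<psi>' n = inv_into (carrier (A n)) (\<psi> n)"

lemma anti_inv_closed [simp]: "a \<in> carrier (A n) \<Longrightarrow> \<psi>' n a \<in> carrier (A n)"
  unfolding \<psi>'_def using bij_betw_inv_into[OF anti_bij] by (rule bij_betwE[THEN bspec])

lemma anti_inv_right [simp]: "a \<in> carrier (A n) \<Longrightarrow> \<psi> n (\<psi>' n a) = a"
  unfolding \<psi>'_def by (rule bij_betw_inv_into_right[OF anti_bij])

lemma anti_inv_left [simp]: "a \<in> carrier (A n) \<Longrightarrow> \<psi>' n (\<psi> n a) = a"
  unfolding \<psi>'_def by (rule bij_betw_inv_into_left[OF anti_bij])

lemma anti_injective: "\<lbrakk>a \<in> carrier (A n); b \<in> carrier (A n); \<psi> n a = \<psi> n b\<rbrakk> \<Longrightarrow> a = b"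
  using anti_inv_left by metis

lemma anti_inv_add: "\<lbrakk>a \<in> carrier (A n); b \<in> carrier (A n)\<rbrakk> \<Longrightarrow> \<psi>' n (a \<oplus>\<^bsub>A n\<^esub> b) = \<psi>' n a \<oplus>\<^bsub>A n\<^esub> \<psi>' n b"
  by (rule anti_injective[of _ n]) (simp_all add: anti_add)

lemma anti_inv_mult: "\<lbrakk>a \<in> carrier (A n); b \<in> carrier (A n)\<rbrakk> \<Longrightarrow> \<psi>' n (a \<otimes>\<^bsub>A n\<^esub> b) = \<psi>' n b \<otimes>\<^bsub>A n\<^esub> \<psi>' n a"
  by (rule anti_injective[of _ n]) (simp_all add: anti_mult)

lemma anti_inv_one [simp]: "\<psi>' n \<one>\<^bsub>A n\<^esub> = \<one>\<^bsub>A n\<^esub>"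
  by (rule anti_injective[of _ n]) simp_all

text \<open>The images of \<open>A_k\<close> and \<open>A_p\<close> in \<open>A_(k+p)\<close>
  commute. This is what lets \<open>A_k\<close> act on a tensor product formed over
  \<open>A_p\<close>.\<close>

lemma em_one_mult:
  assumes "a \<in> carrier (A k)" "b \<in> carrier (A p)" "k + p = n"
  shows "em k p \<one>\<^bsub>A k\<^esub> b \<otimes>\<^bsub>A n\<^esub> em k p a \<one>\<^bsub>A p\<^esub> = em k p a b"
    "em k p a \<one>\<^bsub>A p\<^esub> \<otimes>\<^bsub>A n\<^esub> em k p \<one>\<^bsub>A k\<^esub> b = em k p a b"
  using assms by (simp_all add: em_mult)

end

locale twisted_pair = nice_tower_of_algebras T
  for T :: "('k, 'a) tower" +
  fixes P :: "('a, 'p) family" and N :: "('a, 'x) family"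
  assumes P: "graded_module (alg T n) (P n)" and N: "graded_module (alg T n) (N n)"
begin

abbreviation TP where "TP p \<equiv> twist T p (P p)"
abbreviation RN where "RN k p \<equiv> right_part T k p (N (k + p))"
abbreviation W where "W k p \<equiv> twisted_restriction T k p (P p) (N (k + p))"
abbreviation tp where "tp k p \<equiv> pure (A p) (TP p) (RN k p)"

text \<open>Since \<open>\<psi>\<close> preserves degrees and the unit has degree zero, a
  homogeneous element of \<open>A_p\<close> shifts both the twisted module and the restricted one by
  its own degree.\<close>

lemma TR_pair: "graded_tensor_pair (A p) (TP p) (RN k p)"
proof -
  interpret P: graded_group "P p" by (rule graded_moduleD(4)[OF P])
  interpret N: graded_group "N (k + p)" by (rule graded_moduleD(4)[OF N])
  note m = graded_module_smult[OF P] graded_module_smult[OF N]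
  show ?thesis
  proof (intro graded_tensor_pair.intro graded_carrier_pair.intro tensor_pair.intro graded_tensor_pair_axioms.intro)
    show "abelian_group (TP p)" "abelian_group (RN k p)" "is_graded (TP p)" "is_graded (RN k p)"
      unfolding twist_def right_part_def
      by (intro abelian_group_restrict_scalars is_graded_restrict_scalars P.abelian_group_axioms
          N.abelian_group_axioms P.graded N.graded)+
    fix Q :: "'a \<Rightarrow> bool" and r
    assume r: "r \<in> carrier (A p)" and Q: "\<And>e r. shifts (A p) (TP p) (RN k p) e r \<Longrightarrow> Q r"
      and add: "\<And>r s. \<lbrakk>r \<in> carrier (A p); s \<in> carrier (A p); Q r; Q s\<rbrakk> \<Longrightarrow> Q (r \<oplus>\<^bsub>A p\<^esub> s)"
    from r show "Q r"
    proof (induction rule: AG.graded_induct)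
      case (homogeneous d r)
      have "shifts (A p) (TP p) (RN k p) d r"
        unfolding shifts_def
      proof (intro conjI allI ballI AG.grade_carrier[OF homogeneous])
        fix j x assume "x \<in> grade (TP p) j"
        then show "r \<odot>\<^bsub>TP p\<^esub> x \<in> grade (TP p) (j + d)"
          using graded_moduleD(6)[OF P anti_grade[OF homogeneous], of x j] by (simp add: add.commute)
      next
        fix j v assume "v \<in> grade (RN k p) j"
        then show "r \<odot>\<^bsub>RN k p\<^esub> v \<in> grade (RN k p) (j + d)"
          using graded_moduleD(6)[OF N em_grade[OF grade_one homogeneous refl], of v k j] by (simp add: add.commute)
      qed
      then show ?case by (rule Q)
    qed (rule add)
  qed (simp_all add: m anti_add em_add_right)
qed

sublocale TPP: graded_tensor_pair "A p" "TP p" "RN k p" for p k by (rule TR_pair)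

lemma W_eq: "W k p = tensor_product (A p) (TP p) (RN k p)
    (\<lambda>a. tensor_map (A p) (TP p) (RN k p) (\<lambda>x. x) (\<lambda>y. em k p a \<one>\<^bsub>A p\<^esub> \<odot>\<^bsub>N (k + p)\<^esub> y))"
  by (simp add: twisted_restriction_def Let_def)

text \<open>Balance is the commutation of \<open>a \<otimes> 1\<close> with
  \<open>1 \<otimes> b\<close> in \<open>A_(k+p)\<close>.\<close>

lemma W_balanced:
  assumes "a \<in> carrier (A k)"
  shows "balanced (A p) (TP p) (RN k p) (tensor_group (A p) (TP p) (RN k p))
    (\<lambda>x v. tp k p x (em k p a \<one>\<^bsub>A p\<^esub> \<odot>\<^bsub>N (k + p)\<^esub> v))"
proof (rule balancedI)
  note m = graded_module_smult[OF N[of "k + p"]]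
  fix b x v assume h: "b \<in> carrier (A p)" "x \<in> carrier (TP p)" "v \<in> carrier (RN k p)"
  have "em k p \<one>\<^bsub>A k\<^esub> b \<odot>\<^bsub>N (k + p)\<^esub> (em k p a \<one>\<^bsub>A p\<^esub> \<odot>\<^bsub>N (k + p)\<^esub> v)
      = em k p a \<one>\<^bsub>A p\<^esub> \<odot>\<^bsub>N (k + p)\<^esub> (em k p \<one>\<^bsub>A k\<^esub> b \<odot>\<^bsub>N (k + p)\<^esub> v)"
    using h assms by (simp flip: m(4) add: em_one_mult)
  then show "tp k p (b \<odot>\<^bsub>TP p\<^esub> x) (em k p a \<one>\<^bsub>A p\<^esub> \<odot>\<^bsub>N (k + p)\<^esub> v)
      = tp k p x (em k p a \<one>\<^bsub>A p\<^esub> \<odot>\<^bsub>N (k + p)\<^esub> (b \<odot>\<^bsub>RN k p\<^esub> v))"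
    using TPP.pure_smult[of b p x "em k p a \<one>\<^bsub>A p\<^esub> \<odot>\<^bsub>N (k + p)\<^esub> v" k] h assms m by simp
qed (use assms TPP.pure_add_left TPP.pure_add_right in
    \<open>auto simp: graded_module_smult[OF N] intro!: TPP.pure_closed\<close>)

lemma W_graded_module: "graded_module (A k) (W k p)"
  unfolding W_eq
proof (rule TPP.tensor_graded_module[OF TPP.tensor_left_module[OF A.ring_axioms]])
  fix s x y i j l assume h: "s \<in> grade (A k) i" "x \<in> grade (TP p) j" "y \<in> grade (RN k p) l"
  have "em k p s \<one>\<^bsub>A p\<^esub> \<odot>\<^bsub>N (k + p)\<^esub> y \<in> grade (N (k + p)) (i + l)"
    using graded_moduleD(6)[OF N em_grade[OF h(1) grade_one refl], of y p l] h(3) by simp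
  then show "\<exists>j' l'. x \<in> grade (TP p) j' \<and> em k p s \<one>\<^bsub>A p\<^esub> \<odot>\<^bsub>N (k + p)\<^esub> y \<in> grade (RN k p) l' \<and> j' + l' = i + (j + l)"
    using h(2) by (intro exI[of _ j] exI[of _ "i + l"]) simp
next
  note m = graded_module_smult[OF N[of "k + p"]]
  fix s s' x y assume h: "s \<in> carrier (A k)" "s' \<in> carrier (A k)" "x \<in> carrier (TP p)" "y \<in> carrier (RN k p)"
  show "tp k p x (em k p (s \<otimes>\<^bsub>A k\<^esub> s') \<one>\<^bsub>A p\<^esub> \<odot>\<^bsub>N (k + p)\<^esub> y)
      = tp k p x (em k p s \<one>\<^bsub>A p\<^esub> \<odot>\<^bsub>N (k + p)\<^esub> (em k p s' \<one>\<^bsub>A p\<^esub> \<odot>\<^bsub>N (k + p)\<^esub> y))"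
    using h by (simp flip: m(4) add: em_mult)
qed (use W_balanced AG.grade_carrier TPP.pure_add_right in
    \<open>auto simp: em_add_left em_one graded_module_smult[OF N]\<close>)

lemma W_carrier: "carrier (W k p) = carrier (tensor_group (A p) (TP p) (RN k p))"
  and W_add: "add (W k p) = mult (tensor_group (A p) (TP p) (RN k p))"
  unfolding W_eq by simp_all

lemma TR_summands: "summands (UNIV :: nat set) (W k)"
  by (rule summands.intro) (simp_all add: graded_moduleD(3)[OF W_graded_module])

sublocale S: summands UNIV "W k" for k by (rule TR_summands)

abbreviation V where "V \<equiv> obj (TR_functor T P) N"
abbreviation t where "t \<equiv> tr_gen T P N"

lemma TR_eq: "V k = direct_sum UNIV (W k)"
  by (simp add: TR_functor_def)

lemma TR_abelian: "abelian_group (V k)"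
  unfolding TR_eq by (rule S.abelian_direct_sum)

sublocale V: abelian_group "V k" for k by (rule TR_abelian)

lemma TR_graded_module: "graded_module (A k) (V k)"
  unfolding TR_eq by (rule S.direct_sum_graded_module[OF W_graded_module AG.grade_carrier])

lemma tp_closed: "\<lbrakk>x \<in> carrier (P p); v \<in> carrier (N (k + p))\<rbrakk> \<Longrightarrow> tp k p x v \<in> carrier (W k p)"
  unfolding W_carrier by (rule TPP.pure_closed) simp_all

lemma tr_closed: "\<lbrakk>x \<in> carrier (P p); v \<in> carrier (N (k + p))\<rbrakk> \<Longrightarrow> t k p x v \<in> carrier (V k)"
  unfolding tr_gen_def TR_eq by (rule S.summand_closed[OF UNIV_I tp_closed])

lemma tr_add1: "\<lbrakk>x \<in> carrier (P p); x' \<in> carrier (P p); v \<in> carrier (N (k + p))\<rbrakk> \<Longrightarrow>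
    t k p (x \<oplus>\<^bsub>P p\<^esub> x') v = t k p x v \<oplus>\<^bsub>V k\<^esub> t k p x' v"
  unfolding tr_gen_def TR_eq
  by (subst S.summand_add[symmetric, OF UNIV_I tp_closed tp_closed])
     (use TPP.pure_add_left[of x p x' v k] in \<open>simp_all add: W_add\<close>)

lemma tr_add2: "\<lbrakk>x \<in> carrier (P p); v \<in> carrier (N (k + p)); v' \<in> carrier (N (k + p))\<rbrakk> \<Longrightarrow>
    t k p x (v \<oplus>\<^bsub>N (k + p)\<^esub> v') = t k p x v \<oplus>\<^bsub>V k\<^esub> t k p x v'"
  unfolding tr_gen_def TR_eq
  by (subst S.summand_add[symmetric, OF UNIV_I tp_closed tp_closed])
     (use TPP.pure_add_right[of x p v k v'] in \<open>simp_all add: W_add\<close>)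

lemma tr_balanced: "\<lbrakk>a \<in> carrier (A p); x \<in> carrier (P p); v \<in> carrier (N (k + p))\<rbrakk> \<Longrightarrow>
    t k p (\<psi> p a \<odot>\<^bsub>P p\<^esub> x) v = t k p x (em k p \<one>\<^bsub>A k\<^esub> a \<odot>\<^bsub>N (k + p)\<^esub> v)"
  unfolding tr_gen_def using TPP.pure_smult[of a p x v k] by simp

lemma tr_smult:
  assumes "a \<in> carrier (A k)" "x \<in> carrier (P p)" "v \<in> carrier (N (k + p))"
  shows "a \<odot>\<^bsub>V k\<^esub> t k p x v = t k p x (em k p a \<one>\<^bsub>A p\<^esub> \<odot>\<^bsub>N (k + p)\<^esub> v)"
proof -
  note z = left_module_smult_zero[OF graded_moduleD(1)[OF W_graded_module] assms(1)]
  have "a \<odot>\<^bsub>W k p\<^esub> tp k p x v = tp k p x (em k p a \<one>\<^bsub>A p\<^esub> \<odot>\<^bsub>N (k + p)\<^esub> v)"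
    unfolding W_eq tensor_product_simps
    by (rule tensor_map_pure[OF TPP.tensor_pair_axioms TPP.tensor_pair_axioms W_balanced])
       (use assms graded_module_smult(1)[OF N] in auto)
  then show ?thesis
    using z by (auto simp: tr_gen_def TR_eq summand_def intro!: restrict_ext)
qed

lemma tr_grade:
  assumes "x \<in> grade (P p) d" "v \<in> grade (N (k + p)) e"
  shows "t k p x v \<in> grade (V k) (d + e)"
  unfolding tr_gen_def TR_eq
proof (rule S.summand_grade)
  show "tp k p x v \<in> grade (W k p) (d + e)"
    unfolding W_eq tensor_product_simps by (rule generate.incl) (use assms in auto)
  show "tp k p x v \<in> carrier (W k p)"
    by (rule tp_closed) (use assms graded_group.grade_carrier[OF graded_moduleD(4)[OF P]]
        graded_group.grade_carrier[OF graded_moduleD(4)[OF N]] in blast)+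
qed (simp_all add: graded_group.grade_zero[OF graded_moduleD(4)[OF W_graded_module]])

lemma tr_induct [consumes 1, case_names gen add]:
  assumes u: "u \<in> carrier (V k)"
    and gen: "\<And>p x v. \<lbrakk>x \<in> carrier (P p); v \<in> carrier (N (k + p))\<rbrakk> \<Longrightarrow> Q (t k p x v)"
    and add: "\<And>u v. \<lbrakk>u \<in> carrier (V k); v \<in> carrier (V k); Q u; Q v\<rbrakk> \<Longrightarrow> Q (u \<oplus>\<^bsub>V k\<^esub> v)"
  shows "Q u"
  using u unfolding TR_eq
proof (induction rule: S.direct_sum_induct)
  case (summand p u)
  then have u: "u \<in> carrier (tensor_group (A p) (TP p) (RN k p))" by (simp add: W_carrier)
  from u show ?case
  proof (induction rule: TPP.tensor_induct)
    case (pure x v)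
    then show ?case using assms(2)[of x p v] by (simp add: tr_gen_def)
  next
    case (add u v)
    then have uv: "u \<in> carrier (W k p)" "v \<in> carrier (W k p)" by (simp_all add: W_carrier)
    have "Q (S.\<iota> k p u \<oplus>\<^bsub>S.D k\<^esub> S.\<iota> k p v)"
      using add.IH assms(3)[unfolded TR_eq] S.summand_closed[OF UNIV_I uv(1)] S.summand_closed[OF UNIV_I uv(2)] by blast
    then show ?case
      using S.summand_add[OF UNIV_I uv] by (simp only: W_add)
  qed
next
  case (add u v)
  then show ?case using assms(3) by (simp only: TR_eq)
qed

lemma tr_hom_grade:
  assumes h: "h \<in> ahom (V k) L" and L: "abelian_group L" and u: "u \<in> grade (V k) d"
    and H: "additive_subgroup H L"
    and p: "\<And>p e f x v. \<lbrakk>x \<in> grade (P p) e; v \<in> grade (N (k + p)) f; e + f = d\<rbrakk> \<Longrightarrow> h (t k p x v) \<in> H"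
  shows "h u \<in> H"
proof -
  have uV: "u \<in> carrier (S.D k)" and ug: "\<And>p. p \<in> UNIV \<Longrightarrow> u p \<in> grade (W k p) d"
    using u unfolding TR_eq by simp_all
  note gr = graded_moduleD(4)[OF W_graded_module]
  show ?thesis
  proof (rule S.direct_sum_induct_within[OF uV ug])
    show "\<zero>\<^bsub>W k p\<^esub> \<in> grade (W k p) d" for p
      by (rule graded_group.grade_zero[OF gr])
    show "grade (W k p) d \<subseteq> carrier (W k p)" for p
      using graded_group.grade_carrier[OF gr] by blast
  next
    fix q u assume u: "u \<in> grade (W k q) d"
    have "S.\<iota> k q \<in> ahom (W k q) (V k)"
      using S.summand_hom[OF UNIV_I] by (simp only: TR_eq)
    from hom_compose[OF this h] have c: "h \<circ> S.\<iota> k q \<in> ahom (W k q) L" .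
    have "(h \<circ> S.\<iota> k q) u \<in> H"
    proof (rule TPP.hom_grade[OF _ L _ H])
      show "h \<circ> S.\<iota> k q \<in> hom (tensor_group (A q) (TP q) (RN k q)) (add_monoid L)"
        using c unfolding W_eq hom_tensor_product .
      show "u \<in> generate (tensor_group (A q) (TP q) (RN k q)) (TPP.hgens q k d)"
        using u unfolding W_eq tensor_product_simps .
    qed (use p in \<open>auto simp: tr_gen_def\<close>)
    then show "h (S.\<iota> k q u) \<in> H" by simp
  next
    fix u v assume "u \<in> carrier (S.D k)" "v \<in> carrier (S.D k)" "h u \<in> H" "h v \<in> H"
    then show "h (u \<oplus>\<^bsub>S.D k\<^esub> v) \<in> H"
      using ahom_add[OF h, of u v] additive_subgroup.a_closed[OF H] by (simp only: TR_eq)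
  qed
qed

text \<open>Each summand is a single tensor product over \<open>A_p\<close>, so one lift per summand
  is enough; the direct sum then collects them.\<close>

lemma tr_lift:
  assumes L: "abelian_group L"
    and cl: "\<And>p x v. \<lbrakk>x \<in> carrier (P p); v \<in> carrier (N (k + p))\<rbrakk> \<Longrightarrow> \<phi> p x v \<in> carrier L"
    and add1: "\<And>p x x' v. \<lbrakk>x \<in> carrier (P p); x' \<in> carrier (P p); v \<in> carrier (N (k + p))\<rbrakk> \<Longrightarrow>
      \<phi> p (x \<oplus>\<^bsub>P p\<^esub> x') v = \<phi> p x v \<oplus>\<^bsub>L\<^esub> \<phi> p x' v"
    and add2: "\<And>p x v v'. \<lbrakk>x \<in> carrier (P p); v \<in> carrier (N (k + p)); v' \<in> carrier (N (k + p))\<rbrakk> \<Longrightarrow>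
      \<phi> p x (v \<oplus>\<^bsub>N (k + p)\<^esub> v') = \<phi> p x v \<oplus>\<^bsub>L\<^esub> \<phi> p x v'"
    and bal: "\<And>p a x v. \<lbrakk>a \<in> carrier (A p); x \<in> carrier (P p); v \<in> carrier (N (k + p))\<rbrakk> \<Longrightarrow>
      \<phi> p (\<psi> p a \<odot>\<^bsub>P p\<^esub> x) v = \<phi> p x (em k p \<one>\<^bsub>A k\<^esub> a \<odot>\<^bsub>N (k + p)\<^esub> v)"
  shows "\<exists>h\<in>ahom (V k) L. \<forall>p. \<forall>x\<in>carrier (P p). \<forall>v\<in>carrier (N (k + p)). h (t k p x v) = \<phi> p x v"
proof -
  interpret L: abelian_group L by (rule L)
  define h where "h p = tensor_lift (A p) (TP p) (RN k p) (add_monoid L) (\<phi> p)" for p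
  have b: "balanced (A p) (TP p) (RN k p) (add_monoid L) (\<phi> p)" for p
    by (rule balancedI) (simp_all add: cl add1 add2 bal)
  have h: "h p \<in> ahom (W k p) L" for p
    unfolding h_def W_eq hom_tensor_product by (rule TPP.tensor_lift_hom[OF L.a_comm_group b])
  have hp: "h p (tp k p x v) = \<phi> p x v" if "x \<in> carrier (P p)" "v \<in> carrier (N (k + p))" for p x v
    unfolding h_def by (rule TPP.tensor_lift_pure[OF L.a_comm_group b]) (use that in simp_all)
  obtain f where f: "f \<in> hom (add_monoid (S.D k)) (add_monoid L)"
    and fi: "\<forall>p\<in>UNIV. \<forall>u\<in>carrier (W k p). f (S.\<iota> k p u) = h p u"
    using S.direct_sum_lift[OF L.a_comm_group h] by blast
  have f': "f \<in> ahom (V k) L" using f by (simp only: TR_eq)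
  show ?thesis
    by (rule bexI[OF _ f']) (use fi tp_closed hp in \<open>simp add: tr_gen_def\<close>)
qed

lemma tr_finite_support:
  assumes "finite {n. carrier (P n) \<noteq> {\<zero>\<^bsub>P n\<^esub>}}" "finite {n. carrier (N n) \<noteq> {\<zero>\<^bsub>N n\<^esub>}}"
  shows "finite {k. carrier (V k) \<noteq> {\<zero>\<^bsub>V k\<^esub>}}"
proof -
  let ?P = "{n. carrier (P n) \<noteq> {\<zero>\<^bsub>P n\<^esub>}}" and ?N = "{n. carrier (N n) \<noteq> {\<zero>\<^bsub>N n\<^esub>}}"
  \<comment> \<open>Truncated subtraction does no harm: every \<open>k\<close> in question is
    recovered as \<open>(k + p) - p\<close>.\<close>
  have "k \<in> (\<lambda>(p, n). n - p) ` (?P \<times> ?N)" if "carrier (V k) \<noteq> {\<zero>\<^bsub>V k\<^esub>}" for k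
  proof (rule ccontr)
    assume k: "k \<notin> (\<lambda>(p, n). n - p) ` (?P \<times> ?N)"
    have "u = \<zero>\<^bsub>V k\<^esub>" if "u \<in> carrier (V k)" for u
      using that
    proof (induction rule: tr_induct)
      case (gen p x v)
      have "\<not> (p \<in> ?P \<and> k + p \<in> ?N)"
      proof
        assume "p \<in> ?P \<and> k + p \<in> ?N"
        then have "(\<lambda>(p, n). n - p) (p, k + p) \<in> (\<lambda>(p, n). n - p) ` (?P \<times> ?N)" by (intro imageI) simp
        then show False using k by simp
      qed
      then consider "carrier (P p) = {\<zero>\<^bsub>P p\<^esub>}" | "carrier (N (k + p)) = {\<zero>\<^bsub>N (k + p)\<^esub>}"
        by auto
      then show ?case
      proof cases
        case 1
        have e: "x \<oplus>\<^bsub>P p\<^esub> x = x"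
          by (rule trivial_group_add[OF graded_moduleD(3)[OF P] 1 gen(1)])
        show ?thesis
          using tr_add1[OF gen(1,1,2)] tr_closed[OF gen] unfolding e by (simp add: V.add.l_cancel_one')
      next
        case 2
        have e: "v \<oplus>\<^bsub>N (k + p)\<^esub> v = v"
          by (rule trivial_group_add[OF graded_moduleD(3)[OF N] 2 gen(2)])
        show ?thesis
          using tr_add2[OF gen(1,2,2)] tr_closed[OF gen] unfolding e by (simp add: V.add.l_cancel_one')
      qed
    qed simp
    then have "carrier (V k) \<subseteq> {\<zero>\<^bsub>V k\<^esub>}" by (intro subsetI) simp
    then show False using that V.zero_closed by (auto dest: subset_singletonD)
  qed
  then have "{k. carrier (V k) \<noteq> {\<zero>\<^bsub>V k\<^esub>}} \<subseteq> (\<lambda>(p, n). n - p) ` (?P \<times> ?N)" by blast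
  then show ?thesis using assms finite_subset by blast
qed

end

section \<open>Induction and twisted restriction as functors\<close>

lemma graded_homD:
  assumes "f \<in> graded_hom A M N"
  shows "f \<in> ahom M N"
    and "x \<in> carrier M \<Longrightarrow> f x \<in> carrier N"
    and "\<lbrakk>a \<in> carrier A; x \<in> carrier M\<rbrakk> \<Longrightarrow> f (a \<odot>\<^bsub>M\<^esub> x) = a \<odot>\<^bsub>N\<^esub> f x"
    and "x \<in> grade M d \<Longrightarrow> f x \<in> grade N d"
  using assms by (auto simp: graded_hom_def module_hom_def image_subset_iff intro!: ahomI)

lemma graded_homI:
  assumes "f \<in> ahom M N"
    and "\<And>a x. \<lbrakk>a \<in> carrier A; x \<in> carrier M\<rbrakk> \<Longrightarrow> f (a \<odot>\<^bsub>M\<^esub> x) = a \<odot>\<^bsub>N\<^esub> f x"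
    and "\<And>x d. x \<in> grade M d \<Longrightarrow> f x \<in> grade N d"
  shows "f \<in> graded_hom A M N"
  using assms ahom_closed[OF assms(1)] ahom_add[OF assms(1)]
  by (auto simp: graded_hom_def module_hom_def)

lemma gmodD:
  assumes "M \<in> gmod T"
  shows "graded_module (alg T n) (M n)" "finite {n. carrier (M n) \<noteq> {\<zero>\<^bsub>M n\<^esub>}}"
  using assms by (auto simp: gmod_def)

lemma gmod_homD: "f \<in> gmod_hom T M N \<Longrightarrow> f n \<in> graded_hom (alg T n) (M n) (N n)"
  by (simp add: gmod_hom_def)

section \<open>Finite generation\<close>

lemma left_module_zero_smult:
  assumes "left_module R M" "x \<in> carrier M"
  shows "\<zero>\<^bsub>R\<^esub> \<odot>\<^bsub>M\<^esub> x = \<zero>\<^bsub>M\<^esub>"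
proof -
  interpret R: ring R by (rule left_module.axioms(1)[OF assms(1)])
  interpret M: abelian_group M by (rule left_module.axioms(2)[OF assms(1)])
  show ?thesis
    using left_module.smult_l_distr[OF assms(1) R.zero_closed R.zero_closed assms(2)]
      left_module.smult_closed[OF assms(1) R.zero_closed assms(2)]
    by (simp add: M.add.l_cancel_one')
qed

text \<open>Generation is phrased by closed subsets instead of linear combinations, since this form
  is an induction rule over the module. Closure is only demanded for elements of the
  carrier.\<close>

definition generates :: "('r, 'u) ring_scheme \<Rightarrow> ('r, 'x, 'v) module_scheme \<Rightarrow> 'x set \<Rightarrow> bool"
  where "generates R M B \<longleftrightarrow> finite B \<and> B \<subseteq> carrier M \<and>
    (\<forall>H. B \<subseteq> H \<and> \<zero>\<^bsub>M\<^esub> \<in> H \<and> (\<forall>x\<in>carrier M. \<forall>y\<in>carrier M. x \<in> H \<longrightarrow> y \<in> H \<longrightarrow> x \<oplus>\<^bsub>M\<^esub> y \<in> H) \<and>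
      (\<forall>r\<in>carrier R. \<forall>x\<in>carrier M. x \<in> H \<longrightarrow> r \<odot>\<^bsub>M\<^esub> x \<in> H) \<longrightarrow> carrier M \<subseteq> H)"

lemma generatesI:
  assumes "finite B" "B \<subseteq> carrier M"
    and "\<And>H x. \<lbrakk>x \<in> carrier M; B \<subseteq> H; \<zero>\<^bsub>M\<^esub> \<in> H;
      \<And>x y. \<lbrakk>x \<in> carrier M; y \<in> carrier M; x \<in> H; y \<in> H\<rbrakk> \<Longrightarrow> x \<oplus>\<^bsub>M\<^esub> y \<in> H;
      \<And>r x. \<lbrakk>r \<in> carrier R; x \<in> carrier M; x \<in> H\<rbrakk> \<Longrightarrow> r \<odot>\<^bsub>M\<^esub> x \<in> H\<rbrakk> \<Longrightarrow> x \<in> H"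
  shows "generates R M B"
  unfolding generates_def
proof (intro conjI assms(1,2) allI impI subsetI)
  fix H x assume x: "x \<in> carrier M"
    and H: "B \<subseteq> H \<and> \<zero>\<^bsub>M\<^esub> \<in> H \<and>
      (\<forall>x\<in>carrier M. \<forall>y\<in>carrier M. x \<in> H \<longrightarrow> y \<in> H \<longrightarrow> x \<oplus>\<^bsub>M\<^esub> y \<in> H) \<and>
      (\<forall>r\<in>carrier R. \<forall>x\<in>carrier M. x \<in> H \<longrightarrow> r \<odot>\<^bsub>M\<^esub> x \<in> H)"
  show "x \<in> H"
    by (rule assms(3)[OF x]) (use H in simp_all)
qed

lemma generates_induct [consumes 2, case_names base zero add smult]:
  assumes "generates R M B" and "x \<in> carrier M"
    and "\<And>b. b \<in> B \<Longrightarrow> Q b" and "Q \<zero>\<^bsub>M\<^esub>"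
    and "\<And>x y. \<lbrakk>x \<in> carrier M; y \<in> carrier M; Q x; Q y\<rbrakk> \<Longrightarrow> Q (x \<oplus>\<^bsub>M\<^esub> y)"
    and "\<And>r x. \<lbrakk>r \<in> carrier R; x \<in> carrier M; Q x\<rbrakk> \<Longrightarrow> Q (r \<odot>\<^bsub>M\<^esub> x)"
  shows "Q x"
proof -
  have "carrier M \<subseteq> Collect Q"
    using assms(1) unfolding generates_def
    by (elim conjE allE[of _ "Collect Q"] impE) (simp_all add: assms(3-6) subset_iff)
  then show ?thesis using assms(2) by blast
qed

text \<open>Linear combinations of \<open>B\<close> form a closed set containing \<open>B\<close>,
  and conversely every closed set containing \<open>B\<close> contains all of them, by induction on
  the set of summands.\<close>

lemma finitely_generated_iff:
  assumes M: "left_module R M"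
  shows "finitely_generated R M \<longleftrightarrow> (\<exists>B. generates R M B)"
proof -
  interpret M: left_module R M by (rule M)
  interpret R: ring R by (rule M.R.ring_axioms)
  have sum: "(\<Oplus>\<^bsub>M\<^esub>b\<in>C. c b \<odot>\<^bsub>M\<^esub> b) \<in> H \<inter> carrier M"
    if "finite C" "C \<subseteq> carrier M" "c \<in> C \<rightarrow> carrier R" "C \<subseteq> H" "\<zero>\<^bsub>M\<^esub> \<in> H"
      "\<And>x y. \<lbrakk>x \<in> carrier M; y \<in> carrier M; x \<in> H; y \<in> H\<rbrakk> \<Longrightarrow> x \<oplus>\<^bsub>M\<^esub> y \<in> H"
      "\<And>r x. \<lbrakk>r \<in> carrier R; x \<in> carrier M; x \<in> H\<rbrakk> \<Longrightarrow> r \<odot>\<^bsub>M\<^esub> x \<in> H" for C c H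
    using that
  proof (induction C)
    case empty
    then show ?case by simp
  next
    case (insert b C)
    have "(\<lambda>b. c b \<odot>\<^bsub>M\<^esub> b) \<in> C \<rightarrow> carrier M" "c b \<odot>\<^bsub>M\<^esub> b \<in> carrier M"
      using insert.prems by auto
    then show ?case using insert by auto
  qed
  show ?thesis
  proof
    assume "finitely_generated R M"
    then obtain B where B: "finite B" "B \<subseteq> carrier M"
      and gen: "\<And>x. x \<in> carrier M \<Longrightarrow> \<exists>c\<in>B \<rightarrow> carrier R. x = (\<Oplus>\<^bsub>M\<^esub>b\<in>B. c b \<odot>\<^bsub>M\<^esub> b)"
      unfolding finitely_generated_def by auto
    have "generates R M B"
    proof (rule generatesI[OF B])
      fix H x assume "x \<in> carrier M" and H: "B \<subseteq> H" "\<zero>\<^bsub>M\<^esub> \<in> H"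
        "\<And>x y. \<lbrakk>x \<in> carrier M; y \<in> carrier M; x \<in> H; y \<in> H\<rbrakk> \<Longrightarrow> x \<oplus>\<^bsub>M\<^esub> y \<in> H"
        "\<And>r x. \<lbrakk>r \<in> carrier R; x \<in> carrier M; x \<in> H\<rbrakk> \<Longrightarrow> r \<odot>\<^bsub>M\<^esub> x \<in> H"
      then obtain c where "c \<in> B \<rightarrow> carrier R" "x = (\<Oplus>\<^bsub>M\<^esub>b\<in>B. c b \<odot>\<^bsub>M\<^esub> b)"
        using gen by blast
      then show "x \<in> H" using sum[OF B _ H] by simp
    qed
    then show "\<exists>B. generates R M B" ..
  next
    assume "\<exists>B. generates R M B"
    then obtain B where gen: "generates R M B" ..
    then have B: "finite B" "B \<subseteq> carrier M" unfolding generates_def by auto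
    let ?s = "\<lambda>c. (\<Oplus>\<^bsub>M\<^esub>b\<in>B. c b \<odot>\<^bsub>M\<^esub> b)"
    let ?H = "?s ` (B \<rightarrow> carrier R)"
    have cl: "c b \<odot>\<^bsub>M\<^esub> b \<in> carrier M" if "c \<in> B \<rightarrow> carrier R" "b \<in> B" for c b
      using that B by auto
    have "x \<in> ?H" if "x \<in> carrier M" for x
      using gen that
    proof (induction rule: generates_induct)
      case (base b)
      \<comment> \<open>The indicator of \<open>b\<close> exhibits \<open>b\<close> as a linear
        combination of \<open>B\<close>.\<close>
      let ?c = "\<lambda>b'. if b = b' then \<one>\<^bsub>R\<^esub> else \<zero>\<^bsub>R\<^esub>"
      have "?s ?c = (\<Oplus>\<^bsub>M\<^esub>b'\<in>B. if b = b' then b' else \<zero>\<^bsub>M\<^esub>)"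
        by (rule M.finsum_cong') (use B left_module_zero_smult[OF M] in auto)
      also have "\<dots> = b"
        using M.finsum_singleton[of b B "\<lambda>b. b"] B base by auto
      finally show ?case by (intro image_eqI[of _ _ ?c]) auto
    next
      case zero
      have "?s (\<lambda>_. \<zero>\<^bsub>R\<^esub>) = (\<Oplus>\<^bsub>M\<^esub>b\<in>B. \<zero>\<^bsub>M\<^esub>)"
        by (rule M.finsum_cong') (use B left_module_zero_smult[OF M] in auto)
      then show ?case by (intro image_eqI[of _ _ "\<lambda>_. \<zero>\<^bsub>R\<^esub>"]) auto
    next
      case (add x y)
      then obtain c d where c: "c \<in> B \<rightarrow> carrier R" "x = ?s c" and d: "d \<in> B \<rightarrow> carrier R" "y = ?s d" by blast
      have "?s (\<lambda>b. c b \<oplus>\<^bsub>R\<^esub> d b) = (\<Oplus>\<^bsub>M\<^esub>b\<in>B. c b \<odot>\<^bsub>M\<^esub> b \<oplus>\<^bsub>M\<^esub> d b \<odot>\<^bsub>M\<^esub> b)"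
        by (rule M.finsum_cong') (use B c d in \<open>auto simp: M.smult_l_distr Pi_iff subset_iff\<close>)
      also have "\<dots> = x \<oplus>\<^bsub>M\<^esub> y"
        unfolding c d using cl c d by (intro M.finsum_addf) auto
      finally show ?case using c d by (intro image_eqI[of _ _ "\<lambda>b. c b \<oplus>\<^bsub>R\<^esub> d b"]) auto
    next
      case (smult r x)
      then obtain c where r: "r \<in> carrier R" and c: "c \<in> B \<rightarrow> carrier R" "x = ?s c" by blast
      have "?s (\<lambda>b. r \<otimes>\<^bsub>R\<^esub> c b) = (\<Oplus>\<^bsub>M\<^esub>b\<in>B. r \<odot>\<^bsub>M\<^esub> (c b \<odot>\<^bsub>M\<^esub> b))"
        by (rule M.finsum_cong') (use B c r in \<open>auto simp: M.smult_assoc1 Pi_iff subset_iff\<close>)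
      also have "\<dots> = r \<odot>\<^bsub>M\<^esub> x"
        unfolding c
        by (rule ahom_finsum[OF M.M.abelian_group_axioms M.M.abelian_group_axioms ahomI, symmetric])
           (use r cl[OF c(1)] in \<open>auto simp: M.smult_r_distr\<close>)
      finally show ?case using c r by (intro image_eqI[of _ _ "\<lambda>b. r \<otimes>\<^bsub>R\<^esub> c b"]) auto
    qed
    then show "finitely_generated R M"
      unfolding finitely_generated_def using B by blast
  qed
qed

lemma (in nice_tower_of_algebras) left_module_over_base:
  assumes "graded_module (A n) M"
  shows "left_module K (restrict_scalars (scalar (A n)) M)"
proof (intro left_module.intro K_ring abelian_group_restrict_scalars graded_moduleD(3)[OF assms] left_module_axioms.intro)
  note m = graded_module_smult[OF assms]
  have "scalar (A n) (c \<otimes>\<^bsub>K\<^esub> d) = scalar (A n) c \<otimes>\<^bsub>A n\<^esub> scalar (A n) d" if "c \<in> carrier K" "d \<in> carrier K" for c d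
    using that by (simp add: scalar_mult_left) (simp add: scalar_def AM.smult_assoc1)
  then show "(c \<otimes>\<^bsub>K\<^esub> d) \<odot>\<^bsub>restrict_scalars (scalar (A n)) M\<^esub> x
      = c \<odot>\<^bsub>restrict_scalars (scalar (A n)) M\<^esub> (d \<odot>\<^bsub>restrict_scalars (scalar (A n)) M\<^esub> x)"
    if "c \<in> carrier K" "d \<in> carrier K" "x \<in> carrier (restrict_scalars (scalar (A n)) M)" for c d x
    using that m by simp
  show "\<one>\<^bsub>K\<^esub> \<odot>\<^bsub>restrict_scalars (scalar (A n)) M\<^esub> x = x"
    if "x \<in> carrier (restrict_scalars (scalar (A n)) M)" for x
    using that m by (simp add: scalar_def)
qed (simp_all add: graded_module_smult[OF assms] scalar_add)

context module_pair
begin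

text \<open>Linearity and degree of an additive map are read off from generators, where the algebra
  acts on the first entry alone.\<close>

lemma ind_graded_homI:
  assumes h: "h \<in> ahom (V k) L" and L: "graded_module (A k) L"
    and lin: "\<And>m n a c x y. \<lbrakk>m + n = k; a \<in> carrier (A k); c \<in> carrier (A k); x \<in> carrier (X m); y \<in> carrier (Y n)\<rbrakk> \<Longrightarrow>
      h (i k m n (a \<otimes>\<^bsub>A k\<^esub> c) x y) = a \<odot>\<^bsub>L\<^esub> h (i k m n c x y)"
    and gr: "\<And>m n e f l c x y. \<lbrakk>m + n = k; c \<in> grade (A k) e; x \<in> grade (X m) f; y \<in> grade (Y n) l\<rbrakk> \<Longrightarrow>
      h (i k m n c x y) \<in> grade L (e + f + l)"
  shows "h \<in> graded_hom (A k) (V k) L"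
proof (rule graded_homI[OF h])
  fix a u assume a: "a \<in> carrier (A k)" and u: "u \<in> carrier (V k)"
  note m = graded_module_smult[OF IND_graded_module[of k]]
  show "h (a \<odot>\<^bsub>V k\<^esub> u) = a \<odot>\<^bsub>L\<^esub> h u"
    using u
  proof (induction rule: ind_induct)
    case (gen m n c x y)
    then show ?case using a lin by (simp add: ind_smult)
  next
    case (add u v)
    then show ?case
      using a by (simp add: ahom_add[OF h] ahom_closed[OF h] m graded_module_smult[OF L])
  qed
next
  fix u d assume u: "u \<in> grade (V k) d"
  show "h u \<in> grade L d"
    by (rule ind_hom_grade[OF h graded_moduleD(3)[OF L] u graded_group.grade_subgroup[OF graded_moduleD(4)[OF L]]])
       (use gr in blast)
qed

text \<open>The elements \<open>1 \<otimes> (b \<otimes> c)\<close> generate, with \<open>b\<close>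
  and \<open>c\<close> from finite generating sets and over the finitely many splittings of
  \<open>k\<close>. Scalars in front of \<open>x\<close> or \<open>y\<close> move into the first
  entry by balance, and from there they act from outside. This gives finite generation of
  \<open>IND(P, Q)\<close>.\<close>

lemma ind_finitely_generated:
  assumes X: "\<And>n. finitely_generated (A n) (X n)" and Y: "\<And>n. finitely_generated (A n) (Y n)"
  shows "finitely_generated (A k) (V k)"
proof -
  note XM = module_pair.X[OF module_pair_axioms] and YM = module_pair.Y[OF module_pair_axioms]
  have "\<forall>n. \<exists>B. generates (A n) (X n) B" "\<forall>n. \<exists>B. generates (A n) (Y n) B"
    using X Y finitely_generated_iff[OF graded_moduleD(1)[OF XM]] finitely_generated_iff[OF graded_moduleD(1)[OF YM]]
    by blast+
  then obtain B C where B: "\<And>n. generates (A n) (X n) (B n)" and C: "\<And>n. generates (A n) (Y n) (C n)"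
    by moura
  have BX: "finite (B n)" "B n \<subseteq> carrier (X n)" and CY: "finite (C n)" "C n \<subseteq> carrier (Y n)" for n
    using B[of n] C[of n] unfolding generates_def by auto
  let ?G = "\<Union>(m, n)\<in>splittings k. (\<lambda>(b, c). i k m n \<one>\<^bsub>A k\<^esub> b c) ` (B m \<times> C n)"
  have fin: "finite (splittings k)"
    by (rule finite_subset[of _ "{..k} \<times> {..k}"]) auto
  have "generates (A k) (V k) ?G"
  proof (rule generatesI)
    show "finite ?G" using fin BX CY by auto
    show "?G \<subseteq> carrier (V k)"
      by (auto intro!: ind_closed subsetD[OF BX(2)] subsetD[OF CY(2)])
    fix H u assume u: "u \<in> carrier (V k)" and GH: "?G \<subseteq> H" and zeroH: "\<zero>\<^bsub>V k\<^esub> \<in> H"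
      and plus: "\<And>x y. \<lbrakk>x \<in> carrier (V k); y \<in> carrier (V k); x \<in> H; y \<in> H\<rbrakk> \<Longrightarrow> x \<oplus>\<^bsub>V k\<^esub> y \<in> H"
      and scale: "\<And>r x. \<lbrakk>r \<in> carrier (A k); x \<in> carrier (V k); x \<in> H\<rbrakk> \<Longrightarrow> r \<odot>\<^bsub>V k\<^esub> x \<in> H"
    show "u \<in> H"
      using u
    proof (induction rule: ind_induct)
      case (gen m n c x y)
      note mn = this(1)
      interpret Xm: abelian_group "X m" by (rule graded_moduleD(3)[OF XM])
      interpret Yn: abelian_group "Y n" by (rule graded_moduleD(3)[OF YM])
      have z2: "i k m n c \<zero>\<^bsub>X m\<^esub> y = \<zero>\<^bsub>V k\<^esub>" if "c \<in> carrier (A k)" "y \<in> carrier (Y n)" for c y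
        using ind_add2[OF mn that(1) Xm.zero_closed Xm.zero_closed that(2)]
          ind_closed[OF mn that(1) Xm.zero_closed that(2)] by (simp add: V.add.l_cancel_one')
      have z3: "i k m n c x \<zero>\<^bsub>Y n\<^esub> = \<zero>\<^bsub>V k\<^esub>" if "c \<in> carrier (A k)" "x \<in> carrier (X m)" for c x
        using ind_add3[OF mn that Yn.zero_closed Yn.zero_closed]
          ind_closed[OF mn that Yn.zero_closed] by (simp add: V.add.l_cancel_one')
      \<comment> \<open>The quantifier over \<open>c\<close> keeps the induction hypothesis
        applicable after a scalar has been absorbed into \<open>c\<close>.\<close>
      have "\<forall>c\<in>carrier (A k). i k m n c b y \<in> H" if b: "b \<in> B m" and y: "y \<in> carrier (Y n)" for b y
        using C[of n] y
      proof (induction rule: generates_induct)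
        case (base b')
        then have H: "i k m n \<one>\<^bsub>A k\<^esub> b b' \<in> H" using GH b mn by blast
        have c: "b \<in> carrier (X m)" "b' \<in> carrier (Y n)" using base b BX CY by blast+
        show ?case
        proof
          fix c assume "c \<in> carrier (A k)"
          then show "i k m n c b b' \<in> H"
            using scale[OF _ ind_closed[OF mn A.one_closed c] H, of c] ind_smult[OF mn _ A.one_closed c, of c] by simp
        qed
      next
        case zero
        show ?case using z3 subsetD[OF BX(2) b] zeroH by simp
      next
        case (add y y')
        show ?case
        proof
          fix c assume c: "c \<in> carrier (A k)"
          have bX: "b \<in> carrier (X m)" using b BX by blast
          show "i k m n c b (y \<oplus>\<^bsub>Y n\<^esub> y') \<in> H"
            using ind_add3[OF mn c bX add(1,2)] plus[OF ind_closed[OF mn c bX add(1)] ind_closed[OF mn c bX add(2)]]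
              add(3,4) c by simp
        qed
      next
        case (smult a y)
        show ?case
        proof
          fix c assume c: "c \<in> carrier (A k)"
          have "i k m n c b (a \<odot>\<^bsub>Y n\<^esub> y) = i k m n (c \<otimes>\<^bsub>A k\<^esub> em m n \<one>\<^bsub>A m\<^esub> a) b y"
            using ind_balanced[OF mn c A.one_closed smult(1) subsetD[OF BX(2) b] smult(2)]
              graded_module_smult(5)[OF XM subsetD[OF BX(2) b]] by simp
          then show "i k m n c b (a \<odot>\<^bsub>Y n\<^esub> y) \<in> H" using smult c mn by simp
        qed
      qed
      then have bH: "i k m n c b y \<in> H" if "b \<in> B m" "c \<in> carrier (A k)" "y \<in> carrier (Y n)" for b c y
        using that by blast
      have "\<forall>c\<in>carrier (A k). \<forall>y\<in>carrier (Y n). i k m n c x y \<in> H"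
        using B[of m] gen(3)
      proof (induction rule: generates_induct)
        case (base b)
        then show ?case using bH by blast
      next
        case zero
        show ?case using z2 zeroH by auto
      next
        case (add x x')
        show ?case
        proof (intro ballI)
          fix c y assume c: "c \<in> carrier (A k)" and y: "y \<in> carrier (Y n)"
          show "i k m n c (x \<oplus>\<^bsub>X m\<^esub> x') y \<in> H"
            using ind_add2[OF mn c add(1,2) y] plus[OF ind_closed[OF mn c add(1) y] ind_closed[OF mn c add(2) y]]
              add(3,4) c y by simp
        qed
      next
        case (smult a x)
        show ?case
        proof (intro ballI)
          fix c y assume c: "c \<in> carrier (A k)" and y: "y \<in> carrier (Y n)"
          have "i k m n c (a \<odot>\<^bsub>X m\<^esub> x) y = i k m n (c \<otimes>\<^bsub>A k\<^esub> em m n a \<one>\<^bsub>A n\<^esub>) x y"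
            using ind_balanced[OF mn c smult(1) A.one_closed smult(2) y] graded_module_smult(5)[OF YM y] by simp
          then show "i k m n c (a \<odot>\<^bsub>X m\<^esub> x) y \<in> H" using smult c y mn by simp
        qed
      qed
      then show ?case using gen by blast
    qed (rule plus)
  qed
  then show ?thesis
    using finitely_generated_iff[OF graded_moduleD(1)[OF IND_graded_module]] by blast
qed

end

context twisted_pair
begin

lemma tr_graded_homI:
  assumes h: "h \<in> ahom (V k) L" and L: "graded_module (A k) L"
    and lin: "\<And>p a x v. \<lbrakk>a \<in> carrier (A k); x \<in> carrier (P p); v \<in> carrier (N (k + p))\<rbrakk> \<Longrightarrow>
      h (t k p x (em k p a \<one>\<^bsub>A p\<^esub> \<odot>\<^bsub>N (k + p)\<^esub> v)) = a \<odot>\<^bsub>L\<^esub> h (t k p x v)"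
    and gr: "\<And>p e f x v. \<lbrakk>x \<in> grade (P p) e; v \<in> grade (N (k + p)) f\<rbrakk> \<Longrightarrow> h (t k p x v) \<in> grade L (e + f)"
  shows "h \<in> graded_hom (A k) (V k) L"
proof (rule graded_homI[OF h])
  fix a u assume a: "a \<in> carrier (A k)" and u: "u \<in> carrier (V k)"
  note m = graded_module_smult[OF TR_graded_module[of k]]
  show "h (a \<odot>\<^bsub>V k\<^esub> u) = a \<odot>\<^bsub>L\<^esub> h u"
    using u
  proof (induction rule: tr_induct)
    case (gen p x v)
    then show ?case using a lin by (simp add: tr_smult)
  next
    case (add u v)
    then show ?case
      using a by (simp add: ahom_add[OF h] ahom_closed[OF h] m graded_module_smult[OF L])
  qed
next
  fix u d assume u: "u \<in> grade (V k) d"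
  show "h u \<in> grade L d"
    by (rule tr_hom_grade[OF h graded_moduleD(3)[OF L] u graded_group.grade_subgroup[OF graded_moduleD(4)[OF L]]])
       (use gr in blast)
qed

lemma tr_hom_eqI:
  assumes "h \<in> ahom (V k) L" "h' \<in> ahom (V k) L" "u \<in> carrier (V k)"
    and "\<And>p x v. \<lbrakk>x \<in> carrier (P p); v \<in> carrier (N (k + p))\<rbrakk> \<Longrightarrow> h (t k p x v) = h' (t k p x v)"
  shows "h u = h' u"
  using assms(3) by (induction rule: tr_induct) (simp_all add: assms ahom_add[OF assms(1)] ahom_add[OF assms(2)])

text \<open>Algebra coefficients in the first factor are pushed over to the second one, whose
  vectors are combinations over the base of finitely many. Finitely many tensors therefore span each
  degree over the base field.\<close>

lemma tr_finitely_generated: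
  assumes Pf: "finite {n. carrier (P n) \<noteq> {\<zero>\<^bsub>P n\<^esub>}}"
    and P: "\<And>n. finitely_generated (A n) (P n)"
    and N: "\<And>n. finitely_generated K (restrict_scalars (scalar (A n)) (N n))"
  shows "finitely_generated K (restrict_scalars (scalar (A k)) (V k))"
proof -
  note PM = twisted_pair.P[OF twisted_pair_axioms] and NM = twisted_pair.N[OF twisted_pair_axioms]
  have "\<forall>n. \<exists>B. generates (A n) (P n) B" "\<forall>n. \<exists>B. generates K (restrict_scalars (scalar (A n)) (N n)) B"
    using P N finitely_generated_iff[OF graded_moduleD(1)[OF PM]] finitely_generated_iff[OF left_module_over_base[OF NM]]
    by blast+
  then obtain B C where B: "\<And>n. generates (A n) (P n) (B n)"
    and C: "\<And>n. generates K (restrict_scalars (scalar (A n)) (N n)) (C n)"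
    by moura
  have BP: "finite (B n)" "B n \<subseteq> carrier (P n)" and CN: "finite (C n)" "C n \<subseteq> carrier (N n)" for n
    using B[of n] C[of n] unfolding generates_def by auto
  let ?S = "{n. carrier (P n) \<noteq> {\<zero>\<^bsub>P n\<^esub>}}"
  \<comment> \<open>Only degrees in the support of \<open>P\<close> are used, which keeps the set
    finite; outside the support the first factor is zero.\<close>
  let ?G = "\<Union>p\<in>?S. (\<lambda>(b, c). t k p b c) ` (B p \<times> C (k + p))"
  let ?V = "restrict_scalars (scalar (A k)) (V k)"
  have "generates K ?V ?G"
  proof (rule generatesI)
    show "finite ?G" using Pf BP CN by auto
    show "?G \<subseteq> carrier ?V"
      by (auto intro!: tr_closed subsetD[OF BP(2)] subsetD[OF CN(2)])
    fix H u assume u: "u \<in> carrier ?V" and GH: "?G \<subseteq> H" and zeroH: "\<zero>\<^bsub>?V\<^esub> \<in> H"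
      and plus': "\<And>x y. \<lbrakk>x \<in> carrier ?V; y \<in> carrier ?V; x \<in> H; y \<in> H\<rbrakk> \<Longrightarrow> x \<oplus>\<^bsub>?V\<^esub> y \<in> H"
      and scale': "\<And>r x. \<lbrakk>r \<in> carrier K; x \<in> carrier ?V; x \<in> H\<rbrakk> \<Longrightarrow> r \<odot>\<^bsub>?V\<^esub> x \<in> H"
    have plus: "\<And>x y. \<lbrakk>x \<in> carrier (V k); y \<in> carrier (V k); x \<in> H; y \<in> H\<rbrakk> \<Longrightarrow> x \<oplus>\<^bsub>V k\<^esub> y \<in> H"
      and scale: "\<And>r x. \<lbrakk>r \<in> carrier K; x \<in> carrier (V k); x \<in> H\<rbrakk> \<Longrightarrow> scalar (A k) r \<odot>\<^bsub>V k\<^esub> x \<in> H"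
      using plus' scale' by simp_all
    have "u \<in> carrier (V k)" using u by simp
    then show "u \<in> H"
    proof (induction rule: tr_induct)
      case (gen p x v)
      interpret Pp: abelian_group "P p" by (rule graded_moduleD(3)[OF PM])
      interpret Np: abelian_group "N (k + p)" by (rule graded_moduleD(3)[OF NM])
      have z1: "t k p \<zero>\<^bsub>P p\<^esub> v = \<zero>\<^bsub>V k\<^esub>" if "v \<in> carrier (N (k + p))" for v
        using tr_add1[OF Pp.zero_closed Pp.zero_closed that] tr_closed[OF Pp.zero_closed that]
        by (simp add: V.add.l_cancel_one')
      have z2: "t k p x \<zero>\<^bsub>N (k + p)\<^esub> = \<zero>\<^bsub>V k\<^esub>" if "x \<in> carrier (P p)" for x
        using tr_add2[OF that Np.zero_closed Np.zero_closed] tr_closed[OF that Np.zero_closed]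
        by (simp add: V.add.l_cancel_one')
      show ?case
      proof (cases "p \<in> ?S")
        case False
        then have "x = \<zero>\<^bsub>P p\<^esub>" using gen(1) by auto
        then show ?thesis using z1[OF gen(2)] zeroH by simp
      next
        case p: True
        have bH: "t k p b v \<in> H" if b: "b \<in> B p" and v: "v \<in> carrier (N (k + p))" for b v
        proof -
          have bP: "b \<in> carrier (P p)" using b BP by blast
          have "v \<in> carrier (restrict_scalars (scalar (A (k + p))) (N (k + p)))" using v by simp
          with C[of "k + p"] show ?thesis
          proof (induction rule: generates_induct)
            case (base c)
            then show ?case using GH p b by blast
          next
            case zero
            show ?case using z2[OF bP] zeroH by simp
          next
            case (add v v')
            then show ?case
              using tr_add2[OF bP, of v k v'] plus[OF tr_closed[OF bP, of v] tr_closed[OF bP, of v']] by simp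
          next
            case (smult r v)
            then show ?case
              using tr_smult[OF scalar_closed bP, of r v k] scale[OF _ tr_closed[OF bP, of v], of r]
              by (simp add: em_scalar_left)
          qed
        qed
        have "\<forall>v\<in>carrier (N (k + p)). t k p x v \<in> H"
          using B[of p] gen(1)
        proof (induction rule: generates_induct)
          case (base b)
          then show ?case using bH by blast
        next
          case zero
          show ?case using z1 zeroH by simp
        next
          case (add x x')
          show ?case
          proof
            fix v assume v: "v \<in> carrier (N (k + p))"
            show "t k p (x \<oplus>\<^bsub>P p\<^esub> x') v \<in> H"
              using tr_add1[OF add(1,2) v] plus[OF tr_closed[OF add(1) v] tr_closed[OF add(2) v]] add(3,4) v by simp
          qed
        next
          case (smult a x)
          show ?case
          proof
            fix v assume v: "v \<in> carrier (N (k + p))"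
            \<comment> \<open>Balance moves values of \<open>\<psi>\<close>, so \<open>a\<close> is
              read as the image of \<open>\<psi>' p a\<close>.\<close>
            have "t k p (a \<odot>\<^bsub>P p\<^esub> x) v = t k p x (em k p \<one>\<^bsub>A k\<^esub> (\<psi>' p a) \<odot>\<^bsub>N (k + p)\<^esub> v)"
              using tr_balanced[of "\<psi>' p a" p x v k] smult(1,2) v by simp
            then show "t k p (a \<odot>\<^bsub>P p\<^esub> x) v \<in> H"
              using smult v graded_module_smult(1)[OF NM] by simp
          qed
        qed
        then show ?thesis using gen by blast
      qed
    qed (rule plus)
  qed
  then show ?thesis
    using finitely_generated_iff[OF left_module_over_base[OF TR_graded_module]] by blast
qed

end

section \<open>Values of the functors on objects and morphisms\<close>

context nice_tower_of_algebras
begin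

lemma module_pairI: "\<lbrakk>M \<in> gmod T; N \<in> gmod T\<rbrakk> \<Longrightarrow> module_pair T M N"
  by (intro module_pair.intro nice_tower_of_algebras_axioms module_pair_axioms.intro gmodD(1))

lemma twisted_pairI: "\<lbrakk>P \<in> gmod T; N \<in> gmod T\<rbrakk> \<Longrightarrow> twisted_pair T P N"
  by (intro twisted_pair.intro nice_tower_of_algebras_axioms twisted_pair_axioms.intro gmodD(1))

lemma IND_gmod:
  assumes "M \<in> gmod T" "N \<in> gmod T" shows "IND T M N \<in> gmod T"
proof -
  interpret module_pair T M N by (rule module_pairI[OF assms])
  show ?thesis
    unfolding gmod_def using IND_graded_module ind_finite_support gmodD(2)[OF assms(1)] gmodD(2)[OF assms(2)] by blast
qed

lemma TR_gmod:
  assumes "P \<in> gmod T" "N \<in> gmod T" shows "obj (TR_functor T P) N \<in> gmod T"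
proof -
  interpret twisted_pair T P N by (rule twisted_pairI[OF assms])
  show ?thesis
    unfolding gmod_def using TR_graded_module tr_finite_support gmodD(2)[OF assms(1)] gmodD(2)[OF assms(2)] by blast
qed

lemma TR_fmod:
  assumes "P \<in> gmod T" "\<And>n. finitely_generated (A n) (P n)" "N \<in> fmod T"
  shows "obj (TR_functor T P) N \<in> fmod T"
proof -
  have Ng: "N \<in> gmod T" using assms(3) by (simp add: fmod_def)
  interpret twisted_pair T P N by (rule twisted_pairI[OF assms(1) Ng])
  show ?thesis
    using TR_gmod[OF assms(1) Ng] tr_finitely_generated[OF gmodD(2)[OF assms(1)] assms(2)] assms(3)
    by (simp add: fmod_def)
qed

text \<open>The action on morphisms is given on representatives at two levels of tensor products. It
  is well defined because the inner map \<open>f \<otimes> id\<close> is linear over the tensor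
  algebra, which makes the outer map balanced. Afterwards the functor is known by its effect on
  generators.\<close>

lemma I_mor:
  assumes L: "L \<in> gmod T" and L': "L' \<in> gmod T" and M: "M \<in> gmod T" and f: "f \<in> gmod_hom T L L'"
  shows "mor (I_functor T M) L L' f k \<in> ahom (IND T L M k) (IND T L' M k)"
    and "\<lbrakk>m + n = k; c \<in> carrier (A k); x \<in> carrier (L m); y \<in> carrier (M n)\<rbrakk> \<Longrightarrow>
      mor (I_functor T M) L L' f k (ind_gen T L M k m n c x y) = ind_gen T L' M k m n c (f m x) y"
proof -
  interpret D: module_pair T L M by (rule module_pairI[OF L M])
  interpret D': module_pair T L' M by (rule module_pairI[OF L' M])
  note fD = graded_homD[OF gmod_homD[OF f]]
  let ?o = "\<lambda>m n. outer_tensor_map K (A m) (A n) (L' m) (M n) (f m) (\<lambda>y. y)"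
  have ob: "balanced K (D.XK m) (D.YK n) (tensor_group K (D'.XK m) (D'.YK n)) (\<lambda>x y. D'.zp m n (f m x) y)" for m n
    by (rule balancedI)
       (use fD D'.ZP.pure_add_left D'.ZP.pure_add_right D'.ZP.pure_smult in
         \<open>auto simp: ahom_add[OF fD(1)] intro!: D'.ZP.pure_closed\<close>)
  note ohyps = D.ZP.tensor_pair_axioms D'.ZP.tensor_pair_axioms ob
  have o: "?o m n \<in> hom (tensor_group K (D.XK m) (D.YK n)) (tensor_group K (D'.XK m) (D'.YK n))" for m n
    unfolding outer_tensor_map_def by (rule tensor_map_hom[OF ohyps]) (use fD(2) in auto)
  have op: "?o m n (D.zp m n x y) = D'.zp m n (f m x) y" if "x \<in> carrier (L m)" "y \<in> carrier (M n)" for m n x y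
    unfolding outer_tensor_map_def by (rule tensor_map_pure[OF ohyps]) (use fD(2) that in auto)
  have oc: "?o m n z \<in> carrier (D'.Z m n)" if "z \<in> carrier (D.Z m n)" for m n z
    using hom_in_carrier[OF o] that by simp
  \<comment> \<open>Linearity is checked for pure ring elements on pure vectors, where it is
    linearity of \<open>f\<close>, and then extended additively in the vector and in the ring
    element.\<close>
  have oR: "?o m n (r \<odot>\<^bsub>D.Z m n\<^esub> z) = r \<odot>\<^bsub>D'.Z m n\<^esub> ?o m n z"
    if r: "r \<in> carrier (R m n)" and z: "z \<in> carrier (D.Z m n)" for m n r z
  proof -
    have r': "r \<in> carrier (tensor_group K (A m) (A n))" using r by simp
    then show ?thesis
    proof (induction rule: AT.tensor_induct)
      case (pure a b)
      have pc: "pure K (A m) (A n) a b \<in> carrier (R m n)" using pure by simp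
      have "z \<in> carrier (tensor_group K (D.XK m) (D.YK n))" using z by simp
      then show ?case
      proof (induction rule: D.ZP.tensor_induct)
        case xy: (pure x y)
        then have xy: "x \<in> carrier (L m)" "y \<in> carrier (M n)" by simp_all
        show ?case
          unfolding D.Z_smult_pure[OF pure xy] op[OF xy] D'.Z_smult_pure[OF pure fD(2)[OF xy(1)] xy(2)]
          using op[of "a \<odot>\<^bsub>L m\<^esub> x" m "b \<odot>\<^bsub>M n\<^esub> y" n] pure xy fD(3)
          by (simp add: graded_module_smult[OF D.X] graded_module_smult[OF D.Y])
      next
        case (add z z')
        then show ?case
          using hom_mult[OF D.Z_smult_hom_right[OF pc]] hom_in_carrier[OF D.Z_smult_hom_right[OF pc]]
            hom_mult[OF D'.Z_smult_hom_right[OF pc]] hom_mult[OF o] hom_in_carrier[OF o] by simp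
      qed
    next
      case (add r s)
      have "r \<odot>\<^bsub>D.Z m n\<^esub> z \<in> carrier (D.Z m n)" "s \<odot>\<^bsub>D.Z m n\<^esub> z \<in> carrier (D.Z m n)"
        using D.Z_smult_closed[OF _ z] add by simp_all
      then show ?case
        using hom_mult[OF D.Z_smult_hom_left[OF z] add(1,2)] hom_mult[OF D'.Z_smult_hom_left[OF oc[OF z]] add(1,2)]
          hom_mult[OF o] add(3,4) by simp
    qed
  qed
  have ib: "balanced (R m n) (D.C m n) (D.Z m n) (tensor_group (R m n) (D'.C m n) (D'.Z m n))
      (\<lambda>c z. pure (R m n) (D'.C m n) (D'.Z m n) c (?o m n z))" for m n
  proof (rule balancedI)
    fix c z z' assume "c \<in> carrier (D.C m n)" "z \<in> carrier (D.Z m n)" "z' \<in> carrier (D.Z m n)"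
    then show "pure (R m n) (D'.C m n) (D'.Z m n) c (?o m n (z \<oplus>\<^bsub>D.Z m n\<^esub> z'))
        = pure (R m n) (D'.C m n) (D'.Z m n) c (?o m n z) \<otimes>\<^bsub>tensor_group (R m n) (D'.C m n) (D'.Z m n)\<^esub>
          pure (R m n) (D'.C m n) (D'.Z m n) c (?o m n z')"
      using D'.UP.pure_add_right[of c m n "?o m n z" "?o m n z'"] oc hom_mult[OF o] by simp
  qed (use oc oR D'.UP.pure_add_left D'.UP.pure_smult D'.UP.pure_closed in auto)
  let ?i = "\<lambda>m n. induce_map T m n (L' m) (M n) (f m) (\<lambda>y. y)"
  note ihyps = D.UP.tensor_pair_axioms D'.UP.tensor_pair_axioms ib
  have i: "?i m n \<in> ahom (D.U m n) (D'.U m n)" for m n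
    unfolding induce_map_def D.induce_eq D'.induce_eq hom_tensor_product
    by (rule tensor_map_hom[OF ihyps]) (use oc in auto)
  have ip: "?i m n (D.g m n c x y) = D'.g m n c (f m x) y"
    if "c \<in> carrier (A (m + n))" "x \<in> carrier (L m)" "y \<in> carrier (M n)" for m n c x y
    unfolding induce_map_def induce_gen_def op[OF that(2,3), symmetric]
    by (rule tensor_map_pure[OF ihyps]) (use oc that in auto)
  have m: "mor (I_functor T M) L L' f k = direct_sum_map (splittings k) (\<lambda>(m, n). ?i m n)"
    by (simp add: I_functor_def)
  have i': "(case mn of (m, n) \<Rightarrow> ?i m n) \<in> ahom (case mn of (m, n) \<Rightarrow> D.U m n) (case mn of (m, n) \<Rightarrow> D'.U m n)" for mn
    using i by (cases mn) simp
  show "mor (I_functor T M) L L' f k \<in> ahom (IND T L M k) (IND T L' M k)"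
    unfolding m D.IND_eq D'.IND_eq by (rule D.S.direct_sum_map_hom(1)[OF D'.splittings_summands i'])
  show "\<lbrakk>m + n = k; c \<in> carrier (A k); x \<in> carrier (L m); y \<in> carrier (M n)\<rbrakk> \<Longrightarrow>
      mor (I_functor T M) L L' f k (ind_gen T L M k m n c x y) = ind_gen T L' M k m n c (f m x) y"
    unfolding m ind_gen_def
    by (subst D.S.direct_sum_map_hom(2)[OF D'.splittings_summands i']) (auto simp: ip intro: D.g_closed)
qed

lemma TR_mor:
  assumes P: "P \<in> gmod T" and L: "L \<in> gmod T" and L': "L' \<in> gmod T" and f: "f \<in> gmod_hom T L L'"
  shows "mor (TR_functor T P) L L' f k \<in> ahom (obj (TR_functor T P) L k) (obj (TR_functor T P) L' k)"
    and "\<lbrakk>x \<in> carrier (P p); v \<in> carrier (L (k + p))\<rbrakk> \<Longrightarrow>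
      mor (TR_functor T P) L L' f k (tr_gen T P L k p x v) = tr_gen T P L' k p x (f (k + p) v)"
proof -
  interpret D: twisted_pair T P L by (rule twisted_pairI[OF P L])
  interpret D': twisted_pair T P L' by (rule twisted_pairI[OF P L'])
  note fD = graded_homD[OF gmod_homD[OF f]]
  let ?i = "\<lambda>p. tensor_map (A p) (D'.TP p) (D'.RN k p) (\<lambda>x. x) (f (k + p))"
  have b: "balanced (A p) (D.TP p) (D.RN k p) (tensor_group (A p) (D'.TP p) (D'.RN k p)) (\<lambda>x v. D'.tp k p x (f (k + p) v))" for p
    by (rule balancedI)
       (use fD D'.TPP.pure_add_left D'.TPP.pure_add_right D'.TPP.pure_smult in
         \<open>auto simp: ahom_add[OF fD(1)] intro!: D'.TPP.pure_closed\<close>)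
  note hyps = D.TPP.tensor_pair_axioms D'.TPP.tensor_pair_axioms b
  have i: "?i p \<in> ahom (D.W k p) (D'.W k p)" for p
    unfolding D.W_eq D'.W_eq hom_tensor_product by (rule tensor_map_hom[OF hyps]) (use fD(2) in auto)
  have ip: "?i p (D.tp k p x v) = D'.tp k p x (f (k + p) v)" if "x \<in> carrier (P p)" "v \<in> carrier (L (k + p))" for p x v
    by (rule tensor_map_pure[OF hyps]) (use fD(2) that in auto)
  have m: "mor (TR_functor T P) L L' f k = direct_sum_map UNIV ?i"
    by (simp add: TR_functor_def)
  show "mor (TR_functor T P) L L' f k \<in> ahom (obj (TR_functor T P) L k) (obj (TR_functor T P) L' k)"
    unfolding m D.TR_eq D'.TR_eq by (rule D.S.direct_sum_map_hom(1)[OF D'.TR_summands i])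
  show "\<lbrakk>x \<in> carrier (P p); v \<in> carrier (L (k + p))\<rbrakk> \<Longrightarrow>
      mor (TR_functor T P) L L' f k (tr_gen T P L k p x v) = tr_gen T P L' k p x (f (k + p) v)"
    unfolding m tr_gen_def
    by (subst D.S.direct_sum_map_hom(2)[OF D'.TR_summands i]) (auto simp: ip intro: D.tp_closed)
qed

end

section \<open>Composition and restriction of functors\<close>

lemma gmod_hom_id: "(\<lambda>n x. x) \<in> gmod_hom T M M"
  by (auto simp: gmod_hom_def graded_hom_def module_hom_def)

lemma gmod_hom_comp:
  "\<lbrakk>f \<in> gmod_hom T M M'; g \<in> gmod_hom T M' M''\<rbrakk> \<Longrightarrow> (\<lambda>n x. g n (f n x)) \<in> gmod_hom T M M''"
  by (auto simp: gmod_hom_def graded_hom_def module_hom_def Pi_iff image_subset_iff)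

lemma same_map_trans: "\<lbrakk>same_map M f g; same_map M g h\<rbrakk> \<Longrightarrow> same_map M f h"
  by (simp add: same_map_def)

lemma is_gfunctorD:
  assumes "is_gfunctor T C D F"
  shows "L \<in> C \<Longrightarrow> obj F L \<in> D"
    and "\<lbrakk>L \<in> C; L' \<in> C; f \<in> gmod_hom T L L'\<rbrakk> \<Longrightarrow> mor F L L' f \<in> gmod_hom T (obj F L) (obj F L')"
    and "\<lbrakk>L \<in> C; L' \<in> C; f \<in> gmod_hom T L L'; g \<in> gmod_hom T L L'; same_map L f g\<rbrakk> \<Longrightarrow>
      same_map (obj F L) (mor F L L' f) (mor F L L' g)"
    and "L \<in> C \<Longrightarrow> same_map (obj F L) (mor F L L (\<lambda>n x. x)) (\<lambda>n x. x)"
    and "\<lbrakk>L \<in> C; L' \<in> C; L'' \<in> C; f \<in> gmod_hom T L L'; g \<in> gmod_hom T L' L''\<rbrakk> \<Longrightarrow>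
      same_map (obj F L) (mor F L L'' (\<lambda>n x. g n (f n x))) (\<lambda>n x. mor F L' L'' g n (mor F L L' f n x))"
  using assms unfolding is_gfunctor_def by blast+

text \<open>The laws of the inner functor hold only up to equality on carriers. Before the outer
  laws apply, the outer functor has to carry this equality along, hence the transitivity
  steps.\<close>

lemma is_gfunctor_comp:
  assumes F: "is_gfunctor T D E F" and G: "is_gfunctor T C D G"
  shows "is_gfunctor T C E (F \<circ>\<^sub>F G)"
  unfolding is_gfunctor_def gfunctor_comp_def gfunctor.simps
proof (intro conjI ballI impI)
  note F = is_gfunctorD[OF F] and G = is_gfunctorD[OF G]
  show "obj F (obj G L) \<in> E" if "L \<in> C" for L
    using F(1) G(1) that by blast
  show "mor F (obj G L) (obj G L') (mor G L L' f) \<in> gmod_hom T (obj F (obj G L)) (obj F (obj G L'))"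
    if "L \<in> C" "L' \<in> C" "f \<in> gmod_hom T L L'" for L L' f
    using F(2) G(1,2) that by blast
  show "same_map (obj F (obj G L)) (mor F (obj G L) (obj G L') (mor G L L' f)) (mor F (obj G L) (obj G L') (mor G L L' g))"
    if "L \<in> C" "L' \<in> C" "f \<in> gmod_hom T L L'" "g \<in> gmod_hom T L L'" "same_map L f g" for L L' f g
    by (rule F(3)) (use G that in blast)+
  show "same_map (obj F (obj G L)) (mor F (obj G L) (obj G L) (mor G L L (\<lambda>n x. x))) (\<lambda>n x. x)" if "L \<in> C" for L
    by (rule same_map_trans[OF F(3) F(4)])
       (use G(1)[OF that] G(2)[OF that that gmod_hom_id] G(4)[OF that] gmod_hom_id in blast)+
  show "same_map (obj F (obj G L)) (mor F (obj G L) (obj G L'') (mor G L L'' (\<lambda>n x. g n (f n x))))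
      (\<lambda>n x. mor F (obj G L') (obj G L'') (mor G L' L'' g) n (mor F (obj G L) (obj G L') (mor G L L' f) n x))"
    if h: "L \<in> C" "L' \<in> C" "L'' \<in> C" "f \<in> gmod_hom T L L'" "g \<in> gmod_hom T L' L''" for L L' L'' f g
  proof (rule same_map_trans[OF F(3) F(5)])
    note o = G(1)[OF h(1)] G(1)[OF h(2)] G(1)[OF h(3)] and m = G(2)[OF h(1,2,4)] G(2)[OF h(2,3,5)]
    show "obj G L \<in> D" "obj G L'' \<in> D" "obj G L \<in> D" "obj G L' \<in> D" "obj G L'' \<in> D" by (rule o)+
    show "mor G L L'' (\<lambda>n x. g n (f n x)) \<in> gmod_hom T (obj G L) (obj G L'')"
      by (rule G(2)[OF h(1,3) gmod_hom_comp[OF h(4,5)]])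
    show "(\<lambda>n x. mor G L' L'' g n (mor G L L' f n x)) \<in> gmod_hom T (obj G L) (obj G L'')"
      by (rule gmod_hom_comp[OF m])
  qed (rule G(5)[OF h] G(2)[OF h(1,2,4)] G(2)[OF h(2,3,5)])+
qed

lemma is_gfunctor_restrict:
  assumes F: "is_gfunctor T C D F" and C: "C' \<subseteq> C" and D: "\<And>L. L \<in> C' \<Longrightarrow> obj F L \<in> D'"
  shows "is_gfunctor T C' D' F"
  unfolding is_gfunctor_def
  by (intro conjI ballI impI D is_gfunctorD[OF F] subsetD[OF C])

lemma ahom_comp: "\<lbrakk>f \<in> ahom L M; g \<in> ahom M N\<rbrakk> \<Longrightarrow> (\<lambda>x. g (f x)) \<in> ahom L N"
  using hom_compose[of f "add_monoid L" "add_monoid M" g "add_monoid N"] by (simp add: comp_def)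

lemma ahom_id: "(\<lambda>x. x) \<in> ahom M M"
  by (rule ahomI) simp_all

context nice_tower_of_algebras
begin

text \<open>Each law equates two additive maps out of an induced module. By \<open>I_mor\<close> a
  morphism only changes the middle entry of a generator, so the maps agree there.\<close>

lemma I_functor_is_gfunctor:
  assumes M: "M \<in> gmod T"
  shows "is_gfunctor T (gmod T) (gmod T) (I_functor T M)"
  unfolding is_gfunctor_def
proof (intro conjI ballI impI)
  have o: "obj (I_functor T M) L = IND T L M" for L by (simp add: I_functor_def)
  show "obj (I_functor T M) L \<in> gmod T" if "L \<in> gmod T" for L
    unfolding o by (rule IND_gmod[OF that M])
  fix L :: "('a, 'l) family" assume L: "L \<in> gmod T"
  interpret D: module_pair T L M by (rule module_pairI[OF L M])
  show "same_map (obj (I_functor T M) L) (mor (I_functor T M) L L (\<lambda>n x. x)) (\<lambda>n x. x)"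
    unfolding same_map_def o
  proof (intro allI ballI)
    fix k u assume u: "u \<in> carrier (IND T L M k)"
    show "mor (I_functor T M) L L (\<lambda>n x. x) k u = u"
      by (rule D.ind_hom_eqI[OF I_mor(1)[OF L L M gmod_hom_id] ahom_id u]) (simp add: I_mor(2)[OF L L M gmod_hom_id])
  qed
  fix L' :: "('a, 'l) family" assume L': "L' \<in> gmod T"
  interpret D': module_pair T L' M by (rule module_pairI[OF L' M])
  fix f assume f: "f \<in> gmod_hom T L L'"
  note fD = graded_homD[OF gmod_homD[OF f]] and F = I_mor[OF L L' M f]
  show "mor (I_functor T M) L L' f \<in> gmod_hom T (obj (I_functor T M) L) (obj (I_functor T M) L')"
    unfolding gmod_hom_def o
  proof (intro CollectI allI)
    fix k
    show "mor (I_functor T M) L L' f k \<in> graded_hom (A k) (IND T L M k) (IND T L' M k)"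
      by (rule D.ind_graded_homI[OF F(1) D'.IND_graded_module])
         (use fD in \<open>auto simp: F(2) D'.ind_smult AG.grade_carrier
            graded_group.grade_carrier[OF graded_moduleD(4)[OF D.X]] graded_group.grade_carrier[OF graded_moduleD(4)[OF D.Y]]
            intro!: D'.ind_grade\<close>)
  qed
  show "same_map (obj (I_functor T M) L) (mor (I_functor T M) L L' f) (mor (I_functor T M) L L' g)"
    if g: "g \<in> gmod_hom T L L'" and fg: "same_map L f g" for g
    unfolding same_map_def o
  proof (intro allI ballI)
    fix k u assume u: "u \<in> carrier (IND T L M k)"
    show "mor (I_functor T M) L L' f k u = mor (I_functor T M) L L' g k u"
      by (rule D.ind_hom_eqI[OF F(1) I_mor(1)[OF L L' M g] u])
         (use fg in \<open>simp add: F(2) I_mor(2)[OF L L' M g] same_map_def\<close>)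
  qed
  fix L'' :: "('a, 'l) family" and g assume L'': "L'' \<in> gmod T" and g: "g \<in> gmod_hom T L' L''"
  note G = I_mor[OF L' L'' M g] and GF = I_mor[OF L L'' M gmod_hom_comp[OF f g]]
  show "same_map (obj (I_functor T M) L) (mor (I_functor T M) L L'' (\<lambda>n x. g n (f n x)))
      (\<lambda>n x. mor (I_functor T M) L' L'' g n (mor (I_functor T M) L L' f n x))"
    unfolding same_map_def o
  proof (intro allI ballI)
    fix k u assume u: "u \<in> carrier (IND T L M k)"
    show "mor (I_functor T M) L L'' (\<lambda>n x. g n (f n x)) k u = mor (I_functor T M) L' L'' g k (mor (I_functor T M) L L' f k u)"
      by (rule D.ind_hom_eqI[OF GF(1) ahom_comp[OF F(1) G(1)] u]) (simp add: F(2) G(2) GF(2) fD(2))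
  qed
qed

lemma TR_functor_is_gfunctor:
  assumes P: "P \<in> gmod T"
  shows "is_gfunctor T (gmod T) (gmod T) (TR_functor T P)"
  unfolding is_gfunctor_def
proof (intro conjI ballI impI)
  let ?o = "obj (TR_functor T P)" and ?m = "mor (TR_functor T P)"
  show "?o L \<in> gmod T" if "L \<in> gmod T" for L
    by (rule TR_gmod[OF P that])
  fix L :: "('a, 'l) family" assume L: "L \<in> gmod T"
  interpret D: twisted_pair T P L by (rule twisted_pairI[OF P L])
  show "same_map (?o L) (?m L L (\<lambda>n x. x)) (\<lambda>n x. x)"
    unfolding same_map_def
  proof (intro allI ballI)
    fix k u assume u: "u \<in> carrier (?o L k)"
    show "?m L L (\<lambda>n x. x) k u = u"
      by (rule D.tr_hom_eqI[OF TR_mor(1)[OF P L L gmod_hom_id] ahom_id u]) (simp add: TR_mor(2)[OF P L L gmod_hom_id])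
  qed
  fix L' :: "('a, 'l) family" assume L': "L' \<in> gmod T"
  interpret D': twisted_pair T P L' by (rule twisted_pairI[OF P L'])
  fix f assume f: "f \<in> gmod_hom T L L'"
  note fD = graded_homD[OF gmod_homD[OF f]] and F = TR_mor[OF P L L' f]
  show "?m L L' f \<in> gmod_hom T (?o L) (?o L')"
    unfolding gmod_hom_def
  proof (intro CollectI allI)
    fix k
    show "?m L L' f k \<in> graded_hom (A k) (?o L k) (?o L' k)"
      by (rule D.tr_graded_homI[OF F(1) D'.TR_graded_module])
         (use fD in \<open>auto simp: F(2) D'.tr_smult graded_module_smult(1)[OF D.N]
            graded_group.grade_carrier[OF graded_moduleD(4)[OF D.P]] graded_group.grade_carrier[OF graded_moduleD(4)[OF D.N]]
            intro!: D'.tr_grade\<close>)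
  qed
  show "same_map (?o L) (?m L L' f) (?m L L' g)"
    if g: "g \<in> gmod_hom T L L'" and fg: "same_map L f g" for g
    unfolding same_map_def
  proof (intro allI ballI)
    fix k u assume u: "u \<in> carrier (?o L k)"
    show "?m L L' f k u = ?m L L' g k u"
      by (rule D.tr_hom_eqI[OF F(1) TR_mor(1)[OF P L L' g] u])
         (use fg in \<open>simp add: F(2) TR_mor(2)[OF P L L' g] same_map_def\<close>)
  qed
  fix L'' :: "('a, 'l) family" and g assume L'': "L'' \<in> gmod T" and g: "g \<in> gmod_hom T L' L''"
  note G = TR_mor[OF P L' L'' g] and GF = TR_mor[OF P L L'' gmod_hom_comp[OF f g]]
  show "same_map (?o L) (?m L L'' (\<lambda>n x. g n (f n x))) (\<lambda>n x. ?m L' L'' g n (?m L L' f n x))"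
    unfolding same_map_def
  proof (intro allI ballI)
    fix k u assume u: "u \<in> carrier (?o L k)"
    show "?m L L'' (\<lambda>n x. g n (f n x)) k u = ?m L' L'' g k (?m L L' f k u)"
      by (rule D.tr_hom_eqI[OF GF(1) ahom_comp[OF F(1) G(1)] u]) (simp add: F(2) G(2) GF(2) fD(2))
  qed
qed

end

section \<open>Composites of induction functors\<close>

lemma component_graded_hom:
  assumes U: "graded_group U" and V: "graded_group V" and h: "h \<in> ahom U V"
    and g: "\<And>d x. x \<in> grade U d \<Longrightarrow> h x \<in> grade V d" and x: "x \<in> carrier U"
  shows "component V d (h x) = h (component U d x)"
proof -
  interpret U: graded_group U by (rule U)
  interpret V: graded_group V by (rule V)
  show ?thesis
    using x
  proof (induction rule: U.graded_induct)
    case (homogeneous e x)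
    then show ?case
      using V.component_of_grade[OF g] U.component_of_grade
        ahom_zero[OF U.abelian_group_axioms V.abelian_group_axioms h] by simp
  next
    case (add x y)
    then show ?case
      by (simp add: ahom_add[OF h] ahom_closed[OF h] U.component_add V.component_add U.component_closed)
  qed
qed

text \<open>Linearity transfers along the bijection. For degrees, \<open>h\<close> sends the
  component of degree \<open>d\<close> of \<open>h' y\<close> to that of \<open>y\<close>, which is
  \<open>y\<close> itself; injectivity makes \<open>h' y\<close> equal to its own component.\<close>

lemma graded_hom_inverse:
  assumes U: "graded_module R U" and V: "graded_module R V" and h: "h \<in> graded_hom R U V"
    and h': "h' \<in> ahom V U"
    and hh': "\<And>x. x \<in> carrier U \<Longrightarrow> h' (h x) = x" "\<And>y. y \<in> carrier V \<Longrightarrow> h (h' y) = y"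
  shows "h' \<in> graded_hom R V U"
proof (rule graded_homI[OF h'])
  note h = graded_homD[OF h]
  interpret U: graded_group U by (rule graded_moduleD(4)[OF U])
  interpret V: graded_group V by (rule graded_moduleD(4)[OF V])
  fix a y assume a: "a \<in> carrier R" and y: "y \<in> carrier V"
  have "h' (a \<odot>\<^bsub>V\<^esub> y) = h' (h (a \<odot>\<^bsub>U\<^esub> h' y))"
    using a y h(3) hh'(2) ahom_closed[OF h'] by simp
  then show "h' (a \<odot>\<^bsub>V\<^esub> y) = a \<odot>\<^bsub>U\<^esub> h' y"
    using a y hh'(1) ahom_closed[OF h'] graded_module_smult(1)[OF U] by simp
next
  note h = graded_homD[OF h]
  interpret U: graded_group U by (rule graded_moduleD(4)[OF U])
  interpret V: graded_group V by (rule graded_moduleD(4)[OF V])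
  fix y d assume y: "y \<in> grade V d"
  have yV: "y \<in> carrier V" by (rule V.grade_carrier[OF y])
  then have x: "h' y \<in> carrier U" by (rule ahom_closed[OF h'])
  have "h (component U d (h' y)) = y"
    using component_graded_hom[OF U.graded_group_axioms V.graded_group_axioms h(1,4) x, of d]
      V.component_of_grade[OF y] hh'(2)[OF yV] by simp
  then have "component U d (h' y) = h' y"
    using hh'(1)[OF U.component_closed[OF x]] by metis
  then show "h' y \<in> grade U d"
    using U.component_grade[OF x] by metis
qed

text \<open>\<open>E\<close> and \<open>E'\<close> are the inner inductions, of \<open>L\<close>
  with \<open>N\<close> and of \<open>N\<close> with \<open>M\<close>. \<open>F\<close> and
  \<open>G\<close> are the two iterated inductions built on them, whose isomorphism is the
  goal.\<close>

locale module_triple = nice_tower_of_algebras T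
  for T :: "('k, 'a) tower" +
  fixes L :: "('a, 'l) family" and N :: "('a, 'n) family" and M :: "('a, 'm) family"
  assumes L: "graded_module (alg T n) (L n)" and N: "graded_module (alg T n) (N n)"
    and M: "graded_module (alg T n) (M n)"
begin

sublocale E: module_pair T L N by unfold_locales (rule L N)+
sublocale E': module_pair T N M by unfold_locales (rule N M)+
sublocale F: module_pair T "IND T L N" M by unfold_locales (rule E.IND_graded_module M)+
sublocale G: module_pair T L "IND T N M" by unfold_locales (rule L E'.IND_graded_module)+

text \<open>The inner algebra element is normalised to the unit; a general one is absorbed into
  \<open>c\<close>.\<close>

definition left_gen where
  "left_gen k l n m c x y z = ind_gen T (IND T L N) M k (l + n) m c (ind_gen T L N (l + n) l n \<one>\<^bsub>A (l + n)\<^esub> x y) z"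

definition right_gen where
  "right_gen k l n m c x y z = ind_gen T L (IND T N M) k l (n + m) c x (ind_gen T N M (n + m) n m \<one>\<^bsub>A (n + m)\<^esub> y z)"

text \<open>Families of maps which both iterated inductions classify. Balance is bracketed as
  \<open>(a \<otimes> b) \<otimes> e\<close>, which suits the left composite; the right one is
  adapted by \<open>em_assoc\<close>.\<close>

definition multilinear where
  "multilinear k V \<phi> \<longleftrightarrow> (\<forall>l n m. l + n + m = k \<longrightarrow> (\<forall>c\<in>carrier (A k). \<forall>x\<in>carrier (L l). \<forall>y\<in>carrier (N n). \<forall>z\<in>carrier (M m).
    \<phi> l n m c x y z \<in> carrier V \<and>
    (\<forall>c'\<in>carrier (A k). \<phi> l n m (c \<oplus>\<^bsub>A k\<^esub> c') x y z = \<phi> l n m c x y z \<oplus>\<^bsub>V\<^esub> \<phi> l n m c' x y z) \<and>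
    (\<forall>x'\<in>carrier (L l). \<phi> l n m c (x \<oplus>\<^bsub>L l\<^esub> x') y z = \<phi> l n m c x y z \<oplus>\<^bsub>V\<^esub> \<phi> l n m c x' y z) \<and>
    (\<forall>y'\<in>carrier (N n). \<phi> l n m c x (y \<oplus>\<^bsub>N n\<^esub> y') z = \<phi> l n m c x y z \<oplus>\<^bsub>V\<^esub> \<phi> l n m c x y' z) \<and>
    (\<forall>z'\<in>carrier (M m). \<phi> l n m c x y (z \<oplus>\<^bsub>M m\<^esub> z') = \<phi> l n m c x y z \<oplus>\<^bsub>V\<^esub> \<phi> l n m c x y z') \<and>
    (\<forall>a\<in>carrier (A l). \<forall>b\<in>carrier (A n). \<forall>e\<in>carrier (A m).
      \<phi> l n m (c \<otimes>\<^bsub>A k\<^esub> em (l + n) m (em l n a b) e) x y z = \<phi> l n m c (a \<odot>\<^bsub>L l\<^esub> x) (b \<odot>\<^bsub>N n\<^esub> y) (e \<odot>\<^bsub>M m\<^esub> z))))"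

lemma multilinearD:
  assumes "multilinear k V \<phi>" "l + n + m = k" "c \<in> carrier (A k)" "x \<in> carrier (L l)" "y \<in> carrier (N n)" "z \<in> carrier (M m)"
  shows "\<phi> l n m c x y z \<in> carrier V"
    and "c' \<in> carrier (A k) \<Longrightarrow> \<phi> l n m (c \<oplus>\<^bsub>A k\<^esub> c') x y z = \<phi> l n m c x y z \<oplus>\<^bsub>V\<^esub> \<phi> l n m c' x y z"
    and "x' \<in> carrier (L l) \<Longrightarrow> \<phi> l n m c (x \<oplus>\<^bsub>L l\<^esub> x') y z = \<phi> l n m c x y z \<oplus>\<^bsub>V\<^esub> \<phi> l n m c x' y z"
    and "y' \<in> carrier (N n) \<Longrightarrow> \<phi> l n m c x (y \<oplus>\<^bsub>N n\<^esub> y') z = \<phi> l n m c x y z \<oplus>\<^bsub>V\<^esub> \<phi> l n m c x y' z"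
    and "z' \<in> carrier (M m) \<Longrightarrow> \<phi> l n m c x y (z \<oplus>\<^bsub>M m\<^esub> z') = \<phi> l n m c x y z \<oplus>\<^bsub>V\<^esub> \<phi> l n m c x y z'"
    and "\<lbrakk>a \<in> carrier (A l); b \<in> carrier (A n); e \<in> carrier (A m)\<rbrakk> \<Longrightarrow>
      \<phi> l n m (c \<otimes>\<^bsub>A k\<^esub> em (l + n) m (em l n a b) e) x y z = \<phi> l n m c (a \<odot>\<^bsub>L l\<^esub> x) (b \<odot>\<^bsub>N n\<^esub> y) (e \<odot>\<^bsub>M m\<^esub> z)"
  using assms unfolding multilinear_def by blast+

text \<open>Only balance has content: \<open>a \<otimes> b\<close> crosses the outer tensor sign as
  one element, multiplies the unit of the inner generator, and then splits across the inner tensor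
  sign.\<close>

lemma left_gen_multilinear: "multilinear k (F.V k) (left_gen k)"
  unfolding multilinear_def left_gen_def
proof (intro allI impI ballI conjI)
  fix l n m c x y z
  assume k: "l + n + m = k" and c: "c \<in> carrier (A k)" and x: "x \<in> carrier (L l)" and y: "y \<in> carrier (N n)" and z: "z \<in> carrier (M m)"
  let ?r = "l + n"
  let ?e = "E.i ?r l n \<one>\<^bsub>A ?r\<^esub>"
  have ec: "?e x y \<in> carrier (E.V ?r)" if "x \<in> carrier (L l)" "y \<in> carrier (N n)" for x y
    by (rule E.ind_closed[OF refl A.one_closed that])
  show "F.i k ?r m c (?e x y) z \<in> carrier (F.V k)"
    by (rule F.ind_closed[OF k c ec[OF x y] z])
  show "F.i k ?r m (c \<oplus>\<^bsub>A k\<^esub> c') (?e x y) z = F.i k ?r m c (?e x y) z \<oplus>\<^bsub>F.V k\<^esub> F.i k ?r m c' (?e x y) z"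
    if "c' \<in> carrier (A k)" for c'
    by (rule F.ind_add1[OF k c that ec[OF x y] z])
  show "F.i k ?r m c (?e (x \<oplus>\<^bsub>L l\<^esub> x') y) z = F.i k ?r m c (?e x y) z \<oplus>\<^bsub>F.V k\<^esub> F.i k ?r m c (?e x' y) z"
    if "x' \<in> carrier (L l)" for x'
    unfolding E.ind_add2[OF refl A.one_closed x that y] by (rule F.ind_add2[OF k c ec[OF x y] ec[OF that y] z])
  show "F.i k ?r m c (?e x (y \<oplus>\<^bsub>N n\<^esub> y')) z = F.i k ?r m c (?e x y) z \<oplus>\<^bsub>F.V k\<^esub> F.i k ?r m c (?e x y') z"
    if "y' \<in> carrier (N n)" for y'
    unfolding E.ind_add3[OF refl A.one_closed x y that] by (rule F.ind_add2[OF k c ec[OF x y] ec[OF x that] z])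
  show "F.i k ?r m c (?e x y) (z \<oplus>\<^bsub>M m\<^esub> z') = F.i k ?r m c (?e x y) z \<oplus>\<^bsub>F.V k\<^esub> F.i k ?r m c (?e x y) z'"
    if "z' \<in> carrier (M m)" for z'
    by (rule F.ind_add3[OF k c ec[OF x y] z that])
  show "F.i k ?r m (c \<otimes>\<^bsub>A k\<^esub> em ?r m (em l n a b) e) (?e x y) z
      = F.i k ?r m c (?e (a \<odot>\<^bsub>L l\<^esub> x) (b \<odot>\<^bsub>N n\<^esub> y)) (e \<odot>\<^bsub>M m\<^esub> z)"
    if abe: "a \<in> carrier (A l)" "b \<in> carrier (A n)" "e \<in> carrier (A m)" for a b e
  proof -
    have "em l n a b \<odot>\<^bsub>E.V ?r\<^esub> ?e x y = ?e (a \<odot>\<^bsub>L l\<^esub> x) (b \<odot>\<^bsub>N n\<^esub> y)"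
      using E.ind_smult[OF refl em_closed[OF abe(1,2) refl] A.one_closed x y]
        E.ind_balanced[OF refl A.one_closed abe(1,2) x y] abe by simp
    then show ?thesis
      using F.ind_balanced[OF k c em_closed[OF abe(1,2) refl] abe(3) ec[OF x y] z] by simp
  qed
qed

lemma right_gen_multilinear: "multilinear k (G.V k) (right_gen k)"
  unfolding multilinear_def right_gen_def
proof (intro allI impI ballI conjI)
  fix l n m c x y z
  assume k': "l + n + m = k" and c: "c \<in> carrier (A k)" and x: "x \<in> carrier (L l)" and y: "y \<in> carrier (N n)" and z: "z \<in> carrier (M m)"
  have k: "l + (n + m) = k" using k' by simp
  let ?s = "n + m"
  let ?e = "E'.i ?s n m \<one>\<^bsub>A ?s\<^esub>"
  have ec: "?e y z \<in> carrier (E'.V ?s)" if "y \<in> carrier (N n)" "z \<in> carrier (M m)" for y z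
    by (rule E'.ind_closed[OF refl A.one_closed that])
  show "G.i k l ?s c x (?e y z) \<in> carrier (G.V k)"
    by (rule G.ind_closed[OF k c x ec[OF y z]])
  show "G.i k l ?s (c \<oplus>\<^bsub>A k\<^esub> c') x (?e y z) = G.i k l ?s c x (?e y z) \<oplus>\<^bsub>G.V k\<^esub> G.i k l ?s c' x (?e y z)"
    if "c' \<in> carrier (A k)" for c'
    by (rule G.ind_add1[OF k c that x ec[OF y z]])
  show "G.i k l ?s c (x \<oplus>\<^bsub>L l\<^esub> x') (?e y z) = G.i k l ?s c x (?e y z) \<oplus>\<^bsub>G.V k\<^esub> G.i k l ?s c x' (?e y z)"
    if "x' \<in> carrier (L l)" for x'
    by (rule G.ind_add2[OF k c x that ec[OF y z]])
  show "G.i k l ?s c x (?e (y \<oplus>\<^bsub>N n\<^esub> y') z) = G.i k l ?s c x (?e y z) \<oplus>\<^bsub>G.V k\<^esub> G.i k l ?s c x (?e y' z)"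
    if "y' \<in> carrier (N n)" for y'
    unfolding E'.ind_add2[OF refl A.one_closed y that z] by (rule G.ind_add3[OF k c x ec[OF y z] ec[OF that z]])
  show "G.i k l ?s c x (?e y (z \<oplus>\<^bsub>M m\<^esub> z')) = G.i k l ?s c x (?e y z) \<oplus>\<^bsub>G.V k\<^esub> G.i k l ?s c x (?e y z')"
    if "z' \<in> carrier (M m)" for z'
    unfolding E'.ind_add3[OF refl A.one_closed y z that] by (rule G.ind_add3[OF k c x ec[OF y z] ec[OF y that]])
  show "G.i k l ?s (c \<otimes>\<^bsub>A k\<^esub> em (l + n) m (em l n a b) e) x (?e y z)
      = G.i k l ?s c (a \<odot>\<^bsub>L l\<^esub> x) (?e (b \<odot>\<^bsub>N n\<^esub> y) (e \<odot>\<^bsub>M m\<^esub> z))"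
    if abe: "a \<in> carrier (A l)" "b \<in> carrier (A n)" "e \<in> carrier (A m)" for a b e
  proof -
    have "em n m b e \<odot>\<^bsub>E'.V ?s\<^esub> ?e y z = ?e (b \<odot>\<^bsub>N n\<^esub> y) (e \<odot>\<^bsub>M m\<^esub> z)"
      using E'.ind_smult[OF refl em_closed[OF abe(2,3) refl] A.one_closed y z]
        E'.ind_balanced[OF refl A.one_closed abe(2,3) y z] abe by simp
    then show ?thesis
      \<comment> \<open>In the right composite \<open>a\<close> acts on the first factor and
        \<open>b \<otimes> e\<close> on the second, so the product is bracketed to the right
        first.\<close>
      unfolding em_assoc[OF abe refl refl]
      using G.ind_balanced[OF k c abe(1) em_closed[OF abe(2,3) refl] x ec[OF y z]] by simp
  qed
qed

text \<open>With \<open>c\<close> and \<open>z\<close> frozen, the inner induced module is lifted to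
  \<open>H r m c z\<close>; this family is then lifted along the outer one. The value at an inner
  element \<open>d\<close> is forced, since \<open>d\<close> can be moved into \<open>c\<close> as
  \<open>d \<otimes> 1\<close>.\<close>

lemma left_lift:
  assumes V: "abelian_group V" and \<phi>: "multilinear k V \<phi>"
  shows "\<exists>h\<in>ahom (F.V k) V. \<forall>r m l n c d x y z. r + m = k \<longrightarrow> l + n = r \<longrightarrow> c \<in> carrier (A k) \<longrightarrow> d \<in> carrier (A r) \<longrightarrow>
    x \<in> carrier (L l) \<longrightarrow> y \<in> carrier (N n) \<longrightarrow> z \<in> carrier (M m) \<longrightarrow>
    h (F.i k r m c (E.i r l n d x y) z) = \<phi> l n m (c \<otimes>\<^bsub>A k\<^esub> em r m d \<one>\<^bsub>A m\<^esub>) x y z"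
proof -
  interpret V: abelian_group V by (rule V)
  note mc = multilinearD[OF \<phi>]
  define Q where "Q r m c z h \<longleftrightarrow> h \<in> ahom (E.V r) V \<and> (\<forall>l n. l + n = r \<longrightarrow> (\<forall>d\<in>carrier (A r). \<forall>x\<in>carrier (L l). \<forall>y\<in>carrier (N n).
      h (E.i r l n d x y) = \<phi> l n m (c \<otimes>\<^bsub>A k\<^esub> em r m d \<one>\<^bsub>A m\<^esub>) x y z))" for r m c z h
  define H where "H r m c z = (SOME h. Q r m c z h)" for r m c z
  have QH: "Q r m c z (H r m c z)" if rm: "r + m = k" and c: "c \<in> carrier (A k)" and z: "z \<in> carrier (M m)" for r m c z
  proof -
    have "\<exists>h\<in>ahom (E.V r) V. \<forall>l n. l + n = r \<longrightarrow> (\<forall>d\<in>carrier (A r). \<forall>x\<in>carrier (L l). \<forall>y\<in>carrier (N n).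
      h (E.i r l n d x y) = \<phi> l n m (c \<otimes>\<^bsub>A k\<^esub> em r m d \<one>\<^bsub>A m\<^esub>) x y z)"
    proof (rule E.ind_lift[OF V])
      fix l n d x y assume ln: "l + n = r" and d: "d \<in> carrier (A r)" and x: "x \<in> carrier (L l)" and y: "y \<in> carrier (N n)"
      have k: "l + n + m = k" using ln rm by simp
      have cd: "c \<otimes>\<^bsub>A k\<^esub> em r m d \<one>\<^bsub>A m\<^esub> \<in> carrier (A k)" using c d rm by simp
      note mcd = mc[OF k cd x y z]
      show "\<phi> l n m (c \<otimes>\<^bsub>A k\<^esub> em r m d \<one>\<^bsub>A m\<^esub>) x y z \<in> carrier V" by (rule mcd(1))
      show "\<phi> l n m (c \<otimes>\<^bsub>A k\<^esub> em r m (d \<oplus>\<^bsub>A r\<^esub> d') \<one>\<^bsub>A m\<^esub>) x y z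
          = \<phi> l n m (c \<otimes>\<^bsub>A k\<^esub> em r m d \<one>\<^bsub>A m\<^esub>) x y z \<oplus>\<^bsub>V\<^esub> \<phi> l n m (c \<otimes>\<^bsub>A k\<^esub> em r m d' \<one>\<^bsub>A m\<^esub>) x y z"
        if "d' \<in> carrier (A r)" for d'
        using mcd(2)[of "c \<otimes>\<^bsub>A k\<^esub> em r m d' \<one>\<^bsub>A m\<^esub>"] that c d rm by (simp add: em_add_left A.r_distr)
      show "\<phi> l n m (c \<otimes>\<^bsub>A k\<^esub> em r m d \<one>\<^bsub>A m\<^esub>) (x \<oplus>\<^bsub>L l\<^esub> x') y z
          = \<phi> l n m (c \<otimes>\<^bsub>A k\<^esub> em r m d \<one>\<^bsub>A m\<^esub>) x y z \<oplus>\<^bsub>V\<^esub> \<phi> l n m (c \<otimes>\<^bsub>A k\<^esub> em r m d \<one>\<^bsub>A m\<^esub>) x' y z"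
        if "x' \<in> carrier (L l)" for x' by (rule mcd(3)[OF that])
      show "\<phi> l n m (c \<otimes>\<^bsub>A k\<^esub> em r m d \<one>\<^bsub>A m\<^esub>) x (y \<oplus>\<^bsub>N n\<^esub> y') z
          = \<phi> l n m (c \<otimes>\<^bsub>A k\<^esub> em r m d \<one>\<^bsub>A m\<^esub>) x y z \<oplus>\<^bsub>V\<^esub> \<phi> l n m (c \<otimes>\<^bsub>A k\<^esub> em r m d \<one>\<^bsub>A m\<^esub>) x y' z"
        if "y' \<in> carrier (N n)" for y' by (rule mcd(4)[OF that])
      show "\<phi> l n m (c \<otimes>\<^bsub>A k\<^esub> em r m (d \<otimes>\<^bsub>A r\<^esub> em l n a b) \<one>\<^bsub>A m\<^esub>) x y z
          = \<phi> l n m (c \<otimes>\<^bsub>A k\<^esub> em r m d \<one>\<^bsub>A m\<^esub>) (a \<odot>\<^bsub>L l\<^esub> x) (b \<odot>\<^bsub>N n\<^esub> y) z"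
        if ab: "a \<in> carrier (A l)" "b \<in> carrier (A n)" for a b
      proof -
        have e: "em r m (d \<otimes>\<^bsub>A r\<^esub> em l n a b) \<one>\<^bsub>A m\<^esub> = em r m d \<one>\<^bsub>A m\<^esub> \<otimes>\<^bsub>A k\<^esub> em r m (em l n a b) \<one>\<^bsub>A m\<^esub>"
          using d ab ln rm by (simp add: em_mult)
        show ?thesis
          unfolding e using mcd(6)[OF ab A.one_closed] c d ab ln rm graded_module_smult(5)[OF M z]
          by (simp add: A.m_assoc)
      qed
    qed
    then have "\<exists>h. Q r m c z h" by (auto simp: Q_def)
    then show ?thesis unfolding H_def by (rule someI_ex)
  qed
  have H: "H r m c z \<in> ahom (E.V r) V" if "r + m = k" "c \<in> carrier (A k)" "z \<in> carrier (M m)" for r m c z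
    using QH[OF that] by (simp add: Q_def)
  have HE: "H r m c z (E.i r l n d x y) = \<phi> l n m (c \<otimes>\<^bsub>A k\<^esub> em r m d \<one>\<^bsub>A m\<^esub>) x y z"
    if "r + m = k" "c \<in> carrier (A k)" "z \<in> carrier (M m)" "l + n = r" "d \<in> carrier (A r)" "x \<in> carrier (L l)" "y \<in> carrier (N n)"
    for r m c z l n d x y
    using QH[OF that(1-3)] that(4-7) by (simp add: Q_def)
  have "\<exists>h\<in>ahom (F.V k) V. \<forall>r m. r + m = k \<longrightarrow> (\<forall>c\<in>carrier (A k). \<forall>w\<in>carrier (E.V r). \<forall>z\<in>carrier (M m).
      h (F.i k r m c w z) = H r m c z w)"
  proof (rule F.ind_lift[OF V])
    fix r m c w z assume rm: "r + m = k" and c: "c \<in> carrier (A k)" and w: "w \<in> carrier (E.V r)" and z: "z \<in> carrier (M m)"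
    show "H r m c z w \<in> carrier V" by (rule ahom_closed[OF H[OF rm c z] w])
    show "H r m c z (w \<oplus>\<^bsub>E.V r\<^esub> w') = H r m c z w \<oplus>\<^bsub>V\<^esub> H r m c z w'" if "w' \<in> carrier (E.V r)" for w'
      by (rule ahom_add[OF H[OF rm c z] w that])
    \<comment> \<open>The maps for \<open>c\<close>, for \<open>c'\<close> and for their sum are
      chosen separately, so additivity is verified on generators of the inner module.\<close>
    show "H r m (c \<oplus>\<^bsub>A k\<^esub> c') z w = H r m c z w \<oplus>\<^bsub>V\<^esub> H r m c' z w" if c': "c' \<in> carrier (A k)" for c'
      using w
    proof (induction rule: E.ind_induct)
      case (gen l n d x y)
      have k: "l + n + m = k" using gen(1) rm by simp
      show ?case
        using c c' z gen rm
          mc(2)[OF k _ gen(3,4) z, of "c \<otimes>\<^bsub>A k\<^esub> em r m d \<one>\<^bsub>A m\<^esub>" "c' \<otimes>\<^bsub>A k\<^esub> em r m d \<one>\<^bsub>A m\<^esub>"]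
        by (simp add: HE A.l_distr)
    next
      case (add u v)
      then show ?case
        using ahom_closed[OF H[OF rm c z]] ahom_closed[OF H[OF rm c' z]] c c' rm z
        by (simp add: ahom_add[OF H] V.a_ac)
    qed
    show "H r m c (z \<oplus>\<^bsub>M m\<^esub> z') w = H r m c z w \<oplus>\<^bsub>V\<^esub> H r m c z' w" if z': "z' \<in> carrier (M m)" for z'
      using w
    proof (induction rule: E.ind_induct)
      interpret Mm: abelian_group "M m" by (rule graded_moduleD(3)[OF M])
      case (gen l n d x y)
      have k: "l + n + m = k" using gen(1) rm by simp
      show ?case
        using c z z' gen rm mc(5)[OF k _ gen(3,4) z z', of "c \<otimes>\<^bsub>A k\<^esub> em r m d \<one>\<^bsub>A m\<^esub>"]
        by (simp add: HE)
    next
      interpret Mm: abelian_group "M m" by (rule graded_moduleD(3)[OF M])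
      case (add u v)
      then show ?case
        using ahom_closed[OF H[OF rm c z]] ahom_closed[OF H[OF rm c z']] c rm z z'
        by (simp add: ahom_add[OF H] V.a_ac)
    qed
    show "H r m (c \<otimes>\<^bsub>A k\<^esub> em r m a e) z w = H r m c (e \<odot>\<^bsub>M m\<^esub> z) (a \<odot>\<^bsub>E.V r\<^esub> w)"
      if a: "a \<in> carrier (A r)" and e: "e \<in> carrier (A m)" for a e
      using w
    proof (induction rule: E.ind_induct)
      case (gen l n d x y)
      have k: "l + n + m = k" using gen(1) rm by simp
      let ?c = "c \<otimes>\<^bsub>A k\<^esub> em r m (a \<otimes>\<^bsub>A r\<^esub> d) \<one>\<^bsub>A m\<^esub>"
      have cc: "?c \<in> carrier (A k)" using c a gen rm by simp
      \<comment> \<open>In the factors \<open>r\<close> and \<open>m\<close>, \<open>(a \<otimes>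
        e)(d \<otimes> 1) = (ad \<otimes> 1)(1 \<otimes> e)\<close>. The last factor is written over
        \<open>l\<close>, \<open>n\<close>, \<open>m\<close> so that balance applies to it.\<close>
      have "c \<otimes>\<^bsub>A k\<^esub> em r m a e \<otimes>\<^bsub>A k\<^esub> em r m d \<one>\<^bsub>A m\<^esub> = ?c \<otimes>\<^bsub>A k\<^esub> em r m (em l n \<one>\<^bsub>A l\<^esub> \<one>\<^bsub>A n\<^esub>) e"
        using c a e gen rm by (simp add: A.m_assoc em_mult em_one)
      then have "H r m (c \<otimes>\<^bsub>A k\<^esub> em r m a e) z (E.i r l n d x y) = \<phi> l n m (?c \<otimes>\<^bsub>A k\<^esub> em r m (em l n \<one>\<^bsub>A l\<^esub> \<one>\<^bsub>A n\<^esub>) e) x y z"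
        using c a e z gen rm by (simp add: HE)
      also have "\<dots> = \<phi> l n m ?c x y (e \<odot>\<^bsub>M m\<^esub> z)"
        using mc(6)[OF k cc gen(3,4) z A.one_closed A.one_closed e] gen
          graded_module_smult(5)[OF L gen(3)] graded_module_smult(5)[OF N gen(4)] by simp
      also have "\<dots> = H r m c (e \<odot>\<^bsub>M m\<^esub> z) (a \<odot>\<^bsub>E.V r\<^esub> E.i r l n d x y)"
        using c a e z gen rm graded_module_smult(1)[OF M e z] by (simp add: E.ind_smult HE)
      finally show ?case .
    next
      case (add u v)
      have cc: "c \<otimes>\<^bsub>A k\<^esub> em r m a e \<in> carrier (A k)" using c a e rm by simp
      have ez: "e \<odot>\<^bsub>M m\<^esub> z \<in> carrier (M m)" by (rule graded_module_smult(1)[OF M e z])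
      show ?case
        using add a ahom_add[OF H[OF rm cc z], of u v] ahom_add[OF H[OF rm c ez], of "a \<odot>\<^bsub>E.V r\<^esub> u" "a \<odot>\<^bsub>E.V r\<^esub> v"]
        by (simp add: graded_module_smult[OF E.IND_graded_module])
    qed
  qed
  then obtain h where h: "h \<in> ahom (F.V k) V"
    and hH: "\<And>r m c w z. \<lbrakk>r + m = k; c \<in> carrier (A k); w \<in> carrier (E.V r); z \<in> carrier (M m)\<rbrakk> \<Longrightarrow> h (F.i k r m c w z) = H r m c z w"
    by blast
  show ?thesis
    by (rule bexI[OF _ h]) (auto simp: hH HE E.ind_closed)
qed

text \<open>Mirror image of \<open>left_lift\<close>: \<open>c\<close> and \<open>x\<close> are
  frozen, and the inner element \<open>d\<close> enters \<open>c\<close> as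
  \<open>1 \<otimes> d\<close>. Rebracketing is now needed before balance can be applied.\<close>

lemma right_lift:
  assumes V: "abelian_group V" and \<phi>: "multilinear k V \<phi>"
  shows "\<exists>h\<in>ahom (G.V k) V. \<forall>l s n m c d x y z. l + s = k \<longrightarrow> n + m = s \<longrightarrow> c \<in> carrier (A k) \<longrightarrow> d \<in> carrier (A s) \<longrightarrow>
    x \<in> carrier (L l) \<longrightarrow> y \<in> carrier (N n) \<longrightarrow> z \<in> carrier (M m) \<longrightarrow>
    h (G.i k l s c x (E'.i s n m d y z)) = \<phi> l n m (c \<otimes>\<^bsub>A k\<^esub> em l s \<one>\<^bsub>A l\<^esub> d) x y z"
proof -
  interpret V: abelian_group V by (rule V)
  note mc = multilinearD[OF \<phi>]
  define Q where "Q l s c x h \<longleftrightarrow> h \<in> ahom (E'.V s) V \<and> (\<forall>n m. n + m = s \<longrightarrow> (\<forall>d\<in>carrier (A s). \<forall>y\<in>carrier (N n). \<forall>z\<in>carrier (M m).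
      h (E'.i s n m d y z) = \<phi> l n m (c \<otimes>\<^bsub>A k\<^esub> em l s \<one>\<^bsub>A l\<^esub> d) x y z))" for l s c x h
  define H where "H l s c x = (SOME h. Q l s c x h)" for l s c x
  have QH: "Q l s c x (H l s c x)" if ls: "l + s = k" and c: "c \<in> carrier (A k)" and x: "x \<in> carrier (L l)" for l s c x
  proof -
    have "\<exists>h\<in>ahom (E'.V s) V. \<forall>n m. n + m = s \<longrightarrow> (\<forall>d\<in>carrier (A s). \<forall>y\<in>carrier (N n). \<forall>z\<in>carrier (M m).
      h (E'.i s n m d y z) = \<phi> l n m (c \<otimes>\<^bsub>A k\<^esub> em l s \<one>\<^bsub>A l\<^esub> d) x y z)"
    proof (rule E'.ind_lift[OF V])
      fix n m d y z assume nm: "n + m = s" and d: "d \<in> carrier (A s)" and y: "y \<in> carrier (N n)" and z: "z \<in> carrier (M m)"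
      have k: "l + n + m = k" using nm ls by simp
      have cd: "c \<otimes>\<^bsub>A k\<^esub> em l s \<one>\<^bsub>A l\<^esub> d \<in> carrier (A k)" using c d ls by simp
      note mcd = mc[OF k cd x y z]
      show "\<phi> l n m (c \<otimes>\<^bsub>A k\<^esub> em l s \<one>\<^bsub>A l\<^esub> d) x y z \<in> carrier V" by (rule mcd(1))
      show "\<phi> l n m (c \<otimes>\<^bsub>A k\<^esub> em l s \<one>\<^bsub>A l\<^esub> (d \<oplus>\<^bsub>A s\<^esub> d')) x y z
          = \<phi> l n m (c \<otimes>\<^bsub>A k\<^esub> em l s \<one>\<^bsub>A l\<^esub> d) x y z \<oplus>\<^bsub>V\<^esub> \<phi> l n m (c \<otimes>\<^bsub>A k\<^esub> em l s \<one>\<^bsub>A l\<^esub> d') x y z"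
        if "d' \<in> carrier (A s)" for d'
        using mcd(2)[of "c \<otimes>\<^bsub>A k\<^esub> em l s \<one>\<^bsub>A l\<^esub> d'"] that c d ls by (simp add: em_add_right A.r_distr)
      show "\<phi> l n m (c \<otimes>\<^bsub>A k\<^esub> em l s \<one>\<^bsub>A l\<^esub> d) x (y \<oplus>\<^bsub>N n\<^esub> y') z
          = \<phi> l n m (c \<otimes>\<^bsub>A k\<^esub> em l s \<one>\<^bsub>A l\<^esub> d) x y z \<oplus>\<^bsub>V\<^esub> \<phi> l n m (c \<otimes>\<^bsub>A k\<^esub> em l s \<one>\<^bsub>A l\<^esub> d) x y' z"
        if "y' \<in> carrier (N n)" for y' by (rule mcd(4)[OF that])
      show "\<phi> l n m (c \<otimes>\<^bsub>A k\<^esub> em l s \<one>\<^bsub>A l\<^esub> d) x y (z \<oplus>\<^bsub>M m\<^esub> z')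
          = \<phi> l n m (c \<otimes>\<^bsub>A k\<^esub> em l s \<one>\<^bsub>A l\<^esub> d) x y z \<oplus>\<^bsub>V\<^esub> \<phi> l n m (c \<otimes>\<^bsub>A k\<^esub> em l s \<one>\<^bsub>A l\<^esub> d) x y z'"
        if "z' \<in> carrier (M m)" for z' by (rule mcd(5)[OF that])
      show "\<phi> l n m (c \<otimes>\<^bsub>A k\<^esub> em l s \<one>\<^bsub>A l\<^esub> (d \<otimes>\<^bsub>A s\<^esub> em n m b e)) x y z
          = \<phi> l n m (c \<otimes>\<^bsub>A k\<^esub> em l s \<one>\<^bsub>A l\<^esub> d) x (b \<odot>\<^bsub>N n\<^esub> y) (e \<odot>\<^bsub>M m\<^esub> z)"
        if be: "b \<in> carrier (A n)" "e \<in> carrier (A m)" for b e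
      proof -
        have eq: "em l s \<one>\<^bsub>A l\<^esub> (d \<otimes>\<^bsub>A s\<^esub> em n m b e) = em l s \<one>\<^bsub>A l\<^esub> d \<otimes>\<^bsub>A k\<^esub> em (l + n) m (em l n \<one>\<^bsub>A l\<^esub> b) e"
          using d be nm ls by (simp add: em_assoc[OF A.one_closed be refl nm] em_mult)
        show ?thesis
          unfolding eq using mcd(6)[OF A.one_closed be] c d be nm ls graded_module_smult(5)[OF L x]
          by (simp add: A.m_assoc)
      qed
    qed
    then have "\<exists>h. Q l s c x h" by (auto simp: Q_def)
    then show ?thesis unfolding H_def by (rule someI_ex)
  qed
  have H: "H l s c x \<in> ahom (E'.V s) V" if "l + s = k" "c \<in> carrier (A k)" "x \<in> carrier (L l)" for l s c x
    using QH[OF that] by (simp add: Q_def)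
  have HE: "H l s c x (E'.i s n m d y z) = \<phi> l n m (c \<otimes>\<^bsub>A k\<^esub> em l s \<one>\<^bsub>A l\<^esub> d) x y z"
    if "l + s = k" "c \<in> carrier (A k)" "x \<in> carrier (L l)" "n + m = s" "d \<in> carrier (A s)" "y \<in> carrier (N n)" "z \<in> carrier (M m)"
    for l s c x n m d y z
    using QH[OF that(1-3)] that(4-7) by (simp add: Q_def)
  have "\<exists>h\<in>ahom (G.V k) V. \<forall>l s. l + s = k \<longrightarrow> (\<forall>c\<in>carrier (A k). \<forall>x\<in>carrier (L l). \<forall>w\<in>carrier (E'.V s).
      h (G.i k l s c x w) = H l s c x w)"
  proof (rule G.ind_lift[OF V])
    fix l s c x w assume ls: "l + s = k" and c: "c \<in> carrier (A k)" and x: "x \<in> carrier (L l)" and w: "w \<in> carrier (E'.V s)"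
    show "H l s c x w \<in> carrier V" by (rule ahom_closed[OF H[OF ls c x] w])
    show "H l s c x (w \<oplus>\<^bsub>E'.V s\<^esub> w') = H l s c x w \<oplus>\<^bsub>V\<^esub> H l s c x w'" if "w' \<in> carrier (E'.V s)" for w'
      by (rule ahom_add[OF H[OF ls c x] w that])
    show "H l s (c \<oplus>\<^bsub>A k\<^esub> c') x w = H l s c x w \<oplus>\<^bsub>V\<^esub> H l s c' x w" if c': "c' \<in> carrier (A k)" for c'
      using w
    proof (induction rule: E'.ind_induct)
      case (gen n m d y z)
      have k: "l + n + m = k" using gen(1) ls by simp
      show ?case
        using c c' x gen ls
          mc(2)[OF k _ x gen(3,4), of "c \<otimes>\<^bsub>A k\<^esub> em l s \<one>\<^bsub>A l\<^esub> d" "c' \<otimes>\<^bsub>A k\<^esub> em l s \<one>\<^bsub>A l\<^esub> d"]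
        by (simp add: HE A.l_distr)
    next
      case (add u v)
      then show ?case
        using ahom_closed[OF H[OF ls c x]] ahom_closed[OF H[OF ls c' x]] c c' ls x
        by (simp add: ahom_add[OF H] V.a_ac)
    qed
    show "H l s c (x \<oplus>\<^bsub>L l\<^esub> x') w = H l s c x w \<oplus>\<^bsub>V\<^esub> H l s c x' w" if x': "x' \<in> carrier (L l)" for x'
      using w
    proof (induction rule: E'.ind_induct)
      interpret Ll: abelian_group "L l" by (rule graded_moduleD(3)[OF L])
      case (gen n m d y z)
      have k: "l + n + m = k" using gen(1) ls by simp
      show ?case
        using c x x' gen ls mc(3)[OF k _ x gen(3,4) x', of "c \<otimes>\<^bsub>A k\<^esub> em l s \<one>\<^bsub>A l\<^esub> d"]
        by (simp add: HE)
    next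
      interpret Ll: abelian_group "L l" by (rule graded_moduleD(3)[OF L])
      case (add u v)
      then show ?case
        using ahom_closed[OF H[OF ls c x]] ahom_closed[OF H[OF ls c x']] c ls x x'
        by (simp add: ahom_add[OF H] V.a_ac)
    qed
    show "H l s (c \<otimes>\<^bsub>A k\<^esub> em l s a e) x w = H l s c (a \<odot>\<^bsub>L l\<^esub> x) (e \<odot>\<^bsub>E'.V s\<^esub> w)"
      if a: "a \<in> carrier (A l)" and e: "e \<in> carrier (A s)" for a e
      using w
    proof (induction rule: E'.ind_induct)
      case (gen n m d y z)
      have k: "l + n + m = k" using gen(1) ls by simp
      let ?c = "c \<otimes>\<^bsub>A k\<^esub> em l s \<one>\<^bsub>A l\<^esub> (e \<otimes>\<^bsub>A s\<^esub> d)"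
      have cc: "?c \<in> carrier (A k)" using c e gen ls by simp
      \<comment> \<open>The splitting of \<open>k\<close> is \<open>(l, s)\<close> here, while
        balance speaks of the bracketing over \<open>l + n\<close> and \<open>m\<close>; the unit of
        \<open>A_s\<close> is split as \<open>1 \<otimes> 1\<close>.\<close>
      have "em (l + n) m (em l n a \<one>\<^bsub>A n\<^esub>) \<one>\<^bsub>A m\<^esub> = em l s a \<one>\<^bsub>A s\<^esub>"
        using em_assoc[OF a A.one_closed A.one_closed refl gen(1)] em_one[OF gen(1)] by simp
      then have "c \<otimes>\<^bsub>A k\<^esub> em l s a e \<otimes>\<^bsub>A k\<^esub> em l s \<one>\<^bsub>A l\<^esub> d = ?c \<otimes>\<^bsub>A k\<^esub> em (l + n) m (em l n a \<one>\<^bsub>A n\<^esub>) \<one>\<^bsub>A m\<^esub>"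
        using c a e gen ls by (simp add: A.m_assoc em_mult)
      then have "H l s (c \<otimes>\<^bsub>A k\<^esub> em l s a e) x (E'.i s n m d y z) = \<phi> l n m (?c \<otimes>\<^bsub>A k\<^esub> em (l + n) m (em l n a \<one>\<^bsub>A n\<^esub>) \<one>\<^bsub>A m\<^esub>) x y z"
        using c a e x gen ls by (simp add: HE)
      also have "\<dots> = \<phi> l n m ?c (a \<odot>\<^bsub>L l\<^esub> x) y z"
        using mc(6)[OF k cc x gen(3,4) a A.one_closed A.one_closed]
          graded_module_smult(5)[OF N gen(3)] graded_module_smult(5)[OF M gen(4)] by simp
      also have "\<dots> = H l s c (a \<odot>\<^bsub>L l\<^esub> x) (e \<odot>\<^bsub>E'.V s\<^esub> E'.i s n m d y z)"
        using c a e x gen ls graded_module_smult(1)[OF L a x] by (simp add: E'.ind_smult HE)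
      finally show ?case .
    next
      case (add u v)
      have cc: "c \<otimes>\<^bsub>A k\<^esub> em l s a e \<in> carrier (A k)" using c a e ls by simp
      have ax: "a \<odot>\<^bsub>L l\<^esub> x \<in> carrier (L l)" by (rule graded_module_smult(1)[OF L a x])
      show ?case
        using add e ahom_add[OF H[OF ls cc x], of u v] ahom_add[OF H[OF ls c ax], of "e \<odot>\<^bsub>E'.V s\<^esub> u" "e \<odot>\<^bsub>E'.V s\<^esub> v"]
        by (simp add: graded_module_smult[OF E'.IND_graded_module])
    qed
  qed
  then obtain h where h: "h \<in> ahom (G.V k) V"
    and hH: "\<And>l s c x w. \<lbrakk>l + s = k; c \<in> carrier (A k); x \<in> carrier (L l); w \<in> carrier (E'.V s)\<rbrakk> \<Longrightarrow> h (G.i k l s c x w) = H l s c x w"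
    by blast
  show ?thesis
    by (rule bexI[OF _ h]) (auto simp: hH HE E'.ind_closed)
qed

end

text \<open>Inverses are chosen degree by degree as additive maps; \<open>graded_hom_inverse\<close>
  upgrades them to morphisms.\<close>

lemma gmod_isoI:
  assumes "\<And>k. graded_module (alg T k) (U k)" "\<And>k. graded_module (alg T k) (V k)"
    and "\<And>k. f k \<in> graded_hom (alg T k) (U k) (V k)"
    and "\<And>k. \<exists>h\<in>ahom (V k) (U k). (\<forall>u\<in>carrier (U k). h (f k u) = u) \<and> (\<forall>v\<in>carrier (V k). f k (h v) = v)"
  shows "f \<in> gmod_iso T U V"
proof -
  have "\<forall>k. \<exists>h. h \<in> ahom (V k) (U k) \<and> (\<forall>u\<in>carrier (U k). h (f k u) = u) \<and> (\<forall>v\<in>carrier (V k). f k (h v) = v)"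
    using assms(4) by blast
  from choice[OF this] obtain h where h: "\<And>k. h k \<in> ahom (V k) (U k)"
    "\<And>k u. u \<in> carrier (U k) \<Longrightarrow> h k (f k u) = u" "\<And>k v. v \<in> carrier (V k) \<Longrightarrow> f k (h k v) = v"
    by blast
  have "h \<in> gmod_hom T V U"
    unfolding gmod_hom_def
    using graded_hom_inverse[OF assms(1) assms(2) assms(3) h] by simp
  then show ?thesis
    unfolding gmod_iso_def gmod_hom_def same_map_def using assms(3) h by auto
qed

section \<open>The associativity isomorphism of induction\<close>

context module_triple
begin

definition assoc_map where
  "assoc_map k = (SOME h. h \<in> ahom (F.V k) (G.V k) \<and> (\<forall>r m l n c d x y z. r + m = k \<longrightarrow> l + n = r \<longrightarrow>
    c \<in> carrier (A k) \<longrightarrow> d \<in> carrier (A r) \<longrightarrow> x \<in> carrier (L l) \<longrightarrow> y \<in> carrier (N n) \<longrightarrow> z \<in> carrier (M m) \<longrightarrow>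
    h (F.i k r m c (E.i r l n d x y) z) = right_gen k l n m (c \<otimes>\<^bsub>A k\<^esub> em r m d \<one>\<^bsub>A m\<^esub>) x y z))"

lemma assoc_map_hom: "assoc_map k \<in> ahom (F.V k) (G.V k)"
  and assoc_map_gen: "\<lbrakk>r + m = k; l + n = r; c \<in> carrier (A k); d \<in> carrier (A r);
      x \<in> carrier (L l); y \<in> carrier (N n); z \<in> carrier (M m)\<rbrakk> \<Longrightarrow>
    assoc_map k (F.i k r m c (E.i r l n d x y) z) = right_gen k l n m (c \<otimes>\<^bsub>A k\<^esub> em r m d \<one>\<^bsub>A m\<^esub>) x y z"
  using someI_ex[OF left_lift[OF G.IND_abelian right_gen_multilinear, unfolded Bex_def], of k]
  unfolding assoc_map_def[symmetric] by blast+

text \<open>The factor \<open>d \<otimes> 1\<close> crosses the outer tensor sign and acts on the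
  inner generator, whose unit it replaces by \<open>d\<close>.\<close>

lemma left_gen_absorb:
  assumes "r + m = k" "l + n = r" "c \<in> carrier (A k)" "d \<in> carrier (A r)"
    "x \<in> carrier (L l)" "y \<in> carrier (N n)" "z \<in> carrier (M m)"
  shows "left_gen k l n m (c \<otimes>\<^bsub>A k\<^esub> em r m d \<one>\<^bsub>A m\<^esub>) x y z = F.i k r m c (E.i r l n d x y) z"
  using assms(2)
  using F.ind_balanced[OF assms(1,3,4) A.one_closed E.ind_closed[OF assms(2) A.one_closed assms(5,6)] assms(7)]
    E.ind_smult[OF assms(2,4) A.one_closed assms(5,6)] graded_module_smult(5)[OF M assms(7)] assms(4)
  by (simp add: left_gen_def)

lemma right_gen_absorb:
  assumes "l + s = k" "n + m = s" "c \<in> carrier (A k)" "d \<in> carrier (A s)"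
    "x \<in> carrier (L l)" "y \<in> carrier (N n)" "z \<in> carrier (M m)"
  shows "right_gen k l n m (c \<otimes>\<^bsub>A k\<^esub> em l s \<one>\<^bsub>A l\<^esub> d) x y z = G.i k l s c x (E'.i s n m d y z)"
  using assms(2)
  using G.ind_balanced[OF assms(1,3) A.one_closed assms(4,5) E'.ind_closed[OF assms(2) A.one_closed assms(6,7)]]
    E'.ind_smult[OF assms(2,4) A.one_closed assms(6,7)] graded_module_smult(5)[OF L assms(5)] assms(4)
  by (simp add: right_gen_def)

lemma left_hom_eqI:
  assumes "h \<in> ahom (F.V k) V" "h' \<in> ahom (F.V k) V" "u \<in> carrier (F.V k)"
    and eq: "\<And>r m l n c d x y z. \<lbrakk>r + m = k; l + n = r; c \<in> carrier (A k); d \<in> carrier (A r);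
      x \<in> carrier (L l); y \<in> carrier (N n); z \<in> carrier (M m)\<rbrakk> \<Longrightarrow>
      h (F.i k r m c (E.i r l n d x y) z) = h' (F.i k r m c (E.i r l n d x y) z)"
  shows "h u = h' u"
proof (rule F.ind_hom_eqI[OF assms(1-3)])
  fix r m c w z assume rm: "r + m = k" and c: "c \<in> carrier (A k)" and w: "w \<in> carrier (E.V r)" and z: "z \<in> carrier (M m)"
  show "h (F.i k r m c w z) = h' (F.i k r m c w z)"
    using w
  proof (induction rule: E.ind_induct)
    case (gen l n d x y)
    then show ?case using eq rm c z by blast
  next
    case (add u v)
    then show ?case
      using F.ind_add2[OF rm c add(1,2) z] F.ind_closed[OF rm c _ z]
      by (simp add: ahom_add[OF assms(1)] ahom_add[OF assms(2)])
  qed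
qed

lemma right_hom_eqI:
  assumes "h \<in> ahom (G.V k) V" "h' \<in> ahom (G.V k) V" "u \<in> carrier (G.V k)"
    and eq: "\<And>l s n m c d x y z. \<lbrakk>l + s = k; n + m = s; c \<in> carrier (A k); d \<in> carrier (A s);
      x \<in> carrier (L l); y \<in> carrier (N n); z \<in> carrier (M m)\<rbrakk> \<Longrightarrow>
      h (G.i k l s c x (E'.i s n m d y z)) = h' (G.i k l s c x (E'.i s n m d y z))"
  shows "h u = h' u"
proof (rule G.ind_hom_eqI[OF assms(1-3)])
  fix l s c x w assume ls: "l + s = k" and c: "c \<in> carrier (A k)" and x: "x \<in> carrier (L l)" and w: "w \<in> carrier (E'.V s)"
  show "h (G.i k l s c x w) = h' (G.i k l s c x w)"
    using w
  proof (induction rule: E'.ind_induct)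
    case (gen n m d y z)
    then show ?case using eq ls c x by blast
  next
    case (add u v)
    then show ?case
      using G.ind_add3[OF ls c x add(1,2)] G.ind_closed[OF ls c x]
      by (simp add: ahom_add[OF assms(1)] ahom_add[OF assms(2)])
  qed
qed

text \<open>The inverse is the lift of \<open>left_gen\<close> along the right composite. The two
  maps exchange \<open>left_gen\<close> and \<open>right_gen\<close> with equal arguments, and the
  absorption lemmas return from normalised to arbitrary generators.\<close>

lemma assoc_map_inverse:
  "\<exists>h\<in>ahom (G.V k) (F.V k). (\<forall>u\<in>carrier (F.V k). h (assoc_map k u) = u) \<and> (\<forall>u\<in>carrier (G.V k). assoc_map k (h u) = u)"
proof -
  obtain h where h: "h \<in> ahom (G.V k) (F.V k)"
    and hg: "\<And>l s n m c d x y z. \<lbrakk>l + s = k; n + m = s; c \<in> carrier (A k); d \<in> carrier (A s);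
      x \<in> carrier (L l); y \<in> carrier (N n); z \<in> carrier (M m)\<rbrakk> \<Longrightarrow>
      h (G.i k l s c x (E'.i s n m d y z)) = left_gen k l n m (c \<otimes>\<^bsub>A k\<^esub> em l s \<one>\<^bsub>A l\<^esub> d) x y z"
    using right_lift[OF F.IND_abelian left_gen_multilinear, of k] by blast
  have hr: "h (right_gen k l n m c x y z) = left_gen k l n m c x y z"
    if "l + n + m = k" "c \<in> carrier (A k)" "x \<in> carrier (L l)" "y \<in> carrier (N n)" "z \<in> carrier (M m)" for l n m c x y z
    unfolding right_gen_def using hg[of l "n + m" n m c "\<one>\<^bsub>A (n + m)\<^esub>" x y z] em_one[of l "n + m" k] that by simp
  have al: "assoc_map k (left_gen k l n m c x y z) = right_gen k l n m c x y z"
    if "l + n + m = k" "c \<in> carrier (A k)" "x \<in> carrier (L l)" "y \<in> carrier (N n)" "z \<in> carrier (M m)" for l n m c x y z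
    unfolding left_gen_def using assoc_map_gen[of "l + n" m k l n c "\<one>\<^bsub>A (l + n)\<^esub>" x y z] em_one[of "l + n" m k] that by simp
  have "h (assoc_map k u) = u" if u: "u \<in> carrier (F.V k)" for u
    by (rule left_hom_eqI[OF ahom_comp[OF assoc_map_hom h] ahom_id u])
       (auto simp: assoc_map_gen hr left_gen_absorb)
  moreover have "assoc_map k (h u) = u" if u: "u \<in> carrier (G.V k)" for u
    by (rule right_hom_eqI[OF ahom_comp[OF h assoc_map_hom] ahom_id u])
       (auto simp: hg al right_gen_absorb)
  ultimately show ?thesis using h by blast
qed

lemma right_gen_grade:
  assumes "l + n + m = k" "c \<in> grade (A k) e" "x \<in> grade (L l) f" "y \<in> grade (N n) g" "z \<in> grade (M m) j"
  shows "right_gen k l n m c x y z \<in> grade (G.V k) (e + f + (g + j))"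
proof -
  have k: "l + (n + m) = k" using assms(1) by simp
  show ?thesis
    unfolding right_gen_def
    using G.ind_grade[OF k assms(2,3) E'.ind_grade[OF refl grade_one assms(4,5)]] by simp
qed

lemma assoc_map_graded: "assoc_map k \<in> graded_hom (A k) (F.V k) (G.V k)"
proof (rule F.ind_graded_homI[OF assoc_map_hom G.IND_graded_module])
  fix r m a c w z assume rm: "r + m = k" and a: "a \<in> carrier (A k)" and c: "c \<in> carrier (A k)"
    and w: "w \<in> carrier (E.V r)" and z: "z \<in> carrier (M m)"
  show "assoc_map k (F.i k r m (a \<otimes>\<^bsub>A k\<^esub> c) w z) = a \<odot>\<^bsub>G.V k\<^esub> assoc_map k (F.i k r m c w z)"
    using w
  proof (induction rule: E.ind_induct)
    case (gen l n d x y)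
    have "right_gen k l n m (a \<otimes>\<^bsub>A k\<^esub> (c \<otimes>\<^bsub>A k\<^esub> em r m d \<one>\<^bsub>A m\<^esub>)) x y z
        = a \<odot>\<^bsub>G.V k\<^esub> right_gen k l n m (c \<otimes>\<^bsub>A k\<^esub> em r m d \<one>\<^bsub>A m\<^esub>) x y z"
      unfolding right_gen_def
      by (rule G.ind_smult[symmetric]) (use gen a c rm z in \<open>auto intro!: E'.ind_closed\<close>)
    then show ?case using gen a c rm z by (simp add: assoc_map_gen A.m_assoc)
  next
    case (add u v)
    then show ?case
      using F.ind_add2[OF rm c add(1,2) z] F.ind_add2[OF rm A.m_closed[OF a c] add(1,2) z]
        F.ind_closed[OF rm c _ z] F.ind_closed[OF rm A.m_closed[OF a c] _ z] a
      by (simp add: ahom_add[OF assoc_map_hom] graded_module_smult(3)[OF G.IND_graded_module]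
          ahom_closed[OF assoc_map_hom])
  qed
next
  fix r m e f j c w z assume rm: "r + m = k" and c: "c \<in> grade (A k) e" and w: "w \<in> grade (E.V r) f" and z: "z \<in> grade (M m) j"
  have cc: "c \<in> carrier (A k)" by (rule AG.grade_carrier[OF c])
  have zc: "z \<in> carrier (M m)" by (rule graded_group.grade_carrier[OF graded_moduleD(4)[OF M] z])
  let ?h = "\<lambda>w. assoc_map k (F.i k r m c w z)"
  show "?h w \<in> grade (G.V k) (e + f + j)"
  proof (rule E.ind_hom_grade[where h = ?h, OF _ G.IND_abelian w])
    show "?h \<in> ahom (E.V r) (G.V k)"
      by (rule ahomI) (simp_all add: F.ind_add2[OF rm cc _ _ zc] F.ind_closed[OF rm cc _ zc]
          ahom_add[OF assoc_map_hom] ahom_closed[OF assoc_map_hom])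
    show "additive_subgroup (grade (G.V k) (e + f + j)) (G.V k)"
      by (rule graded_group.grade_subgroup[OF graded_moduleD(4)[OF G.IND_graded_module]])
    fix l n d' x' y' d x y assume ln: "l + n = r" and d: "d \<in> grade (A r) d'" and x: "x \<in> grade (L l) x'" and y: "y \<in> grade (N n) y'"
      and f: "d' + x' + y' = f"
    have "c \<otimes>\<^bsub>A k\<^esub> em r m d \<one>\<^bsub>A m\<^esub> \<in> grade (A k) (e + (d' + 0))"
      by (rule grade_mult[OF c em_grade[OF d grade_one rm]])
    \<comment> \<open>The degree of \<open>d\<close> moves to the outer algebra element and the
      inserted units have degree zero, so the total is unchanged.\<close>
    moreover have "e + (d' + 0) + x' + (y' + j) = e + f + j" using f by simp
    ultimately have "right_gen k l n m (c \<otimes>\<^bsub>A k\<^esub> em r m d \<one>\<^bsub>A m\<^esub>) x y z \<in> grade (G.V k) (e + f + j)"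
      using right_gen_grade[OF _ _ x y z, of k] ln rm by metis
    then show "?h (E.i r l n d x y) \<in> grade (G.V k) (e + f + j)"
      using assoc_map_gen[OF rm ln cc AG.grade_carrier[OF d] graded_group.grade_carrier[OF graded_moduleD(4)[OF L] x]
          graded_group.grade_carrier[OF graded_moduleD(4)[OF N] y] zc] by simp
  qed
qed

lemma assoc_map_iso: "assoc_map \<in> gmod_iso T F.V G.V"
  by (rule gmod_isoI[OF F.IND_graded_module G.IND_graded_module assoc_map_graded assoc_map_inverse])

end

text \<open>For naturality, a morphism changes only the entry \<open>x\<close> of a generator in
  either composite, while the isomorphism leaves \<open>x\<close>, \<open>y\<close>,
  \<open>z\<close> in place and acts on the algebra elements.\<close>

theorem (in nice_tower_of_algebras) I_functor_comp:
  assumes M: "M \<in> gmod T" and N: "N \<in> gmod T"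
  shows "isomorphic_functors T (gmod T) (gmod T) (gmod T)
    (I_functor T M \<circ>\<^sub>F I_functor T N) (I_functor T (IND T N M))"
  unfolding isomorphic_functors_def
proof (intro conjI exI[of _ "\<lambda>L. module_triple.assoc_map T L N M"] ballI)
  show "is_gfunctor T (gmod T) (gmod T) (I_functor T M \<circ>\<^sub>F I_functor T N)"
    by (rule is_gfunctor_comp[OF I_functor_is_gfunctor[OF M] I_functor_is_gfunctor[OF N]])
  have NM: "IND T N M \<in> gmod T" by (rule IND_gmod[OF N M])
  then show "is_gfunctor T (gmod T) (gmod T) (I_functor T (IND T N M))"
    by (rule I_functor_is_gfunctor)
  have triple: "module_triple T L N M" if "L \<in> gmod T" for L :: "('a, 'l) family"
    using that M N by (intro module_triple.intro nice_tower_of_algebras_axioms module_triple_axioms.intro gmodD(1))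
  have obj: "obj (I_functor T M \<circ>\<^sub>F I_functor T N) L = IND T (IND T L N) M"
    "obj (I_functor T (IND T N M)) L = IND T L (IND T N M)" for L :: "('a, 'l) family"
    by (simp_all add: gfunctor_comp_def I_functor_def)
  fix L :: "('a, 'l) family" assume L: "L \<in> gmod T"
  interpret D: module_triple T L N M by (rule triple[OF L])
  show "D.assoc_map \<in> gmod_iso T (obj (I_functor T M \<circ>\<^sub>F I_functor T N) L) (obj (I_functor T (IND T N M)) L)"
    unfolding obj by (rule D.assoc_map_iso)
  fix L' :: "('a, 'l) family" and f assume L': "L' \<in> gmod T" and f: "f \<in> gmod_hom T L L'"
  interpret D': module_triple T L' N M by (rule triple[OF L'])
  note fD = graded_homD[OF gmod_homD[OF f]]
  let ?g = "mor (I_functor T N) L L' f"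
  have g: "?g \<in> gmod_hom T (IND T L N) (IND T L' N)"
    using is_gfunctorD(2)[OF I_functor_is_gfunctor[OF N] L L' f] by (simp add: I_functor_def)
  note LN = IND_gmod[OF L N] IND_gmod[OF L' N]
  note I1 = I_mor[OF L L' N f] and I2 = I_mor[OF LN M g] and I3 = I_mor[OF L L' NM f]
  have mor: "mor (I_functor T M \<circ>\<^sub>F I_functor T N) L L' f = mor (I_functor T M) (IND T L N) (IND T L' N) ?g"
    by (simp add: gfunctor_comp_def I_functor_def)
  show "same_map (obj (I_functor T M \<circ>\<^sub>F I_functor T N) L)
      (\<lambda>k x. D'.assoc_map k (mor (I_functor T M \<circ>\<^sub>F I_functor T N) L L' f k x))
      (\<lambda>k x. mor (I_functor T (IND T N M)) L L' f k (D.assoc_map k x))"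
    unfolding same_map_def obj mor
  proof (intro allI ballI)
    fix k u assume u: "u \<in> carrier (IND T (IND T L N) M k)"
    show "D'.assoc_map k (mor (I_functor T M) (IND T L N) (IND T L' N) ?g k u)
        = mor (I_functor T (IND T N M)) L L' f k (D.assoc_map k u)"
    proof (rule D.left_hom_eqI[OF ahom_comp[OF I2(1) D'.assoc_map_hom] ahom_comp[OF D.assoc_map_hom I3(1)] u])
      fix r m l n c d x y z
      assume h: "r + m = k" "l + n = r" "c \<in> carrier (A k)" "d \<in> carrier (A r)"
        "x \<in> carrier (L l)" "y \<in> carrier (N n)" "z \<in> carrier (M m)"
      have E: "D.E.i r l n d x y \<in> carrier (D.E.V r)" by (rule D.E.ind_closed[OF h(2,4,5,6)])
      have E': "D.E'.i (n + m) n m \<one>\<^bsub>A (n + m)\<^esub> y z \<in> carrier (D.E'.V (n + m))"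
        by (rule D.E'.ind_closed[OF refl A.one_closed h(6,7)])
      have c: "c \<otimes>\<^bsub>A k\<^esub> em r m d \<one>\<^bsub>A m\<^esub> \<in> carrier (A k)" using h by simp
      have k: "l + (n + m) = k" using h by simp
      show "D'.assoc_map k (mor (I_functor T M) (IND T L N) (IND T L' N) ?g k (D.F.i k r m c (D.E.i r l n d x y) z))
          = mor (I_functor T (IND T N M)) L L' f k (D.assoc_map k (D.F.i k r m c (D.E.i r l n d x y) z))"
        unfolding I2(2)[OF h(1,3) E h(7)] I1(2)[OF h(2,4,5,6)] D.assoc_map_gen[OF h]
          D'.assoc_map_gen[OF h(1-4) fD(2)[OF h(5)] h(6,7)]
        unfolding D.right_gen_def D'.right_gen_def I3(2)[OF k c h(5) E'] ..
    qed
  qed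
qed

section \<open>Composites of twisted restriction functors\<close>

text \<open>\<open>E\<close> is the restriction of \<open>N\<close> along \<open>Q\<close> and
  \<open>F\<close> its further restriction along \<open>P\<close>; \<open>E'\<close> is the induced
  family of \<open>P\<close> and \<open>Q\<close>, and \<open>G\<close> the restriction of
  \<open>N\<close> along it.\<close>

locale twisted_triple = nice_tower_of_algebras T
  for T :: "('k, 'a) tower" +
  fixes P :: "('a, 'p) family" and Q :: "('a, 'q) family" and N :: "('a, 'x) family"
  assumes anti: "anti_multiplicative T"
    and P: "graded_module (alg T n) (P n)" and Q: "graded_module (alg T n) (Q n)"
    and N: "graded_module (alg T n) (N n)"
begin

sublocale E: twisted_pair T Q N by unfold_locales (rule Q N)+
sublocale E': module_pair T P Q by unfold_locales (rule P Q)+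
sublocale F: twisted_pair T P "obj (TR_functor T Q) N" by unfold_locales (rule P E.TR_graded_module)+
sublocale G: twisted_pair T "IND T P Q" N by unfold_locales (rule E'.IND_graded_module N)+

lemma anti_em: "\<lbrakk>a \<in> carrier (A m); b \<in> carrier (A n); m + n = k\<rbrakk> \<Longrightarrow>
    \<psi> k (em m n a b) = em m n (\<psi> m a) (\<psi> n b)"
  using anti by (auto simp: anti_multiplicative_def)

lemma anti_inv_em: "\<lbrakk>a \<in> carrier (A m); b \<in> carrier (A n); m + n = k\<rbrakk> \<Longrightarrow>
    \<psi>' k (em m n a b) = em m n (\<psi>' m a) (\<psi>' n b)"
  by (rule anti_injective[of _ k]) (simp_all add: anti_em)

definition left_gen where
  "left_gen k p q x y v = tr_gen T P (obj (TR_functor T Q) N) k p x (tr_gen T Q N (k + p) q y v)"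

definition right_gen where
  "right_gen k p q x y v = tr_gen T (IND T P Q) N k (p + q) (ind_gen T P Q (p + q) p q \<one>\<^bsub>A (p + q)\<^esub> x y) v"

text \<open>The index \<open>k + p + q\<close> is bracketed as in the iterated restriction. The
  restriction along \<open>IND(P, Q)\<close> lives over \<open>k + (p + q)\<close>, and its lemmas
  pass between the two forms.\<close>

definition multilinear where
  "multilinear k V \<phi> \<longleftrightarrow> (\<forall>p q. \<forall>x\<in>carrier (P p). \<forall>y\<in>carrier (Q q). \<forall>v\<in>carrier (N (k + p + q)).
    \<phi> p q x y v \<in> carrier V \<and>
    (\<forall>x'\<in>carrier (P p). \<phi> p q (x \<oplus>\<^bsub>P p\<^esub> x') y v = \<phi> p q x y v \<oplus>\<^bsub>V\<^esub> \<phi> p q x' y v) \<and>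
    (\<forall>y'\<in>carrier (Q q). \<phi> p q x (y \<oplus>\<^bsub>Q q\<^esub> y') v = \<phi> p q x y v \<oplus>\<^bsub>V\<^esub> \<phi> p q x y' v) \<and>
    (\<forall>v'\<in>carrier (N (k + p + q)). \<phi> p q x y (v \<oplus>\<^bsub>N (k + p + q)\<^esub> v') = \<phi> p q x y v \<oplus>\<^bsub>V\<^esub> \<phi> p q x y v') \<and>
    (\<forall>a\<in>carrier (A p). \<forall>b\<in>carrier (A q).
      \<phi> p q (\<psi> p a \<odot>\<^bsub>P p\<^esub> x) (\<psi> q b \<odot>\<^bsub>Q q\<^esub> y) v = \<phi> p q x y (em (k + p) q (em k p \<one>\<^bsub>A k\<^esub> a) b \<odot>\<^bsub>N (k + p + q)\<^esub> v)))"

lemma multilinearD: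
  assumes "multilinear k V \<phi>" "x \<in> carrier (P p)" "y \<in> carrier (Q q)" "v \<in> carrier (N (k + p + q))"
  shows "\<phi> p q x y v \<in> carrier V"
    and "x' \<in> carrier (P p) \<Longrightarrow> \<phi> p q (x \<oplus>\<^bsub>P p\<^esub> x') y v = \<phi> p q x y v \<oplus>\<^bsub>V\<^esub> \<phi> p q x' y v"
    and "y' \<in> carrier (Q q) \<Longrightarrow> \<phi> p q x (y \<oplus>\<^bsub>Q q\<^esub> y') v = \<phi> p q x y v \<oplus>\<^bsub>V\<^esub> \<phi> p q x y' v"
    and "v' \<in> carrier (N (k + p + q)) \<Longrightarrow> \<phi> p q x y (v \<oplus>\<^bsub>N (k + p + q)\<^esub> v') = \<phi> p q x y v \<oplus>\<^bsub>V\<^esub> \<phi> p q x y v'"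
    and "\<lbrakk>a \<in> carrier (A p); b \<in> carrier (A q)\<rbrakk> \<Longrightarrow>
      \<phi> p q (\<psi> p a \<odot>\<^bsub>P p\<^esub> x) (\<psi> q b \<odot>\<^bsub>Q q\<^esub> y) v = \<phi> p q x y (em (k + p) q (em k p \<one>\<^bsub>A k\<^esub> a) b \<odot>\<^bsub>N (k + p + q)\<^esub> v)"
  using assms unfolding multilinear_def by blast+

lemma em_split:
  assumes "a \<in> carrier (A p)" "b \<in> carrier (A q)"
  shows "em (k + p) q \<one>\<^bsub>A (k + p)\<^esub> b \<otimes>\<^bsub>A (k + p + q)\<^esub> em (k + p) q (em k p \<one>\<^bsub>A k\<^esub> a) \<one>\<^bsub>A q\<^esub>
    = em (k + p) q (em k p \<one>\<^bsub>A k\<^esub> a) b"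
  using assms by (simp add: em_mult)

text \<open>For balance, \<open>a\<close> crosses the outer tensor sign and acts on the inner
  restriction, that is, on \<open>v\<close>; next \<open>b\<close> crosses the inner sign. By
  \<open>em_split\<close> the two actions on \<open>v\<close> combine to that of
  \<open>1 \<otimes> a \<otimes> b\<close>.\<close>

lemma left_gen_multilinear: "multilinear k (F.V k) (left_gen k)"
  unfolding multilinear_def left_gen_def
proof (intro allI ballI conjI)
  fix p q x y v assume x: "x \<in> carrier (P p)" and y: "y \<in> carrier (Q q)" and v: "v \<in> carrier (N (k + p + q))"
  let ?e = "E.t (k + p) q"
  have ec: "?e y v \<in> carrier (E.V (k + p))" if "y \<in> carrier (Q q)" "v \<in> carrier (N (k + p + q))" for y v
    by (rule E.tr_closed[OF that])
  show "F.t k p x (?e y v) \<in> carrier (F.V k)"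
    by (rule F.tr_closed[OF x ec[OF y v]])
  show "F.t k p (x \<oplus>\<^bsub>P p\<^esub> x') (?e y v) = F.t k p x (?e y v) \<oplus>\<^bsub>F.V k\<^esub> F.t k p x' (?e y v)"
    if "x' \<in> carrier (P p)" for x'
    by (rule F.tr_add1[OF x that ec[OF y v]])
  show "F.t k p x (?e (y \<oplus>\<^bsub>Q q\<^esub> y') v) = F.t k p x (?e y v) \<oplus>\<^bsub>F.V k\<^esub> F.t k p x (?e y' v)"
    if "y' \<in> carrier (Q q)" for y'
    unfolding E.tr_add1[OF y that v] by (rule F.tr_add2[OF x ec[OF y v] ec[OF that v]])
  show "F.t k p x (?e y (v \<oplus>\<^bsub>N (k + p + q)\<^esub> v')) = F.t k p x (?e y v) \<oplus>\<^bsub>F.V k\<^esub> F.t k p x (?e y v')"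
    if "v' \<in> carrier (N (k + p + q))" for v'
    unfolding E.tr_add2[OF y v that] by (rule F.tr_add2[OF x ec[OF y v] ec[OF y that]])
  fix a b assume a: "a \<in> carrier (A p)" and b: "b \<in> carrier (A q)"
  note sm = graded_module_smult[OF N[of "k + p + q"]]
  have y': "\<psi> q b \<odot>\<^bsub>Q q\<^esub> y \<in> carrier (Q q)"
    by (rule graded_module_smult(1)[OF Q]) (use b y in simp_all)
  have ea: "em k p \<one>\<^bsub>A k\<^esub> a \<in> carrier (A (k + p))" using a by simp
  have w: "em (k + p) q (em k p \<one>\<^bsub>A k\<^esub> a) \<one>\<^bsub>A q\<^esub> \<odot>\<^bsub>N (k + p + q)\<^esub> v \<in> carrier (N (k + p + q))"
    by (rule sm(1)) (use a v in simp_all)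
  have "F.t k p (\<psi> p a \<odot>\<^bsub>P p\<^esub> x) (?e (\<psi> q b \<odot>\<^bsub>Q q\<^esub> y) v)
      = F.t k p x (em k p \<one>\<^bsub>A k\<^esub> a \<odot>\<^bsub>E.V (k + p)\<^esub> ?e (\<psi> q b \<odot>\<^bsub>Q q\<^esub> y) v)"
    by (rule F.tr_balanced[OF a x ec[OF y' v]])
  also have "\<dots> = F.t k p x (?e y (em (k + p) q \<one>\<^bsub>A (k + p)\<^esub> b \<odot>\<^bsub>N (k + p + q)\<^esub>
      (em (k + p) q (em k p \<one>\<^bsub>A k\<^esub> a) \<one>\<^bsub>A q\<^esub> \<odot>\<^bsub>N (k + p + q)\<^esub> v)))"
    unfolding E.tr_smult[OF ea y' v] E.tr_balanced[OF b y w] ..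
  also have "\<dots> = F.t k p x (?e y (em (k + p) q (em k p \<one>\<^bsub>A k\<^esub> a) b \<odot>\<^bsub>N (k + p + q)\<^esub> v))"
    using a b v by (simp flip: sm(4) add: em_split)
  finally show "F.t k p (\<psi> p a \<odot>\<^bsub>P p\<^esub> x) (?e (\<psi> q b \<odot>\<^bsub>Q q\<^esub> y) v)
      = F.t k p x (?e y (em (k + p) q (em k p \<one>\<^bsub>A k\<^esub> a) b \<odot>\<^bsub>N (k + p + q)\<^esub> v))" .
qed

lemma right_gen_multilinear: "multilinear k (G.V k) (right_gen k)"
  unfolding multilinear_def right_gen_def
proof (intro allI ballI conjI)
  fix p q x y v assume x: "x \<in> carrier (P p)" and y: "y \<in> carrier (Q q)" and v': "v \<in> carrier (N (k + p + q))"
  let ?e = "E'.i (p + q) p q \<one>\<^bsub>A (p + q)\<^esub>"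
  have eq: "k + p + q = k + (p + q)" by simp
  have v: "v \<in> carrier (N (k + (p + q)))" using v' by (simp only: eq)
  have ec: "?e x y \<in> carrier (E'.V (p + q))" if "x \<in> carrier (P p)" "y \<in> carrier (Q q)" for x y
    by (rule E'.ind_closed[OF refl A.one_closed that])
  show "G.t k (p + q) (?e x y) v \<in> carrier (G.V k)"
    by (rule G.tr_closed[OF ec[OF x y] v])
  show "G.t k (p + q) (?e (x \<oplus>\<^bsub>P p\<^esub> x') y) v = G.t k (p + q) (?e x y) v \<oplus>\<^bsub>G.V k\<^esub> G.t k (p + q) (?e x' y) v"
    if "x' \<in> carrier (P p)" for x'
    unfolding E'.ind_add2[OF refl A.one_closed x that y] by (rule G.tr_add1[OF ec[OF x y] ec[OF that y] v])
  show "G.t k (p + q) (?e x (y \<oplus>\<^bsub>Q q\<^esub> y')) v = G.t k (p + q) (?e x y) v \<oplus>\<^bsub>G.V k\<^esub> G.t k (p + q) (?e x y') v"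
    if "y' \<in> carrier (Q q)" for y'
    unfolding E'.ind_add3[OF refl A.one_closed x y that] by (rule G.tr_add1[OF ec[OF x y] ec[OF x that] v])
  show "G.t k (p + q) (?e x y) (v \<oplus>\<^bsub>N (k + p + q)\<^esub> v') = G.t k (p + q) (?e x y) v \<oplus>\<^bsub>G.V k\<^esub> G.t k (p + q) (?e x y) v'"
    if "v' \<in> carrier (N (k + p + q))" for v'
    unfolding eq by (rule G.tr_add2[OF ec[OF x y] v that[unfolded eq]])
  fix a b assume a: "a \<in> carrier (A p)" and b: "b \<in> carrier (A q)"
  \<comment> \<open>Compatibility of the anti-automorphisms with the tower combines the two twists
    into the one twist by which \<open>A_(p+q)\<close> crosses to \<open>v\<close>.\<close>
  have "?e (\<psi> p a \<odot>\<^bsub>P p\<^esub> x) (\<psi> q b \<odot>\<^bsub>Q q\<^esub> y) = \<psi> (p + q) (em p q a b) \<odot>\<^bsub>E'.V (p + q)\<^esub> ?e x y"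
    using E'.ind_smult[OF refl _ A.one_closed x y, of "em p q (\<psi> p a) (\<psi> q b)"]
      E'.ind_balanced[OF refl A.one_closed _ _ x y, of "\<psi> p a" "\<psi> q b"] a b by (simp add: anti_em)
  then show "G.t k (p + q) (?e (\<psi> p a \<odot>\<^bsub>P p\<^esub> x) (\<psi> q b \<odot>\<^bsub>Q q\<^esub> y)) v
      = G.t k (p + q) (?e x y) (em (k + p) q (em k p \<one>\<^bsub>A k\<^esub> a) b \<odot>\<^bsub>N (k + p + q)\<^esub> v)"
    unfolding eq em_assoc[OF A.one_closed a b refl refl]
    using G.tr_balanced[OF em_closed[OF a b refl] ec[OF x y] v] by simp
qed

text \<open>With \<open>x\<close> frozen, the inner restriction is lifted by balance at
  \<open>a = 1\<close>; the outer lift then uses balance at \<open>b = 1\<close>.\<close>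

lemma left_lift:
  assumes V: "abelian_group V" and \<phi>: "multilinear k V \<phi>"
  shows "\<exists>h\<in>ahom (F.V k) V. \<forall>p q. \<forall>x\<in>carrier (P p). \<forall>y\<in>carrier (Q q). \<forall>v\<in>carrier (N (k + p + q)).
    h (left_gen k p q x y v) = \<phi> p q x y v"
proof -
  interpret V: abelian_group V by (rule V)
  note mc = multilinearD[OF \<phi>]
  define R where "R p x h \<longleftrightarrow> h \<in> ahom (E.V (k + p)) V \<and>
      (\<forall>q. \<forall>y\<in>carrier (Q q). \<forall>v\<in>carrier (N (k + p + q)). h (E.t (k + p) q y v) = \<phi> p q x y v)" for p x h
  define H where "H p x = (SOME h. R p x h)" for p x
  have RH: "R p x (H p x)" if x: "x \<in> carrier (P p)" for p x
  proof -
    have "\<exists>h\<in>ahom (E.V (k + p)) V. \<forall>q. \<forall>y\<in>carrier (Q q). \<forall>v\<in>carrier (N (k + p + q)). h (E.t (k + p) q y v) = \<phi> p q x y v"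
    proof (rule E.tr_lift[OF V])
      fix q y v assume y: "y \<in> carrier (Q q)" and v: "v \<in> carrier (N (k + p + q))"
      note m = mc[OF x y v]
      show "\<phi> p q x y v \<in> carrier V" by (rule m(1))
      show "\<phi> p q x (y \<oplus>\<^bsub>Q q\<^esub> y') v = \<phi> p q x y v \<oplus>\<^bsub>V\<^esub> \<phi> p q x y' v" if "y' \<in> carrier (Q q)" for y'
        by (rule m(3)[OF that])
      show "\<phi> p q x y (v \<oplus>\<^bsub>N (k + p + q)\<^esub> v') = \<phi> p q x y v \<oplus>\<^bsub>V\<^esub> \<phi> p q x y v'" if "v' \<in> carrier (N (k + p + q))" for v'
        by (rule m(4)[OF that])
      show "\<phi> p q x (\<psi> q b \<odot>\<^bsub>Q q\<^esub> y) v = \<phi> p q x y (em (k + p) q \<one>\<^bsub>A (k + p)\<^esub> b \<odot>\<^bsub>N (k + p + q)\<^esub> v)"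
        if "b \<in> carrier (A q)" for b
        using m(5)[OF A.one_closed that] graded_module_smult(5)[OF P x] by (simp add: em_one)
    qed
    then have "\<exists>h. R p x h" by (auto simp: R_def)
    then show ?thesis unfolding H_def by (rule someI_ex)
  qed
  have H: "H p x \<in> ahom (E.V (k + p)) V" if "x \<in> carrier (P p)" for p x
    using RH[OF that] by (simp add: R_def)
  have HE: "H p x (E.t (k + p) q y v) = \<phi> p q x y v"
    if "x \<in> carrier (P p)" "y \<in> carrier (Q q)" "v \<in> carrier (N (k + p + q))" for p q x y v
    using RH[OF that(1)] that(2,3) by (simp add: R_def)
  have "\<exists>h\<in>ahom (F.V k) V. \<forall>p. \<forall>x\<in>carrier (P p). \<forall>w\<in>carrier (E.V (k + p)). h (F.t k p x w) = H p x w"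
  proof (rule F.tr_lift[OF V])
    fix p x w assume x: "x \<in> carrier (P p)" and w: "w \<in> carrier (E.V (k + p))"
    show "H p x w \<in> carrier V" by (rule ahom_closed[OF H[OF x] w])
    show "H p x (w \<oplus>\<^bsub>E.V (k + p)\<^esub> w') = H p x w \<oplus>\<^bsub>V\<^esub> H p x w'" if "w' \<in> carrier (E.V (k + p))" for w'
      by (rule ahom_add[OF H[OF x] w that])
    show "H p (x \<oplus>\<^bsub>P p\<^esub> x') w = H p x w \<oplus>\<^bsub>V\<^esub> H p x' w" if x': "x' \<in> carrier (P p)" for x'
    proof -
      interpret Pp: abelian_group "P p" by (rule graded_moduleD(3)[OF P])
      show ?thesis
        using w
      proof (induction rule: E.tr_induct)
        case (gen q y v)
        then show ?case using x x' mc(2)[OF x gen x'] by (simp add: HE)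
      next
        case (add u v)
        then show ?case
          using ahom_closed[OF H[OF x]] ahom_closed[OF H[OF x']] x x'
          by (simp add: ahom_add[OF H] V.a_ac)
      qed
    qed
    show "H p (\<psi> p a \<odot>\<^bsub>P p\<^esub> x) w = H p x (em k p \<one>\<^bsub>A k\<^esub> a \<odot>\<^bsub>E.V (k + p)\<^esub> w)" if a: "a \<in> carrier (A p)" for a
    proof -
      have ax: "\<psi> p a \<odot>\<^bsub>P p\<^esub> x \<in> carrier (P p)"
        by (rule graded_module_smult(1)[OF P]) (use a x in simp_all)
      have ea: "em k p \<one>\<^bsub>A k\<^esub> a \<in> carrier (A (k + p))" using a by simp
      show ?thesis
        using w
      proof (induction rule: E.tr_induct)
        case (gen q y v)
        have "em (k + p) q (em k p \<one>\<^bsub>A k\<^esub> a) \<one>\<^bsub>A q\<^esub> \<odot>\<^bsub>N (k + p + q)\<^esub> v \<in> carrier (N (k + p + q))"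
          by (rule graded_module_smult(1)[OF N]) (use a gen in simp_all)
        then show ?case
          using mc(5)[OF x gen a A.one_closed] graded_module_smult(5)[OF Q gen(1)] gen x ax ea
          by (simp add: HE E.tr_smult)
      next
        case (add u v)
        then show ?case
          using ea by (simp add: ahom_add[OF H[OF ax]] ahom_add[OF H[OF x]] graded_module_smult[OF E.TR_graded_module])
      qed
    qed
  qed
  then obtain h where h: "h \<in> ahom (F.V k) V"
    and hH: "\<And>p x w. \<lbrakk>x \<in> carrier (P p); w \<in> carrier (E.V (k + p))\<rbrakk> \<Longrightarrow> h (F.t k p x w) = H p x w"
    by blast
  show ?thesis
    by (rule bexI[OF _ h]) (auto simp: left_gen_def hH HE E.tr_closed)
qed

text \<open>In \<open>P\<^sup>\<psi> \<otimes> X\<close> the relation \<open>\<psi>(a)x \<otimes> v = x \<otimes> av\<close> holds, so moving \<open>c\<close> across the tensor sign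
  turns it into the inverse image of \<open>c\<close> under \<open>\<psi>\<close>.\<close>

lemma right_lift:
  assumes V: "abelian_group V" and \<phi>: "multilinear k V \<phi>"
  shows "\<exists>h\<in>ahom (G.V k) V. \<forall>r p q c x y v. p + q = r \<longrightarrow> c \<in> carrier (A r) \<longrightarrow>
    x \<in> carrier (P p) \<longrightarrow> y \<in> carrier (Q q) \<longrightarrow> v \<in> carrier (N (k + r)) \<longrightarrow>
    h (G.t k r (E'.i r p q c x y) v) = \<phi> p q x y (em k r \<one>\<^bsub>A k\<^esub> (\<psi>' r c) \<odot>\<^bsub>N (k + r)\<^esub> v)"
proof -
  interpret V: abelian_group V by (rule V)
  note sm = graded_module_smult[OF N]
  have act: "em k r \<one>\<^bsub>A k\<^esub> d \<odot>\<^bsub>N (k + r)\<^esub> v \<in> carrier (N (k + r))"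
    if "d \<in> carrier (A r)" "v \<in> carrier (N (k + r))" for r d v
    by (rule sm(1)) (use that in simp_all)
  \<comment> \<open>Multilinearity is restated with \<open>p + q = r\<close>, since the lift along
    \<open>IND(P, Q)\<close> needs one index \<open>k + r\<close> for all splittings of
    \<open>r\<close>.\<close>
  have mc: "\<phi> p q x y v \<in> carrier V"
    "x' \<in> carrier (P p) \<Longrightarrow> \<phi> p q (x \<oplus>\<^bsub>P p\<^esub> x') y v = \<phi> p q x y v \<oplus>\<^bsub>V\<^esub> \<phi> p q x' y v"
    "y' \<in> carrier (Q q) \<Longrightarrow> \<phi> p q x (y \<oplus>\<^bsub>Q q\<^esub> y') v = \<phi> p q x y v \<oplus>\<^bsub>V\<^esub> \<phi> p q x y' v"
    "v' \<in> carrier (N (k + r)) \<Longrightarrow> \<phi> p q x y (v \<oplus>\<^bsub>N (k + r)\<^esub> v') = \<phi> p q x y v \<oplus>\<^bsub>V\<^esub> \<phi> p q x y v'"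
    "\<lbrakk>a \<in> carrier (A p); b \<in> carrier (A q)\<rbrakk> \<Longrightarrow>
      \<phi> p q (\<psi> p a \<odot>\<^bsub>P p\<^esub> x) (\<psi> q b \<odot>\<^bsub>Q q\<^esub> y) v = \<phi> p q x y (em k r \<one>\<^bsub>A k\<^esub> (em p q a b) \<odot>\<^bsub>N (k + r)\<^esub> v)"
    if "p + q = r" "x \<in> carrier (P p)" "y \<in> carrier (Q q)" "v \<in> carrier (N (k + r))" for p q r x x' y y' v v' a b
  proof -
    have eq: "k + p + q = k + r" using that(1) by simp
    have v: "v \<in> carrier (N (k + p + q))" using that(4) by (simp only: eq)
    note m = multilinearD[OF \<phi> that(2,3) v, unfolded eq]
    show "\<phi> p q x y v \<in> carrier V" by (rule m(1))
    show "x' \<in> carrier (P p) \<Longrightarrow> \<phi> p q (x \<oplus>\<^bsub>P p\<^esub> x') y v = \<phi> p q x y v \<oplus>\<^bsub>V\<^esub> \<phi> p q x' y v" by (rule m(2))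
    show "y' \<in> carrier (Q q) \<Longrightarrow> \<phi> p q x (y \<oplus>\<^bsub>Q q\<^esub> y') v = \<phi> p q x y v \<oplus>\<^bsub>V\<^esub> \<phi> p q x y' v" by (rule m(3))
    show "v' \<in> carrier (N (k + r)) \<Longrightarrow> \<phi> p q x y (v \<oplus>\<^bsub>N (k + r)\<^esub> v') = \<phi> p q x y v \<oplus>\<^bsub>V\<^esub> \<phi> p q x y v'" by (rule m(4))
    show "\<phi> p q (\<psi> p a \<odot>\<^bsub>P p\<^esub> x) (\<psi> q b \<odot>\<^bsub>Q q\<^esub> y) v = \<phi> p q x y (em k r \<one>\<^bsub>A k\<^esub> (em p q a b) \<odot>\<^bsub>N (k + r)\<^esub> v)"
      if "a \<in> carrier (A p)" "b \<in> carrier (A q)"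
      using m(5)[OF that] em_assoc[OF A.one_closed that refl \<open>p + q = r\<close>] by simp
  qed
  define R where "R r v h \<longleftrightarrow> h \<in> ahom (E'.V r) V \<and> (\<forall>p q. p + q = r \<longrightarrow> (\<forall>c\<in>carrier (A r). \<forall>x\<in>carrier (P p). \<forall>y\<in>carrier (Q q).
      h (E'.i r p q c x y) = \<phi> p q x y (em k r \<one>\<^bsub>A k\<^esub> (\<psi>' r c) \<odot>\<^bsub>N (k + r)\<^esub> v)))" for r v h
  define H where "H r v = (SOME h. R r v h)" for r v
  have RH: "R r v (H r v)" if v: "v \<in> carrier (N (k + r))" for r v
  proof -
    have "\<exists>h\<in>ahom (E'.V r) V. \<forall>p q. p + q = r \<longrightarrow> (\<forall>c\<in>carrier (A r). \<forall>x\<in>carrier (P p). \<forall>y\<in>carrier (Q q).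
      h (E'.i r p q c x y) = \<phi> p q x y (em k r \<one>\<^bsub>A k\<^esub> (\<psi>' r c) \<odot>\<^bsub>N (k + r)\<^esub> v))"
    proof (rule E'.ind_lift[OF V])
      fix p q c x y assume pq: "p + q = r" and c: "c \<in> carrier (A r)" and x: "x \<in> carrier (P p)" and y: "y \<in> carrier (Q q)"
      let ?w = "\<lambda>c. em k r \<one>\<^bsub>A k\<^esub> (\<psi>' r c) \<odot>\<^bsub>N (k + r)\<^esub> v"
      have w: "?w c \<in> carrier (N (k + r))" if "c \<in> carrier (A r)" for c
        by (rule act[OF anti_inv_closed[OF that] v])
      note m = mc[OF pq x y w[OF c]]
      show "\<phi> p q x y (?w c) \<in> carrier V" by (rule m(1))
      show "\<phi> p q x y (?w (c \<oplus>\<^bsub>A r\<^esub> c')) = \<phi> p q x y (?w c) \<oplus>\<^bsub>V\<^esub> \<phi> p q x y (?w c')" if c': "c' \<in> carrier (A r)" for c'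
        using m(4)[OF w[OF c']] c c' v by (simp add: anti_inv_add em_add_right sm(2))
      show "\<phi> p q (x \<oplus>\<^bsub>P p\<^esub> x') y (?w c) = \<phi> p q x y (?w c) \<oplus>\<^bsub>V\<^esub> \<phi> p q x' y (?w c)" if "x' \<in> carrier (P p)" for x'
        by (rule m(2)[OF that])
      show "\<phi> p q x (y \<oplus>\<^bsub>Q q\<^esub> y') (?w c) = \<phi> p q x y (?w c) \<oplus>\<^bsub>V\<^esub> \<phi> p q x y' (?w c)" if "y' \<in> carrier (Q q)" for y'
        by (rule m(3)[OF that])
      show "\<phi> p q x y (?w (c \<otimes>\<^bsub>A r\<^esub> em p q a b)) = \<phi> p q (a \<odot>\<^bsub>P p\<^esub> x) (b \<odot>\<^bsub>Q q\<^esub> y) (?w c)"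
        if a: "a \<in> carrier (A p)" and b: "b \<in> carrier (A q)" for a b
      proof -
        \<comment> \<open>As \<open>\<psi>'\<close> reverses products, the part from
          \<open>a\<close> and \<open>b\<close> stands on the left and acts on \<open>v\<close>
          last, after \<open>\<psi>'\<close> of \<open>c\<close>. This is the position in which
          balance can move it to \<open>x\<close> and \<open>y\<close>.\<close>
        have "em k r \<one>\<^bsub>A k\<^esub> (\<psi>' r (c \<otimes>\<^bsub>A r\<^esub> em p q a b))
            = em k r \<one>\<^bsub>A k\<^esub> (em p q (\<psi>' p a) (\<psi>' q b)) \<otimes>\<^bsub>A (k + r)\<^esub> em k r \<one>\<^bsub>A k\<^esub> (\<psi>' r c)"
          using a b c pq by (simp add: anti_inv_mult anti_inv_em em_mult)
        then have "?w (c \<otimes>\<^bsub>A r\<^esub> em p q a b) = em k r \<one>\<^bsub>A k\<^esub> (em p q (\<psi>' p a) (\<psi>' q b)) \<odot>\<^bsub>N (k + r)\<^esub> ?w c"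
          using a b c pq v by (simp add: sm(4))
        then show ?thesis
          using m(5)[of "\<psi>' p a" "\<psi>' q b"] a b by simp
      qed
    qed
    then have "\<exists>h. R r v h" by (auto simp: R_def)
    then show ?thesis unfolding H_def by (rule someI_ex)
  qed
  have H: "H r v \<in> ahom (E'.V r) V" if "v \<in> carrier (N (k + r))" for r v
    using RH[OF that] by (simp add: R_def)
  have HE: "H r v (E'.i r p q c x y) = \<phi> p q x y (em k r \<one>\<^bsub>A k\<^esub> (\<psi>' r c) \<odot>\<^bsub>N (k + r)\<^esub> v)"
    if "v \<in> carrier (N (k + r))" "p + q = r" "c \<in> carrier (A r)" "x \<in> carrier (P p)" "y \<in> carrier (Q q)" for r v p q c x y
    using RH[OF that(1)] that(2-5) by (simp add: R_def)
  have "\<exists>h\<in>ahom (G.V k) V. \<forall>r. \<forall>w\<in>carrier (E'.V r). \<forall>v\<in>carrier (N (k + r)). h (G.t k r w v) = H r v w"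
  proof (rule G.tr_lift[OF V])
    fix r w v assume w: "w \<in> carrier (E'.V r)" and v: "v \<in> carrier (N (k + r))"
    show "H r v w \<in> carrier V" by (rule ahom_closed[OF H[OF v] w])
    show "H r v (w \<oplus>\<^bsub>E'.V r\<^esub> w') = H r v w \<oplus>\<^bsub>V\<^esub> H r v w'" if "w' \<in> carrier (E'.V r)" for w'
      by (rule ahom_add[OF H[OF v] w that])
    show "H r (v \<oplus>\<^bsub>N (k + r)\<^esub> v') w = H r v w \<oplus>\<^bsub>V\<^esub> H r v' w" if v': "v' \<in> carrier (N (k + r))" for v'
    proof -
      interpret Nn: abelian_group "N (k + r)" by (rule graded_moduleD(3)[OF N])
      show ?thesis
        using w
      proof (induction rule: E'.ind_induct)
        case (gen p q c x y)
        have d: "\<psi>' r c \<in> carrier (A r)" using gen by simp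
        show ?case
          using v v' gen mc(4)[OF gen(1,3,4) act[OF d v] act[OF d v']] by (simp add: HE sm(3))
      next
        case (add u u')
        then show ?case
          using ahom_closed[OF H[OF v]] ahom_closed[OF H[OF v']] v v'
          by (simp add: ahom_add[OF H] V.a_ac)
      qed
    qed
    show "H r v (\<psi> r a \<odot>\<^bsub>E'.V r\<^esub> w) = H r (em k r \<one>\<^bsub>A k\<^esub> a \<odot>\<^bsub>N (k + r)\<^esub> v) w" if a: "a \<in> carrier (A r)" for a
      using w
    proof (induction rule: E'.ind_induct)
      case (gen p q c x y)
      \<comment> \<open>The reversal cancels the twist: \<open>\<psi>'\<close> of
        \<open>\<psi>(a) c\<close> is \<open>\<psi>'(c) a\<close>, so \<open>a\<close> acts on
        \<open>v\<close> first, as the outer balance demands.\<close>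
      have "em k r \<one>\<^bsub>A k\<^esub> (\<psi>' r (\<psi> r a \<otimes>\<^bsub>A r\<^esub> c)) = em k r \<one>\<^bsub>A k\<^esub> (\<psi>' r c) \<otimes>\<^bsub>A (k + r)\<^esub> em k r \<one>\<^bsub>A k\<^esub> a"
        using a gen by (simp add: anti_inv_mult em_mult)
      then show ?case
        using a v gen act[OF a v] by (simp add: E'.ind_smult HE sm(4))
    next
      case (add u u')
      then show ?case
        using a v act[OF a v] by (simp add: ahom_add[OF H] graded_module_smult[OF E'.IND_graded_module])
    qed
  qed
  then obtain h where h: "h \<in> ahom (G.V k) V"
    and hH: "\<And>r w v. \<lbrakk>w \<in> carrier (E'.V r); v \<in> carrier (N (k + r))\<rbrakk> \<Longrightarrow> h (G.t k r w v) = H r v w"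
    by blast
  show ?thesis
    by (rule bexI[OF _ h]) (auto simp: hH HE E'.ind_closed)
qed

section \<open>The composition isomorphism of twisted restriction\<close>

definition assoc_map where
  "assoc_map k = (SOME h. h \<in> ahom (F.V k) (G.V k) \<and>
    (\<forall>p q. \<forall>x\<in>carrier (P p). \<forall>y\<in>carrier (Q q). \<forall>v\<in>carrier (N (k + p + q)).
      h (left_gen k p q x y v) = right_gen k p q x y v))"

lemma assoc_map_hom: "assoc_map k \<in> ahom (F.V k) (G.V k)"
  and assoc_map_gen: "\<lbrakk>x \<in> carrier (P p); y \<in> carrier (Q q); v \<in> carrier (N (k + p + q))\<rbrakk> \<Longrightarrow>
    assoc_map k (left_gen k p q x y v) = right_gen k p q x y v"
  using someI_ex[OF left_lift[OF G.TR_abelian right_gen_multilinear, unfolded Bex_def], of k]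
  unfolding assoc_map_def[symmetric] by blast+

lemma left_hom_eqI:
  assumes "h \<in> ahom (F.V k) V" "h' \<in> ahom (F.V k) V" "u \<in> carrier (F.V k)"
    and eq: "\<And>p q x y v. \<lbrakk>x \<in> carrier (P p); y \<in> carrier (Q q); v \<in> carrier (N (k + p + q))\<rbrakk> \<Longrightarrow>
      h (left_gen k p q x y v) = h' (left_gen k p q x y v)"
  shows "h u = h' u"
proof (rule F.tr_hom_eqI[OF assms(1-3)])
  fix p x w assume x: "x \<in> carrier (P p)" and w: "w \<in> carrier (E.V (k + p))"
  show "h (F.t k p x w) = h' (F.t k p x w)"
    using w
  proof (induction rule: E.tr_induct)
    case (gen q y v)
    then show ?case using eq[of x p y q v] x by (simp add: left_gen_def)
  next
    case (add u v)
    then show ?case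
      using F.tr_add2[OF x add(1,2)] F.tr_closed[OF x]
      by (simp add: ahom_add[OF assms(1)] ahom_add[OF assms(2)])
  qed
qed

text \<open>Written as \<open>\<psi>\<close> of \<open>\<psi>' r c\<close>, the element
  \<open>c\<close> is a twisted scalar acting on the generator with unit, and it crosses to
  \<open>v\<close>.\<close>

lemma right_gen_absorb:
  assumes "p + q = r" "c \<in> carrier (A r)" "x \<in> carrier (P p)" "y \<in> carrier (Q q)" "v \<in> carrier (N (k + r))"
  shows "right_gen k p q x y (em k r \<one>\<^bsub>A k\<^esub> (\<psi>' r c) \<odot>\<^bsub>N (k + r)\<^esub> v) = G.t k r (E'.i r p q c x y) v"
proof -
  have "E'.i r p q c x y = \<psi> r (\<psi>' r c) \<odot>\<^bsub>E'.V r\<^esub> E'.i r p q \<one>\<^bsub>A r\<^esub> x y"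
    using E'.ind_smult[OF assms(1,2) A.one_closed assms(3,4)] assms(2) by simp
  then show ?thesis
    using G.tr_balanced[OF anti_inv_closed[OF assms(2)] E'.ind_closed[OF assms(1) A.one_closed assms(3,4)] assms(5)] assms(1)
    by (auto simp: right_gen_def)
qed

lemma right_hom_eqI:
  assumes "h \<in> ahom (G.V k) V" "h' \<in> ahom (G.V k) V" "u \<in> carrier (G.V k)"
    and eq: "\<And>r p q c x y v. \<lbrakk>p + q = r; c \<in> carrier (A r); x \<in> carrier (P p); y \<in> carrier (Q q); v \<in> carrier (N (k + r))\<rbrakk> \<Longrightarrow>
      h (G.t k r (E'.i r p q c x y) v) = h' (G.t k r (E'.i r p q c x y) v)"
  shows "h u = h' u"
proof (rule G.tr_hom_eqI[OF assms(1-3)])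
  fix r w v assume w: "w \<in> carrier (E'.V r)" and v: "v \<in> carrier (N (k + r))"
  show "h (G.t k r w v) = h' (G.t k r w v)"
    using w
  proof (induction rule: E'.ind_induct)
    case (gen p q c x y)
    then show ?case using eq v by blast
  next
    case (add u u')
    then show ?case
      using G.tr_add1[OF add(1,2) v] G.tr_closed[OF _ v]
      by (simp add: ahom_add[OF assms(1)] ahom_add[OF assms(2)])
  qed
qed

lemma assoc_map_inverse:
  "\<exists>h\<in>ahom (G.V k) (F.V k). (\<forall>u\<in>carrier (F.V k). h (assoc_map k u) = u) \<and> (\<forall>u\<in>carrier (G.V k). assoc_map k (h u) = u)"
proof -
  obtain h where h: "h \<in> ahom (G.V k) (F.V k)"
    and hg: "\<And>r p q c x y v. \<lbrakk>p + q = r; c \<in> carrier (A r); x \<in> carrier (P p); y \<in> carrier (Q q); v \<in> carrier (N (k + r))\<rbrakk> \<Longrightarrow>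
      h (G.t k r (E'.i r p q c x y) v) = left_gen k p q x y (em k r \<one>\<^bsub>A k\<^esub> (\<psi>' r c) \<odot>\<^bsub>N (k + r)\<^esub> v)"
    using right_lift[OF F.TR_abelian left_gen_multilinear, of k] by blast
  have hr: "h (right_gen k p q x y v) = left_gen k p q x y v"
    if "x \<in> carrier (P p)" "y \<in> carrier (Q q)" "v \<in> carrier (N (k + p + q))" for p q x y v
  proof -
    have v: "v \<in> carrier (N (k + (p + q)))" using that(3) by (simp add: add.assoc)
    show ?thesis
      unfolding right_gen_def
      \<comment> \<open>In the normalised generator \<open>c = 1\<close>, so its preimage under
        \<open>\<psi>\<close> is the unit and \<open>v\<close> stays as it is.\<close>
      using hg[OF refl A.one_closed that(1,2) v] graded_module_smult(5)[OF N v] by (simp add: em_one)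
  qed
  have "h (assoc_map k u) = u" if u: "u \<in> carrier (F.V k)" for u
    by (rule left_hom_eqI[OF ahom_comp[OF assoc_map_hom h] ahom_id u]) (simp add: assoc_map_gen hr)
  moreover have "assoc_map k (h u) = u" if u: "u \<in> carrier (G.V k)" for u
  proof (rule right_hom_eqI[OF ahom_comp[OF h assoc_map_hom] ahom_id u])
    fix r p q c x y v
    assume g: "p + q = r" "c \<in> carrier (A r)" "x \<in> carrier (P p)" "y \<in> carrier (Q q)" "v \<in> carrier (N (k + r))"
    have "em k r \<one>\<^bsub>A k\<^esub> (\<psi>' r c) \<odot>\<^bsub>N (k + r)\<^esub> v \<in> carrier (N (k + r))"
      by (rule graded_module_smult(1)[OF N]) (use g in simp_all)
    then have "em k r \<one>\<^bsub>A k\<^esub> (\<psi>' r c) \<odot>\<^bsub>N (k + r)\<^esub> v \<in> carrier (N (k + p + q))"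
      using g(1) by (simp add: add.assoc)
    then show "assoc_map k (h (G.t k r (E'.i r p q c x y) v)) = G.t k r (E'.i r p q c x y) v"
      unfolding hg[OF g] by (simp only: assoc_map_gen[OF g(3,4)] right_gen_absorb[OF g])
  qed
  ultimately show ?thesis using h by blast
qed

lemma right_gen_grade:
  assumes "x \<in> grade (P p) d" "y \<in> grade (Q q) e" "v \<in> grade (N (k + p + q)) f"
  shows "right_gen k p q x y v \<in> grade (G.V k) (d + (e + f))"
proof -
  have v: "v \<in> grade (N (k + (p + q))) f" using assms(3) by (simp add: add.assoc)
  show ?thesis
    unfolding right_gen_def
    using G.tr_grade[OF E'.ind_grade[OF refl grade_one assms(1,2)] v] by (simp add: add.assoc)
qed

text \<open>In the iterated restriction \<open>A_k\<close> acts through two successive units, in the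
  other one through the unit of \<open>A_(p+q)\<close>; associativity of the tower identifies the
  two.\<close>

lemma right_gen_smult:
  assumes "a \<in> carrier (A k)" "x \<in> carrier (P p)" "y \<in> carrier (Q q)" "v \<in> carrier (N (k + p + q))"
  shows "right_gen k p q x y (em (k + p) q (em k p a \<one>\<^bsub>A p\<^esub>) \<one>\<^bsub>A q\<^esub> \<odot>\<^bsub>N (k + p + q)\<^esub> v)
    = a \<odot>\<^bsub>G.V k\<^esub> right_gen k p q x y v"
proof -
  have v: "v \<in> carrier (N (k + (p + q)))" using assms(4) by (simp add: add.assoc)
  have "em (k + p) q (em k p a \<one>\<^bsub>A p\<^esub>) \<one>\<^bsub>A q\<^esub> = em k (p + q) a \<one>\<^bsub>A (p + q)\<^esub>"
    using em_assoc[OF assms(1) A.one_closed A.one_closed refl refl, of p q] by (simp add: em_one)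
  then show ?thesis
    unfolding right_gen_def
    using G.tr_smult[OF assms(1) E'.ind_closed[OF refl A.one_closed assms(2,3)] v] by (simp add: add.assoc)
qed

lemma assoc_map_graded: "assoc_map k \<in> graded_hom (A k) (F.V k) (G.V k)"
proof (rule F.tr_graded_homI[OF assoc_map_hom G.TR_graded_module])
  fix p a x w assume a: "a \<in> carrier (A k)" and x: "x \<in> carrier (P p)" and w: "w \<in> carrier (E.V (k + p))"
  have ea: "em k p a \<one>\<^bsub>A p\<^esub> \<in> carrier (A (k + p))" using a by simp
  note sm = graded_module_smult[OF E.TR_graded_module[of "k + p"]]
  show "assoc_map k (F.t k p x (em k p a \<one>\<^bsub>A p\<^esub> \<odot>\<^bsub>E.V (k + p)\<^esub> w)) = a \<odot>\<^bsub>G.V k\<^esub> assoc_map k (F.t k p x w)"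
    using w
  proof (induction rule: E.tr_induct)
    case (gen q y v)
    let ?v = "em (k + p) q (em k p a \<one>\<^bsub>A p\<^esub>) \<one>\<^bsub>A q\<^esub> \<odot>\<^bsub>N (k + p + q)\<^esub> v"
    have "?v \<in> carrier (N (k + p + q))"
      by (rule graded_module_smult(1)[OF N]) (use ea gen in simp_all)
    then have "assoc_map k (left_gen k p q x y ?v) = right_gen k p q x y ?v"
      using assoc_map_gen x gen by blast
    then show ?case
      unfolding E.tr_smult[OF ea gen] left_gen_def[symmetric] assoc_map_gen[OF x gen]
      by (simp only: right_gen_smult[OF a x gen])
  next
    case (add u v)
    then show ?case
      using F.tr_add2[OF x add(1,2)] F.tr_add2[OF x sm(1)[OF ea add(1)] sm(1)[OF ea add(2)]]
        F.tr_closed[OF x] ea a sm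
      by (simp add: ahom_add[OF assoc_map_hom] graded_module_smult(3)[OF G.TR_graded_module]
          ahom_closed[OF assoc_map_hom])
  qed
next
  fix p e f x w assume x: "x \<in> grade (P p) e" and w: "w \<in> grade (E.V (k + p)) f"
  have xc: "x \<in> carrier (P p)" by (rule graded_group.grade_carrier[OF graded_moduleD(4)[OF P] x])
  let ?h = "\<lambda>w. assoc_map k (F.t k p x w)"
  show "?h w \<in> grade (G.V k) (e + f)"
  proof (rule E.tr_hom_grade[where h = ?h, OF _ G.TR_abelian w])
    show "?h \<in> ahom (E.V (k + p)) (G.V k)"
      by (rule ahomI) (simp_all add: F.tr_add2[OF xc] F.tr_closed[OF xc]
          ahom_add[OF assoc_map_hom] ahom_closed[OF assoc_map_hom])
    show "additive_subgroup (grade (G.V k) (e + f)) (G.V k)"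
      by (rule graded_group.grade_subgroup[OF graded_moduleD(4)[OF G.TR_graded_module]])
    fix q d d' y v assume y: "y \<in> grade (Q q) d" and v: "v \<in> grade (N (k + p + q)) d'" and f: "d + d' = f"
    show "?h (E.t (k + p) q y v) \<in> grade (G.V k) (e + f)"
      using right_gen_grade[OF x y v] f
        assoc_map_gen[OF xc graded_group.grade_carrier[OF graded_moduleD(4)[OF Q] y]
          graded_group.grade_carrier[OF graded_moduleD(4)[OF N] v], unfolded left_gen_def] by simp
  qed
qed

lemma assoc_map_iso: "assoc_map \<in> gmod_iso T F.V G.V"
  by (rule gmod_isoI[OF F.TR_graded_module G.TR_graded_module assoc_map_graded assoc_map_inverse])

end

text \<open>For naturality, a morphism only touches the entry \<open>v\<close>, in the same degree
  on both sides, and the isomorphism does not move \<open>v\<close>.\<close>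

theorem (in nice_tower_of_algebras) TR_functor_comp:
  assumes anti: "anti_multiplicative T" and P: "P \<in> gmod T" and Q: "Q \<in> gmod T"
  shows "isomorphic_functors T (gmod T) (gmod T) (gmod T)
    (TR_functor T P \<circ>\<^sub>F TR_functor T Q) (TR_functor T (IND T P Q))"
  unfolding isomorphic_functors_def
proof (intro conjI exI[of _ "\<lambda>L. twisted_triple.assoc_map T P Q L"] ballI)
  show "is_gfunctor T (gmod T) (gmod T) (TR_functor T P \<circ>\<^sub>F TR_functor T Q)"
    by (rule is_gfunctor_comp[OF TR_functor_is_gfunctor[OF P] TR_functor_is_gfunctor[OF Q]])
  have PQ: "IND T P Q \<in> gmod T" by (rule IND_gmod[OF P Q])
  then show "is_gfunctor T (gmod T) (gmod T) (TR_functor T (IND T P Q))"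
    by (rule TR_functor_is_gfunctor)
  have triple: "twisted_triple T P Q L" if "L \<in> gmod T" for L :: "('a, 'l) family"
    using that P Q anti by (intro twisted_triple.intro nice_tower_of_algebras_axioms twisted_triple_axioms.intro gmodD(1))
  let ?F = "TR_functor T P" and ?G = "TR_functor T Q" and ?H = "TR_functor T (IND T P Q)"
  have obj: "obj (?F \<circ>\<^sub>F ?G) L = obj ?F (obj ?G L)" for L :: "('a, 'l) family"
    by (simp add: gfunctor_comp_def)
  fix L :: "('a, 'l) family" assume L: "L \<in> gmod T"
  interpret D: twisted_triple T P Q L by (rule triple[OF L])
  show "D.assoc_map \<in> gmod_iso T (obj (?F \<circ>\<^sub>F ?G) L) (obj ?H L)"
    unfolding obj by (rule D.assoc_map_iso)
  fix L' :: "('a, 'l) family" and f assume L': "L' \<in> gmod T" and f: "f \<in> gmod_hom T L L'"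
  interpret D': twisted_triple T P Q L' by (rule triple[OF L'])
  note fD = graded_homD[OF gmod_homD[OF f]]
  let ?g = "mor ?G L L' f"
  have g: "?g \<in> gmod_hom T (obj ?G L) (obj ?G L')"
    by (rule is_gfunctorD(2)[OF TR_functor_is_gfunctor[OF Q] L L' f])
  note QL = TR_gmod[OF Q L] TR_gmod[OF Q L']
  note T1 = TR_mor[OF Q L L' f] and T2 = TR_mor[OF P QL g] and T3 = TR_mor[OF PQ L L' f]
  have mor: "mor (?F \<circ>\<^sub>F ?G) L L' f = mor ?F (obj ?G L) (obj ?G L') ?g"
    by (simp add: gfunctor_comp_def)
  show "same_map (obj (?F \<circ>\<^sub>F ?G) L) (\<lambda>k x. D'.assoc_map k (mor (?F \<circ>\<^sub>F ?G) L L' f k x))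
      (\<lambda>k x. mor ?H L L' f k (D.assoc_map k x))"
    unfolding same_map_def obj mor
  proof (intro allI ballI)
    fix k u assume u: "u \<in> carrier (obj ?F (obj ?G L) k)"
    show "D'.assoc_map k (mor ?F (obj ?G L) (obj ?G L') ?g k u) = mor ?H L L' f k (D.assoc_map k u)"
    proof (rule D.left_hom_eqI[OF ahom_comp[OF T2(1) D'.assoc_map_hom] ahom_comp[OF D.assoc_map_hom T3(1)] u])
      fix p q x y v assume h: "x \<in> carrier (P p)" "y \<in> carrier (Q q)" "v \<in> carrier (L (k + p + q))"
      have v: "v \<in> carrier (L (k + (p + q)))" using h(3) by (simp add: add.assoc)
      have E': "D.E'.i (p + q) p q \<one>\<^bsub>A (p + q)\<^esub> x y \<in> carrier (D.E'.V (p + q))"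
        by (rule D.E'.ind_closed[OF refl A.one_closed h(1,2)])
      have "mor ?F (obj ?G L) (obj ?G L') ?g k (D.left_gen k p q x y v) = D'.left_gen k p q x y (f (k + p + q) v)"
        unfolding D.left_gen_def D'.left_gen_def T2(2)[OF h(1) D.E.tr_closed[OF h(2,3)]] T1(2)[OF h(2,3)] ..
      then show "D'.assoc_map k (mor ?F (obj ?G L) (obj ?G L') ?g k (D.left_gen k p q x y v))
          = mor ?H L L' f k (D.assoc_map k (D.left_gen k p q x y v))"
        unfolding D.assoc_map_gen[OF h]
        using D'.assoc_map_gen[OF h(1,2) fD(2)[OF h(3)]] T3(2)[OF E' v]
        by (simp add: D.right_gen_def D'.right_gen_def add.assoc)
    qed
  qed
qed

text \<open>The subcategory is full, so the natural isomorphism restricts with its naturality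
  squares; the targets may shrink because only the values on objects have to lie in them.\<close>

lemma isomorphic_functors_restrict:
  assumes "isomorphic_functors T C D E F G" "C' \<subseteq> C"
    and "\<And>L. L \<in> C' \<Longrightarrow> obj F L \<in> D'" "\<And>L. L \<in> C' \<Longrightarrow> obj G L \<in> E'"
  shows "isomorphic_functors T C' D' E' F G"
proof -
  have F: "is_gfunctor T C' D' F" and G: "is_gfunctor T C' E' G"
    using assms is_gfunctor_restrict unfolding isomorphic_functors_def by blast+
  obtain \<eta> where "\<forall>L\<in>C. \<eta> L \<in> gmod_iso T (obj F L) (obj G L)"
    "\<forall>L\<in>C. \<forall>L'\<in>C. \<forall>f\<in>gmod_hom T L L'.
        same_map (obj F L) (\<lambda>n x. \<eta> L' n (mor F L L' f n x)) (\<lambda>n x. mor G L L' f n (\<eta> L n x))"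
    using assms(1) unfolding isomorphic_functors_def by blast
  then show ?thesis
    unfolding isomorphic_functors_def using F G assms(2)
    by (intro conjI exI[of _ \<eta>] ballI) (auto simp: subset_iff)
qed

text \<open>Both isomorphisms are restricted from \<open>gmod\<close>. For twisted restriction the
  values stay in \<open>fmod\<close>, by finite generation of \<open>P\<close>, of \<open>Q\<close>
  and, through \<open>ind_finitely_generated\<close>, of \<open>IND(P, Q)\<close>.\<close>

theorem theorem2p4p5:
  fixes T :: "('k, 'a) tower"
    and M :: "('a, 'm) family" and N :: "('a, 'n) family"
    and P :: "('a, 'p) family" and Q :: "('a, 'q) family"
  assumes "nice_tower T"
    and "M \<in> fmod T" and "N \<in> fmod T"
    and "P \<in> pmod T" and "Q \<in> pmod T"
  shows "isomorphic_functors T (fmod T :: ('a, 'l) family set) (gmod T) (gmod T)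
      (I_functor T M \<circ>\<^sub>F I_functor T N) (I_functor T (IND T N M)) \<and>
    (anti_multiplicative T \<longrightarrow>
      isomorphic_functors T (fmod T :: ('a, 'l) family set) (fmod T) (fmod T)
        (TR_functor T P \<circ>\<^sub>F TR_functor T Q) (TR_functor T (IND T P Q)))"
proof (intro conjI impI)
  interpret nice_tower_of_algebras T by unfold_locales (rule assms(1))
  have g: "M \<in> gmod T" "N \<in> gmod T" "P \<in> gmod T" "Q \<in> gmod T"
    using assms by (auto simp: fmod_def pmod_def)
  have fg: "\<And>n. finitely_generated (alg T n) (P n)" "\<And>n. finitely_generated (alg T n) (Q n)"
    using assms by (auto simp: pmod_def)
  have sub: "fmod T \<subseteq> (gmod T :: ('a, 'l) family set)" by (auto simp: fmod_def)
  show "isomorphic_functors T (fmod T :: ('a, 'l) family set) (gmod T) (gmod T)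
      (I_functor T M \<circ>\<^sub>F I_functor T N) (I_functor T (IND T N M))"
    by (rule isomorphic_functors_restrict[OF I_functor_comp[OF g(1,2)] sub])
       (use sub g in \<open>auto simp: gfunctor_comp_def I_functor_def intro!: IND_gmod\<close>)
  assume anti: "anti_multiplicative T"
  have PQ: "IND T P Q \<in> gmod T" by (rule IND_gmod[OF g(3,4)])
  interpret PQ: module_pair T P Q by (rule module_pairI[OF g(3,4)])
  show "isomorphic_functors T (fmod T :: ('a, 'l) family set) (fmod T) (fmod T)
        (TR_functor T P \<circ>\<^sub>F TR_functor T Q) (TR_functor T (IND T P Q))"
    by (rule isomorphic_functors_restrict[OF TR_functor_comp[OF anti g(3,4)] sub])
       (auto simp: gfunctor_comp_def intro!: TR_fmod[OF g(3) fg(1)] TR_fmod[OF g(4) fg(2)]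
         TR_fmod[OF PQ PQ.ind_finitely_generated[OF fg]])
qed

end
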